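(* For any $T\in\mathbb{N}$ and any integer $t\in[0,T-1]$ there exists a constant $\mathsf{C}<+\infty$ such that for any $L\in\mathbb{N}$ and any $(N_0,N_1,\dots,N_L)\in\{2,3,\dots\}^{L+1}$, $$ \mathbb{E}\left[\left\|\hat{\eta}_t^{ML}(e)-\eta_t(e)\right\|_2^2\right] \leq \mathsf{C}\left( \sum_{l=0}^L \frac{\Delta_l}{N_l} + \sum_{l=1}^L\ \sum_{q=1,\, q\neq l}^L\frac{\Delta_l\Delta_q}{N_lN_q} + \Delta_L^2 \right), $$ where $\hat{\eta}_t^{ML}(e)$ is the ideal (i.i.d.) multilevel estimator and $\eta_t(e)=\mathbb{E}[X_t|\mathscr{F}_t]$ is the filter mean, both defined in the context.
   Context: Model. Fix $d_x,d_y\in\mathbb{N}$, a $d_x\times d_x$ real matrix $A$, a $d_y\times d_x$ real matrix $C$, and symmetric invertible matrices $R_1^{1/2}$ ($d_x\times d_x$) and $R_2^{1/2}$ ($d_y\times d_y$); $R_i=(R_i^{1/2})^2$, $S=C^{\top}R_2^{-1}C$. The signal and observations satisfy $dX_t=AX_tdt+R_1^{1/2}dW_t$, $dY_t=CX_tdt+R_2^{1/2}dV_t$, $Y_0=0$, $X_0\sim\mathcal{N}_{d_x}(\mathcal{M}_0,\mathcal{P}_0)$, with $(V,W)$ a standard $(d_y+d_x)$-dimensional Brownian motion independent of $X_0$. $\{\mathscr{F}_t\}_{t\ge0}$ is the filtration generated by $Y$, $\eta_t$ is the conditional law of $X_t$ given $\mathscr{F}_t$, $e(x)=x$, and $\pi(\varphi)$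 denotes the integral of $\varphi$ with respect to $\pi$; so $\eta_t(e)=\mathbb{E}[X_t|\mathscr{F}_t]$. $\|\cdot\|_2$ is the Euclidean norm. $\mathbb{N}_0=\mathbb{N}\cup\{0\}$ and $\Delta_l=2^{-l}$. Discretized Riccati recursion. $\mathrm{Ricc}(Q)=AQ+QA^{\top}-QSQ+R_1$, $\mathrm{SRicc}(Q)=(A-QS)Q(A^{\top}-SQ)$. For $l\in\mathbb{N}_0$ set $P_0^l=\mathcal{P}_0$ and $P^l_{(k+1)\Delta_l}=P^l_{k\Delta_l}+\mathrm{Ricc}(P^l_{k\Delta_l})\Delta_l+\mathrm{SRicc}(P^l_{k\Delta_l})\Delta_l^2$, $k\in\mathbb{N}_0$, and $U^l_{k\Delta_l}=P^l_{k\Delta_l}C^{\top}R_2^{-1}$. I.i.d. Euler dynamics at level $s$. Given Brownian motions $\overline{W}^i$ ($d_x$-dimensional) and $\overline{V}^i$ ($d_y$-dimensional) and an initial state $\zeta_0^{i,s}$, for $k\in\mathbb{N}_0$, $$\zeta^{i,s}_{(k+1)\Delta_s}=\zeta^{i,s}_{k\Delta_s}+A\zeta^{i,s}_{k\Delta_s}\Delta_s+R_1^{1/2}[\overline{W}^i_{(k+1)\Delta_s}-\overline{W}^i_{k\Delta_s}]+U^s_{k\Delta_s}\Big([Y_{(k+1)\Delta_s}-Y_{k\Delta_s}]-\big[C\zeta^{i,s}_{k\Delta_s}\Delta_s+R_2^{1/2}[\overline{V}^i_{(k+1)\Delta_s}-\overline{V}^i_{k\Delta_s}]\big]\Big).$$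 Ideal multilevel estimator. At level $0$, run $N_0$ copies with $s=0$, with independent initial states distributed as $\mathcal{N}_{d_x}(\mathcal{M}_0,\mathcal{P}_0)$ and independent standard Brownian motions $(\overline{W}^i,\overline{V}^i)$; set $\hat\eta_t^{N_0,0}(e)=\frac1{N_0}\sum_{i=1}^{N_0}\zeta_t^{i,0}$. For each $l\in\{1,\dots,L\}$, run $N_l$ coupled pairs $(\zeta^{i,l},\zeta^{i,l-1})$, $i=1,\dots,N_l$, where the two components of a pair follow the dynamics with $s=l$ and $s=l-1$ respectively, share the same initial state $\zeta_0^{i,l}=\zeta_0^{i,l-1}\sim\mathcal{N}_{d_x}(\mathcal{M}_0,\mathcal{P}_0)$ and the same Brownian motions $(\overline{W}^i,\overline{V}^i)$; these initial states and Brownian motions are independent over $i$. Set $[\hat\eta_t^{N_l,l}-\hat\eta_t^{N_l,l-1}](e)=\frac1{N_l}\sum_{i=1}^{N_l}(\zeta_t^{i,l}-\zeta_t^{i,l-1})$. The random inputs (initial states and Brownian motions) used at different $l\in\{0,\dots,L\}$ are independent, and all are independent of $(X_0,W,V)$; the same observation path $Y$ is used at all levels. Then $$\hat\eta_t^{ML}(e)=\hat\eta_t^{N_0,0}(e)+\sum_{l=1}^L[\hat\eta_t^{N_l,l}-\hat\eta_t^{N_l,l-1}](e).$$ $\mathbb{E}$ is expectation over all of this randomness, including the data. Standing assumptions. (1) $\mu(A)<0$, where $\mu(B)$ is the largest eigenvalue of $\frac12(B+B^{\top})$. (2) There is a finite constant bounding $|P^l_{k\Delta_l}(j_1,j_2)|$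 for all $(k,l)\in\mathbb{N}_0^2$ and all $(j_1,j_2)\in\{1,\dots,d_x\}^2$. (3) The matrices $(R_1^{1/2},AR_1^{1/2},\dots,A^{d_x-1}R_1^{1/2})$ and $(C,CA,\dots,CA^{d_x-1})^{\top}$ (i.e. the blocks $C,CA,\dots,CA^{d_x-1}$ stacked) both have rank $d_x$. *)

theory Defs
  imports "HOL-Analysis.Analysis" "HOL-Probability.Probability"
begin

section \<open>Matrices\<close>

(* The type class power on vec is the componentwise one, hence a separate matrix power. *)
primrec matrix_power :: "real^'n^'n \<Rightarrow> nat \<Rightarrow> real^'n^'n" where
  "matrix_power A 0 = mat 1"
| "matrix_power A (Suc k) = A ** matrix_power A k"

definition real_eigenvalues :: "real^'n^'n \<Rightarrow> real set" where
  "real_eigenvalues B = {c. \<exists>v. v \<noteq> 0 \<and> B *v v = c *\<^sub>R v}"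

definition log_norm :: "real^'n^'n \<Rightarrow> real" where
  "log_norm B = Max (real_eigenvalues ((1/2) *\<^sub>R (B + transpose B)))"

(* The number of columns of (B, AB, ..., A^(d-1) B) is no index type, so its rank is spelled out
   as the dimension of the span of all columns of all blocks; dually with rows for the stacked
   matrix of the blocks C A^k. These are the library's row_rank_def and column_rank_def for
   the block matrices. *)
definition controllability_rank :: "real^'n^'n \<Rightarrow> real^'m^'n \<Rightarrow> nat" where
  "controllability_rank A B = dim (\<Union>k<CARD('n). columns (matrix_power A k ** B))"

definition observability_rank :: "real^'n^'n \<Rightarrow> real^'n^'m \<Rightarrow> nat" where
  "observability_rank A C = dim (\<Union>k<CARD('n). rows (C ** matrix_power A k))"


section \<open>Gaussian vectors, Brownian motion, generated sigma-algebras\<close>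

definition isotropic_normal_density :: "real \<Rightarrow> 'a::euclidean_space \<Rightarrow> real" where
  "isotropic_normal_density \<sigma> x = (\<Prod>b\<in>Basis. normal_density 0 \<sigma> (x \<bullet> b))"

(* The covariance may be singular: the law N(m, P) is the law of m + B G with G standard normal
   and P = B B^T, which does not depend on the choice of B. *)
definition normal_vector ::
  "'w measure \<Rightarrow> ('w \<Rightarrow> real^'n) \<Rightarrow> real^'n \<Rightarrow> real^'n^'n \<Rightarrow> bool" where
  "normal_vector M Z m P \<longleftrightarrow> Z \<in> borel_measurable M \<and>
     (\<exists>B :: real^'n^'n. P = B ** transpose B \<and>
        distr M borel Z =
        distr (density lborel (\<lambda>z. ennreal (isotropic_normal_density 1 z))) borel
          (\<lambda>z. m + B *v z))"

definition process_algebra ::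
  "'w measure \<Rightarrow> 'i set \<Rightarrow> ('i \<Rightarrow> 'w \<Rightarrow> 'a::topological_space) \<Rightarrow> 'w measure" where
  "process_algebra M I X =
     sigma (space M) {X t -` B \<inter> space M | t B. t \<in> I \<and> B \<in> sets borel}"

(* Processes on the half-line [0, infinity) are indexed by real; values at negative times are
   irrelevant. *)
definition standard_brownian_motion ::
  "'w measure \<Rightarrow> (real \<Rightarrow> 'w \<Rightarrow> 'a::euclidean_space) \<Rightarrow> bool" where
  "standard_brownian_motion M B \<longleftrightarrow>
     (\<forall>t\<ge>0. B t \<in> borel_measurable M) \<and>
     (AE \<omega> in M. B 0 \<omega> = 0) \<and>
     (AE \<omega> in M. continuous_on {0..} (\<lambda>t. B t \<omega>)) \<and>
     (\<forall>s t. 0 \<le> s \<and> s < t \<longrightarrow>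
        distributed M lborel (\<lambda>\<omega>. B t \<omega> - B s \<omega>)
          (\<lambda>x. ennreal (isotropic_normal_density (sqrt (t - s)) x)) \<and>
        prob_space.indep_set M
          (sets (process_algebra M {0..s} B))
          (sets (vimage_algebra (space M) (\<lambda>\<omega>. B t \<omega> - B s \<omega>) borel)))"

definition gaussian_start_with_noise ::
  "'w measure \<Rightarrow> real^'x \<Rightarrow> real^'x^'x \<Rightarrow>
   ('w \<Rightarrow> real^'x) \<Rightarrow> (real \<Rightarrow> 'w \<Rightarrow> real^'y) \<Rightarrow> (real \<Rightarrow> 'w \<Rightarrow> real^'x) \<Rightarrow> bool" where
  "gaussian_start_with_noise M m P Z V W \<longleftrightarrow>
     normal_vector M Z m P \<and>
     standard_brownian_motion M (\<lambda>t \<omega>. (V t \<omega>, W t \<omega>)) \<and>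
     prob_space.indep_set M
       (sets (vimage_algebra (space M) Z borel))
       (sets (process_algebra M {0..} (\<lambda>t \<omega>. (V t \<omega>, W t \<omega>))))"

definition start_noise_events ::
  "'w measure \<Rightarrow>
   ('w \<Rightarrow> real^'x) \<Rightarrow> (real \<Rightarrow> 'w \<Rightarrow> real^'y) \<Rightarrow> (real \<Rightarrow> 'w \<Rightarrow> real^'x) \<Rightarrow> 'w set set" where
  "start_noise_events M Z V W =
     sets (process_algebra M {0..} (\<lambda>t \<omega>. (Z \<omega>, V t \<omega>, W t \<omega>)))"


section \<open>Signal, observations and filter mean\<close>

(* The noise is additive, so the two stochastic differential equations are pathwise integral
   equations. *)
definition signal_observation ::
  "'w measure \<Rightarrow> real^'x^'x \<Rightarrow> real^'x^'y \<Rightarrow> real^'x^'x \<Rightarrow> real^'y^'y \<Rightarrow>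
   real^'x \<Rightarrow> real^'x^'x \<Rightarrow>
   (real \<Rightarrow> 'w \<Rightarrow> real^'x) \<Rightarrow> (real \<Rightarrow> 'w \<Rightarrow> real^'y) \<Rightarrow>
   (real \<Rightarrow> 'w \<Rightarrow> real^'y) \<Rightarrow> (real \<Rightarrow> 'w \<Rightarrow> real^'x) \<Rightarrow> bool" where
  "signal_observation M A C R1h R2h M0 P0 X Y V W \<longleftrightarrow>
     gaussian_start_with_noise M M0 P0 (X 0) V W \<and>
     (\<forall>t\<ge>0. X t \<in> borel_measurable M \<and> Y t \<in> borel_measurable M) \<and>
     (AE \<omega> in M.
        continuous_on {0..} (\<lambda>t. X t \<omega>) \<and>
        (\<forall>t\<ge>0. X t \<omega> = X 0 \<omega> + integral {0..t} (\<lambda>s. A *v X s \<omega>) + R1h *v W t \<omega>) \<and>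
        Y 0 \<omega> = 0 \<and>
        (\<forall>t\<ge>0. Y t \<omega> = integral {0..t} (\<lambda>s. C *v X s \<omega>) + R2h *v V t \<omega>))"

definition filter_mean ::
  "'w measure \<Rightarrow> (real \<Rightarrow> 'w \<Rightarrow> real^'x) \<Rightarrow> (real \<Rightarrow> 'w \<Rightarrow> real^'y) \<Rightarrow>
   real \<Rightarrow> 'w \<Rightarrow> real^'x" where
  "filter_mean M X Y t \<omega> =
     (\<chi> j. real_cond_exp M (process_algebra M {0..t} Y) (\<lambda>\<omega>'. X t \<omega>' $ j) \<omega>)"


section \<open>Discretized Riccati recursion and Euler dynamics\<close>

definition step_size :: "nat \<Rightarrow> real" where
  "step_size l = 1 / 2 ^ l"

definition S_matrix :: "real^'x^'y \<Rightarrow> real^'y^'y \<Rightarrow> real^'x^'x" where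
  "S_matrix C R2h = transpose C ** matrix_inv (R2h ** R2h) ** C"

definition Ricc ::
  "real^'x^'x \<Rightarrow> real^'x^'y \<Rightarrow> real^'x^'x \<Rightarrow> real^'y^'y \<Rightarrow> real^'x^'x \<Rightarrow> real^'x^'x" where
  "Ricc A C R1h R2h Q =
     A ** Q + Q ** transpose A - Q ** S_matrix C R2h ** Q + R1h ** R1h"

definition SRicc ::
  "real^'x^'x \<Rightarrow> real^'x^'y \<Rightarrow> real^'y^'y \<Rightarrow> real^'x^'x \<Rightarrow> real^'x^'x" where
  "SRicc A C R2h Q =
     (A - Q ** S_matrix C R2h) ** Q ** (transpose A - S_matrix C R2h ** Q)"

(* The natural number argument k stands for the time k * step_size l, here and below. *)
primrec riccati_rec ::
  "real^'x^'x \<Rightarrow> real^'x^'y \<Rightarrow> real^'x^'x \<Rightarrow> real^'y^'y \<Rightarrow> real^'x^'x \<Rightarrow>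
   nat \<Rightarrow> nat \<Rightarrow> real^'x^'x" where
  "riccati_rec A C R1h R2h P0 l 0 = P0"
| "riccati_rec A C R1h R2h P0 l (Suc k) =
     (let P = riccati_rec A C R1h R2h P0 l k in
      P + step_size l *\<^sub>R Ricc A C R1h R2h P + (step_size l)\<^sup>2 *\<^sub>R SRicc A C R2h P)"

definition gain ::
  "real^'x^'x \<Rightarrow> real^'x^'y \<Rightarrow> real^'x^'x \<Rightarrow> real^'y^'y \<Rightarrow> real^'x^'x \<Rightarrow>
   nat \<Rightarrow> nat \<Rightarrow> real^'y^'x" where
  "gain A C R1h R2h P0 l k =
     riccati_rec A C R1h R2h P0 l k ** transpose C ** matrix_inv (R2h ** R2h)"

(* A function of the initial state z0 and of the paths v, w (noises) and y (observations), so
   that sharing inputs between two levels amounts to using the same arguments. *)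
primrec euler ::
  "real^'x^'x \<Rightarrow> real^'x^'y \<Rightarrow> real^'x^'x \<Rightarrow> real^'y^'y \<Rightarrow> real^'x^'x \<Rightarrow> nat \<Rightarrow>
   real^'x \<Rightarrow> (real \<Rightarrow> real^'y) \<Rightarrow> (real \<Rightarrow> real^'x) \<Rightarrow> (real \<Rightarrow> real^'y) \<Rightarrow>
   nat \<Rightarrow> real^'x" where
  "euler A C R1h R2h P0 s z0 v w y 0 = z0"
| "euler A C R1h R2h P0 s z0 v w y (Suc k) =
     (let z = euler A C R1h R2h P0 s z0 v w y k;
          t = real k * step_size s;
          t' = real (Suc k) * step_size s
      in z + step_size s *\<^sub>R (A *v z) + R1h *v (w t' - w t)
         + gain A C R1h R2h P0 s k *v
             ((y t' - y t) - (step_size s *\<^sub>R (C *v z) + R2h *v (v t' - v t))))"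


section \<open>Ideal multilevel estimator\<close>

(* Z l i, V l i, W l i are the initial state and the noises of sample i at level l; for l > 0 both
   members of the coupled pair use them. The index None is for the model's (X_0, V, W). *)
definition multilevel_inputs ::
  "'w measure \<Rightarrow> real^'x \<Rightarrow> real^'x^'x \<Rightarrow>
   ('w \<Rightarrow> real^'x) \<Rightarrow> (real \<Rightarrow> 'w \<Rightarrow> real^'y) \<Rightarrow> (real \<Rightarrow> 'w \<Rightarrow> real^'x) \<Rightarrow>
   nat \<Rightarrow> (nat \<Rightarrow> nat) \<Rightarrow>
   (nat \<Rightarrow> nat \<Rightarrow> 'w \<Rightarrow> real^'x) \<Rightarrow> (nat \<Rightarrow> nat \<Rightarrow> real \<Rightarrow> 'w \<Rightarrow> real^'y) \<Rightarrow>
   (nat \<Rightarrow> nat \<Rightarrow> real \<Rightarrow> 'w \<Rightarrow> real^'x) \<Rightarrow> bool" where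
  "multilevel_inputs M M0 P0 X0 V0 W0 L N Z V W \<longleftrightarrow>
     (\<forall>l\<le>L. \<forall>i\<in>{1..N l}. gaussian_start_with_noise M M0 P0 (Z l i) (V l i) (W l i)) \<and>
     prob_space.indep_sets M
       (\<lambda>j. case j of
              None \<Rightarrow> start_noise_events M X0 V0 W0
            | Some (l, i) \<Rightarrow> start_noise_events M (Z l i) (V l i) (W l i))
       (insert None (Some ` (SIGMA l:{0..L}. {1..N l})))"

(* The estimator at an integer time t, which is the grid point t * 2^s at level s. *)
definition multilevel_estimator ::
  "real^'x^'x \<Rightarrow> real^'x^'y \<Rightarrow> real^'x^'x \<Rightarrow> real^'y^'y \<Rightarrow> real^'x^'x \<Rightarrow>
   (real \<Rightarrow> 'w \<Rightarrow> real^'y) \<Rightarrow> nat \<Rightarrow> (nat \<Rightarrow> nat) \<Rightarrow>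
   (nat \<Rightarrow> nat \<Rightarrow> 'w \<Rightarrow> real^'x) \<Rightarrow> (nat \<Rightarrow> nat \<Rightarrow> real \<Rightarrow> 'w \<Rightarrow> real^'y) \<Rightarrow>
   (nat \<Rightarrow> nat \<Rightarrow> real \<Rightarrow> 'w \<Rightarrow> real^'x) \<Rightarrow> nat \<Rightarrow> 'w \<Rightarrow> real^'x" where
  "multilevel_estimator A C R1h R2h P0 Y L N Z V W t \<omega> =
     (let \<zeta> = (\<lambda>l i s. euler A C R1h R2h P0 s (Z l i \<omega>) (\<lambda>r. V l i r \<omega>) (\<lambda>r. W l i r \<omega>)
                        (\<lambda>r. Y r \<omega>) (t * 2 ^ s))
      in (1 / real (N 0)) *\<^sub>R (\<Sum>i=1..N 0. \<zeta> 0 i 0)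
         + (\<Sum>l=1..L. (1 / real (N l)) *\<^sub>R (\<Sum>i=1..N l. \<zeta> l i l - \<zeta> l i (l - 1))))"

end

theory Submission
  imports Defs
begin

text \<open>The gains of the Riccati recursion are deterministic. So every sample is the sum of the Euler scheme that
  is driven by the observations alone and started at the mean, and of a part that is linear in the centred
  initial state and in the noise of that sample and does not see the observations (lemma \<open>euler_split\<close>). In
  the multilevel sum the first parts telescope to the scheme \<open>m\<^sup>L\<close> of the finest level (lemma
  \<open>multilevel_estimator_split\<close>), and the second parts have mean zero and are independent over all samples. The
  error of the estimator is thus a bias, \<open>m\<^sup>L\<close> minus the filter mean, plus an orthogonal sum of fluctuations.

  Fluctuations. Two consecutive levels, seen as linear functionals of the same initial state and noise
  increments, have coefficients that differ by \<open>O(\<Delta>\<^sub>l)\<close>. This holds for the Riccati recursion because it is a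
  one-step scheme with bounded orbits (lemma \<open>riccati_rec_refine\<close>), and it carries over to the Euler scheme
  because the noise is additive (lemmas \<open>linear_recursion_refine\<close> and \<open>euler_functional\<close>). As the inputs are
  independent, a functional with coefficients of size \<open>a\<close> has mean square \<open>O(a\<^sup>2)\<close> on a bounded time interval.
  The second part of a coupled pair at level \<open>l \<ge> 1\<close> therefore has mean square \<open>O(\<Delta>\<^sub>l\<^sup>2)\<close>, and at level zero
  that of a sample is bounded. Both are \<open>O(\<Delta>\<^sub>l)\<close>, so the average over \<open>N\<^sub>l\<close> of them contributes \<open>O(\<Delta>\<^sub>l / N\<^sub>l)\<close>
  (lemma \<open>fluctuation_mean_square\<close>).

  Bias. The same comparison of coefficients, applied to the increments of the observations, shows that
  consecutive schemes \<open>m\<^sup>l\<close> differ by \<open>O(\<Delta>\<^sub>l)\<close> in mean square. So they converge to some \<open>m\<close>, with rate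
  \<open>O(\<Delta>\<^sub>l)\<close>, and \<open>m\<close> is a function of the observations. To see that \<open>m\<close> is the filter mean, write
  \<open>X - m\<^sup>l = e\<^sup>l + o(1)\<close> along every continuous path (lemma \<open>filter_scheme_tendsto\<close>), where the centred scheme
  \<open>e\<^sup>l\<close> is driven by the noise of the model only; it converges to some \<open>\<Xi>\<close>, and \<open>X = m + \<Xi>\<close>. By Gaussian
  integration by parts the expectation of \<open>e\<^sup>l\<close> times a product of bounded smooth functions of the discretized
  observations is a combination of covariances of \<open>e\<^sup>l\<close> with these observations. The gain of the Riccati
  recursion makes these covariances \<open>O(\<Delta>\<^sub>l)\<close> (lemma \<open>filter_error_observation_covariance\<close>). In the limit \<open>\<Xi>\<close> is
  orthogonal to all such products (lemma \<open>limit_error_orthogonal\<close>), hence to all events of the observation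
  filtration, which says that \<open>m\<close> is the conditional expectation (lemma \<open>filter_scheme_rate\<close>).\<close>

section \<open>Linear functionals of an initial state and of inputs\<close>

definition linear_bounded_by :: "real \<Rightarrow> ('a::real_normed_vector \<Rightarrow> 'b::real_normed_vector) \<Rightarrow> bool" where
  "linear_bounded_by a D \<longleftrightarrow> linear D \<and> (\<forall>x. norm (D x) \<le> a * norm x)"

lemma linear_bounded_byD:
  assumes "linear_bounded_by a D"
  shows "linear D" "norm (D x) \<le> a * norm x"
  using assms by (auto simp: linear_bounded_by_def)

lemma linear_bounded_by_mono: "linear_bounded_by a D \<Longrightarrow> a \<le> b \<Longrightarrow> linear_bounded_by b D"
  unfolding linear_bounded_by_def by (meson mult_right_mono norm_ge_zero order_trans)

lemma linear_bounded_by_zero: "0 \<le> a \<Longrightarrow> linear_bounded_by a (\<lambda>_. 0)"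
  unfolding linear_bounded_by_def by (auto intro: linear_zero)

lemma linear_bounded_by_id: "1 \<le> a \<Longrightarrow> linear_bounded_by a (\<lambda>x. x)"
  unfolding linear_bounded_by_def by (auto intro: linear_ident simp: mult_left_le_one_le mult_le_cancel_right1)

lemma linear_bounded_by_add:
  "linear_bounded_by a D \<Longrightarrow> linear_bounded_by b E \<Longrightarrow> linear_bounded_by (a + b) (\<lambda>x. D x + E x)"
  unfolding linear_bounded_by_def
  by (auto intro!: linear_compose_add norm_triangle_le add_mono simp: distrib_right)

lemma linear_bounded_by_scale:
  "linear_bounded_by a D \<Longrightarrow> 0 \<le> c \<Longrightarrow> linear_bounded_by (c * a) (\<lambda>x. c *\<^sub>R D x)"
  unfolding linear_bounded_by_def
  by (auto intro!: linear_compose_scale_right mult_left_mono simp: mult.assoc)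

lemma linear_bounded_by_comp:
  assumes "linear_bounded_by a D" "linear_bounded_by b E" "0 \<le> b"
  shows "linear_bounded_by (b * a) (\<lambda>x. E (D x))"
proof -
  have "linear (\<lambda>x. E (D x))"
    using linear_compose[of D E] assms by (simp add: linear_bounded_by_def o_def)
  moreover have "norm (E (D x)) \<le> b * a * norm x" for x
    using linear_bounded_byD(2)[OF assms(2), of "D x"] mult_left_mono[OF linear_bounded_byD(2)[OF assms(1), of x] assms(3)]
    by (simp add: mult.assoc)
  ultimately show ?thesis by (simp add: linear_bounded_by_def)
qed

text \<open>The bound concerns each coefficient separately, not the operator norm: for independent inputs of variance
  \<open>d\<close> the mean square is a sum of squared coefficients times \<open>d\<close>, and \<open>n d\<close> stays bounded.\<close>

definition input_functional ::
  "real \<Rightarrow> nat \<Rightarrow> ('s::real_normed_vector \<Rightarrow> (nat \<Rightarrow> 'u::real_normed_vector) \<Rightarrow> 'a::real_normed_vector) \<Rightarrow> bool" where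
  "input_functional a n f \<longleftrightarrow> (\<exists>D c. linear_bounded_by a D \<and> (\<forall>j<n. linear_bounded_by a (c j)) \<and>
     (\<forall>z u. f z u = D z + (\<Sum>j<n. c j (u j))))"

lemma input_functional_mono: "input_functional a n f \<Longrightarrow> a \<le> b \<Longrightarrow> input_functional b n f"
  unfolding input_functional_def by (meson linear_bounded_by_mono)

lemma input_functional_add:
  assumes "input_functional a n f" "input_functional b n g"
  shows "input_functional (a + b) n (\<lambda>z u. f z u + g z u)"
proof -
  obtain D c where 1: "linear_bounded_by a D" "\<forall>j<n. linear_bounded_by a (c j)" "\<forall>z u. f z u = D z + (\<Sum>j<n. c j (u j))"
    using assms(1) by (auto simp: input_functional_def)
  obtain D' c' where 2: "linear_bounded_by b D'" "\<forall>j<n. linear_bounded_by b (c' j)" "\<forall>z u. g z u = D' z + (\<Sum>j<n. c' j (u j))"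
    using assms(2) by (auto simp: input_functional_def)
  show ?thesis unfolding input_functional_def
    using 1 2
    by (intro exI[of _ "\<lambda>x. D x + D' x"] exI[of _ "\<lambda>j x. c j x + c' j x"])
      (auto simp: sum.distrib intro!: linear_bounded_by_add)
qed

lemma input_functional_comp:
  assumes "input_functional a n f" "linear_bounded_by b E" "0 \<le> b"
  shows "input_functional (b * a) n (\<lambda>z u. E (f z u))"
proof -
  obtain D c where 1: "linear_bounded_by a D" "\<forall>j<n. linear_bounded_by a (c j)" "\<forall>z u. f z u = D z + (\<Sum>j<n. c j (u j))"
    using assms(1) by (auto simp: input_functional_def)
  have E: "linear E" using assms(2) by (rule linear_bounded_byD)
  have "linear_bounded_by (b * a) (\<lambda>x. E (D x))"
    by (rule linear_bounded_by_comp[OF 1(1) assms(2,3)])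
  moreover have "\<forall>j<n. linear_bounded_by (b * a) (\<lambda>x. E (c j x))"
    using linear_bounded_by_comp[OF _ assms(2,3)] 1(2) by blast
  moreover have "\<forall>z u. E (f z u) = E (D z) + (\<Sum>j<n. E (c j (u j)))"
    using 1(3) by (simp add: linear_add[OF E] linear_sum[OF E])
  ultimately show ?thesis unfolding input_functional_def
    by (intro exI[of _ "\<lambda>x. E (D x)"] exI[of _ "\<lambda>j x. E (c j x)"] conjI) assumption+
qed

lemma input_functional_Suc:
  assumes "input_functional a n f" "linear_bounded_by a G"
  shows "input_functional a (Suc n) (\<lambda>z u. f z u + G (u n))"
proof -
  obtain D c where 1: "linear_bounded_by a D" "\<forall>j<n. linear_bounded_by a (c j)" "\<forall>z u. f z u = D z + (\<Sum>j<n. c j (u j))"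
    using assms(1) by (auto simp: input_functional_def)
  show ?thesis unfolding input_functional_def
    using 1 assms(2)
    by (intro exI[of _ D] exI[of _ "c(n := G)"]) (auto simp: less_Suc_eq)
qed

lemma input_functional_measurable:
  fixes f :: "'s::euclidean_space \<Rightarrow> (nat \<Rightarrow> 'u::euclidean_space) \<Rightarrow> 'c::euclidean_space"
  assumes f: "input_functional a n f" and z: "z \<in> borel_measurable N" and u: "\<And>j. j < n \<Longrightarrow> u j \<in> borel_measurable N"
  shows "(\<lambda>\<omega>. f (z \<omega>) (\<lambda>j. u j \<omega>)) \<in> borel_measurable N"
proof -
  obtain D C where D: "linear_bounded_by a D" "\<And>j. j < n \<Longrightarrow> linear_bounded_by a (C j)" "\<And>z u. f z u = D z + (\<Sum>j<n. C j (u j))"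
    using f by (auto simp: input_functional_def)
  have lm: "L \<in> borel_measurable borel" if "linear_bounded_by a L" for L :: "'b::euclidean_space \<Rightarrow> 'c"
    using that by (intro borel_measurable_continuous_onI linear_continuous_on)
      (simp add: linear_conv_bounded_linear[symmetric] linear_bounded_by_def)
  have "(\<lambda>\<omega>. C j (u j \<omega>)) \<in> borel_measurable N" if "j \<in> {..<n}" for j
    using measurable_compose[OF u lm[OF D(2)]] that by auto
  then show ?thesis
    unfolding D(3) by (intro borel_measurable_add borel_measurable_sum measurable_compose[OF z lm[OF D(1)]])
qed

primrec linear_recursion ::
  "(nat \<Rightarrow> 's \<Rightarrow> 's) \<Rightarrow> (nat \<Rightarrow> 'u \<Rightarrow> 's) \<Rightarrow> real \<Rightarrow> 's::real_normed_vector \<Rightarrow> (nat \<Rightarrow> 'u) \<Rightarrow> nat \<Rightarrow> 's" where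
  "linear_recursion F G d z u 0 = z"
| "linear_recursion F G d z u (Suc k) =
     linear_recursion F G d z u k + d *\<^sub>R F k (linear_recursion F G d z u k) + G k (u k)"

lemma linear_recursion_bounded:
  fixes F :: "nat \<Rightarrow> 's::real_normed_vector \<Rightarrow> 's" and G :: "nat \<Rightarrow> 'u::real_normed_vector \<Rightarrow> 's"
  assumes "1 \<le> b" "0 \<le> d"
    and "\<And>k. k < n \<Longrightarrow> linear_bounded_by b (F k)" "\<And>k. k < n \<Longrightarrow> linear_bounded_by b (G k)"
  shows "input_functional (b * (1 + b * d) ^ n) n (\<lambda>z u. linear_recursion F G d z u n)"
  using assms(3,4)
proof (induction n)
  case 0
  have "linear_bounded_by b (\<lambda>x::'s. x)" using assms(1) by (rule linear_bounded_by_id)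
  then show ?case unfolding input_functional_def by (intro exI[of _ "\<lambda>x. x"]) auto
next
  case (Suc n)
  let ?a = "b * (1 + b * d) ^ n"
  have IH: "input_functional ?a n (\<lambda>z u. linear_recursion F G d z u n)"
    using Suc.IH Suc.prems less_SucI by blast
  have *: "linear_bounded_by (1 + d * b) (\<lambda>x. x + d *\<^sub>R F n x)"
    using assms Suc.prems by (intro linear_bounded_by_add linear_bounded_by_id linear_bounded_by_scale) auto
  have p: "1 \<le> (1 + b * d) ^ Suc n" using assms by (intro one_le_power) auto
  have "linear_bounded_by (b * (1 + b * d) ^ Suc n) (G n)"
    using p assms(1)
    by (intro linear_bounded_by_mono[OF Suc.prems(2)]) (auto simp: mult_le_cancel_left1 simp del: power_Suc)
  moreover have "input_functional (b * (1 + b * d) ^ Suc n) n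
     (\<lambda>z u. linear_recursion F G d z u n + d *\<^sub>R F n (linear_recursion F G d z u n))"
    using input_functional_comp[OF IH *] assms by (simp add: algebra_simps)
  ultimately show ?case
    using input_functional_Suc by fastforce
qed

text \<open>One step of size \<open>d\<close> and two steps of size \<open>d / 2\<close> differ by \<open>O(d\<^sup>2)\<close> in the
  coefficients of the old inputs and by \<open>O(d)\<close> in those of the two new inputs, so a discrete Gronwall
  argument on the coefficients, not on the values, gives the order one. The inputs themselves may be as
  rough as Brownian increments.\<close>

lemma linear_recursion_refine:
  fixes F F' :: "nat \<Rightarrow> 's::real_normed_vector \<Rightarrow> 's" and G G' :: "nat \<Rightarrow> 'u::real_normed_vector \<Rightarrow> 's"
  assumes b: "1 \<le> b" and d: "0 \<le> d" and c: "0 \<le> c" and B: "1 \<le> B"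
    and F: "\<And>k. k < n \<Longrightarrow> linear_bounded_by b (F k)"
    and F': "\<And>k. k < 2 * n \<Longrightarrow> linear_bounded_by b (F' k)"
    and G': "\<And>k. k < 2 * n \<Longrightarrow> linear_bounded_by b (G' k)"
    and FF: "\<And>k. k < 2 * n \<Longrightarrow> linear_bounded_by (c * d) (\<lambda>x. F' k x - F (k div 2) x)"
    and GG: "\<And>k. k < 2 * n \<Longrightarrow> linear_bounded_by (c * d) (\<lambda>x. G' k x - G (k div 2) x)"
    and fine: "\<And>k. k \<le> 2 * n \<Longrightarrow> input_functional B k (\<lambda>z u. linear_recursion F' G' (d / 2) z u k)"
  shows "input_functional ((c + b\<^sup>2) * B * d * (1 + (b + 1) * d) ^ n) (2 * n)
     (\<lambda>z u. linear_recursion F' G' (d / 2) z u (2 * n)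
          - linear_recursion F G d z (\<lambda>j. u (2 * j) + u (2 * j + 1)) n)"
  using F F' G' FF GG fine
proof (induction n)
  case 0
  show ?case unfolding input_functional_def
    using b c d B by (intro exI[of _ "\<lambda>_. 0"]) (auto intro!: linear_bounded_by_zero)
next
  case (Suc n)
  let ?a = "\<lambda>n. (c + b\<^sup>2) * B * d * (1 + (b + 1) * d) ^ n"
  let ?x = "\<lambda>z u. linear_recursion F' G' (d / 2) z u (2 * n)"
  let ?y = "\<lambda>z u. linear_recursion F G d z (\<lambda>j. u (2 * j) + u (2 * j + 1)) n"
  have IH: "input_functional (?a n) (2 * n) (\<lambda>z u. ?x z u - ?y z u)"
    by (rule Suc.IH) (auto intro!: Suc.prems)
  have F: "linear_bounded_by b (F n)" using Suc.prems(1)[of n] by simp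
  have F1: "linear_bounded_by b (F' (2 * n))" and F2: "linear_bounded_by b (F' (2 * n + 1))"
    and G1: "linear_bounded_by b (G' (2 * n))"
    using Suc.prems(2)[of "2 * n"] Suc.prems(2)[of "2 * n + 1"] Suc.prems(3)[of "2 * n"] by simp_all
  have FF1: "linear_bounded_by (c * d) (\<lambda>x. F' (2 * n) x - F n x)"
   and FF2: "linear_bounded_by (c * d) (\<lambda>x. F' (2 * n + 1) x - F n x)"
   and GG1: "linear_bounded_by (c * d) (\<lambda>x. G' (2 * n) x - G n x)"
   and GG2: "linear_bounded_by (c * d) (\<lambda>x. G' (2 * n + 1) x - G n x)"
    using Suc.prems(4)[of "2 * n"] Suc.prems(4)[of "2 * n + 1"]
      Suc.prems(5)[of "2 * n"] Suc.prems(5)[of "2 * n + 1"] by simp_all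
  have X: "input_functional B (2 * n) ?x" using Suc.prems(6)[of "2 * n"] by simp
  (* E is the change of the old inputs: changed coefficients, and the second half step acting on the first.
     g1 and g2 are the changes of the coefficients of the two new inputs. *)
  define E where "E x = (d / 2) *\<^sub>R (F' (2 * n + 1) x - F n x) + (d / 2) *\<^sub>R (F' (2 * n) x - F n x)
      + (d / 2) *\<^sub>R F' (2 * n + 1) ((d / 2) *\<^sub>R F' (2 * n) x)" for x
  have "linear_bounded_by (d / 2 * (c * d) + d / 2 * (c * d) + d / 2 * (b * (d / 2 * b))) E"
    unfolding E_def using b c d
    by (intro linear_bounded_by_add linear_bounded_by_scale FF1 FF2 linear_bounded_by_comp[OF _ F2] F1) auto
  then have E: "linear_bounded_by ((c + b\<^sup>2) * d * d) E"
  proof (rule linear_bounded_by_mono)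
    have "0 \<le> b * b * (d * d)" using d by simp
    then show "d / 2 * (c * d) + d / 2 * (c * d) + d / 2 * (b * (d / 2 * b)) \<le> (c + b\<^sup>2) * d * d"
      by (simp add: power2_eq_square field_simps)
  qed
  define g1 where "g1 x = (G' (2 * n) x - G n x) + (d / 2) *\<^sub>R F' (2 * n + 1) (G' (2 * n) x)" for x
  define g2 where "g2 x = G' (2 * n + 1) x - G n x" for x
  have an: "(c + b\<^sup>2) * d \<le> ?a (Suc n)"
  proof -
    have "1 * 1 \<le> B * (1 + (b + 1) * d) ^ Suc n"
      using b d B by (intro mult_mono one_le_power) auto
    then have "(c + b\<^sup>2) * d * 1 \<le> (c + b\<^sup>2) * d * (B * (1 + (b + 1) * d) ^ Suc n)"
      using b c d by (intro mult_left_mono) auto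
    then show ?thesis by (simp add: mult_ac)
  qed
  have g1: "linear_bounded_by (?a (Suc n)) g1"
  proof -
    have 1: "linear_bounded_by (c * d + d / 2 * (b * b)) g1"
      unfolding g1_def using b d
      by (intro linear_bounded_by_add linear_bounded_by_scale GG1 linear_bounded_by_comp[OF _ F2] G1) auto
    have 2: "c * d + d / 2 * (b * b) \<le> (c + b\<^sup>2) * d"
    proof -
      have "0 \<le> d * (b * b)" using d by simp
      then show ?thesis by (simp add: power2_eq_square algebra_simps)
    qed
    show ?thesis by (rule linear_bounded_by_mono[OF 1 order_trans[OF 2 an]])
  qed
  have g2: "linear_bounded_by (?a (Suc n)) g2"
  proof -
    have "c * d \<le> (c + b\<^sup>2) * d" using d by (simp add: algebra_simps)
    then show ?thesis unfolding g2_def by (rule linear_bounded_by_mono[OF GG2 order_trans[OF _ an]])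
  qed
  have old: "input_functional (?a (Suc n)) (2 * n)
     (\<lambda>z u. ((?x z u - ?y z u) + d *\<^sub>R F n (?x z u - ?y z u)) + E (?x z u))"
  proof -
    have "linear_bounded_by (1 + d * b) (\<lambda>x. x + d *\<^sub>R F n x)"
      using b d by (intro linear_bounded_by_add linear_bounded_by_id linear_bounded_by_scale F) auto
    from input_functional_add[OF input_functional_comp[OF IH this] input_functional_comp[OF X E]]
    have 1: "input_functional ((1 + d * b) * ?a n + (c + b\<^sup>2) * d * d * B) (2 * n)
       (\<lambda>z u. ((?x z u - ?y z u) + d *\<^sub>R F n (?x z u - ?y z u)) + E (?x z u))"
      using b c d by simp
    have "(c + b\<^sup>2) * B * d * 1 \<le> ?a n" using b c d B by (intro mult_left_mono one_le_power) auto
    then have "(c + b\<^sup>2) * d * d * B \<le> d * ?a n"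
      using mult_left_mono[OF _ d, of "(c + b\<^sup>2) * B * d * 1" "?a n"] by (simp only: mult_ac mult_1_right mult_1_left)
    then have "(1 + d * b) * ?a n + (c + b\<^sup>2) * d * d * B \<le> (1 + d * b) * ?a n + d * ?a n" by simp
    also have "\<dots> = ?a (Suc n)" by (simp add: algebra_simps)
    finally show ?thesis using 1 input_functional_mono by blast
  qed
  have lF: "linear (F n)" "linear (F' (2 * n))" "linear (F' (2 * n + 1))"
    using F F1 F2 by (auto dest: linear_bounded_byD)
  have lF3: "linear (F' (Suc (2 * n)))" using lF(3) by simp
  have lG: "linear (G n)"
  proof -
    show ?thesis
      using linear_compose_sub[OF linear_bounded_byD(1)[OF G1] linear_bounded_byD(1)[OF GG1]] by simp
  qed
  have eq: "linear_recursion F' G' (d / 2) z u (2 * Suc n)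
      - linear_recursion F G d z (\<lambda>j. u (2 * j) + u (2 * j + 1)) (Suc n) =
      (((?x z u - ?y z u) + d *\<^sub>R F n (?x z u - ?y z u)) + E (?x z u)) + g1 (u (2 * n)) + g2 (u (Suc (2 * n)))"
    for z u
  proof -
    have s2: "2 * Suc n = Suc (Suc (2 * n))" by simp
    have half: "d *\<^sub>R v = (d / 2) *\<^sub>R v + (d / 2) *\<^sub>R v" for v :: 's
      by (simp flip: scaleR_add_left)
    show ?thesis
      unfolding s2 linear_recursion.simps E_def g1_def g2_def half
      by (simp add: linear_add[OF lF(1)] linear_add[OF lF(2)] linear_add[OF lF3] linear_add[OF lG]
          linear_diff[OF lF(1)] linear_scale[OF lF3] scaleR_add_right scaleR_diff_right)
  qed
  show ?case
    using input_functional_Suc[OF input_functional_Suc[OF old g1] g2]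
    unfolding eq by simp
qed

section \<open>The discretized Riccati recursion\<close>

text \<open>The increment functions of the Riccati recursion are polynomials in the matrix, hence Lipschitz on bounded
  sets only, which suffices because the recursion stays bounded uniformly in the level.\<close>

definition lipschitz_on_balls :: "('a::real_normed_vector \<Rightarrow> 'b::real_normed_vector) \<Rightarrow> bool" where
  "lipschitz_on_balls f \<longleftrightarrow> (\<forall>r. \<exists>K\<ge>0. \<forall>x y. norm x \<le> r \<longrightarrow> norm y \<le> r \<longrightarrow> norm (f x - f y) \<le> K * norm (x - y))"

lemma lipschitz_on_balls_bounded:
  assumes "lipschitz_on_balls f"
  shows "\<exists>K\<ge>0. \<forall>x. norm x \<le> r \<longrightarrow> norm (f x) \<le> K"
proof -
  obtain K where K: "K \<ge> 0" "\<And>x y. norm x \<le> r \<Longrightarrow> norm y \<le> r \<Longrightarrow> norm (f x - f y) \<le> K * norm (x - y)"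
    using assms unfolding lipschitz_on_balls_def by meson
  have "norm (f x) \<le> norm (f 0) + K * \<bar>r\<bar>" if x: "norm x \<le> r" for x
  proof -
    have r: "0 \<le> r" using x norm_ge_zero order_trans by blast
    then have "norm (f x - f 0) \<le> K * norm (x - 0)" using K(2)[of x 0] x by simp
    also have "\<dots> \<le> K * \<bar>r\<bar>" using K(1) x r by (intro mult_left_mono) auto
    finally show ?thesis using norm_triangle_sub[of "f x" "f 0"] by simp
  qed
  then show ?thesis using K(1) by (intro exI[of _ "norm (f 0) + K * \<bar>r\<bar>"]) auto
qed

lemma lipschitz_on_balls_const: "lipschitz_on_balls (\<lambda>_. c)"
  unfolding lipschitz_on_balls_def by (auto intro!: exI[of _ 0])

lemma lipschitz_on_balls_id: "lipschitz_on_balls (\<lambda>x. x)"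
  unfolding lipschitz_on_balls_def by (auto intro!: exI[of _ 1])

lemma lipschitz_on_balls_add:
  assumes "lipschitz_on_balls f" "lipschitz_on_balls g"
  shows "lipschitz_on_balls (\<lambda>x. f x + g x)"
  unfolding lipschitz_on_balls_def
proof
  fix r
  obtain K where K: "K \<ge> 0" "\<And>x y. norm x \<le> r \<Longrightarrow> norm y \<le> r \<Longrightarrow> norm (f x - f y) \<le> K * norm (x - y)"
    using assms(1) unfolding lipschitz_on_balls_def by meson
  obtain L where L: "L \<ge> 0" "\<And>x y. norm x \<le> r \<Longrightarrow> norm y \<le> r \<Longrightarrow> norm (g x - g y) \<le> L * norm (x - y)"
    using assms(2) unfolding lipschitz_on_balls_def by meson
  have "norm (f x + g x - (f y + g y)) \<le> (K + L) * norm (x - y)" if "norm x \<le> r" "norm y \<le> r" for x y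
    using norm_triangle_le[OF add_mono[OF K(2)[OF that] L(2)[OF that]]]
    by (simp add: algebra_simps)
  then show "\<exists>K\<ge>0. \<forall>x y. norm x \<le> r \<longrightarrow> norm y \<le> r \<longrightarrow> norm (f x + g x - (f y + g y)) \<le> K * norm (x - y)"
    using K(1) L(1) by (intro exI[of _ "K + L"]) auto
qed

lemma lipschitz_on_balls_bilinear:
  assumes "bounded_bilinear pr" and f: "lipschitz_on_balls f" and g: "lipschitz_on_balls g"
  shows "lipschitz_on_balls (\<lambda>x. pr (f x) (g x))"
  unfolding lipschitz_on_balls_def
proof
  fix r
  interpret bounded_bilinear pr by fact
  obtain B where B: "0 \<le> B" "\<And>a b. norm (pr a b) \<le> norm a * norm b * B" using nonneg_bounded by blast
  obtain K where K: "K \<ge> 0" "\<And>x y. norm x \<le> r \<Longrightarrow> norm y \<le> r \<Longrightarrow> norm (f x - f y) \<le> K * norm (x - y)"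
    using f unfolding lipschitz_on_balls_def by meson
  obtain L where L: "L \<ge> 0" "\<And>x y. norm x \<le> r \<Longrightarrow> norm y \<le> r \<Longrightarrow> norm (g x - g y) \<le> L * norm (x - y)"
    using g unfolding lipschitz_on_balls_def by meson
  obtain P where P: "0 \<le> P" "\<And>x. norm x \<le> r \<Longrightarrow> norm (f x) \<le> P" using lipschitz_on_balls_bounded[OF f] by blast
  obtain Q where Q: "0 \<le> Q" "\<And>x. norm x \<le> r \<Longrightarrow> norm (g x) \<le> Q" using lipschitz_on_balls_bounded[OF g] by blast
  have "norm (pr (f x) (g x) - pr (f y) (g y)) \<le> (P * L * B + K * Q * B) * norm (x - y)"
    if x: "norm x \<le> r" and y: "norm y \<le> r" for x y
  proof -
    have "pr (f x) (g x) - pr (f y) (g y) = pr (f x) (g x - g y) + pr (f x - f y) (g y)"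
      by (simp add: diff_left diff_right)
    also have "norm \<dots> \<le> norm (f x) * norm (g x - g y) * B + norm (f x - f y) * norm (g y) * B"
      by (intro norm_triangle_le add_mono B)
    also have "\<dots> \<le> P * (L * norm (x - y)) * B + (K * norm (x - y)) * Q * B"
      using x y B(1) P(1) Q(1) K(1) by (intro add_mono mult_right_mono mult_mono P(2) Q(2) K(2) L(2)) auto
    finally show ?thesis by (simp add: algebra_simps)
  qed
  then show "\<exists>K\<ge>0. \<forall>x y. norm x \<le> r \<longrightarrow> norm y \<le> r \<longrightarrow> norm (pr (f x) (g x) - pr (f y) (g y)) \<le> K * norm (x - y)"
    using K(1) L(1) P(1) Q(1) B(1) by (intro exI[of _ "P * L * B + K * Q * B"]) auto
qed

text \<open>Two half steps and one full step of a locally Lipschitz one-step scheme differ by \<open>O(d\<^sup>2)\<close>,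
  so along bounded orbits consecutive levels stay \<open>O(d)\<close> close.\<close>

lemma one_step_scheme_refine:
  fixes R T :: "'a::real_normed_vector \<Rightarrow> 'a" and p q :: "nat \<Rightarrow> 'a"
  assumes d: "0 \<le> d" "d \<le> 1"
    and KR: "0 \<le> K" "\<And>x y. norm x \<le> r \<Longrightarrow> norm y \<le> r \<Longrightarrow> norm (R x - R y) \<le> K * norm (x - y)"
    and bR: "0 \<le> B" "\<And>x. norm x \<le> r \<Longrightarrow> norm (R x) \<le> B" "\<And>x. norm x \<le> r \<Longrightarrow> norm (T x) \<le> B"
    and p: "\<And>k. p (Suc k) = p k + d *\<^sub>R R (p k) + d\<^sup>2 *\<^sub>R T (p k)" "\<And>k. norm (p k) \<le> r"
    and q: "\<And>k. q (Suc k) = q k + (d / 2) *\<^sub>R R (q k) + (d / 2)\<^sup>2 *\<^sub>R T (q k)" "\<And>k. norm (q k) \<le> r"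
    and pq: "p 0 = q 0"
  shows "norm (q (2 * k) - p k) \<le> (2 * K * B + 2 * B) * d * (1 + (K + 1) * d) ^ k"
    and "norm (q (Suc k) - q k) \<le> 2 * B * d"
proof -
  have step: "norm (q (Suc k) - q k) \<le> 2 * B * d" for k
  proof -
    have "q (Suc k) - q k = (d / 2) *\<^sub>R R (q k) + (d / 2)\<^sup>2 *\<^sub>R T (q k)" using q(1) by simp
    also have "norm \<dots> \<le> (d / 2) * B + (d / 2)\<^sup>2 * B"
      using d bR q(2) by (intro norm_triangle_le add_mono) (auto intro!: mult_left_mono)
    also have "\<dots> \<le> d * B + d * B"
    proof (intro add_mono mult_right_mono bR)
      show "(d / 2)\<^sup>2 \<le> d" using d mult_mono[of "d/2" 1 "d/2" d] by (simp add: power2_eq_square)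
    qed (use d in auto)
    finally show ?thesis by simp
  qed
  then show "norm (q (Suc k) - q k) \<le> 2 * B * d" .
  show "norm (q (2 * k) - p k) \<le> (2 * K * B + 2 * B) * d * (1 + (K + 1) * d) ^ k"
  proof (induction k)
    case 0
    then show ?case using pq d KR bR by simp
  next
    case (Suc k)
    define e where "e = q (2 * k) - p k"
    define a where "a = (2 * K * B + 2 * B) * d * (1 + (K + 1) * d) ^ k"
    let ?q0 = "q (2 * k)" and ?q1 = "q (Suc (2 * k))"
    have eq: "q (2 * Suc k) - p (Suc k) = (e + d *\<^sub>R (R ?q0 - R (p k))) + (d / 2) *\<^sub>R (R ?q1 - R ?q0)
       + ((d / 2)\<^sup>2 *\<^sub>R T ?q0 + (d / 2)\<^sup>2 *\<^sub>R T ?q1 - d\<^sup>2 *\<^sub>R T (p k))"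
    proof -
      have half: "d *\<^sub>R v = (d / 2) *\<^sub>R v + (d / 2) *\<^sub>R v" for v :: 'a
        by (simp flip: scaleR_add_left)
      have s2: "2 * Suc k = Suc (Suc (2 * k))" by simp
      show ?thesis unfolding s2 q(1)[of "Suc (2 * k)"] q(1)[of "2 * k"] p(1)[of k] e_def half
        by (simp only: q(1)[of "2 * k", symmetric]) (simp add: scaleR_diff_right q(1)[of "2 * k"])
    qed
    have "norm (e + d *\<^sub>R (R ?q0 - R (p k))) \<le> norm e + d * (K * norm e)"
      using KR(2)[OF q(2)[of "2 * k"] p(2)[of k]] d(1)
      by (intro norm_triangle_le add_left_mono) (auto simp: e_def intro!: mult_left_mono)
    moreover have "norm ((d / 2) *\<^sub>R (R ?q1 - R ?q0)) \<le> K * B * d * d"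
    proof -
      have "norm (R ?q1 - R ?q0) \<le> K * (2 * B * d)"
        using KR(2)[OF q(2)[of "Suc (2 * k)"] q(2)[of "2 * k"]] mult_left_mono[OF step[of "2 * k"] KR(1)]
        by linarith
      then have "(d / 2) * norm (R ?q1 - R ?q0) \<le> (d / 2) * (K * (2 * B * d))"
        using d by (intro mult_left_mono) auto
      then show ?thesis using d by (simp add: mult_ac)
    qed
    moreover have "norm ((d / 2)\<^sup>2 *\<^sub>R T ?q0 + (d / 2)\<^sup>2 *\<^sub>R T ?q1 - d\<^sup>2 *\<^sub>R T (p k)) \<le> (d / 2)\<^sup>2 * B + (d / 2)\<^sup>2 * B + d\<^sup>2 * B"
      using p(2) q(2) bR by (intro norm_triangle_le_diff norm_triangle_le add_mono) (auto intro!: mult_left_mono)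
    moreover have "norm e + d * (K * norm e) \<le> a + d * (K * a)"
      using Suc.IH KR d unfolding e_def a_def by (intro add_mono mult_left_mono) auto
    moreover have "(d / 2)\<^sup>2 * B + (d / 2)\<^sup>2 * B + d\<^sup>2 * B \<le> 2 * B * d * d"
    proof -
      have "0 \<le> B * (d * d)" using bR(1) d by simp
      then show ?thesis by (simp add: power2_eq_square field_simps)
    qed
    moreover have "(K * B + 2 * B) * d * d \<le> a * d"
    proof (rule mult_right_mono)
      have "(K * B + 2 * B) * d \<le> (2 * K * B + 2 * B) * d * 1"
        using KR bR d mult_nonneg_nonneg[OF KR(1) bR(1)] by (simp add: mult_right_mono)
      also have "\<dots> \<le> a" unfolding a_def using KR bR d by (intro mult_left_mono one_le_power) auto
      finally show "(K * B + 2 * B) * d \<le> a" .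
    qed (fact d)
    moreover have "norm (q (2 * Suc k) - p (Suc k)) \<le> norm (e + d *\<^sub>R (R ?q0 - R (p k))) + norm ((d / 2) *\<^sub>R (R ?q1 - R ?q0))
       + norm ((d / 2)\<^sup>2 *\<^sub>R T ?q0 + (d / 2)\<^sup>2 *\<^sub>R T ?q1 - d\<^sup>2 *\<^sub>R T (p k))"
      unfolding eq by (intro norm_triangle_le add_right_mono norm_triangle_ineq)
    ultimately have "norm (q (2 * Suc k) - p (Suc k)) \<le> a + d * (K * a) + a * d"
      by (simp add: algebra_simps)
    then show ?case by (simp add: algebra_simps a_def)
  qed
qed

lemma bounded_bilinear_matrix_mult:
  "bounded_bilinear (\<lambda>(A::real^'m^'n) (B::real^'k^'m). A ** B)"
  unfolding bilinear_conv_bounded_bilinear[symmetric] bilinear_def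
  by (auto intro!: linearI
      simp: matrix_matrix_mult_def vec_eq_iff algebra_simps sum.distrib sum_distrib_left)

lemma bounded_bilinear_matrix_vector_mult:
  "bounded_bilinear (\<lambda>(A::real^'m^'n) (x::real^'m). A *v x)"
  unfolding bilinear_conv_bounded_bilinear[symmetric] bilinear_def
  by (auto intro!: linearI simp: matrix_vector_mult_def vec_eq_iff algebra_simps sum.distrib sum_distrib_left)

lemma linear_bounded_by_matrix:
  "\<exists>c\<ge>0. \<forall>A::real^'m^'n. linear_bounded_by (c * norm A) (\<lambda>x. A *v x)"
proof -
  interpret bounded_bilinear "\<lambda>(A::real^'m^'n) (x::real^'m). A *v x"
    by (rule bounded_bilinear_matrix_vector_mult)
  obtain B where "0 \<le> B" "\<And>a b. norm ((a::real^'m^'n) *v b) \<le> norm a * norm b * B" using nonneg_bounded by blast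
  then show ?thesis
    by (intro exI[of _ B]) (auto simp: linear_bounded_by_def mult_ac)
qed

lemma matrix_mult_norm_bound:
  "\<exists>c\<ge>0. \<forall>(A::real^'m^'n) (B::real^'k^'m). norm (A ** B) \<le> c * norm A * norm B"
proof -
  interpret bounded_bilinear "\<lambda>(A::real^'m^'n) (B::real^'k^'m). A ** B" by (rule bounded_bilinear_matrix_mult)
  obtain K where "0 \<le> K" "\<And>a b. norm ((a::real^'m^'n) ** (b::real^'k^'m)) \<le> norm a * norm b * K" using nonneg_bounded by blast
  then show ?thesis by (intro exI[of _ K]) (auto simp: mult_ac)
qed

lemma quadratic_form_bound:
  fixes Q :: "real^'n^'n"
  shows "\<exists>p\<ge>0. \<forall>x. x \<bullet> (Q *v x) \<le> p * (norm x)\<^sup>2"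
proof -
  obtain c where c: "c \<ge> 0" "\<And>A::real^'n^'n. linear_bounded_by (c * norm A) (\<lambda>x. A *v x)"
    using linear_bounded_by_matrix by blast
  have "x \<bullet> (Q *v x) \<le> c * norm Q * (norm x)\<^sup>2" for x
  proof -
    have "x \<bullet> (Q *v x) \<le> norm x * norm (Q *v x)" by (rule norm_cauchy_schwarz)
    also have "\<dots> \<le> norm x * (c * norm Q * norm x)" by (intro mult_left_mono linear_bounded_byD(2)[OF c(2)]) simp
    finally show ?thesis by (simp add: power2_eq_square mult_ac)
  qed
  then show ?thesis using c by (intro exI[of _ "c * norm Q"]) simp
qed

lemma norm_le_of_entries:
  fixes Q :: "real^'n^'m"
  assumes "\<And>i j. \<bar>Q $ i $ j\<bar> \<le> K"
  shows "norm Q \<le> real CARD('m) * (real CARD('n) * K)"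
proof -
  have "norm (Q $ i) \<le> real CARD('n) * K" for i
    using order_trans[OF norm_le_l1_cart sum_bounded_above[of UNIV "\<lambda>j. \<bar>Q $ i $ j\<bar>" K]] assms by simp
  then have "L2_set (\<lambda>i. norm (Q $ i)) UNIV \<le> real CARD('m) * (real CARD('n) * K)"
    using order_trans[OF L2_set_le_sum sum_bounded_above[of UNIV "\<lambda>i. norm (Q $ i)" "real CARD('n) * K"]] by simp
  then show ?thesis by (simp add: norm_vec_def)
qed

lemma step_size_pos: "0 < step_size l" and step_size_le_1: "step_size l \<le> 1"
  and step_size_Suc: "step_size (Suc l) = step_size l / 2"
  and step_size_grid: "real (t * 2 ^ l) * step_size l = real t"
  by (auto simp: step_size_def)

lemma lipschitz_on_balls_Ricc: "lipschitz_on_balls (Ricc A C R1h R2h)"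
proof -
  note m = lipschitz_on_balls_bilinear[OF bounded_bilinear_matrix_mult]
  note c = lipschitz_on_balls_const lipschitz_on_balls_id
  have minus: "P - Q = P + (- 1) *\<^sub>R Q" for P Q :: "real^'a^'a" by simp
  show ?thesis
    unfolding Ricc_def[abs_def] minus
    by (intro lipschitz_on_balls_add m c lipschitz_on_balls_bilinear[OF bounded_bilinear_scaleR])
qed

lemma lipschitz_on_balls_SRicc: "lipschitz_on_balls (SRicc A C R2h)"
proof -
  note m = lipschitz_on_balls_bilinear[OF bounded_bilinear_matrix_mult]
  note c = lipschitz_on_balls_const lipschitz_on_balls_id
  have minus: "P - Q = P + (- 1) *\<^sub>R Q" for P Q :: "real^'a^'a" by simp
  show ?thesis
    unfolding SRicc_def[abs_def] minus
    by (intro lipschitz_on_balls_add m c lipschitz_on_balls_bilinear[OF bounded_bilinear_scaleR])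
qed

lemma power_one_plus_le_exp:
  assumes "0 \<le> a" "0 \<le> d" "real n * d \<le> T"
  shows "(1 + a * d) ^ n \<le> exp (a * T)"
proof -
  have "(1 + a * d) ^ n \<le> exp (a * d) ^ n" using assms by (intro power_mono) auto
  also have "\<dots> = exp (a * (real n * d))" by (simp add: exp_of_nat_mult[symmetric] mult_ac)
  also have "\<dots> \<le> exp (a * T)" using assms by (simp add: mult_left_mono)
  finally show ?thesis .
qed

text \<open>A fine index \<open>2 k + 1\<close> has no counterpart on the coarse grid. It is compared with the coarse value at the
  preceding grid point, at the cost of one fine step, which is also \<open>O(d)\<close>.\<close>

lemma riccati_rec_refine:
  assumes "\<exists>K::real. \<forall>k l. \<forall>j1 j2. \<bar>riccati_rec A C R1h R2h P0 l k $ j1 $ j2\<bar> \<le> K"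
  obtains r K where "0 \<le> r" "0 \<le> K"
    "\<And>l k. norm (riccati_rec A C R1h R2h P0 l k) \<le> r"
    "\<And>l k n. k < 2 * n \<Longrightarrow> real n * step_size l \<le> T \<Longrightarrow>
       norm (riccati_rec A C R1h R2h P0 (Suc l) k - riccati_rec A C R1h R2h P0 l (k div 2)) \<le> K * step_size l"
proof -
  let ?P = "riccati_rec A C R1h R2h P0"
  obtain K0 where K0: "\<And>l k j1 j2. \<bar>?P l k $ j1 $ j2\<bar> \<le> K0" using assms by blast
  define r where "r = real CARD('a) * (real CARD('a) * K0)"
  have r: "norm (?P l k) \<le> r" for l k unfolding r_def by (rule norm_le_of_entries) (rule K0)
  have r0: "0 \<le> r" using r[of 0 0] norm_ge_zero order_trans by blast
  obtain L where L: "0 \<le> L" "\<And>x y. norm x \<le> r \<Longrightarrow> norm y \<le> r \<Longrightarrow>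
      norm (Ricc A C R1h R2h x - Ricc A C R1h R2h y) \<le> L * norm (x - y)"
    using lipschitz_on_balls_Ricc unfolding lipschitz_on_balls_def by meson
  obtain B1 where B1: "0 \<le> B1" "\<And>x. norm x \<le> r \<Longrightarrow> norm (Ricc A C R1h R2h x) \<le> B1"
    using lipschitz_on_balls_bounded[OF lipschitz_on_balls_Ricc] by meson
  obtain B2 where B2: "0 \<le> B2" "\<And>x. norm x \<le> r \<Longrightarrow> norm (SRicc A C R2h x) \<le> B2"
    using lipschitz_on_balls_bounded[OF lipschitz_on_balls_SRicc] by meson
  define B where "B = B1 + B2"
  have B: "0 \<le> B" "\<And>x. norm x \<le> r \<Longrightarrow> norm (Ricc A C R1h R2h x) \<le> B" "\<And>x. norm x \<le> r \<Longrightarrow> norm (SRicc A C R2h x) \<le> B"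
    using B1 B2 by (auto simp: B_def add_increasing add_increasing2)
  define K where "K = (2 * L * B + 2 * B) * exp ((L + 1) * \<bar>T\<bar>) + 2 * B"
  have "norm (?P (Suc l) k - ?P l (k div 2)) \<le> K * step_size l"
    if k: "k < 2 * n" and n: "real n * step_size l \<le> T" for l k n
  proof -
    let ?d = "step_size l"
    have d: "0 \<le> ?d" "?d \<le> 1" using step_size_pos[of l] step_size_le_1[of l] by auto
    have step: "?P l (Suc k) = ?P l k + step_size l *\<^sub>R Ricc A C R1h R2h (?P l k) + (step_size l)\<^sup>2 *\<^sub>R SRicc A C R2h (?P l k)" for l k
      by (simp add: Let_def)
    note ref = one_step_scheme_refine[of ?d L r "Ricc A C R1h R2h" B "SRicc A C R2h" "?P l" "?P (Suc l)",
        OF d L B step r step[of "Suc l", unfolded step_size_Suc] r]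
    have "(1 + (L + 1) * ?d) ^ (k div 2) \<le> exp ((L + 1) * \<bar>T\<bar>)"
    proof (rule power_one_plus_le_exp)
      have "real (k div 2) * ?d \<le> real n * ?d" using k d by (intro mult_right_mono) auto
      then show "real (k div 2) * ?d \<le> \<bar>T\<bar>" using n by linarith
    qed (use L d in auto)
    then have "(2 * L * B + 2 * B) * ?d * (1 + (L + 1) * ?d) ^ (k div 2) \<le> (2 * L * B + 2 * B) * ?d * exp ((L + 1) * \<bar>T\<bar>)"
      using L B d by (intro mult_left_mono) auto
    with ref(1)[of "k div 2"]
    have even: "norm (?P (Suc l) (2 * (k div 2)) - ?P l (k div 2)) \<le> (2 * L * B + 2 * B) * ?d * exp ((L + 1) * \<bar>T\<bar>)"
      by simp
    have K: "K * ?d = (2 * L * B + 2 * B) * ?d * exp ((L + 1) * \<bar>T\<bar>) + 2 * B * ?d"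
      by (simp add: K_def algebra_simps)
    have Bd: "0 \<le> B * ?d" using B(1) d by simp
    show ?thesis
    proof (cases "even k")
      case True
      then have "2 * (k div 2) = k" by simp
      then show ?thesis using even Bd unfolding K by simp
    next
      case False
      then have k': "Suc (2 * (k div 2)) = k" by simp
      have "norm (?P (Suc l) k - ?P (Suc l) (2 * (k div 2))) \<le> 2 * B * ?d"
        using ref(2)[of "2 * (k div 2)"] unfolding k' by simp
      then show ?thesis using even norm_triangle_sub[of "?P (Suc l) k - ?P l (k div 2)" "?P (Suc l) (2 * (k div 2)) - ?P l (k div 2)"]
        unfolding K by simp
    qed
  qed
  moreover have "0 \<le> K" using L B by (simp add: K_def)
  ultimately show ?thesis using that r0 r by blast
qed

section \<open>The Euler dynamics as a linear recursion\<close>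

definition euler_drift ::
  "real^'x^'x \<Rightarrow> real^'x^'y \<Rightarrow> real^'x^'x \<Rightarrow> real^'y^'y \<Rightarrow> real^'x^'x \<Rightarrow> nat \<Rightarrow> nat \<Rightarrow> real^'x \<Rightarrow> real^'x" where
  "euler_drift A C R1h R2h P0 l k x = (A - riccati_rec A C R1h R2h P0 l k ** S_matrix C R2h) *v x"

definition euler_input ::
  "real^'x^'x \<Rightarrow> real^'x^'y \<Rightarrow> real^'x^'x \<Rightarrow> real^'y^'y \<Rightarrow> real^'x^'x \<Rightarrow> nat \<Rightarrow> nat \<Rightarrow> (real^'x) \<times> (real^'y) \<Rightarrow> real^'x" where
  "euler_input A C R1h R2h P0 l k u = fst u + gain A C R1h R2h P0 l k *v snd u"

definition increment :: "(real \<Rightarrow> 'a::real_vector) \<Rightarrow> nat \<Rightarrow> nat \<Rightarrow> 'a" where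
  "increment p l k = p (real (Suc k) * step_size l) - p (real k * step_size l)"

lemma increment_refine:
  "increment p l k = increment p (Suc l) (2 * k) + increment p (Suc l) (2 * k + 1)"
  by (simp add: increment_def step_size_Suc algebra_simps)

abbreviation euler_recursion where
  "euler_recursion A C R1h R2h P0 l \<equiv>
     linear_recursion (euler_drift A C R1h R2h P0 l) (euler_input A C R1h R2h P0 l) (step_size l)"

lemma euler_eq_recursion:
  "euler A C R1h R2h P0 l z v w y k = euler_recursion A C R1h R2h P0 l z
     (\<lambda>j. (R1h *v increment w l j, increment y l j - R2h *v increment v l j)) k"
proof (induction k)
  case (Suc k)
  let ?z = "euler A C R1h R2h P0 l z v w y k"
  have "gain A C R1h R2h P0 l k *v (C *v ?z) = (riccati_rec A C R1h R2h P0 l k ** S_matrix C R2h) *v ?z"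
    by (simp add: gain_def S_matrix_def matrix_vector_mul_assoc matrix_mul_assoc)
  then show ?case
    using Suc by (simp add: Let_def euler_drift_def euler_input_def increment_def
        matrix_vector_mult_diff_distrib matrix_vector_right_distrib matrix_vector_mult_diff_rdistrib
        matrix_vector_mult_scaleR scaleR_diff_right del: of_nat_Suc)
qed simp

lemma linear_recursion_add:
  assumes "\<And>k. linear (F k)" "\<And>k. linear (G k)"
  shows "linear_recursion F G d (z + z') (\<lambda>j. u j + u' j) k = linear_recursion F G d z u k + linear_recursion F G d z' u' k"
  by (induction k) (simp_all add: linear_add[OF assms(1)] linear_add[OF assms(2)] scaleR_add_right)

lemma linear_euler_drift: "linear (euler_drift A C R1h R2h P0 l k)"
  unfolding euler_drift_def by simp

lemma linear_euler_input: "linear (euler_input A C R1h R2h P0 l k)"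
  unfolding euler_input_def
  by (auto intro!: linearI simp: matrix_vector_right_distrib matrix_vector_mult_scaleR scaleR_add_right)

text \<open>The gains are deterministic, so the scheme is jointly linear in the initial state, the noises and the
  observations.\<close>

lemma euler_split:
  "euler A C R1h R2h P0 l z v w y k =
     euler A C R1h R2h P0 l m (\<lambda>_. 0) (\<lambda>_. 0) y k + euler A C R1h R2h P0 l (z - m) v w (\<lambda>_. 0) k"
proof -
  have u: "(R1h *v increment w l j, increment y l j - R2h *v increment v l j) =
     (R1h *v increment (\<lambda>_. 0) l j, increment y l j - R2h *v increment (\<lambda>_. 0) l j)
     + (R1h *v increment w l j, increment (\<lambda>_. 0) l j - R2h *v increment v l j)" for j
    by (simp add: increment_def)
  have z: "z = m + (z - m)" by simp
  show ?thesis
    unfolding euler_eq_recursion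
    by (subst z, subst u) (rule linear_recursion_add[OF linear_euler_drift linear_euler_input])
qed

lemma euler_drift_bounded:
  assumes "\<exists>K::real. \<forall>k l. \<forall>j1 j2. \<bar>riccati_rec A C R1h R2h P l k $ j1 $ j2\<bar> \<le> K"
  shows "\<exists>b\<ge>1. \<forall>l k. linear_bounded_by b (euler_drift A C R1h R2h P l k)"
proof -
  obtain r K0 where r: "0 \<le> r" "0 \<le> K0" "\<And>l k. norm (riccati_rec A C R1h R2h P l k) \<le> r"
    and "\<And>l k n. k < 2 * n \<Longrightarrow> real n * step_size l \<le> 0 \<Longrightarrow> norm (riccati_rec A C R1h R2h P (Suc l) k - riccati_rec A C R1h R2h P l (k div 2)) \<le> K0 * step_size l"
    by (rule riccati_rec_refine[OF assms]) blast
  obtain c where c: "0 \<le> c" "\<And>Q::real^'a^'a. linear_bounded_by (c * norm Q) (\<lambda>x. Q *v x)"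
    using linear_bounded_by_matrix by blast
  obtain c1 where c1: "0 \<le> c1" "\<And>(A::real^'a^'a) (B::real^'a^'a). norm (A ** B) \<le> c1 * norm A * norm B"
    using matrix_mult_norm_bound by blast
  define b where "b = 1 + c * (norm A + c1 * r * norm (S_matrix C R2h))"
  have "linear_bounded_by b (euler_drift A C R1h R2h P l k)" for l k
  proof -
    let ?PS = "riccati_rec A C R1h R2h P l k ** S_matrix C R2h"
    have "c1 * norm (riccati_rec A C R1h R2h P l k) * norm (S_matrix C R2h) \<le> c1 * r * norm (S_matrix C R2h)"
      by (intro mult_right_mono mult_left_mono r c1) simp
    then have "norm (A - ?PS) \<le> norm A + c1 * r * norm (S_matrix C R2h)"
      using norm_triangle_ineq4[of A ?PS] c1(2)[of "riccati_rec A C R1h R2h P l k" "S_matrix C R2h"] by linarith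
    then have "c * norm (A - ?PS) \<le> b" using mult_left_mono[OF _ c(1)] by (simp add: b_def add_increasing)
    then show ?thesis unfolding euler_drift_def by (rule linear_bounded_by_mono[OF c(2)])
  qed
  moreover have "1 \<le> b" using c c1 r by (simp add: b_def)
  ultimately show ?thesis by blast
qed

text \<open>The coarse scheme receives the sums of two consecutive fine inputs, as increments of a path do. The
  bounds hold for arbitrary inputs, so they apply to the noise of a sample, to the noise of the model
  and to the observations alike.\<close>

lemma euler_functional:
  assumes "\<exists>K::real. \<forall>k l. \<forall>j1 j2. \<bar>riccati_rec A C R1h R2h P0 l k $ j1 $ j2\<bar> \<le> K" and T: "0 \<le> T"
  obtains B K where "1 \<le> B" "0 \<le> K"
    "\<And>l n. real n * step_size l \<le> T \<Longrightarrow>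
       input_functional B n (\<lambda>z u. euler_recursion A C R1h R2h P0 l z u n)"
    "\<And>l n. real n * step_size l \<le> T \<Longrightarrow>
       input_functional (K * step_size l) (2 * n)
         (\<lambda>z u. euler_recursion A C R1h R2h P0 (Suc l) z u (2 * n)
              - euler_recursion A C R1h R2h P0 l z (\<lambda>j. u (2 * j) + u (2 * j + 1)) n)"
proof -
  let ?P = "riccati_rec A C R1h R2h P0"
  let ?S = "S_matrix C R2h" and ?H = "transpose C ** matrix_inv (R2h ** R2h)"
  let ?F = "euler_drift A C R1h R2h P0" and ?G = "euler_input A C R1h R2h P0"
  obtain r K0 where r: "0 \<le> r" "0 \<le> K0" "\<And>l k. norm (?P l k) \<le> r"
    and K0: "\<And>l k n. k < 2 * n \<Longrightarrow> real n * step_size l \<le> T \<Longrightarrow>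
       norm (?P (Suc l) k - ?P l (k div 2)) \<le> K0 * step_size l"
    using riccati_rec_refine[OF assms(1)] by metis
  obtain c1 where c1: "0 \<le> c1" "\<And>Q::real^'a^'a. linear_bounded_by (c1 * norm Q) (\<lambda>x. Q *v x)"
    using linear_bounded_by_matrix by blast
  obtain c2 where c2: "0 \<le> c2" "\<And>Q::real^'b^'a. linear_bounded_by (c2 * norm Q) (\<lambda>x. Q *v x)"
    using linear_bounded_by_matrix by blast
  interpret m1: bounded_bilinear "\<lambda>(A::real^'a^'a) (B::real^'a^'a). A ** B" by (rule bounded_bilinear_matrix_mult)
  interpret m2: bounded_bilinear "\<lambda>(A::real^'a^'a) (B::real^'b^'a). A ** B" by (rule bounded_bilinear_matrix_mult)
  obtain k1 where k1: "0 \<le> k1" "\<And>(Q::real^'a^'a) (B::real^'a^'a). norm (Q ** B) \<le> k1 * norm Q * norm B"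
    using matrix_mult_norm_bound by blast
  obtain k2 where k2: "0 \<le> k2" "\<And>(Q::real^'a^'a) (B::real^'b^'a). norm (Q ** B) \<le> k2 * norm Q * norm B"
    using matrix_mult_norm_bound by blast
  define s1 where "s1 = k1 * norm ?S"
  define s2 where "s2 = k2 * norm ?H"
  have s1: "0 \<le> s1" "norm (Q ** ?S) \<le> s1 * norm Q" for Q :: "real^'a^'a"
    using k1(1) k1(2)[of Q ?S] by (simp_all add: s1_def mult_ac)
  have s2: "0 \<le> s2" "norm (Q ** ?H) \<le> s2 * norm Q" for Q :: "real^'a^'a"
    using k2(1) k2(2)[of Q ?H] by (simp_all add: s2_def mult_ac)
  have gain: "gain A C R1h R2h P0 l k = ?P l k ** ?H" for l k
    by (simp add: gain_def matrix_mul_assoc)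
  obtain b0 where b0: "1 \<le> b0" "\<And>l k. linear_bounded_by b0 (?F l k)" using euler_drift_bounded[OF assms(1)] by blast
  define b where "b = b0 + c2 * (s2 * r)"
  have b: "1 \<le> b" "b0 \<le> b" using b0 c2 s2 r by (simp_all add: b_def add_increasing2)
  have F: "linear_bounded_by b (?F l k)" for l k by (rule linear_bounded_by_mono[OF b0(2) b(2)])
  have fst1: "linear_bounded_by 1 (fst :: (real^'a) \<times> (real^'b) \<Rightarrow> real^'a)"
    by (auto simp: linear_bounded_by_def linear_fst norm_fst_le)
  have snd1: "linear_bounded_by 1 (snd :: (real^'a) \<times> (real^'b) \<Rightarrow> real^'b)"
    by (auto simp: linear_bounded_by_def linear_snd norm_snd_le)
  have G: "linear_bounded_by b (?G l k)" for l k
  proof -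
    have "norm (?P l k ** ?H) \<le> s2 * r"
      using s2(2)[of "?P l k"] mult_left_mono[OF r(3)[of l k] s2(1)] by linarith
    then have "1 + c2 * norm (?P l k ** ?H) * 1 \<le> b"
      using mult_left_mono[OF _ c2(1)] b0(1) by (fastforce simp: b_def)
    moreover have "linear_bounded_by (1 + c2 * norm (?P l k ** ?H) * 1) (?G l k)"
      unfolding euler_input_def gain using c2
      by (intro linear_bounded_by_add fst1 linear_bounded_by_comp[OF snd1 c2(2)]) auto
    ultimately show ?thesis by (rule linear_bounded_by_mono[rotated])
  qed
  define c where "c = c1 * (s1 * K0) + c2 * (s2 * K0)"
  have c: "0 \<le> c" using c1 c2 s1 s2 r by (simp add: c_def)
  have FF: "linear_bounded_by (c * step_size l) (\<lambda>x. ?F (Suc l) k x - ?F l (k div 2) x)"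
    if "k < 2 * n" "real n * step_size l \<le> T" for l k n
  proof -
    let ?Q = "?P l (k div 2) - ?P (Suc l) k"
    have Q: "norm ?Q \<le> K0 * step_size l" using K0[OF that] by (simp add: norm_minus_commute)
    have d: "0 \<le> step_size l" using step_size_pos[of l] by simp
    have "(\<lambda>x. ?F (Suc l) k x - ?F l (k div 2) x) = (\<lambda>x. (?Q ** ?S) *v x)"
      by (simp add: euler_drift_def fun_eq_iff m1.diff_left matrix_vector_mult_diff_rdistrib)
    moreover have "c1 * norm (?Q ** ?S) \<le> c * step_size l"
    proof -
      have "c1 * norm (?Q ** ?S) \<le> c1 * (s1 * (K0 * step_size l))"
        using s1(2)[of ?Q] mult_left_mono[OF Q s1(1)] by (intro mult_left_mono c1(1)) linarith
      also have "\<dots> \<le> c * step_size l" using c2 s2 r d by (simp add: c_def algebra_simps)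
      finally show ?thesis .
    qed
    ultimately show ?thesis by (simp only: linear_bounded_by_mono[OF c1(2)])
  qed
  have GG: "linear_bounded_by (c * step_size l) (\<lambda>x. ?G (Suc l) k x - ?G l (k div 2) x)"
    if "k < 2 * n" "real n * step_size l \<le> T" for l k n
  proof -
    let ?Q = "?P (Suc l) k - ?P l (k div 2)"
    have Q: "norm ?Q \<le> K0 * step_size l" using K0[OF that] .
    have d: "0 \<le> step_size l" using step_size_pos[of l] by simp
    have "(\<lambda>x. ?G (Suc l) k x - ?G l (k div 2) x) = (\<lambda>x. (?Q ** ?H) *v snd x)"
      by (simp add: euler_input_def gain fun_eq_iff m2.diff_left matrix_vector_mult_diff_rdistrib)
    moreover have "c2 * norm (?Q ** ?H) * 1 \<le> c * step_size l"
    proof -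
      have "c2 * norm (?Q ** ?H) \<le> c2 * (s2 * (K0 * step_size l))"
        using s2(2)[of ?Q] mult_left_mono[OF Q s2(1)] by (intro mult_left_mono c2(1)) linarith
      also have "\<dots> \<le> c * step_size l" using c1 s1 r d by (simp add: c_def algebra_simps)
      finally show ?thesis by simp
    qed
    moreover note linear_bounded_by_mono[rotated, OF this]
    moreover have "linear_bounded_by (c2 * norm (?Q ** ?H) * 1) (\<lambda>x::(real^'a) \<times> (real^'b). (?Q ** ?H) *v snd x)"
      using c2 by (intro linear_bounded_by_comp[OF snd1 c2(2)]) auto
    ultimately show ?thesis by (simp only:)
  qed
  define B where "B = b * exp (b * T)"
  have B: "1 \<le> B" unfolding B_def using mult_mono[of 1 b 1 "exp (b * T)"] b T by simp
  have bound: "input_functional B n (\<lambda>z u. euler_recursion A C R1h R2h P0 l z u n)"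
    if "real n * step_size l \<le> T" for l n
  proof -
    have "input_functional (b * (1 + b * step_size l) ^ n) n (\<lambda>z u. euler_recursion A C R1h R2h P0 l z u n)"
      using b step_size_pos[of l] F G by (intro linear_recursion_bounded) auto
    moreover have "b * (1 + b * step_size l) ^ n \<le> B"
      unfolding B_def using b step_size_pos[of l] that
      by (intro mult_left_mono power_one_plus_le_exp) auto
    ultimately show ?thesis by (rule input_functional_mono)
  qed
  define K where "K = (c + b\<^sup>2) * B * exp ((b + 1) * T)"
  have K: "0 \<le> K" using c b B by (simp add: K_def)
  have refine: "input_functional (K * step_size l) (2 * n)
         (\<lambda>z u. euler_recursion A C R1h R2h P0 (Suc l) z u (2 * n)
              - euler_recursion A C R1h R2h P0 l z (\<lambda>j. u (2 * j) + u (2 * j + 1)) n)"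
    if n: "real n * step_size l \<le> T" for l n
  proof -
    have d: "0 \<le> step_size l" using step_size_pos[of l] by simp
    have "input_functional ((c + b\<^sup>2) * B * step_size l * (1 + (b + 1) * step_size l) ^ n) (2 * n)
         (\<lambda>z u. linear_recursion (?F (Suc l)) (?G (Suc l)) (step_size l / 2) z u (2 * n)
              - euler_recursion A C R1h R2h P0 l z (\<lambda>j. u (2 * j) + u (2 * j + 1)) n)"
    proof (rule linear_recursion_refine[where F = "?F l" and G = "?G l" and F' = "?F (Suc l)" and G' = "?G (Suc l)", OF b(1) d c B F F G])
      fix k assume k: "k \<le> 2 * n"
      have "real k * step_size (Suc l) \<le> real (2 * n) * step_size (Suc l)"
        using k step_size_pos[of "Suc l"] by (intro mult_right_mono) auto
      then have "real k * step_size (Suc l) \<le> T" using n by (simp add: step_size_Suc)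
      from bound[OF this] show "input_functional B k (\<lambda>z u. linear_recursion (?F (Suc l)) (?G (Suc l)) (step_size l / 2) z u k)"
        by (simp add: step_size_Suc)
    qed (use FF GG n in auto)
    moreover
    have "(c + b\<^sup>2) * B * step_size l * (1 + (b + 1) * step_size l) ^ n \<le> (c + b\<^sup>2) * B * step_size l * exp ((b + 1) * T)"
      using b c B d n by (intro mult_left_mono power_one_plus_le_exp) auto
    then have "(c + b\<^sup>2) * B * step_size l * (1 + (b + 1) * step_size l) ^ n \<le> K * step_size l"
      unfolding K_def by (simp add: mult_ac)
    ultimately show ?thesis
      unfolding step_size_Suc by (rule input_functional_mono)
  qed
  show ?thesis using that[OF B K bound refine] .
qed

section \<open>Mean squares\<close>

definition mean_square :: "'w measure \<Rightarrow> ('w \<Rightarrow> 'a::euclidean_space) \<Rightarrow> ennreal" where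
  "mean_square M f = (\<integral>\<^sup>+\<omega>. ennreal ((norm (f \<omega>))\<^sup>2) \<partial>M)"

lemma mean_square_mono_AE:
  assumes "AE \<omega> in M. norm (f \<omega>) \<le> norm (g \<omega>)"
  shows "mean_square M f \<le> mean_square M g"
  unfolding mean_square_def using assms
  by (intro nn_integral_mono_AE) (auto intro!: ennreal_leI power_mono elim!: eventually_mono)

lemma mean_square_linear:
  assumes "linear_bounded_by a D" "f \<in> borel_measurable M"
  shows "mean_square M (\<lambda>\<omega>. D (f \<omega>)) \<le> ennreal (a\<^sup>2) * mean_square M f"
proof -
  have "ennreal ((norm (D x))\<^sup>2) \<le> ennreal (a\<^sup>2) * ennreal ((norm x)\<^sup>2)" for x
    using power_mono[OF linear_bounded_byD(2)[OF assms(1), of x], of 2]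
    by (simp add: ennreal_leI power_mult_distrib flip: ennreal_mult)
  then have "mean_square M (\<lambda>\<omega>. D (f \<omega>)) \<le> (\<integral>\<^sup>+\<omega>. ennreal (a\<^sup>2) * ennreal ((norm (f \<omega>))\<^sup>2) \<partial>M)"
    unfolding mean_square_def by (intro nn_integral_mono)
  also have "\<dots> = ennreal (a\<^sup>2) * mean_square M f"
    unfolding mean_square_def using assms(2) by (intro nn_integral_cmult) measurable
  finally show ?thesis .
qed

text \<open>This is Minkowski's inequality when the function with index \<open>i\<close> has mean square norm at most
  \<open>sqrt c * w i\<close>; it follows from the Cauchy-Schwarz inequality for finite sums with weights \<open>w\<close>.\<close>

lemma mean_square_sum:
  fixes f :: "'i \<Rightarrow> 'w \<Rightarrow> 'a::euclidean_space"
  assumes "finite I" and w: "\<And>i. i \<in> I \<Longrightarrow> 0 < w i" and c: "0 \<le> c"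
    and f: "\<And>i. i \<in> I \<Longrightarrow> f i \<in> borel_measurable M"
    and ms: "\<And>i. i \<in> I \<Longrightarrow> mean_square M (f i) \<le> ennreal (c * (w i)\<^sup>2)"
  shows "mean_square M (\<lambda>\<omega>. \<Sum>i\<in>I. f i \<omega>) \<le> ennreal (c * (\<Sum>i\<in>I. w i)\<^sup>2)"
proof -
  let ?W = "\<Sum>i\<in>I. w i"
  have W: "0 \<le> ?W" using w by (intro sum_nonneg) (simp add: less_imp_le)
  have pt: "(norm (\<Sum>i\<in>I. f i \<omega>))\<^sup>2 \<le> ?W * (\<Sum>i\<in>I. (norm (f i \<omega>))\<^sup>2 / w i)" for \<omega>
  proof -
    have "norm (\<Sum>i\<in>I. f i \<omega>) \<le> (\<Sum>i\<in>I. sqrt (w i) * (norm (f i \<omega>) / sqrt (w i)))"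
    proof (rule order_trans[OF norm_sum], rule sum_mono)
      fix i assume "i \<in> I"
      then show "norm (f i \<omega>) \<le> sqrt (w i) * (norm (f i \<omega>) / sqrt (w i))" using w[of i] by simp
    qed
    then have "(norm (\<Sum>i\<in>I. f i \<omega>))\<^sup>2 \<le> (\<Sum>i\<in>I. sqrt (w i) * (norm (f i \<omega>) / sqrt (w i)))\<^sup>2"
      by (intro power_mono) auto
    also have "\<dots> \<le> (\<Sum>i\<in>I. (sqrt (w i))\<^sup>2) * (\<Sum>i\<in>I. (norm (f i \<omega>) / sqrt (w i))\<^sup>2)"
      by (rule Cauchy_Schwarz_ineq_sum)
    also have "\<dots> = ?W * (\<Sum>i\<in>I. (norm (f i \<omega>))\<^sup>2 / w i)"
      using w by (intro arg_cong2[where f="(*)"] sum.cong) (auto simp: power_divide less_imp_le)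
    finally show ?thesis .
  qed
  have "mean_square M (\<lambda>\<omega>. \<Sum>i\<in>I. f i \<omega>)
      \<le> (\<integral>\<^sup>+\<omega>. (\<Sum>i\<in>I. ennreal (?W / w i) * ennreal ((norm (f i \<omega>))\<^sup>2)) \<partial>M)"
    unfolding mean_square_def
  proof (rule nn_integral_mono)
    fix \<omega>
    have "ennreal ((norm (\<Sum>i\<in>I. f i \<omega>))\<^sup>2) \<le> ennreal (\<Sum>i\<in>I. ?W / w i * (norm (f i \<omega>))\<^sup>2)"
      using pt[of \<omega>] by (intro ennreal_leI) (simp add: sum_distrib_left)
    also have "\<dots> = (\<Sum>i\<in>I. ennreal (?W / w i * (norm (f i \<omega>))\<^sup>2))"
      using w W by (subst sum_ennreal) (auto simp: less_imp_le)
    also have "\<dots> = (\<Sum>i\<in>I. ennreal (?W / w i) * ennreal ((norm (f i \<omega>))\<^sup>2))"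
      using w W by (intro sum.cong refl ennreal_mult) (auto simp: less_imp_le)
    finally show "ennreal ((norm (\<Sum>i\<in>I. f i \<omega>))\<^sup>2) \<le> (\<Sum>i\<in>I. ennreal (?W / w i) * ennreal ((norm (f i \<omega>))\<^sup>2))" .
  qed
  also have "\<dots> = (\<Sum>i\<in>I. ennreal (?W / w i) * mean_square M (f i))"
    unfolding mean_square_def using f
    by (subst nn_integral_sum) (auto intro!: sum.cong nn_integral_cmult)
  also have "\<dots> \<le> (\<Sum>i\<in>I. ennreal (?W / w i) * ennreal (c * (w i)\<^sup>2))"
    using ms by (intro sum_mono mult_left_mono) auto
  also have "\<dots> = (\<Sum>i\<in>I. ennreal (?W * c * w i))"
    using w W c by (intro sum.cong refl) (simp add: ennreal_mult[symmetric] less_imp_le power2_eq_square)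
  also have "\<dots> = ennreal (\<Sum>i\<in>I. ?W * c * w i)"
    using w W c by (subst sum_ennreal) (auto simp: less_imp_le)
  also have "(\<Sum>i\<in>I. ?W * c * w i) = c * ?W\<^sup>2" by (simp add: sum_distrib_left[symmetric] power2_eq_square)
  finally show ?thesis .
qed

lemma mean_square_add:
  fixes f g :: "'w \<Rightarrow> 'a::euclidean_space"
  assumes [measurable]: "f \<in> borel_measurable M" "g \<in> borel_measurable M"
  shows "mean_square M (\<lambda>\<omega>. f \<omega> + g \<omega>) \<le> 2 * mean_square M f + 2 * mean_square M g"
proof -
  have "(norm (x + y))\<^sup>2 \<le> 2 * (norm x)\<^sup>2 + 2 * (norm y)\<^sup>2" for x y :: 'a
  proof -
    have "(norm (x + y))\<^sup>2 \<le> (norm x + norm y)\<^sup>2" by (intro power_mono norm_triangle_ineq) simp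
    also have "\<dots> \<le> 2 * (norm x)\<^sup>2 + 2 * (norm y)\<^sup>2"
      using sum_squares_bound[of "norm x" "norm y"] by (simp add: power2_sum)
    finally show ?thesis .
  qed
  then have "ennreal ((norm (f \<omega> + g \<omega>))\<^sup>2) \<le> 2 * ennreal ((norm (f \<omega>))\<^sup>2) + 2 * ennreal ((norm (g \<omega>))\<^sup>2)" for \<omega>
  proof -
    have "ennreal ((norm (f \<omega> + g \<omega>))\<^sup>2) \<le> ennreal (2 * (norm (f \<omega>))\<^sup>2 + 2 * (norm (g \<omega>))\<^sup>2)"
      using \<open>\<And>x y. (norm (x + y))\<^sup>2 \<le> 2 * (norm x)\<^sup>2 + 2 * (norm y)\<^sup>2\<close> by (rule ennreal_leI)
    then show ?thesis by (simp add: ennreal_mult)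
  qed
  then have "mean_square M (\<lambda>\<omega>. f \<omega> + g \<omega>)
      \<le> (\<integral>\<^sup>+\<omega>. 2 * ennreal ((norm (f \<omega>))\<^sup>2) + 2 * ennreal ((norm (g \<omega>))\<^sup>2) \<partial>M)"
    unfolding mean_square_def by (intro nn_integral_mono)
  also have "\<dots> = 2 * mean_square M f + 2 * mean_square M g"
    unfolding mean_square_def by (simp add: nn_integral_add nn_integral_cmult)
  finally show ?thesis .
qed

lemma mean_square_add_le:
  fixes f g :: "'w \<Rightarrow> 'a::euclidean_space"
  assumes "f \<in> borel_measurable M" "g \<in> borel_measurable M"
    and "mean_square M f \<le> ennreal a" "mean_square M g \<le> ennreal b" "0 \<le> a" "0 \<le> b"
  shows "mean_square M (\<lambda>\<omega>. f \<omega> + g \<omega>) \<le> ennreal (2 * a + 2 * b)"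
proof -
  have "mean_square M (\<lambda>\<omega>. f \<omega> + g \<omega>) \<le> 2 * ennreal a + 2 * ennreal b"
    using order_trans[OF mean_square_add[OF assms(1,2)] add_mono[OF mult_left_mono[OF assms(3)] mult_left_mono[OF assms(4)]]]
    by simp
  also have "\<dots> = ennreal (2 * a + 2 * b)" using assms by (simp add: ennreal_plus ennreal_mult)
  finally show ?thesis .
qed

text \<open>Fatou's lemma.\<close>

lemma mean_square_lim:
  fixes f :: "nat \<Rightarrow> 'w \<Rightarrow> 'a::euclidean_space"
  assumes f: "\<And>n. f n \<in> borel_measurable M" and lim: "AE \<omega> in M. (\<lambda>n. f n \<omega>) \<longlonglongrightarrow> g \<omega>"
    and le: "\<And>n. n \<ge> n0 \<Longrightarrow> mean_square M (f n) \<le> c"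
  shows "mean_square M g \<le> c"
proof -
  have "mean_square M g = (\<integral>\<^sup>+\<omega>. liminf (\<lambda>n. ennreal ((norm (f (n + n0) \<omega>))\<^sup>2)) \<partial>M)"
    unfolding mean_square_def
  proof (rule nn_integral_cong_AE, use lim in eventually_elim)
    fix \<omega> assume "(\<lambda>n. f n \<omega>) \<longlonglongrightarrow> g \<omega>"
    then have "(\<lambda>n. f (n + n0) \<omega>) \<longlonglongrightarrow> g \<omega>" by (rule LIMSEQ_ignore_initial_segment)
    then have "(\<lambda>n. ennreal ((norm (f (n + n0) \<omega>))\<^sup>2)) \<longlonglongrightarrow> ennreal ((norm (g \<omega>))\<^sup>2)"
      by (intro tendsto_ennrealI tendsto_intros)
    then show "ennreal ((norm (g \<omega>))\<^sup>2) = liminf (\<lambda>n. ennreal ((norm (f (n + n0) \<omega>))\<^sup>2))"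
      by (simp only: lim_imp_Liminf[OF sequentially_bot])
  qed
  also have "\<dots> \<le> liminf (\<lambda>n. mean_square M (f (n + n0)))"
    unfolding mean_square_def using f by (intro nn_integral_liminf) measurable
  also have "\<dots> \<le> limsup (\<lambda>n. mean_square M (f (n + n0)))" by (rule Liminf_le_Limsup) simp
  also have "\<dots> \<le> c" using le by (intro Limsup_bounded) auto
  finally show ?thesis .
qed

lemma step_size_sum: "n \<le> m \<Longrightarrow> (\<Sum>i=n..<m. step_size i) = 2 * step_size n - 2 * step_size m"
  by (induction m rule: dec_induct) (auto simp: step_size_Suc)

lemma summable_step_size: "summable step_size"
  unfolding step_size_def using summable_geometric[of "1/2::real"] by (simp add: power_divide)

lemma mean_square_cauchy_limit:
  fixes f :: "nat \<Rightarrow> 'w \<Rightarrow> 'a::euclidean_space"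
  assumes f: "\<And>n. f n \<in> borel_measurable M" and lim: "AE \<omega> in M. (\<lambda>n. f n \<omega>) \<longlonglongrightarrow> g \<omega>" and c: "0 \<le> c"
    and ms: "\<And>n. mean_square M (\<lambda>\<omega>. f (Suc n) \<omega> - f n \<omega>) \<le> ennreal (c * (step_size n)\<^sup>2)"
  shows "mean_square M (\<lambda>\<omega>. f n \<omega> - g \<omega>) \<le> ennreal (c * (2 * step_size n)\<^sup>2)"
proof (rule mean_square_lim[of "\<lambda>m \<omega>. f n \<omega> - f m \<omega>" _ _ n])
  show "AE \<omega> in M. (\<lambda>m. f n \<omega> - f m \<omega>) \<longlonglongrightarrow> f n \<omega> - g \<omega>"
    using lim by eventually_elim (intro tendsto_intros)
  fix m assume m: "n \<le> m"
  have "mean_square M (\<lambda>\<omega>. f n \<omega> - f m \<omega>) = mean_square M (\<lambda>\<omega>. \<Sum>i=n..<m. f (Suc i) \<omega> - f i \<omega>)"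
    unfolding sum_Suc_diff'[OF m, of "\<lambda>i. f i _"] by (simp add: mean_square_def norm_minus_commute)
  also have "\<dots> \<le> ennreal (c * (\<Sum>i=n..<m. step_size i)\<^sup>2)"
    using ms c f step_size_pos by (intro mean_square_sum) auto
  also have "\<dots> \<le> ennreal (c * (2 * step_size n)\<^sup>2)"
  proof (intro ennreal_leI mult_left_mono power_mono c)
    show "(\<Sum>i=n..<m. step_size i) \<le> 2 * step_size n"
      using step_size_pos[of m] unfolding step_size_sum[OF m] by linarith
    show "0 \<le> (\<Sum>i=n..<m. step_size i)" by (intro sum_nonneg less_imp_le[OF step_size_pos])
  qed
  finally show "mean_square M (\<lambda>\<omega>. f n \<omega> - f m \<omega>) \<le> ennreal (c * (2 * step_size n)\<^sup>2)" .
qed (use f in measurable)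

text \<open>Consecutive distances \<open>O(2\<^sup>-\<^sup>n)\<close> in mean square are summable in the mean, since
  \<open>2 r \<le> 2\<^sup>-\<^sup>n + 2\<^sup>n r\<^sup>2\<close>, so the sequence converges almost surely.\<close>

lemma mean_square_cauchy_convergent:
  fixes f :: "nat \<Rightarrow> 'w \<Rightarrow> 'a::euclidean_space"
  assumes "prob_space M" and f: "\<And>n. f n \<in> borel_measurable M" and c: "0 \<le> c"
    and ms: "\<And>n. mean_square M (\<lambda>\<omega>. f (Suc n) \<omega> - f n \<omega>) \<le> ennreal (c * (step_size n)\<^sup>2)"
  shows "AE \<omega> in M. convergent (\<lambda>n. f n \<omega>)"
proof -
  interpret prob_space M by fact
  let ?d = "\<lambda>n \<omega>. f (Suc n) \<omega> - f n \<omega>"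
  have [measurable]: "?d n \<in> borel_measurable M" for n using f by measurable
  have *: "(\<integral>\<^sup>+\<omega>. ennreal (norm (?d n \<omega>)) \<partial>M) \<le> ennreal ((1 + c) * step_size n)" for n
  proof -
    have s: "0 < step_size n" by (rule step_size_pos)
    have "norm (?d n \<omega>) \<le> step_size n + (1 / step_size n) * (norm (?d n \<omega>))\<^sup>2" for \<omega>
    proof -
      have "2 * step_size n * norm (?d n \<omega>) \<le> (step_size n)\<^sup>2 + (norm (?d n \<omega>))\<^sup>2"
        by (rule sum_squares_bound)
      moreover have "step_size n * norm (?d n \<omega>) \<ge> 0" using s by simp
      ultimately have "step_size n * norm (?d n \<omega>) \<le> (step_size n)\<^sup>2 + (norm (?d n \<omega>))\<^sup>2" by linarith
      then show ?thesis using s by (simp add: field_simps power2_eq_square)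
    qed
    then have "ennreal (norm (?d n \<omega>)) \<le> ennreal (step_size n) + ennreal (1 / step_size n) * ennreal ((norm (?d n \<omega>))\<^sup>2)" for \<omega>
      using s by (simp flip: ennreal_plus ennreal_mult add: ennreal_leI)
    then have "(\<integral>\<^sup>+\<omega>. ennreal (norm (?d n \<omega>)) \<partial>M)
        \<le> (\<integral>\<^sup>+\<omega>. ennreal (step_size n) + ennreal (1 / step_size n) * ennreal ((norm (?d n \<omega>))\<^sup>2) \<partial>M)"
      by (intro nn_integral_mono)
    also have "\<dots> = ennreal (step_size n) + ennreal (1 / step_size n) * mean_square M (?d n)"
      unfolding mean_square_def by (simp add: nn_integral_add nn_integral_cmult emeasure_space_1)
    also have "\<dots> \<le> ennreal (step_size n) + ennreal (1 / step_size n) * ennreal (c * (step_size n)\<^sup>2)"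
      using ms by (intro add_left_mono mult_left_mono) auto
    also have "\<dots> = ennreal ((1 + c) * step_size n)"
      using s c by (simp flip: ennreal_plus ennreal_mult add: power2_eq_square algebra_simps)
    finally show ?thesis .
  qed
  have "(\<integral>\<^sup>+\<omega>. (\<Sum>n. ennreal (norm (?d n \<omega>))) \<partial>M) = (\<Sum>n. \<integral>\<^sup>+\<omega>. ennreal (norm (?d n \<omega>)) \<partial>M)"
    by (intro nn_integral_suminf) measurable
  also have "\<dots> \<le> (\<Sum>n. ennreal ((1 + c) * step_size n))"
    using * by (intro suminf_le) auto
  also have "\<dots> < \<infinity>"
    using c less_imp_le[OF step_size_pos]
    by (subst suminf_ennreal2) (auto intro!: summable_mult summable_step_size)
  finally have "(\<integral>\<^sup>+\<omega>. (\<Sum>n. ennreal (norm (?d n \<omega>))) \<partial>M) \<noteq> \<infinity>" by simp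
  then have "AE \<omega> in M. (\<Sum>n. ennreal (norm (?d n \<omega>))) \<noteq> \<infinity>"
    by (intro nn_integral_noteq_infinite) measurable
  then show ?thesis
  proof eventually_elim
    fix \<omega> assume "(\<Sum>n. ennreal (norm (?d n \<omega>))) \<noteq> \<infinity>"
    then have "summable (\<lambda>n. norm (?d n \<omega>))" by (intro summable_suminf_not_top) auto
    then have "summable (\<lambda>n. ?d n \<omega>)" by (rule summable_norm_cancel)
    then have "convergent (\<lambda>n. \<Sum>i<n. ?d i \<omega>)" by (simp add: summable_iff_convergent)
    then have "convergent (\<lambda>n. f n \<omega> - f 0 \<omega>)"
      unfolding sum_lessThan_telescope[of "\<lambda>n. f n \<omega>"] .
    then have "convergent (\<lambda>n. (f n \<omega> - f 0 \<omega>) + f 0 \<omega>)"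
      by (intro convergent_add convergent_const)
    then show "convergent (\<lambda>n. f n \<omega>)" by simp
  qed
qed

definition square_integrable :: "'w measure \<Rightarrow> ('w \<Rightarrow> 'a::euclidean_space) \<Rightarrow> bool" where
  "square_integrable M f \<longleftrightarrow> f \<in> borel_measurable M \<and> integrable M (\<lambda>\<omega>. (norm (f \<omega>))\<^sup>2)"

lemma square_integrableI:
  assumes "f \<in> borel_measurable M" "mean_square M f < \<infinity>"
  shows "square_integrable M f"
  using assms unfolding square_integrable_def mean_square_def
  by (auto simp: integrable_iff_bounded)

lemma mean_square_eq_integral:
  "square_integrable M f \<Longrightarrow> mean_square M f = ennreal (\<integral>\<omega>. (norm (f \<omega>))\<^sup>2 \<partial>M)"
  unfolding square_integrable_def mean_square_def by (intro nn_integral_eq_integral) auto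

lemma square_integrable_inner:
  fixes f g :: "'w \<Rightarrow> 'a::euclidean_space"
  assumes "square_integrable M f" "square_integrable M g"
  shows "integrable M (\<lambda>\<omega>. f \<omega> \<bullet> g \<omega>)"
proof (rule Bochner_Integration.integrable_bound)
  have [measurable]: "f \<in> borel_measurable M" "g \<in> borel_measurable M"
    using assms by (auto simp: square_integrable_def)
  show "integrable M (\<lambda>\<omega>. (norm (f \<omega>))\<^sup>2 + (norm (g \<omega>))\<^sup>2)"
    using assms by (auto simp: square_integrable_def)
  show "(\<lambda>\<omega>. f \<omega> \<bullet> g \<omega>) \<in> borel_measurable M" by measurable
  have "\<bar>x \<bullet> y\<bar> \<le> (norm x)\<^sup>2 + (norm y)\<^sup>2" for x y :: 'a
  proof -
    have "0 \<le> norm x * norm y" by simp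
    then show ?thesis
      using Cauchy_Schwarz_ineq2[of x y] sum_squares_bound[of "norm x" "norm y"] by linarith
  qed
  then show "AE \<omega> in M. norm (f \<omega> \<bullet> g \<omega>) \<le> norm ((norm (f \<omega>))\<^sup>2 + (norm (g \<omega>))\<^sup>2)"
    by (simp add: abs_of_nonneg)
qed

lemma square_integrable_mult:
  fixes f g :: "'w \<Rightarrow> real"
  shows "square_integrable M f \<Longrightarrow> square_integrable M g \<Longrightarrow> integrable M (\<lambda>\<omega>. f \<omega> * g \<omega>)"
  using square_integrable_inner[of M f g] by simp

lemma (in finite_measure) square_integrable_integrable:
  assumes "square_integrable M f" shows "integrable M f"
proof (rule Bochner_Integration.integrable_bound)
  have [measurable]: "f \<in> borel_measurable M" using assms by (simp add: square_integrable_def)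
  show "f \<in> borel_measurable M" by measurable
  show "integrable M (\<lambda>\<omega>. 1 + (norm (f \<omega>))\<^sup>2)" using assms by (simp add: square_integrable_def)
  have "norm x \<le> 1 + (norm x)\<^sup>2" for x :: 'b
    using sum_squares_bound[of 1 "norm x"] norm_ge_zero[of x] unfolding power2_eq_square by linarith
  then show "AE \<omega> in M. norm (f \<omega>) \<le> norm (1 + (norm (f \<omega>))\<^sup>2)"
    by (simp add: abs_of_nonneg)
qed

lemma square_integrable_add:
  fixes f g :: "'w \<Rightarrow> 'a::euclidean_space"
  assumes "square_integrable M f" "square_integrable M g"
  shows "square_integrable M (\<lambda>\<omega>. f \<omega> + g \<omega>)"
proof (rule square_integrableI)
  have [measurable]: "f \<in> borel_measurable M" "g \<in> borel_measurable M"
    using assms by (auto simp: square_integrable_def)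
  show "(\<lambda>\<omega>. f \<omega> + g \<omega>) \<in> borel_measurable M" by measurable
  have "mean_square M (\<lambda>\<omega>. f \<omega> + g \<omega>) \<le> 2 * mean_square M f + 2 * mean_square M g"
    by (intro mean_square_add) measurable
  also have "\<dots> < \<infinity>" using assms by (simp add: mean_square_eq_integral ennreal_mult_less_top)
  finally show "mean_square M (\<lambda>\<omega>. f \<omega> + g \<omega>) < \<infinity>" .
qed

lemma square_integrable_linear:
  assumes "linear D" "square_integrable M f"
  shows "square_integrable M (\<lambda>\<omega>. D (f \<omega>))"
proof (rule square_integrableI)
  obtain a where a: "linear_bounded_by a D"
    using linear_bounded_pos[OF assms(1)] assms(1) unfolding linear_bounded_by_def by blast
  have [measurable]: "f \<in> borel_measurable M" "D \<in> borel_measurable borel"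
    using assms by (auto simp: square_integrable_def intro!: borel_measurable_continuous_onI linear_continuous_on linear_conv_bounded_linear[THEN iffD1])
  show "(\<lambda>\<omega>. D (f \<omega>)) \<in> borel_measurable M" by measurable
  have "mean_square M (\<lambda>\<omega>. D (f \<omega>)) \<le> ennreal (a\<^sup>2) * mean_square M f"
    by (rule mean_square_linear[OF a]) measurable
  also have "\<dots> < \<infinity>" using assms by (simp add: mean_square_eq_integral ennreal_mult_less_top)
  finally show "mean_square M (\<lambda>\<omega>. D (f \<omega>)) < \<infinity>" .
qed

lemma square_integrable_zero: "square_integrable M (\<lambda>_. 0)"
  by (simp add: square_integrable_def)

lemma square_integrable_sum:
  fixes f :: "'i \<Rightarrow> 'w \<Rightarrow> 'a::euclidean_space"
  shows "(\<And>i. i \<in> I \<Longrightarrow> square_integrable M (f i)) \<Longrightarrow> square_integrable M (\<lambda>\<omega>. \<Sum>i\<in>I. f i \<omega>)"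
  by (induction I rule: infinite_finite_induct) (auto intro: square_integrable_zero square_integrable_add)

lemma mean_square_orthogonal_sum:
  fixes f :: "'i \<Rightarrow> 'w \<Rightarrow> 'a::euclidean_space"
  assumes "finite I" and f: "\<And>i. i \<in> I \<Longrightarrow> square_integrable M (f i)"
    and orth: "\<And>i j. i \<in> I \<Longrightarrow> j \<in> I \<Longrightarrow> i \<noteq> j \<Longrightarrow> (\<integral>\<omega>. f i \<omega> \<bullet> f j \<omega> \<partial>M) = 0"
  shows "mean_square M (\<lambda>\<omega>. \<Sum>i\<in>I. f i \<omega>) = (\<Sum>i\<in>I. mean_square M (f i))"
proof -
  have "(norm (\<Sum>i\<in>I. f i \<omega>))\<^sup>2 = (\<Sum>i\<in>I. \<Sum>j\<in>I. f i \<omega> \<bullet> f j \<omega>)" for \<omega>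
    unfolding power2_norm_eq_inner inner_sum_left inner_sum_right by (rule sum.swap)
  then have "(\<integral>\<omega>. (norm (\<Sum>i\<in>I. f i \<omega>))\<^sup>2 \<partial>M) = (\<Sum>i\<in>I. \<Sum>j\<in>I. \<integral>\<omega>. f i \<omega> \<bullet> f j \<omega> \<partial>M)"
    using f by (simp add: Bochner_Integration.integral_sum Bochner_Integration.integrable_sum square_integrable_inner)
  also have "\<dots> = (\<Sum>i\<in>I. \<Sum>j\<in>I. if j = i then \<integral>\<omega>. (norm (f i \<omega>))\<^sup>2 \<partial>M else 0)"
    using orth by (intro sum.cong refl) (auto simp: power2_norm_eq_inner)
  also have "\<dots> = (\<Sum>i\<in>I. \<integral>\<omega>. (norm (f i \<omega>))\<^sup>2 \<partial>M)" using \<open>finite I\<close> by simp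
  finally show ?thesis
    using f by (simp add: mean_square_eq_integral square_integrable_sum sum_ennreal)
qed

text \<open>Independence of two sigma-algebras is independence of the identity maps into them. This makes the theory
  of independent random variables and of product measures applicable.\<close>

lemma (in prob_space) indep_set_indep_var:
  assumes ind: "indep_set (sets N1) (sets N2)" and sp: "space N1 = space M" "space N2 = space M"
  shows "indep_var N1 (\<lambda>\<omega>. \<omega>) N2 (\<lambda>\<omega>. \<omega>)"
proof -
  have id: "(\<lambda>\<omega>. \<omega>) \<in> measurable M N" and sig: "sigma_sets (space M) {(\<lambda>\<omega>. \<omega>) -` A \<inter> space M |A. A \<in> sets N} = sets N"
    if N: "sets N \<subseteq> events" "space N = space M" for N :: "'a measure"
  proof -
    have eq: "(\<lambda>\<omega>. \<omega>) -` A \<inter> space M = A" if "A \<in> sets N" for A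
      using sets.sets_into_space[OF that] N by auto
    then show "(\<lambda>\<omega>. \<omega>) \<in> measurable M N" using N by (auto simp: measurable_def)
    have "{(\<lambda>\<omega>. \<omega>) -` A \<inter> space M |A. A \<in> sets N} = (\<lambda>A. (\<lambda>\<omega>. \<omega>) -` A \<inter> space M) ` sets N" by blast
    also have "\<dots> = (\<lambda>A. A) ` sets N" by (intro image_cong refl eq)
    finally have "{(\<lambda>\<omega>. \<omega>) -` A \<inter> space M |A. A \<in> sets N} = sets N" by simp
    then show "sigma_sets (space M) {(\<lambda>\<omega>. \<omega>) -` A \<inter> space M |A. A \<in> sets N} = sets N"
      using sets.sigma_sets_eq[of N] N by simp
  qed
  have ev: "sets N1 \<subseteq> events" "sets N2 \<subseteq> events"
    using indep_setD_ev1[OF ind] indep_setD_ev2[OF ind] by auto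
  show ?thesis
    unfolding indep_var_eq using id[OF ev(1) sp(1)] id[OF ev(2) sp(2)] sig[OF ev(1) sp(1)] sig[OF ev(2) sp(2)] ind
    by simp
qed

lemma (in prob_space) indep_orthogonal:
  fixes F G :: "'a \<Rightarrow> 'c::euclidean_space"
  assumes ind: "indep_set (sets N1) (sets N2)" "space N1 = space M" "space N2 = space M"
    and [measurable]: "F \<in> borel_measurable N1" "G \<in> borel_measurable N2"
    and F: "square_integrable M F" and G: "square_integrable M G"
    and mean: "expectation G = 0"
  shows "expectation (\<lambda>\<omega>. F \<omega> \<bullet> G \<omega>) = 0"
proof -
  note indv = indep_set_indep_var[OF ind]
  have iF: "integrable M (\<lambda>\<omega>. F \<omega> \<bullet> b)" and iG: "integrable M (\<lambda>\<omega>. G \<omega> \<bullet> b)" for b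
    using square_integrable_integrable[OF F] square_integrable_integrable[OF G] by simp_all
  have ind': "indep_var borel (\<lambda>\<omega>. F \<omega> \<bullet> b) borel (\<lambda>\<omega>. G \<omega> \<bullet> b)" for b
    using indep_var_compose[OF indv, of "\<lambda>x. F x \<bullet> b" borel "\<lambda>x. G x \<bullet> b" borel] by (simp add: comp_def)
  have "F \<omega> \<bullet> G \<omega> = (\<Sum>b\<in>Basis. (F \<omega> \<bullet> b) * (G \<omega> \<bullet> b))" for \<omega> by (rule euclidean_inner)
  then have "expectation (\<lambda>\<omega>. F \<omega> \<bullet> G \<omega>) = (\<Sum>b\<in>Basis. expectation (\<lambda>\<omega>. F \<omega> \<bullet> b) * expectation (\<lambda>\<omega>. G \<omega> \<bullet> b))"
    by (simp add: Bochner_Integration.integral_sum indep_var_integrable[OF ind' iF iG] indep_var_lebesgue_integral[OF ind' iF iG])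
  also have "\<dots> = 0"
  proof (intro sum.neutral ballI)
    fix b :: 'c
    have "expectation (\<lambda>\<omega>. G \<omega> \<bullet> b) = 0"
      using mean square_integrable_integrable[OF G] by simp
    then show "expectation (\<lambda>\<omega>. F \<omega> \<bullet> b) * expectation (\<lambda>\<omega>. G \<omega> \<bullet> b) = 0" by simp
  qed
  finally show ?thesis .
qed

section \<open>Gaussian integration by parts\<close>

definition smooth_test :: "(real \<Rightarrow> real) \<Rightarrow> (real \<Rightarrow> real) \<Rightarrow> bool" where
  "smooth_test h h' \<longleftrightarrow> (\<forall>x. (h has_real_derivative h' x) (at x)) \<and> continuous_on UNIV h' \<and>
     bounded (range h) \<and> bounded (range h')"

lemma smooth_testD:
  assumes "smooth_test h h'"
  shows "(h has_real_derivative h' x) (at x)" "h \<in> borel_measurable borel" "h' \<in> borel_measurable borel"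
    "continuous_on UNIV h" "continuous_on UNIV h'"
proof -
  show d: "(h has_real_derivative h' x) (at x)" for x using assms by (simp add: smooth_test_def)
  show c: "continuous_on UNIV h" using d by (intro continuous_at_imp_continuous_on ballI DERIV_isCont)
  show c': "continuous_on UNIV h'" using assms by (simp add: smooth_test_def)
  show "h \<in> borel_measurable borel" "h' \<in> borel_measurable borel"
    by (intro borel_measurable_continuous_onI c c')+
qed

lemma smooth_test_bounds:
  assumes "smooth_test h h'"
  shows "\<exists>B. \<forall>x. \<bar>h x\<bar> \<le> B" "\<exists>B. \<forall>x. \<bar>h' x\<bar> \<le> B"
  using assms by (auto simp: smooth_test_def bounded_iff)

lemma smooth_test_affine:
  assumes "smooth_test h h'"
  shows "smooth_test (\<lambda>x. h (a * x + c)) (\<lambda>x. a * h' (a * x + c))"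
proof -
  obtain B B' where B: "\<And>x. \<bar>h x\<bar> \<le> B" "\<And>x. \<bar>h' x\<bar> \<le> B'" using smooth_test_bounds[OF assms] by blast
  have "\<bar>a * h' (a * x + c)\<bar> \<le> \<bar>a\<bar> * B'" for x
    using B(2)[of "a * x + c"] by (simp add: abs_mult mult_left_mono)
  then have "bounded (range (\<lambda>x. a * h' (a * x + c)))" by (auto simp: bounded_iff)
  moreover have "bounded (range (\<lambda>x. h (a * x + c)))" using B(1) by (auto simp: bounded_iff)
  moreover have "((\<lambda>x. h (a * x + c)) has_real_derivative a * h' (a * x + c)) (at x)" for x
  proof -
    have "((\<lambda>x. a * x + c) has_real_derivative a) (at x)" by (auto intro!: derivative_eq_intros)
    from DERIV_chain2[OF smooth_testD(1)[OF assms] this] show ?thesis by (simp add: mult.commute)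
  qed
  moreover have "continuous_on UNIV (\<lambda>x. a * h' (a * x + c))"
    by (intro continuous_intros continuous_on_compose2[OF smooth_testD(5)[OF assms]]) auto
  ultimately show ?thesis by (simp add: smooth_test_def)
qed

lemma smooth_test_shift: "smooth_test h h' \<Longrightarrow> smooth_test (\<lambda>x. h (x + c)) (\<lambda>x. h' (x + c))"
  using smooth_test_affine[of h h' 1 c] by simp

lemma prod_bounded:
  fixes f :: "'i \<Rightarrow> 'b \<Rightarrow> real"
  assumes "\<And>i. i \<in> I \<Longrightarrow> \<exists>B. \<forall>x. \<bar>f i x\<bar> \<le> B"
  shows "\<exists>B. \<forall>x. \<bar>\<Prod>i\<in>I. f i (g i x)\<bar> \<le> B"
proof -
  obtain B where B: "\<And>i x. i \<in> I \<Longrightarrow> \<bar>f i x\<bar> \<le> B i" using assms by metis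
  have "\<bar>\<Prod>i\<in>I. f i (g i x)\<bar> \<le> (\<Prod>i\<in>I. B i)" for x
    unfolding abs_prod using B by (intro prod_mono) auto
  then show ?thesis by blast
qed

lemma integrable_mult_bounded:
  fixes f g :: "'w \<Rightarrow> real"
  assumes "integrable M f" and [measurable]: "g \<in> borel_measurable M" and B: "\<And>x. \<bar>g x\<bar> \<le> B"
  shows "integrable M (\<lambda>x. f x * g x)"
proof (rule Bochner_Integration.integrable_bound)
  have [measurable]: "f \<in> borel_measurable M" using assms by simp
  show "integrable M (\<lambda>x. B * f x)" using assms(1) by simp
  show "(\<lambda>x. f x * g x) \<in> borel_measurable M" by measurable
  have "\<bar>f x * g x\<bar> \<le> \<bar>B * f x\<bar>" for x
    using mult_left_mono[OF order_trans[OF B[of x] abs_ge_self], of "\<bar>f x\<bar>"] by (simp add: abs_mult mult.commute)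
  then show "AE x in M. norm (f x * g x) \<le> norm (B * f x)" by simp
qed

text \<open>The integration by parts identity with product test functions expresses joint normality with mean
  zero. It involves second moments and bounded functions only, so it goes well with convergence in mean square, and
  it avoids densities and characteristic functions on spaces whose dimension grows with the level.\<close>

definition stein_system :: "'w measure \<Rightarrow> ('w \<Rightarrow> real) set \<Rightarrow> bool" where
  "stein_system M H \<longleftrightarrow> (\<forall>\<xi>\<in>H. square_integrable M \<xi>) \<and>
     (\<forall>I::nat set. \<forall>\<eta> h h'. \<forall>\<xi>\<in>H. finite I \<longrightarrow> (\<forall>i\<in>I. \<eta> i \<in> H \<and> smooth_test (h i) (h' i)) \<longrightarrow>
       (\<integral>\<omega>. \<xi> \<omega> * (\<Prod>i\<in>I. h i (\<eta> i \<omega>)) \<partial>M) =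
       (\<Sum>i\<in>I. (\<integral>\<omega>. \<xi> \<omega> * \<eta> i \<omega> \<partial>M) * (\<integral>\<omega>. h' i (\<eta> i \<omega>) * (\<Prod>j\<in>I - {i}. h j (\<eta> j \<omega>)) \<partial>M)))"

lemma stein_systemD1: "stein_system M H \<Longrightarrow> \<xi> \<in> H \<Longrightarrow> square_integrable M \<xi>"
  by (simp add: stein_system_def)

lemma stein_systemD2:
  "stein_system M H \<Longrightarrow> \<xi> \<in> H \<Longrightarrow> finite (I::nat set) \<Longrightarrow> (\<And>i. i \<in> I \<Longrightarrow> \<eta> i \<in> H) \<Longrightarrow>
   (\<And>i. i \<in> I \<Longrightarrow> smooth_test (h i) (h' i)) \<Longrightarrow>
     (\<integral>\<omega>. \<xi> \<omega> * (\<Prod>i\<in>I. h i (\<eta> i \<omega>)) \<partial>M) =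
     (\<Sum>i\<in>I. (\<integral>\<omega>. \<xi> \<omega> * \<eta> i \<omega> \<partial>M) * (\<integral>\<omega>. h' i (\<eta> i \<omega>) * (\<Prod>j\<in>I - {i}. h j (\<eta> j \<omega>)) \<partial>M))"
  by (simp add: stein_system_def)

lemma stein_system_mean: "stein_system M H \<Longrightarrow> \<xi> \<in> H \<Longrightarrow> (\<integral>\<omega>. \<xi> \<omega> \<partial>M) = 0"
  using stein_systemD2[of M H \<xi> "{}"] by simp

lemma stein_system_mono: "stein_system M H \<Longrightarrow> H' \<subseteq> H \<Longrightarrow> stein_system M H'"
  unfolding stein_system_def by (meson subsetD)

lemma stein_system_zero: "stein_system M {\<lambda>_. 0}"
  unfolding stein_system_def by (auto simp: square_integrable_zero)

lemma square_integrable_distr: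
  assumes "X \<in> measurable M N" "q \<in> borel_measurable N"
  shows "square_integrable (distr M N X) q \<longleftrightarrow> square_integrable M (\<lambda>\<omega>. q (X \<omega>))"
  using assms unfolding square_integrable_def
  by (subst integrable_distr_eq) auto

text \<open>The property depends only on the joint law of the family.\<close>

lemma stein_system_distr:
  assumes X: "X \<in> measurable M N" and Q: "Q \<subseteq> borel_measurable N"
  shows "stein_system (distr M N X) Q \<longleftrightarrow> stein_system M ((\<lambda>q \<omega>. q (X \<omega>)) ` Q)"
proof -
  have key: "(\<integral>\<omega>. \<xi> (X \<omega>) * (\<Prod>i\<in>I. h i (\<eta> i (X \<omega>))) \<partial>M) = (\<integral>x. \<xi> x * (\<Prod>i\<in>I. h i (\<eta> i x)) \<partial>distr M N X) \<and>
     (\<forall>i\<in>I. (\<integral>\<omega>. \<xi> (X \<omega>) * \<eta> i (X \<omega>) \<partial>M) = (\<integral>x. \<xi> x * \<eta> i x \<partial>distr M N X) \<and>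
      (\<integral>\<omega>. h' i (\<eta> i (X \<omega>)) * (\<Prod>j\<in>I - {i}. h j (\<eta> j (X \<omega>))) \<partial>M)
        = (\<integral>x. h' i (\<eta> i x) * (\<Prod>j\<in>I - {i}. h j (\<eta> j x)) \<partial>distr M N X))"
    if "\<xi> \<in> Q" "\<forall>i\<in>I. \<eta> i \<in> Q \<and> smooth_test (h i) (h' i)" for \<xi> \<eta> h h' and I :: "nat set"
  proof -
    have [measurable]: "\<xi> \<in> borel_measurable N" using that Q by blast
    have m: "\<eta> i \<in> borel_measurable N" "h i \<in> borel_measurable borel" "h' i \<in> borel_measurable borel" if "i \<in> I" for i
      using that \<open>\<forall>i\<in>I. \<eta> i \<in> Q \<and> smooth_test (h i) (h' i)\<close> Q by (auto dest: smooth_testD)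
    have p: "(\<lambda>x. \<Prod>i\<in>J. h i (\<eta> i x)) \<in> borel_measurable N" if "J \<subseteq> I" for J
    proof (rule borel_measurable_prod)
      fix i assume "i \<in> J"
      then have "i \<in> I" using that by blast
      from measurable_compose[OF m(1)[OF this] m(2)[OF this]] show "(\<lambda>x. h i (\<eta> i x)) \<in> borel_measurable N" .
    qed
    have "(\<lambda>x. \<xi> x * (\<Prod>i\<in>I. h i (\<eta> i x))) \<in> borel_measurable N" using p by measurable
    moreover have "(\<lambda>x. \<xi> x * \<eta> i x) \<in> borel_measurable N" if "i \<in> I" for i using m[OF that] by measurable
    moreover have "(\<lambda>x. h' i (\<eta> i x) * (\<Prod>j\<in>I - {i}. h j (\<eta> j x))) \<in> borel_measurable N" if "i \<in> I" for i
      using measurable_compose[OF m(1)[OF that] m(3)[OF that]] p[of "I - {i}"] by (intro borel_measurable_times) auto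
    ultimately show ?thesis by (simp add: integral_distr[OF X])
  qed
  have sq: "square_integrable (distr M N X) q \<longleftrightarrow> square_integrable M (\<lambda>\<omega>. q (X \<omega>))" if "q \<in> Q" for q
    using that Q by (intro square_integrable_distr[OF X]) auto
  show ?thesis
  proof
    assume L: "stein_system (distr M N X) Q"
    show "stein_system M ((\<lambda>q \<omega>. q (X \<omega>)) ` Q)"
      unfolding stein_system_def
    proof (intro conjI ballI allI impI)
      show "square_integrable M \<xi>" if "\<xi> \<in> (\<lambda>q \<omega>. q (X \<omega>)) ` Q" for \<xi>
        using that sq stein_systemD1[OF L] by auto
      fix I :: "nat set" and \<eta> h h' \<xi>
      assume \<xi>: "\<xi> \<in> (\<lambda>q \<omega>. q (X \<omega>)) ` Q" and "finite I" and \<eta>: "\<forall>i\<in>I. \<eta> i \<in> (\<lambda>q \<omega>. q (X \<omega>)) ` Q \<and> smooth_test (h i) (h' i)"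
      obtain q where q: "q \<in> Q" "\<xi> = (\<lambda>\<omega>. q (X \<omega>))" using \<xi> by blast
      have "\<forall>i\<in>I. \<exists>q. q \<in> Q \<and> \<eta> i = (\<lambda>\<omega>. q (X \<omega>))" using \<eta> by blast
      from bchoice[OF this] obtain r where r: "\<And>i. i \<in> I \<Longrightarrow> r i \<in> Q" "\<And>i. i \<in> I \<Longrightarrow> \<eta> i = (\<lambda>\<omega>. r i (X \<omega>))"
        by blast
      have k: "\<forall>i\<in>I. r i \<in> Q \<and> smooth_test (h i) (h' i)" using r \<eta> by auto
      note K = key[OF q(1) k]
      have "(\<integral>\<omega>. \<xi> \<omega> * (\<Prod>i\<in>I. h i (\<eta> i \<omega>)) \<partial>M) = (\<integral>\<omega>. q (X \<omega>) * (\<Prod>i\<in>I. h i (r i (X \<omega>))) \<partial>M)"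
        using q r by (simp cong: prod.cong)
      also have "\<dots> = (\<Sum>i\<in>I. (\<integral>\<omega>. q (X \<omega>) * r i (X \<omega>) \<partial>M) * (\<integral>\<omega>. h' i (r i (X \<omega>)) * (\<Prod>j\<in>I - {i}. h j (r j (X \<omega>))) \<partial>M))"
        using K stein_systemD2[OF L q(1) \<open>finite I\<close>, of r h h'] k by (simp cong: sum.cong)
      also have "\<dots> = (\<Sum>i\<in>I. (\<integral>\<omega>. \<xi> \<omega> * \<eta> i \<omega> \<partial>M) * (\<integral>\<omega>. h' i (\<eta> i \<omega>) * (\<Prod>j\<in>I - {i}. h j (\<eta> j \<omega>)) \<partial>M))"
      proof (rule sum.cong[OF refl])
        fix i assume i: "i \<in> I"
        have "(\<Prod>j\<in>I - {i}. h j (r j (X \<omega>))) = (\<Prod>j\<in>I - {i}. h j (\<eta> j \<omega>))" for \<omega>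
          using r by (intro prod.cong) auto
        then show "(\<integral>\<omega>. q (X \<omega>) * r i (X \<omega>) \<partial>M) * (\<integral>\<omega>. h' i (r i (X \<omega>)) * (\<Prod>j\<in>I - {i}. h j (r j (X \<omega>))) \<partial>M) =
          (\<integral>\<omega>. \<xi> \<omega> * \<eta> i \<omega> \<partial>M) * (\<integral>\<omega>. h' i (\<eta> i \<omega>) * (\<Prod>j\<in>I - {i}. h j (\<eta> j \<omega>)) \<partial>M)"
          using q r(2)[OF i] by simp
      qed
      finally show "(\<integral>\<omega>. \<xi> \<omega> * (\<Prod>i\<in>I. h i (\<eta> i \<omega>)) \<partial>M) =
        (\<Sum>i\<in>I. (\<integral>\<omega>. \<xi> \<omega> * \<eta> i \<omega> \<partial>M) * (\<integral>\<omega>. h' i (\<eta> i \<omega>) * (\<Prod>j\<in>I - {i}. h j (\<eta> j \<omega>)) \<partial>M))" .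
    qed
  next
    assume R: "stein_system M ((\<lambda>q \<omega>. q (X \<omega>)) ` Q)"
    show "stein_system (distr M N X) Q"
      unfolding stein_system_def
    proof (intro conjI ballI allI impI)
      show "square_integrable (distr M N X) \<xi>" if "\<xi> \<in> Q" for \<xi>
        using that sq stein_systemD1[OF R] by auto
      fix I :: "nat set" and \<eta> h h' \<xi>
      assume \<xi>: "\<xi> \<in> Q" and "finite I" and \<eta>: "\<forall>i\<in>I. \<eta> i \<in> Q \<and> smooth_test (h i) (h' i)"
      show "(\<integral>\<omega>. \<xi> \<omega> * (\<Prod>i\<in>I. h i (\<eta> i \<omega>)) \<partial>distr M N X) =
        (\<Sum>i\<in>I. (\<integral>\<omega>. \<xi> \<omega> * \<eta> i \<omega> \<partial>distr M N X) * (\<integral>\<omega>. h' i (\<eta> i \<omega>) * (\<Prod>j\<in>I - {i}. h j (\<eta> j \<omega>)) \<partial>distr M N X))"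
        unfolding conjunct1[OF key[OF \<xi> \<eta>], symmetric]
      proof (subst stein_systemD2[OF R imageI[OF \<xi>] \<open>finite I\<close>, of "\<lambda>i \<omega>. \<eta> i (X \<omega>)" h h'])
        show "(\<Sum>i\<in>I. (\<integral>\<omega>. \<xi> (X \<omega>) * \<eta> i (X \<omega>) \<partial>M) * (\<integral>\<omega>. h' i (\<eta> i (X \<omega>)) * (\<Prod>j\<in>I - {i}. h j (\<eta> j (X \<omega>))) \<partial>M)) =
         (\<Sum>i\<in>I. (\<integral>\<omega>. \<xi> \<omega> * \<eta> i \<omega> \<partial>distr M N X) * (\<integral>\<omega>. h' i (\<eta> i \<omega>) * (\<Prod>j\<in>I - {i}. h j (\<eta> j \<omega>)) \<partial>distr M N X))"
          using conjunct2[OF key[OF \<xi> \<eta>]] by (intro sum.cong) auto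
      qed (use \<eta> in auto)
    qed
  qed
qed

text \<open>Fubini's theorem reduces the identity for a sum to the identities for the two summands: with the
  other coordinate fixed, it only shifts the arguments of the test functions.\<close>

lemma stein_system_pair:
  assumes "prob_space N1" "prob_space N2" and S1: "stein_system N1 Q1" and S2: "stein_system N2 Q2"
  shows "stein_system (N1 \<Otimes>\<^sub>M N2) {\<lambda>p. q1 (fst p) + q2 (snd p) | q1 q2. q1 \<in> Q1 \<and> q2 \<in> Q2}" (is "stein_system ?N ?Q")
    and "\<And>\<xi>1 \<xi>2 \<eta>1 \<eta>2. \<xi>1 \<in> Q1 \<Longrightarrow> \<xi>2 \<in> Q2 \<Longrightarrow> \<eta>1 \<in> Q1 \<Longrightarrow> \<eta>2 \<in> Q2 \<Longrightarrow>
       (\<integral>p. (\<xi>1 (fst p) + \<xi>2 (snd p)) * (\<eta>1 (fst p) + \<eta>2 (snd p)) \<partial>(N1 \<Otimes>\<^sub>M N2))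
         = (\<integral>x. \<xi>1 x * \<eta>1 x \<partial>N1) + (\<integral>y. \<xi>2 y * \<eta>2 y \<partial>N2)"
proof -
  interpret N1: prob_space N1 by fact
  interpret N2: prob_space N2 by fact
  interpret P: pair_prob_space N1 N2 ..
  have d1: "distr ?N N1 fst = N1" by (rule N2.distr_pair_fst)
  have d2: "distr ?N N2 snd = N2"
  proof -
    interpret Q: pair_prob_space N2 N1 ..
    have "distr ?N N2 snd = distr (distr (N2 \<Otimes>\<^sub>M N1) ?N (\<lambda>(x, y). (y, x))) N2 snd"
      by (subst P.distr_pair_swap) simp
    also have "\<dots> = distr (N2 \<Otimes>\<^sub>M N1) N2 fst"
      by (subst distr_distr) (auto simp: comp_def case_prod_unfold)
    finally show ?thesis by (simp add: N1.distr_pair_fst)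
  qed
  have m1: "q \<in> borel_measurable N1" if "q \<in> Q1" for q using stein_systemD1[OF S1 that] by (simp add: square_integrable_def)
  have m2: "q \<in> borel_measurable N2" if "q \<in> Q2" for q using stein_systemD1[OF S2 that] by (simp add: square_integrable_def)
  have sq1: "square_integrable ?N (\<lambda>p. q (fst p))" if "q \<in> Q1" for q
    using stein_systemD1[OF S1 that] square_integrable_distr[OF measurable_fst m1[OF that], of N2] unfolding d1 by simp
  have sq2: "square_integrable ?N (\<lambda>p. q (snd p))" if "q \<in> Q2" for q
    using stein_systemD1[OF S2 that] square_integrable_distr[OF measurable_snd m2[OF that], of N1] unfolding d2 by simp
  have I1: "(\<integral>p. q (fst p) \<partial>?N) = (\<integral>x. q x \<partial>N1)" if "q \<in> borel_measurable N1" for q :: "_ \<Rightarrow> real"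
    using integral_distr[OF measurable_fst that, of N2] unfolding d1 by simp
  have I2: "(\<integral>p. q (snd p) \<partial>?N) = (\<integral>x. q x \<partial>N2)" if "q \<in> borel_measurable N2" for q :: "_ \<Rightarrow> real"
    using integral_distr[OF measurable_snd that, of N1] unfolding d2 by simp
  have int1: "integrable N1 q" if "q \<in> Q1" for q using N1.square_integrable_integrable stein_systemD1[OF S1 that] by blast
  have int2: "integrable N2 q" if "q \<in> Q2" for q using N2.square_integrable_integrable stein_systemD1[OF S2 that] by blast
  have cross: "(\<integral>p. f (fst p) * g (snd p) \<partial>?N) = 0" if f: "f \<in> Q1" and g: "g \<in> Q2" for f g
  proof -
    have i: "integrable ?N (\<lambda>(x, y). f x * g y)"
      using square_integrable_mult[OF sq1[OF f] sq2[OF g]] by (simp add: case_prod_unfold)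
    have "(\<integral>p. f (fst p) * g (snd p) \<partial>?N) = (\<integral>y. \<integral>x. f x * g y \<partial>N1 \<partial>N2)"
      using P.integral_snd[OF i] by (simp add: case_prod_unfold)
    also have "\<dots> = 0" using stein_system_mean[OF S1 f] by simp
    finally show ?thesis .
  qed
  show cov: "(\<integral>p. (\<xi>1 (fst p) + \<xi>2 (snd p)) * (\<eta>1 (fst p) + \<eta>2 (snd p)) \<partial>?N)
         = (\<integral>x. \<xi>1 x * \<eta>1 x \<partial>N1) + (\<integral>y. \<xi>2 y * \<eta>2 y \<partial>N2)"
    if Q: "\<xi>1 \<in> Q1" "\<xi>2 \<in> Q2" "\<eta>1 \<in> Q1" "\<eta>2 \<in> Q2" for \<xi>1 \<xi>2 \<eta>1 \<eta>2
  proof -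
    have "(\<integral>p. (\<xi>1 (fst p) + \<xi>2 (snd p)) * (\<eta>1 (fst p) + \<eta>2 (snd p)) \<partial>?N) =
       (\<integral>p. (\<xi>1 (fst p) * \<eta>1 (fst p) + \<xi>2 (snd p) * \<eta>2 (snd p)) + (\<xi>1 (fst p) * \<eta>2 (snd p) + \<eta>1 (fst p) * \<xi>2 (snd p)) \<partial>?N)"
      by (intro Bochner_Integration.integral_cong refl) (simp add: algebra_simps)
    also have "\<dots> = ((\<integral>p. \<xi>1 (fst p) * \<eta>1 (fst p) \<partial>?N) + (\<integral>p. \<xi>2 (snd p) * \<eta>2 (snd p) \<partial>?N))
       + ((\<integral>p. \<xi>1 (fst p) * \<eta>2 (snd p) \<partial>?N) + (\<integral>p. \<eta>1 (fst p) * \<xi>2 (snd p) \<partial>?N))"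
      by (simp add: square_integrable_mult sq1 sq2 Q)
    also have "(\<integral>p. \<xi>1 (fst p) * \<eta>1 (fst p) \<partial>?N) = (\<integral>x. \<xi>1 x * \<eta>1 x \<partial>N1)"
      using Q m1 by (intro I1[of "\<lambda>x. \<xi>1 x * \<eta>1 x"]) auto
    also have "(\<integral>p. \<xi>2 (snd p) * \<eta>2 (snd p) \<partial>?N) = (\<integral>x. \<xi>2 x * \<eta>2 x \<partial>N2)"
      using Q m2 by (intro I2[of "\<lambda>x. \<xi>2 x * \<eta>2 x"]) auto
    finally show ?thesis using Q by (simp add: cross)
  qed
  show "stein_system ?N ?Q"
    unfolding stein_system_def
  proof (intro conjI ballI allI impI)
    show "square_integrable ?N \<xi>" if "\<xi> \<in> ?Q" for \<xi>
      using that sq1 sq2 by (auto intro: square_integrable_add)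
    fix I :: "nat set" and \<eta> h h' \<xi>
    assume \<xi>: "\<xi> \<in> ?Q" and I: "finite I" and \<eta>: "\<forall>i\<in>I. \<eta> i \<in> ?Q \<and> smooth_test (h i) (h' i)"
    obtain q1 q2 where q: "q1 \<in> Q1" "q2 \<in> Q2" "\<xi> = (\<lambda>p. q1 (fst p) + q2 (snd p))" using \<xi> by blast
    have "\<forall>i\<in>I. \<exists>r1 r2. r1 \<in> Q1 \<and> r2 \<in> Q2 \<and> \<eta> i = (\<lambda>p. r1 (fst p) + r2 (snd p))" using \<eta> by blast
    then obtain r1 r2 where r: "\<And>i. i \<in> I \<Longrightarrow> r1 i \<in> Q1" "\<And>i. i \<in> I \<Longrightarrow> r2 i \<in> Q2"
       "\<And>i. i \<in> I \<Longrightarrow> \<eta> i = (\<lambda>p. r1 i (fst p) + r2 i (snd p))" by metis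
    have h: "smooth_test (h i) (h' i)" if "i \<in> I" for i using \<eta> that by blast
    have rm: "r1 i \<in> borel_measurable N1" "r2 i \<in> borel_measurable N2" "h i \<in> borel_measurable borel" "h' i \<in> borel_measurable borel" if "i \<in> I" for i
      using r that m1 m2 smooth_testD[OF h[OF that]] by auto
    have pm: "(\<lambda>p. \<Prod>i\<in>J. h i (r1 i (fst p) + r2 i (snd p))) \<in> borel_measurable ?N" if "J \<subseteq> I" for J
    proof (rule borel_measurable_prod)
      fix i assume "i \<in> J"
      then have [measurable]: "r1 i \<in> borel_measurable N1" "r2 i \<in> borel_measurable N2" "h i \<in> borel_measurable borel" using rm that by auto
      show "(\<lambda>p. h i (r1 i (fst p) + r2 i (snd p))) \<in> borel_measurable ?N" by measurable
    qed
    have pb: "\<exists>B. \<forall>p. \<bar>\<Prod>i\<in>J. h i (r1 i (fst p) + r2 i (snd p))\<bar> \<le> B" if "J \<subseteq> I" for J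
    proof (rule prod_bounded[of J h "\<lambda>i p. r1 i (fst p) + r2 i (snd p)"])
      fix i assume "i \<in> J"
      then have "smooth_test (h i) (h' i)" using that h by blast
      then show "\<exists>B. \<forall>x. \<bar>h i x\<bar> \<le> B" by (rule smooth_test_bounds)
    qed
    let ?D = "\<lambda>i p. h' i (r1 i (fst p) + r2 i (snd p)) * (\<Prod>j\<in>I - {i}. h j (r1 j (fst p) + r2 j (snd p)))"
    have Dint: "integrable ?N (?D i)" if i: "i \<in> I" for i
    proof -
      have [measurable]: "r1 i \<in> borel_measurable N1" "r2 i \<in> borel_measurable N2" "h' i \<in> borel_measurable borel" using rm i by auto
      obtain B where B: "\<And>x. \<bar>h' i x\<bar> \<le> B" using smooth_test_bounds(2)[OF h[OF i]] by auto
      have "integrable ?N (\<lambda>p. h' i (r1 i (fst p) + r2 i (snd p)))"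
        using B by (intro P.integrable_const_bound[of _ B]) auto
      moreover obtain B' where "\<And>p. \<bar>\<Prod>j\<in>I - {i}. h j (r1 j (fst p) + r2 j (snd p))\<bar> \<le> B'" using pb[of "I - {i}"] by blast
      ultimately show ?thesis using pm[of "I - {i}"] by (intro integrable_mult_bounded) auto
    qed
    have Dint': "integrable ?N (\<lambda>(x, y). ?D i (x, y))" if "i \<in> I" for i
      using Dint[OF that] by (simp add: case_prod_unfold)
    obtain B where B: "\<And>p. \<bar>\<Prod>i\<in>I. h i (r1 i (fst p) + r2 i (snd p))\<bar> \<le> B" using pb[of I] by blast
    have i1: "integrable ?N (\<lambda>p. q1 (fst p) * (\<Prod>i\<in>I. h i (r1 i (fst p) + r2 i (snd p))))"
      using P.square_integrable_integrable[OF sq1[OF q(1)]] pm B by (intro integrable_mult_bounded) auto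
    have i2: "integrable ?N (\<lambda>p. q2 (snd p) * (\<Prod>i\<in>I. h i (r1 i (fst p) + r2 i (snd p))))"
      using P.square_integrable_integrable[OF sq2[OF q(2)]] pm B by (intro integrable_mult_bounded) auto
    have e1: "(\<integral>p. q1 (fst p) * (\<Prod>i\<in>I. h i (r1 i (fst p) + r2 i (snd p))) \<partial>?N)
       = (\<Sum>i\<in>I. (\<integral>x. q1 x * r1 i x \<partial>N1) * (\<integral>p. ?D i p \<partial>?N))"
    proof -
      have "(\<integral>p. q1 (fst p) * (\<Prod>i\<in>I. h i (r1 i (fst p) + r2 i (snd p))) \<partial>?N)
         = (\<integral>y. \<integral>x. q1 x * (\<Prod>i\<in>I. h i (r1 i x + r2 i y)) \<partial>N1 \<partial>N2)"
        using P.integral_snd[of "\<lambda>x y. q1 x * (\<Prod>i\<in>I. h i (r1 i x + r2 i y))"] i1 by (simp add: case_prod_unfold)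
      also have "\<dots> = (\<integral>y. (\<Sum>i\<in>I. (\<integral>x. q1 x * r1 i x \<partial>N1) * (\<integral>x. ?D i (x, y) \<partial>N1)) \<partial>N2)"
      proof (rule Bochner_Integration.integral_cong[OF refl])
        fix y
        show "(\<integral>x. q1 x * (\<Prod>i\<in>I. h i (r1 i x + r2 i y)) \<partial>N1) =
          (\<Sum>i\<in>I. (\<integral>x. q1 x * r1 i x \<partial>N1) * (\<integral>x. ?D i (x, y) \<partial>N1))"
          using stein_systemD2[OF S1 q(1) I, of r1 "\<lambda>i x. h i (x + r2 i y)" "\<lambda>i x. h' i (x + r2 i y)"] r h
          by (simp add: smooth_test_shift)
      qed
      also have "\<dots> = (\<Sum>i\<in>I. (\<integral>x. q1 x * r1 i x \<partial>N1) * (\<integral>y. \<integral>x. ?D i (x, y) \<partial>N1 \<partial>N2))"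
        using P.integrable_snd[OF Dint'] by (subst Bochner_Integration.integral_sum) auto
      also have "\<dots> = (\<Sum>i\<in>I. (\<integral>x. q1 x * r1 i x \<partial>N1) * (\<integral>p. ?D i p \<partial>?N))"
        using P.integral_snd[OF Dint'] by (intro sum.cong refl) (simp add: case_prod_unfold)
      finally show ?thesis .
    qed
    have e2: "(\<integral>p. q2 (snd p) * (\<Prod>i\<in>I. h i (r1 i (fst p) + r2 i (snd p))) \<partial>?N)
       = (\<Sum>i\<in>I. (\<integral>y. q2 y * r2 i y \<partial>N2) * (\<integral>p. ?D i p \<partial>?N))"
    proof -
      have "(\<integral>p. q2 (snd p) * (\<Prod>i\<in>I. h i (r1 i (fst p) + r2 i (snd p))) \<partial>?N)
         = (\<integral>x. \<integral>y. q2 y * (\<Prod>i\<in>I. h i (r1 i x + r2 i y)) \<partial>N2 \<partial>N1)"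
        using P.integral_fst[of "\<lambda>x y. q2 y * (\<Prod>i\<in>I. h i (r1 i x + r2 i y))"] i2 by (simp add: case_prod_unfold)
      also have "\<dots> = (\<integral>x. (\<Sum>i\<in>I. (\<integral>y. q2 y * r2 i y \<partial>N2) * (\<integral>y. ?D i (x, y) \<partial>N2)) \<partial>N1)"
      proof (rule Bochner_Integration.integral_cong[OF refl])
        fix x
        show "(\<integral>y. q2 y * (\<Prod>i\<in>I. h i (r1 i x + r2 i y)) \<partial>N2) =
          (\<Sum>i\<in>I. (\<integral>y. q2 y * r2 i y \<partial>N2) * (\<integral>y. ?D i (x, y) \<partial>N2))"
          using stein_systemD2[OF S2 q(2) I, of r2 "\<lambda>i y. h i (y + r1 i x)" "\<lambda>i y. h' i (y + r1 i x)"] r h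
          by (simp add: smooth_test_shift add.commute)
      qed
      also have "\<dots> = (\<Sum>i\<in>I. (\<integral>y. q2 y * r2 i y \<partial>N2) * (\<integral>x. \<integral>y. ?D i (x, y) \<partial>N2 \<partial>N1))"
        using P.integrable_fst[OF Dint'] by (subst Bochner_Integration.integral_sum) auto
      also have "\<dots> = (\<Sum>i\<in>I. (\<integral>y. q2 y * r2 i y \<partial>N2) * (\<integral>p. ?D i p \<partial>?N))"
        using P.integral_fst[OF Dint'] by (intro sum.cong refl) (simp add: case_prod_unfold)
      finally show ?thesis .
    qed
    have "(\<integral>p. \<xi> p * (\<Prod>i\<in>I. h i (\<eta> i p)) \<partial>?N) =
       (\<integral>p. q1 (fst p) * (\<Prod>i\<in>I. h i (r1 i (fst p) + r2 i (snd p))) + q2 (snd p) * (\<Prod>i\<in>I. h i (r1 i (fst p) + r2 i (snd p))) \<partial>?N)"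
      using r(3) by (simp add: q(3) distrib_right cong: prod.cong)
    also have "\<dots> = (\<Sum>i\<in>I. ((\<integral>x. q1 x * r1 i x \<partial>N1) + (\<integral>y. q2 y * r2 i y \<partial>N2)) * (\<integral>p. ?D i p \<partial>?N))"
      using i1 i2 by (simp add: e1 e2 sum.distrib distrib_right)
    also have "\<dots> = (\<Sum>i\<in>I. (\<integral>p. \<xi> p * \<eta> i p \<partial>?N) * (\<integral>p. h' i (\<eta> i p) * (\<Prod>j\<in>I - {i}. h j (\<eta> j p)) \<partial>?N))"
    proof (rule sum.cong[OF refl])
      fix i assume i: "i \<in> I"
      have "(\<integral>p. \<xi> p * \<eta> i p \<partial>?N) = (\<integral>x. q1 x * r1 i x \<partial>N1) + (\<integral>y. q2 y * r2 i y \<partial>N2)"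
        unfolding q(3) r(3)[OF i] by (rule cov) (use q r i in auto)
      moreover have "(\<integral>p. h' i (\<eta> i p) * (\<Prod>j\<in>I - {i}. h j (\<eta> j p)) \<partial>?N) = (\<integral>p. ?D i p \<partial>?N)"
      proof -
        have "(\<Prod>j\<in>I - {i}. h j (\<eta> j p)) = (\<Prod>j\<in>I - {i}. h j (r1 j (fst p) + r2 j (snd p)))" for p
          using r(3) by (intro prod.cong) auto
        then show ?thesis using r(3)[OF i] by simp
      qed
      ultimately show "((\<integral>x. q1 x * r1 i x \<partial>N1) + (\<integral>y. q2 y * r2 i y \<partial>N2)) * (\<integral>p. ?D i p \<partial>?N) =
        (\<integral>p. \<xi> p * \<eta> i p \<partial>?N) * (\<integral>p. h' i (\<eta> i p) * (\<Prod>j\<in>I - {i}. h j (\<eta> j p)) \<partial>?N)" by simp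
    qed
    finally show "(\<integral>p. \<xi> p * (\<Prod>i\<in>I. h i (\<eta> i p)) \<partial>?N) =
      (\<Sum>i\<in>I. (\<integral>p. \<xi> p * \<eta> i p \<partial>?N) * (\<integral>p. h' i (\<eta> i p) * (\<Prod>j\<in>I - {i}. h j (\<eta> j p)) \<partial>?N))" .
  qed
qed

text \<open>By independence the joint law of the two families is a product measure.\<close>

lemma (in prob_space) stein_system_indep_add:
  assumes ind: "indep_set (sets N1) (sets N2)" "space N1 = space M" "space N2 = space M"
    and S: "stein_system M H1" "stein_system M H2" and H: "H1 \<subseteq> borel_measurable N1" "H2 \<subseteq> borel_measurable N2"
  shows "stein_system M {\<lambda>\<omega>. \<xi>1 \<omega> + \<xi>2 \<omega> | \<xi>1 \<xi>2. \<xi>1 \<in> H1 \<and> \<xi>2 \<in> H2}"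
proof -
  note iv = indep_set_indep_var[OF ind]
  have m: "(\<lambda>\<omega>. \<omega>) \<in> measurable M N1" "(\<lambda>\<omega>. \<omega>) \<in> measurable M N2"
    and D: "distr M N1 (\<lambda>\<omega>. \<omega>) \<Otimes>\<^sub>M distr M N2 (\<lambda>\<omega>. \<omega>) = distr M (N1 \<Otimes>\<^sub>M N2) (\<lambda>\<omega>. (\<omega>, \<omega>))"
    using iv unfolding indep_var_distribution_eq by auto
  have "stein_system (distr M N1 (\<lambda>\<omega>. \<omega>)) H1" "stein_system (distr M N2 (\<lambda>\<omega>. \<omega>)) H2"
    using S H by (simp_all add: stein_system_distr m)
  from stein_system_pair(1)[OF prob_space_distr[OF m(1)] prob_space_distr[OF m(2)] this]
  have "stein_system (distr M (N1 \<Otimes>\<^sub>M N2) (\<lambda>\<omega>. (\<omega>, \<omega>))) {\<lambda>p. q1 (fst p) + q2 (snd p) | q1 q2. q1 \<in> H1 \<and> q2 \<in> H2}"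
    unfolding D .
  moreover have "{\<lambda>p. q1 (fst p) + q2 (snd p) | q1 q2. q1 \<in> H1 \<and> q2 \<in> H2} \<subseteq> borel_measurable (N1 \<Otimes>\<^sub>M N2)"
  proof safe
    fix q1 q2 assume "q1 \<in> H1" "q2 \<in> H2"
    then have [measurable]: "q1 \<in> borel_measurable N1" "q2 \<in> borel_measurable N2" using H by auto
    show "(\<lambda>p. q1 (fst p) + q2 (snd p)) \<in> borel_measurable (N1 \<Otimes>\<^sub>M N2)" by measurable
  qed
  moreover have "(\<lambda>\<omega>. (\<omega>, \<omega>)) \<in> measurable M (N1 \<Otimes>\<^sub>M N2)" using m by simp
  ultimately have "stein_system M ((\<lambda>q \<omega>. q (\<omega>, \<omega>)) ` {\<lambda>p. q1 (fst p) + q2 (snd p) | q1 q2. q1 \<in> H1 \<and> q2 \<in> H2})"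
    using stein_system_distr by blast
  then show ?thesis
  proof (rule stein_system_mono, safe)
    fix \<xi>1 \<xi>2 assume "\<xi>1 \<in> H1" "\<xi>2 \<in> H2"
    then show "(\<lambda>\<omega>. \<xi>1 \<omega> + \<xi>2 \<omega>) \<in> (\<lambda>q \<omega>. q (\<omega>, \<omega>)) ` {\<lambda>p. q1 (fst p) + q2 (snd p) | q1 q2. q1 \<in> H1 \<and> q2 \<in> H2}"
      by (intro image_eqI[of _ _ "\<lambda>p. \<xi>1 (fst p) + \<xi>2 (snd p)"]) auto
  qed
qed

section \<open>Normal laws satisfy the integration by parts identity\<close>

lemma normal_density_deriv:
  assumes "0 < \<sigma>"
  shows "(normal_density 0 \<sigma> has_real_derivative - (x / \<sigma>\<^sup>2) * normal_density 0 \<sigma> x) (at x)"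
  using assms unfolding normal_density_def
  by (auto intro!: derivative_eq_intros simp: field_simps power2_eq_square)

lemma normal_density_tendsto:
  assumes "0 < \<sigma>" and f: "LIM x F. (x::real)\<^sup>2 :> at_top"
  shows "(normal_density 0 \<sigma> \<longlongrightarrow> 0) F"
proof -
  have "LIM x F. (1 / (2 * \<sigma>\<^sup>2)) * x\<^sup>2 :> at_top"
    using assms by (intro filterlim_tendsto_pos_mult_at_top[OF tendsto_const]) auto
  then have "LIM x F. - ((1 / (2 * \<sigma>\<^sup>2)) * x\<^sup>2) :> at_bot" by (simp add: filterlim_uminus_at_bot)
  then have "((\<lambda>x. exp (- ((1 / (2 * \<sigma>\<^sup>2)) * x\<^sup>2))) \<longlongrightarrow> 0) F"
    by (rule filterlim_compose[OF exp_at_bot])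
  then have "((\<lambda>x. 1 / sqrt (2 * pi * \<sigma>\<^sup>2) * exp (- ((1 / (2 * \<sigma>\<^sup>2)) * x\<^sup>2))) \<longlongrightarrow> 1 / sqrt (2 * pi * \<sigma>\<^sup>2) * 0) F"
    by (intro tendsto_intros)
  then show ?thesis by (simp add: normal_density_def[abs_def])
qed

lemma normal_moment_2_integrable:
  assumes "0 < \<sigma>"
  shows "integrable lborel (\<lambda>x. normal_density 0 \<sigma> x * x)" "integrable lborel (\<lambda>x. normal_density 0 \<sigma> x * x\<^sup>2)"
    "(\<integral>x. normal_density 0 \<sigma> x * x\<^sup>2 \<partial>lborel) = \<sigma>\<^sup>2"
  using integrable_normal_moment[OF assms, of 0 1] integrable_normal_moment[OF assms, of 0 2]
    integral_normal_moment_even[OF assms, of 0 1]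
  by (simp_all add: fact_numeral)

text \<open>The normal density \<open>n\<close> satisfies \<open>\<sigma>\<^sup>2 n'(x) = - x n(x)\<close>, so the difference of the two integrands is the
  derivative of \<open>- \<sigma>\<^sup>2 f n\<close>, which vanishes at both infinities.\<close>

lemma stein_normal:
  assumes \<sigma>: "0 < \<sigma>" and f: "smooth_test f f'"
  shows "(\<integral>x. normal_density 0 \<sigma> x * (x * f x) \<partial>lborel) = \<sigma>\<^sup>2 * (\<integral>x. normal_density 0 \<sigma> x * f' x \<partial>lborel)"
proof -
  let ?n = "normal_density 0 \<sigma>"
  note [measurable] = smooth_testD(2,3)[OF f]
  obtain B B' where B: "\<And>x. \<bar>f x\<bar> \<le> B" "\<And>x. \<bar>f' x\<bar> \<le> B'" using smooth_test_bounds[OF f] by blast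
  have i1: "integrable lborel (\<lambda>x. (?n x * x) * f x)"
    by (rule integrable_mult_bounded[OF normal_moment_2_integrable(1)[OF \<sigma>] _ B(1)]) measurable
  have i2: "integrable lborel (\<lambda>x. ?n x * f' x)"
    by (rule integrable_mult_bounded[OF integrable_normal_density[OF \<sigma>] _ B(2)]) measurable
  let ?F = "\<lambda>x. - (\<sigma>\<^sup>2 * (f x * ?n x))"
  let ?f = "\<lambda>x. (?n x * x) * f x - \<sigma>\<^sup>2 * (?n x * f' x)"
  have d: "(?F has_vector_derivative ?f x) (at x)" for x
  proof -
    have "(?F has_real_derivative - (\<sigma>\<^sup>2 * (f' x * ?n x + (- (x / \<sigma>\<^sup>2) * ?n x) * f x))) (at x)"
      by (intro DERIV_minus DERIV_cmult DERIV_mult smooth_testD(1)[OF f] normal_density_deriv[OF \<sigma>])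
    moreover have "- (\<sigma>\<^sup>2 * (f' x * ?n x + (- (x / \<sigma>\<^sup>2) * ?n x) * f x)) = ?f x"
      using \<sigma> by (simp add: field_simps)
    ultimately show ?thesis by (simp add: has_real_derivative_iff_has_vector_derivative)
  qed
  have cn: "continuous_on UNIV ?n"
    using normal_density_deriv[OF \<sigma>] by (intro continuous_at_imp_continuous_on ballI DERIV_isCont)
  have c: "continuous_on UNIV ?f"
    by (intro continuous_intros cn smooth_testD(4,5)[OF f])
  have lim: "(?F \<longlongrightarrow> 0) F" if "LIM x F. (x::real)\<^sup>2 :> at_top" for F
  proof (rule Lim_null_comparison)
    show "\<forall>\<^sub>F x in F. norm (?F x) \<le> \<sigma>\<^sup>2 * (B * ?n x)"
      using B(1) by (intro always_eventually allI)
        (auto simp: abs_mult intro!: mult_left_mono mult_right_mono)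
    show "((\<lambda>x. \<sigma>\<^sup>2 * (B * ?n x)) \<longlongrightarrow> 0) F"
      using tendsto_mult[OF tendsto_const[of "\<sigma>\<^sup>2 * B"] normal_density_tendsto[OF \<sigma> that]] by (simp add: mult.assoc)
  qed
  have "(LBINT x=-\<infinity>..\<infinity>. ?f x) = 0 - 0"
  proof (rule interval_integral_FTC_integrable)
    show "isCont ?f x" for x using c by (simp add: continuous_on_eq_continuous_at)
    show "set_integrable lborel (einterval (-\<infinity>) \<infinity>) ?f"
      using i1 i2 by (simp add: set_integrable_def einterval_def)
    show "((?F \<circ> real_of_ereal) \<longlongrightarrow> 0) (at_right (-\<infinity>))"
      unfolding ereal_tendsto_simps by (intro lim filterlim_pow_at_bot_even) (auto simp: filterlim_ident)
    show "((?F \<circ> real_of_ereal) \<longlongrightarrow> 0) (at_left \<infinity>)"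
      unfolding ereal_tendsto_simps by (intro lim filterlim_pow_at_top) (auto simp: filterlim_ident)
  qed (use d in auto)
  then have "(\<integral>x. ?f x \<partial>lborel) = 0"
    by (simp add: interval_lebesgue_integral_def set_lebesgue_integral_def einterval_def)
  moreover have "(\<integral>x. ?f x \<partial>lborel) = (\<integral>x. (?n x * x) * f x \<partial>lborel) - (\<integral>x. \<sigma>\<^sup>2 * (?n x * f' x) \<partial>lborel)"
    using i1 i2 by (intro Bochner_Integration.integral_diff) auto
  ultimately show ?thesis by (simp add: mult.assoc)
qed

lemma smooth_test_prod:
  fixes h h' :: "nat \<Rightarrow> real \<Rightarrow> real"
  assumes "finite I" and h: "\<And>i. i \<in> I \<Longrightarrow> smooth_test (h i) (h' i)"
  shows "smooth_test (\<lambda>x. \<Prod>i\<in>I. h i x) (\<lambda>x. \<Sum>i\<in>I. h' i x * (\<Prod>j\<in>I - {i}. h j x))"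
proof -
  have "((\<lambda>x. \<Prod>i\<in>I. h i x) has_real_derivative (\<Sum>i\<in>I. h' i x * (\<Prod>j\<in>I - {i}. h j x))) (at x)" for x
    using h by (intro has_field_derivative_prod) (auto dest: smooth_testD(1))
  moreover have "continuous_on UNIV (\<lambda>x. \<Sum>i\<in>I. h' i x * (\<Prod>j\<in>I - {i}. h j x))"
    using smooth_testD(4,5)[OF h] by (intro continuous_on_sum continuous_on_mult continuous_on_prod) auto
  moreover have pb: "\<exists>B. \<forall>x. \<bar>\<Prod>i\<in>J. h i x\<bar> \<le> B" if "J \<subseteq> I" for J
  proof (rule prod_bounded[of J h "\<lambda>i x. x"])
    fix i assume "i \<in> J"
    then have "smooth_test (h i) (h' i)" using that h by blast
    then show "\<exists>B. \<forall>x. \<bar>h i x\<bar> \<le> B" by (rule smooth_test_bounds)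
  qed
  moreover have "\<exists>B. \<forall>x. \<bar>\<Sum>i\<in>I. h' i x * (\<Prod>j\<in>I - {i}. h j x)\<bar> \<le> B"
  proof -
    have "\<forall>i\<in>I. \<exists>b. \<forall>x. \<bar>h' i x * (\<Prod>j\<in>I - {i}. h j x)\<bar> \<le> b"
    proof
      fix i assume i: "i \<in> I"
      obtain b1 where b1: "\<And>x. \<bar>h' i x\<bar> \<le> b1" using smooth_test_bounds(2)[OF h[OF i]] by auto
      obtain b2 where b2: "\<And>x. \<bar>\<Prod>j\<in>I - {i}. h j x\<bar> \<le> b2" using pb[of "I - {i}"] by blast
      have "\<bar>h' i x * (\<Prod>j\<in>I - {i}. h j x)\<bar> \<le> b1 * b2" for x
        unfolding abs_mult using b1[of x] b2[of x] by (intro mult_mono) auto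
      then show "\<exists>b. \<forall>x. \<bar>h' i x * (\<Prod>j\<in>I - {i}. h j x)\<bar> \<le> b" by blast
    qed
    from bchoice[OF this] obtain b where b: "\<And>i x. i \<in> I \<Longrightarrow> \<bar>h' i x * (\<Prod>j\<in>I - {i}. h j x)\<bar> \<le> b i" by blast
    have "\<bar>\<Sum>i\<in>I. h' i x * (\<Prod>j\<in>I - {i}. h j x)\<bar> \<le> (\<Sum>i\<in>I. b i)" for x
      by (rule order_trans[OF sum_abs sum_mono]) (rule b)
    then show ?thesis by blast
  qed
  ultimately show ?thesis using pb[of I] by (auto simp: smooth_test_def bounded_iff)
qed

text \<open>All members of the family are multiples of one variable, so a product of test functions is a single test
  function of that variable.\<close>

lemma stein_system_normal:
  assumes \<sigma>: "0 < \<sigma>"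
  shows "stein_system (density lborel (\<lambda>x. ennreal (normal_density 0 \<sigma> x))) (range (\<lambda>c x. c * x))"
    and "(\<integral>x. (a * x) * (b * x) \<partial>(density lborel (\<lambda>x. ennreal (normal_density 0 \<sigma> x)))) = \<sigma>\<^sup>2 * (a * b)"
proof -
  let ?N = "density lborel (\<lambda>x. ennreal (normal_density 0 \<sigma> x))"
  interpret prob_space ?N using \<sigma> by (rule prob_space_normal_density)
  have I: "(\<integral>x. g x \<partial>?N) = (\<integral>x. normal_density 0 \<sigma> x * g x \<partial>lborel)" if "g \<in> borel_measurable borel" for g :: "real \<Rightarrow> real"
    using that by (subst integral_density) (auto simp: normal_density_nonneg)
  have sq: "square_integrable ?N (\<lambda>x. c * x)" for c
  proof -
    have "integrable lborel (\<lambda>x. normal_density 0 \<sigma> x * (c * x)\<^sup>2)"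
      using integrable_mult_right[OF normal_moment_2_integrable(2)[OF \<sigma>], of "c\<^sup>2"] by (simp add: power_mult_distrib mult_ac)
    then show ?thesis
      unfolding square_integrable_def by (subst integrable_density) (auto simp: normal_density_nonneg)
  qed
  have "(\<lambda>x. normal_density 0 \<sigma> x * ((a * x) * (b * x))) = (\<lambda>x. (a * b) * (normal_density 0 \<sigma> x * x\<^sup>2))" for a b
    by (simp add: fun_eq_iff power2_eq_square mult_ac)
  then show cov: "(\<integral>x. (a * x) * (b * x) \<partial>?N) = \<sigma>\<^sup>2 * (a * b)" for a b
    by (subst I) (auto simp: normal_moment_2_integrable(3)[OF \<sigma>])
  show "stein_system ?N (range (\<lambda>c x. c * x))"
    unfolding stein_system_def
  proof (intro conjI ballI allI impI)
    show "square_integrable ?N \<xi>" if "\<xi> \<in> range (\<lambda>c x. c * x)" for \<xi> using that sq by auto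
    fix I :: "nat set" and \<eta> :: "nat \<Rightarrow> real \<Rightarrow> real" and h h' \<xi>
    assume \<xi>: "\<xi> \<in> range (\<lambda>(c::real) x. c * x)" and fin: "finite I" and \<eta>: "\<forall>i\<in>I. \<eta> i \<in> range (\<lambda>c x. c * x) \<and> smooth_test (h i) (h' i)"
    obtain a where a: "\<xi> = (\<lambda>x. a * x)" using \<xi> by blast
    have "\<forall>i\<in>I. \<exists>c. \<eta> i = (\<lambda>x. c * x)" using \<eta> by blast
    from bchoice[OF this] obtain b where b: "\<And>i. i \<in> I \<Longrightarrow> \<eta> i = (\<lambda>x. b i * x)" by blast
    have t: "smooth_test (\<lambda>x. h i (b i * x)) (\<lambda>x. b i * h' i (b i * x))" if "i \<in> I" for i
      using smooth_test_affine[of "h i" "h' i" "b i" 0] \<eta> that by simp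
    note sp = smooth_test_prod[OF fin t]
    let ?D = "\<lambda>i x. h' i (b i * x) * (\<Prod>j\<in>I - {i}. h j (b j * x))"
    have Dm: "?D i \<in> borel_measurable borel" if "i \<in> I" for i
    proof -
      have 1: "(\<lambda>x. h j (b j * x)) \<in> borel_measurable borel" if "j \<in> I" for j using smooth_testD(2)[OF t[OF that]] .
      have 2: "h' i \<in> borel_measurable borel" using \<eta> that smooth_testD(3) by blast
      show ?thesis by (intro borel_measurable_times borel_measurable_prod 1 measurable_compose[OF _ 2]) auto
    qed
    have Dint: "integrable ?N (?D i)" if i: "i \<in> I" for i
    proof -
      have hi: "smooth_test (h i) (h' i)" using \<eta> i by blast
      obtain b1 where b1: "\<And>x. \<bar>h' i x\<bar> \<le> b1" using smooth_test_bounds(2)[OF hi] by auto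
      have "\<exists>B. \<forall>x. \<bar>\<Prod>j\<in>I - {i}. h j (b j * x)\<bar> \<le> B"
      proof (rule prod_bounded[of _ h "\<lambda>j x. b j * x"])
        fix j assume "j \<in> I - {i}"
        then have "smooth_test (h j) (h' j)" using \<eta> by blast
        then show "\<exists>B. \<forall>x. \<bar>h j x\<bar> \<le> B" by (rule smooth_test_bounds)
      qed
      then obtain b2 where b2: "\<And>x. \<bar>\<Prod>j\<in>I - {i}. h j (b j * x)\<bar> \<le> b2" by blast
      have "\<bar>?D i x\<bar> \<le> b1 * b2" for x
        unfolding abs_mult using b1[of "b i * x"] b2[of x] by (intro mult_mono) auto
      then show ?thesis using Dm[OF i] by (intro integrable_const_bound[of _ "b1 * b2"]) auto
    qed
    have "(\<integral>x. \<xi> x * (\<Prod>i\<in>I. h i (\<eta> i x)) \<partial>?N) = (\<integral>x. (a * x) * (\<Prod>i\<in>I. h i (b i * x)) \<partial>?N)"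
      using a b by (simp cong: prod.cong)
    also have "\<dots> = a * (\<integral>x. normal_density 0 \<sigma> x * (x * (\<Prod>i\<in>I. h i (b i * x))) \<partial>lborel)"
    proof (subst I)
      have *: "normal_density 0 \<sigma> x * (a * x * (\<Prod>i\<in>I. h i (b i * x))) = a * (normal_density 0 \<sigma> x * (x * (\<Prod>i\<in>I. h i (b i * x))))" for x
        by (simp only: mult_ac)
      show "(\<integral>x. normal_density 0 \<sigma> x * (a * x * (\<Prod>i\<in>I. h i (b i * x))) \<partial>lborel) =
        a * (\<integral>x. normal_density 0 \<sigma> x * (x * (\<Prod>i\<in>I. h i (b i * x))) \<partial>lborel)"
        unfolding * by (rule integral_mult_right_zero)
      show "(\<lambda>x. a * x * (\<Prod>i\<in>I. h i (b i * x))) \<in> borel_measurable borel"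
        using smooth_testD(2)[OF sp] by (intro borel_measurable_times) auto
    qed
    also have "\<dots> = a * (\<sigma>\<^sup>2 * (\<integral>x. normal_density 0 \<sigma> x * (\<Sum>i\<in>I. b i * h' i (b i * x) * (\<Prod>j\<in>I - {i}. h j (b j * x))) \<partial>lborel))"
      by (simp only: stein_normal[OF \<sigma> sp])
    also have "(\<integral>x. normal_density 0 \<sigma> x * (\<Sum>i\<in>I. b i * h' i (b i * x) * (\<Prod>j\<in>I - {i}. h j (b j * x))) \<partial>lborel)
       = (\<integral>x. (\<Sum>i\<in>I. b i * ?D i x) \<partial>?N)"
      using smooth_testD(3)[OF sp] by (subst I) (auto simp: mult.assoc)
    also have "\<dots> = (\<Sum>i\<in>I. b i * (\<integral>x. ?D i x \<partial>?N))"
      using Dint by (subst Bochner_Integration.integral_sum) auto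
    also have "a * (\<sigma>\<^sup>2 * (\<Sum>i\<in>I. b i * (\<integral>x. ?D i x \<partial>?N))) = (\<Sum>i\<in>I. (\<sigma>\<^sup>2 * (a * b i)) * (\<integral>x. ?D i x \<partial>?N))"
      by (simp add: sum_distrib_left mult_ac)
    also have "\<dots> = (\<Sum>i\<in>I. (\<integral>x. \<xi> x * \<eta> i x \<partial>?N) * (\<integral>x. h' i (\<eta> i x) * (\<Prod>j\<in>I - {i}. h j (\<eta> j x)) \<partial>?N))"
    proof (rule sum.cong[OF refl])
      fix i assume i: "i \<in> I"
      have "(\<Prod>j\<in>I - {i}. h j (\<eta> j x)) = (\<Prod>j\<in>I - {i}. h j (b j * x))" for x
        using b by (intro prod.cong) auto
      then show "\<sigma>\<^sup>2 * (a * b i) * (\<integral>x. ?D i x \<partial>?N) =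
         (\<integral>x. \<xi> x * \<eta> i x \<partial>?N) * (\<integral>x. h' i (\<eta> i x) * (\<Prod>j\<in>I - {i}. h j (\<eta> j x)) \<partial>?N)"
        using a b[OF i] cov[of a "b i"] by simp
    qed
    finally show "(\<integral>x. \<xi> x * (\<Prod>i\<in>I. h i (\<eta> i x)) \<partial>?N) =
       (\<Sum>i\<in>I. (\<integral>x. \<xi> x * \<eta> i x \<partial>?N) * (\<integral>x. h' i (\<eta> i x) * (\<Prod>j\<in>I - {i}. h j (\<eta> j x)) \<partial>?N))" .
  qed
qed

lemma stein_system_PiM_normal:
  assumes \<sigma>: "0 < \<sigma>" and "finite J"
  defines "N \<equiv> density lborel (\<lambda>x. ennreal (normal_density 0 \<sigma> x))"
  shows "stein_system (\<Pi>\<^sub>M j\<in>J. N) (range (\<lambda>(a::'i \<Rightarrow> real) f. \<Sum>j\<in>J. a j * f j)) \<and>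
    (\<forall>a b. (\<integral>f. (\<Sum>j\<in>J. a j * f j) * (\<Sum>j\<in>J. b j * f j) \<partial>(\<Pi>\<^sub>M j\<in>J. N)) = \<sigma>\<^sup>2 * (\<Sum>j\<in>J. a j * b j))"
  using \<open>finite J\<close>
proof (induction J rule: finite_induct)
  case empty
  have *: "range (\<lambda>(a::'i \<Rightarrow> real) f. \<Sum>j\<in>{}. a j * (f j::real)) = {\<lambda>_. 0}" by auto
  show ?case unfolding * using stein_system_zero by simp
next
  case (insert i J)
  have N: "prob_space N" unfolding N_def using \<sigma> by (rule prob_space_normal_density)
  have PJ: "prob_space (\<Pi>\<^sub>M j\<in>J. N)" using N by (intro prob_space_PiM)
  let ?X = "\<lambda>(x, f). f(i := x) :: 'i \<Rightarrow> real"
  let ?Q = "\<lambda>J. range (\<lambda>(a::'i \<Rightarrow> real) f. \<Sum>j\<in>J. a j * f j :: real)"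
  have D: "distr (N \<Otimes>\<^sub>M (\<Pi>\<^sub>M j\<in>J. N)) (\<Pi>\<^sub>M j\<in>insert i J. N) ?X = (\<Pi>\<^sub>M j\<in>insert i J. N)"
    using N by (intro distr_pair_PiM_eq_PiM)
  have X[measurable]: "?X \<in> measurable (N \<Otimes>\<^sub>M (\<Pi>\<^sub>M j\<in>J. N)) (\<Pi>\<^sub>M j\<in>insert i J. N)"
    by measurable
  have mN: "(\<lambda>f. f j) \<in> borel_measurable (\<Pi>\<^sub>M j\<in>J. N)" if "j \<in> J" for j and J :: "'i set"
  proof -
    have "sets N = sets borel" by (simp add: N_def)
    then show ?thesis
      using measurable_component_singleton[OF that, of "\<lambda>_. N"] measurable_cong_sets[OF refl] by blast
  qed
  have Qm: "(\<lambda>f. \<Sum>j\<in>J. a j * f j :: real) \<in> borel_measurable (\<Pi>\<^sub>M j\<in>J. N)" for a and J :: "'i set"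
    by (intro borel_measurable_sum borel_measurable_times borel_measurable_const)
      (rule mN)
  note S1 = stein_system_normal[OF \<sigma>, folded N_def]
  have S2: "stein_system (\<Pi>\<^sub>M j\<in>J. N) (?Q J)" using insert.IH by blast
  note P = stein_system_pair[OF N PJ S1(1) S2]
  have eq: "(\<Sum>j\<in>insert i J. a j * ?X p j) = a i * fst p + (\<Sum>j\<in>J. a j * snd p j)" for a p
  proof -
    have "(\<Sum>j\<in>J. a j * (if j = i then fst p else snd p j)) = (\<Sum>j\<in>J. a j * snd p j)"
      using insert.hyps by (intro sum.cong) auto
    then show ?thesis using insert.hyps by (simp add: case_prod_unfold)
  qed
  have "stein_system (N \<Otimes>\<^sub>M (\<Pi>\<^sub>M j\<in>J. N)) ((\<lambda>q p. q (?X p)) ` ?Q (insert i J))"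
  proof (rule stein_system_mono[OF P(1)], safe)
    fix a :: "'i \<Rightarrow> real"
    show "\<exists>q1 q2. (\<lambda>p. \<Sum>j\<in>insert i J. a j * ?X p j) = (\<lambda>p. q1 (fst p) + q2 (snd p)) \<and> q1 \<in> range (*) \<and> q2 \<in> ?Q J"
      unfolding eq by (intro exI[of _ "\<lambda>x. a i * x"] exI[of _ "\<lambda>f. \<Sum>j\<in>J. a j * f j"]) auto
  qed
  moreover have "?Q (insert i J) \<subseteq> borel_measurable (\<Pi>\<^sub>M j\<in>insert i J. N)" using Qm by blast
  note stein_system_distr[OF X this, unfolded D]
  ultimately have "stein_system (\<Pi>\<^sub>M j\<in>insert i J. N) (?Q (insert i J))" by (rule iffD2[rotated])
  moreover have "(\<integral>f. (\<Sum>j\<in>insert i J. a j * f j) * (\<Sum>j\<in>insert i J. b j * f j) \<partial>(\<Pi>\<^sub>M j\<in>insert i J. N))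
     = \<sigma>\<^sup>2 * (\<Sum>j\<in>insert i J. a j * b j)" for a b
  proof -
    have "(\<integral>f. (\<Sum>j\<in>insert i J. a j * f j) * (\<Sum>j\<in>insert i J. b j * f j) \<partial>(\<Pi>\<^sub>M j\<in>insert i J. N))
       = (\<integral>p. (\<Sum>j\<in>insert i J. a j * ?X p j) * (\<Sum>j\<in>insert i J. b j * ?X p j) \<partial>(N \<Otimes>\<^sub>M (\<Pi>\<^sub>M j\<in>J. N)))"
      by (subst D[symmetric], rule integral_distr[OF X]) (intro borel_measurable_times Qm)
    also have "\<dots> = (\<integral>x. (a i * x) * (b i * x) \<partial>N) + (\<integral>f. (\<Sum>j\<in>J. a j * f j) * (\<Sum>j\<in>J. b j * f j) \<partial>(\<Pi>\<^sub>M j\<in>J. N))"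
      unfolding eq by (rule P(2)) auto
    also have "\<dots> = \<sigma>\<^sup>2 * (a i * b i) + \<sigma>\<^sup>2 * (\<Sum>j\<in>J. a j * b j)"
      using insert.IH S1(2) by simp
    finally show ?thesis using insert.hyps by (simp add: distrib_left)
  qed
  ultimately show ?case by blast
qed

abbreviation isotropic_normal :: "real \<Rightarrow> 'a::euclidean_space measure" where
  "isotropic_normal \<sigma> \<equiv> density lborel (\<lambda>x. ennreal (isotropic_normal_density \<sigma> x))"

text \<open>Both Lebesgue measure and the density are products over the coordinates.\<close>

lemma isotropic_normal_coordinates:
  assumes \<sigma>: "0 < \<sigma>"
  defines "N \<equiv> density lborel (\<lambda>x. ennreal (normal_density 0 \<sigma> x))"
  shows "distr (isotropic_normal \<sigma> :: 'a::euclidean_space measure) (\<Pi>\<^sub>M b\<in>Basis. N) (\<lambda>x. \<lambda>b\<in>Basis. x \<bullet> b) = (\<Pi>\<^sub>M b\<in>Basis. N)"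
proof -
  have N: "prob_space N" unfolding N_def using \<sigma> by (rule prob_space_normal_density)
  interpret N: product_sigma_finite "\<lambda>_::'a. N"
    using N by (simp add: product_sigma_finite_def prob_space_imp_sigma_finite)
  have X: "(\<lambda>x. \<lambda>b\<in>Basis. x \<bullet> b) \<in> measurable (isotropic_normal \<sigma> :: 'a measure) (\<Pi>\<^sub>M b\<in>Basis. N)"
    unfolding N_def by (intro measurable_restrict) simp
  show ?thesis
  proof (rule N.PiM_eqI)
    fix A :: "'a \<Rightarrow> real set" assume A: "\<And>b. b \<in> Basis \<Longrightarrow> A b \<in> sets N"
    then have A': "A b \<in> sets borel" if "b \<in> Basis" for b using that by (simp add: N_def)
    have im: "(\<lambda>x::'a. ennreal (isotropic_normal_density \<sigma> x)) \<in> borel_measurable borel"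
      unfolding isotropic_normal_density_def[abs_def] by measurable
    have pre: "(\<lambda>x. \<lambda>b\<in>Basis. x \<bullet> b) -` (Pi\<^sub>E Basis A) \<inter> space (isotropic_normal \<sigma>) = {x::'a. \<forall>b\<in>Basis. x \<bullet> b \<in> A b}"
      by (auto simp: PiE_iff)
    have mset: "{x::'a. \<forall>b\<in>Basis. x \<bullet> b \<in> A b} \<in> sets (isotropic_normal \<sigma>)"
      unfolding pre[symmetric] by (rule measurable_sets[OF X]) (use A in \<open>auto intro!: sets_PiM_I_finite\<close>)
    have "emeasure (distr (isotropic_normal \<sigma>) (\<Pi>\<^sub>M b\<in>Basis. N) (\<lambda>x. \<lambda>b\<in>Basis. x \<bullet> b)) (Pi\<^sub>E Basis A)
       = emeasure (isotropic_normal \<sigma>) {x::'a. \<forall>b\<in>Basis. x \<bullet> b \<in> A b}"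
      unfolding pre[symmetric] using A by (intro emeasure_distr X) (auto intro!: sets_PiM_I_finite)
    also have "\<dots> = (\<integral>\<^sup>+x. ennreal (isotropic_normal_density \<sigma> x) * indicator {x::'a. \<forall>b\<in>Basis. x \<bullet> b \<in> A b} x \<partial>lborel)"
      using mset im by (intro emeasure_density) auto
    also have "\<dots> = (\<integral>\<^sup>+x. (\<Prod>b\<in>Basis. ennreal (normal_density 0 \<sigma> (x \<bullet> b)) * indicator (A b) (x \<bullet> b)) \<partial>lborel)"
    proof (intro nn_integral_cong)
      fix x :: 'a
      have "indicator {x::'a. \<forall>b\<in>Basis. x \<bullet> b \<in> A b} x = (\<Prod>b\<in>Basis. indicator (A b) (x \<bullet> b) :: ennreal)"
        by (auto simp: indicator_def)
      moreover have "ennreal (isotropic_normal_density \<sigma> x) = (\<Prod>b\<in>Basis. ennreal (normal_density 0 \<sigma> (x \<bullet> b)))"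
        unfolding isotropic_normal_density_def by (subst prod_ennreal) (auto simp: normal_density_nonneg)
      ultimately show "ennreal (isotropic_normal_density \<sigma> x) * indicator {x::'a. \<forall>b\<in>Basis. x \<bullet> b \<in> A b} x
          = (\<Prod>b\<in>Basis. ennreal (normal_density 0 \<sigma> (x \<bullet> b)) * indicator (A b) (x \<bullet> b))"
        by (simp add: prod.distrib)
    qed
    also have "\<dots> = (\<Prod>b\<in>(Basis::'a set). \<integral>\<^sup>+x. ennreal (normal_density 0 \<sigma> x) * indicator (A b) x \<partial>lborel)"
      using A' by (intro nn_integral_lborel_prod) auto
    also have "\<dots> = (\<Prod>b\<in>(Basis::'a set). emeasure N (A b))"
      unfolding N_def using A' by (intro prod.cong refl emeasure_density[symmetric]) auto
    finally show "emeasure (distr (isotropic_normal \<sigma>) (\<Pi>\<^sub>M b\<in>Basis. N) (\<lambda>x. \<lambda>b\<in>Basis. x \<bullet> b)) (Pi\<^sub>E Basis A)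
      = (\<Prod>b\<in>(Basis::'a set). emeasure N (A b))" .
  qed auto
qed

lemma stein_system_isotropic:
  assumes \<sigma>: "0 < \<sigma>"
  shows "stein_system (isotropic_normal \<sigma> :: 'a::euclidean_space measure) (range (\<lambda>a x. x \<bullet> a))"
    and "(\<integral>x. (x \<bullet> a) * (x \<bullet> b) \<partial>(isotropic_normal \<sigma> :: 'a measure)) = \<sigma>\<^sup>2 * (a \<bullet> b)"
proof -
  let ?N = "density lborel (\<lambda>x. ennreal (normal_density 0 \<sigma> x))"
  let ?X = "\<lambda>x::'a. \<lambda>b\<in>Basis. x \<bullet> b"
  let ?q = "\<lambda>(c::'a \<Rightarrow> real) f. \<Sum>b\<in>Basis. c b * f b :: real"
  have X: "?X \<in> measurable (isotropic_normal \<sigma>) (\<Pi>\<^sub>M b\<in>Basis. ?N)"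
    by (intro measurable_restrict) simp
  note D = isotropic_normal_coordinates[OF \<sigma>, where 'a='a]
  note S = stein_system_PiM_normal[OF \<sigma> finite_Basis[where 'a='a]]
  have Qm: "?q c \<in> borel_measurable (\<Pi>\<^sub>M b\<in>Basis. ?N)" for c
  proof -
    have 1: "(\<lambda>f. f j) \<in> borel_measurable (\<Pi>\<^sub>M j\<in>Basis. ?N)" if "j \<in> Basis" for j :: 'a
    proof -
      have "sets ?N = sets borel" by simp
      then show ?thesis
        using measurable_component_singleton[OF that, of "\<lambda>_. ?N"] measurable_cong_sets[OF refl] by blast
    qed
    show ?thesis
      by (intro borel_measurable_sum borel_measurable_times borel_measurable_const)
        (rule 1)
  qed
  have eq: "?q (\<lambda>b. a \<bullet> b) (?X x) = x \<bullet> a" for a x :: 'a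
    by (subst euclidean_inner[of x]) (simp add: mult.commute)
  have "stein_system (distr (isotropic_normal \<sigma>) (\<Pi>\<^sub>M b\<in>Basis. ?N) ?X) (range ?q)"
    unfolding D using S by blast
  then have "stein_system (isotropic_normal \<sigma>) ((\<lambda>q x. q (?X x)) ` range ?q)"
    using Qm by (intro stein_system_distr[OF X, THEN iffD1]) auto
  then show "stein_system (isotropic_normal \<sigma> :: 'a measure) (range (\<lambda>a x. x \<bullet> a))"
  proof (rule stein_system_mono, safe)
    fix a :: 'a
    show "(\<lambda>x. x \<bullet> a) \<in> (\<lambda>q x. q (?X x)) ` range ?q"
      using eq[of a] by (intro image_eqI[of _ _ "?q (\<lambda>b. a \<bullet> b)"]) auto
  qed
  have "(\<integral>x. (x \<bullet> a) * (x \<bullet> b) \<partial>(isotropic_normal \<sigma> :: 'a measure)) = (\<integral>x. ?q (\<lambda>e. a \<bullet> e) (?X x) * ?q (\<lambda>e. b \<bullet> e) (?X x) \<partial>isotropic_normal \<sigma>)"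
    unfolding eq ..
  also have "\<dots> = (\<integral>f. ?q (\<lambda>e. a \<bullet> e) f * ?q (\<lambda>e. b \<bullet> e) f \<partial>distr (isotropic_normal \<sigma>) (\<Pi>\<^sub>M b\<in>Basis. ?N) ?X)"
    by (rule integral_distr[OF X, symmetric]) (intro borel_measurable_times Qm)
  also have "\<dots> = \<sigma>\<^sup>2 * (\<Sum>e\<in>Basis. (a \<bullet> e) * (b \<bullet> e))"
    unfolding D using S by blast
  also have "(\<Sum>e\<in>Basis. (a \<bullet> e) * (b \<bullet> e)) = a \<bullet> b" by (rule euclidean_inner[symmetric])
  finally show "(\<integral>x. (x \<bullet> a) * (x \<bullet> b) \<partial>(isotropic_normal \<sigma> :: 'a measure)) = \<sigma>\<^sup>2 * (a \<bullet> b)" .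
qed

section \<open>Linear functionals of the initial state and of the noise\<close>

lemma space_process_algebra [simp]: "space (process_algebra M I X) = space M"
  unfolding process_algebra_def by (subst space_measure_of) auto

lemma sets_process_algebra:
  "sets (process_algebra M I X) = sigma_sets (space M) {X t -` B \<inter> space M | t B. t \<in> I \<and> B \<in> sets borel}"
  unfolding process_algebra_def by (subst sets_measure_of) auto

lemma measurable_process_algebra: "t \<in> I \<Longrightarrow> X t \<in> borel_measurable (process_algebra M I X)"
  by (intro measurableI) (auto simp: sets_process_algebra)

lemma sets_process_algebra_mono: "I \<subseteq> J \<Longrightarrow> sets (process_algebra M I X) \<subseteq> sets (process_algebra M J X)"
  unfolding sets_process_algebra by (rule sigma_sets_mono') auto

lemma sets_process_algebra_subset:
  assumes "\<And>t. t \<in> I \<Longrightarrow> X t \<in> borel_measurable M"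
  shows "sets (process_algebra M I X) \<subseteq> sets M"
  unfolding sets_process_algebra using assms by (intro sets.sigma_sets_subset) (auto intro: measurable_sets)

lemma borel_measurable_subalgebra:
  assumes "f \<in> borel_measurable N" "sets N \<subseteq> sets M" "space N = space M"
  shows "f \<in> borel_measurable M"
  using measurable_mono[of borel borel N M] assms by auto

lemma inner_matrix_transpose: "(A *v x) \<bullet> y = x \<bullet> (transpose A *v y)" for A :: "real^'n^'m"
  by (metis dot_lmul_matrix inner_commute transpose_matrix_vector)

lemma adjoint_bound:
  fixes D :: "'a::euclidean_space \<Rightarrow> 'b::euclidean_space"
  assumes "linear_bounded_by a D" "0 \<le> a"
  shows "norm (adjoint D y) \<le> a * norm y"
proof -
  have lin: "linear D" using assms(1) by (rule linear_bounded_byD)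
  have "(norm (adjoint D y))\<^sup>2 = D (adjoint D y) \<bullet> y"
    by (simp add: power2_norm_eq_inner adjoint_works[OF lin])
  also have "\<dots> \<le> norm (D (adjoint D y)) * norm y" by (rule norm_cauchy_schwarz)
  also have "\<dots> \<le> (a * norm (adjoint D y)) * norm y"
    by (intro mult_right_mono linear_bounded_byD(2)[OF assms(1)]) simp
  finally have "norm (adjoint D y) * norm (adjoint D y) \<le> (a * norm y) * norm (adjoint D y)"
    by (simp add: power2_eq_square mult_ac)
  then show ?thesis using assms(2) by (cases "norm (adjoint D y) = 0") auto
qed

text \<open>The assumptions hold for the noise of the model and for the inputs of each sample, and both are studied
  in this locale.\<close>

locale gaussian_noise = prob_space M for M :: "'w measure" +
  fixes m :: "real^'x" and P :: "real^'x^'x" and Z :: "'w \<Rightarrow> real^'x"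
    and V :: "real \<Rightarrow> 'w \<Rightarrow> real^'y" and W :: "real \<Rightarrow> 'w \<Rightarrow> real^'x"
  assumes start_noise: "gaussian_start_with_noise M m P Z V W"
begin

definition noise_increment :: "nat \<Rightarrow> nat \<Rightarrow> 'w \<Rightarrow> (real^'y) \<times> (real^'x)" where
  "noise_increment l j \<omega> = (increment (\<lambda>r. V r \<omega>) l j, increment (\<lambda>r. W r \<omega>) l j)"

abbreviation noise_algebra :: "real set \<Rightarrow> 'w measure" where
  "noise_algebra I \<equiv> process_algebra M I (\<lambda>t \<omega>. (V t \<omega>, W t \<omega>))"

lemma brownian: "standard_brownian_motion M (\<lambda>t \<omega>. (V t \<omega>, W t \<omega>))"
  using start_noise by (simp add: gaussian_start_with_noise_def)

lemma noise_measurable: "t \<ge> 0 \<Longrightarrow> (\<lambda>\<omega>. (V t \<omega>, W t \<omega>)) \<in> borel_measurable M"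
  using brownian by (simp add: standard_brownian_motion_def)

lemma sets_noise_algebra: "I \<subseteq> {0..} \<Longrightarrow> sets (noise_algebra I) \<subseteq> events"
  by (intro sets_process_algebra_subset noise_measurable) auto

lemma noise_increment_eq:
  "noise_increment l j = (\<lambda>\<omega>. (V (real (Suc j) * step_size l) \<omega>, W (real (Suc j) * step_size l) \<omega>)
      - (V (real j * step_size l) \<omega>, W (real j * step_size l) \<omega>))"
  by (simp add: noise_increment_def increment_def fun_eq_iff)

lemma noise_increment_adapted:
  assumes "j < n"
  shows "noise_increment l j \<in> borel_measurable (noise_algebra {0..real n * step_size l})"
proof -
  have s: "0 \<le> real k * step_size l" "real k * step_size l \<le> real n * step_size l" if "k \<le> n" for k
    using that step_size_pos[of l] by (auto intro!: mult_right_mono)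
  have "(\<lambda>\<omega>. (V (real k * step_size l) \<omega>, W (real k * step_size l) \<omega>)) \<in> borel_measurable (noise_algebra {0..real n * step_size l})"
    if "k \<le> n" for k
    by (rule measurable_process_algebra) (use s[OF that] in auto)
  from this[of j] this[of "Suc j"] assms show ?thesis
    unfolding noise_increment_eq by (intro borel_measurable_diff) auto
qed

lemma noise_increment_measurable [measurable]: "noise_increment l j \<in> borel_measurable M"
  using noise_increment_adapted[of j "Suc j" l] by (rule borel_measurable_subalgebra) (auto intro!: sets_noise_algebra)

lemma noise_increment_law:
  shows "distr M lborel (noise_increment l j) = isotropic_normal (sqrt (step_size l))"
    and "indep_set (sets (noise_algebra {0..real j * step_size l})) (sets (vimage_algebra (space M) (noise_increment l j) borel))"
proof -
  let ?s = "real j * step_size l" and ?t = "real (Suc j) * step_size l"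
  have st: "0 \<le> ?s" "?s < ?t" using step_size_pos[of l] by auto
  have "?t - ?s = step_size l" by (simp add: algebra_simps)
  with brownian st show "distr M lborel (noise_increment l j) = isotropic_normal (sqrt (step_size l))"
    "indep_set (sets (noise_algebra {0..?s})) (sets (vimage_algebra (space M) (noise_increment l j) borel))"
    unfolding standard_brownian_motion_def noise_increment_eq distributed_def by (auto simp del: of_nat_Suc)
qed

lemma stein_system_increment:
  shows "stein_system M (range (\<lambda>b \<omega>. noise_increment l j \<omega> \<bullet> b))"
    and "expectation (\<lambda>\<omega>. (noise_increment l j \<omega> \<bullet> a) * (noise_increment l j \<omega> \<bullet> b)) = step_size l * (a \<bullet> b)"
proof -
  have s: "0 < sqrt (step_size l)" using step_size_pos by simp
  have X: "noise_increment l j \<in> measurable M lborel" by simp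
  have "stein_system (distr M lborel (noise_increment l j)) (range (\<lambda>b x. x \<bullet> b))"
    unfolding noise_increment_law(1) by (rule stein_system_isotropic[OF s])
  then have "stein_system M ((\<lambda>q \<omega>. q (noise_increment l j \<omega>)) ` range (\<lambda>b x. x \<bullet> b))"
    by (intro stein_system_distr[OF X, THEN iffD1]) auto
  then show "stein_system M (range (\<lambda>b \<omega>. noise_increment l j \<omega> \<bullet> b))"
    by (simp add: image_image)
  have "expectation (\<lambda>\<omega>. (noise_increment l j \<omega> \<bullet> a) * (noise_increment l j \<omega> \<bullet> b))
     = (\<integral>x. (x \<bullet> a) * (x \<bullet> b) \<partial>distr M lborel (noise_increment l j))"
    by (rule integral_distr[OF X, symmetric]) simp
  also have "\<dots> = step_size l * (a \<bullet> b)"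
    unfolding noise_increment_law(1) stein_system_isotropic(2)[OF s] using step_size_pos[of l] by simp
  finally show "expectation (\<lambda>\<omega>. (noise_increment l j \<omega> \<bullet> a) * (noise_increment l j \<omega> \<bullet> b)) = step_size l * (a \<bullet> b)" .
qed

lemma start_measurable [measurable]: "Z \<in> borel_measurable M"
  using start_noise by (simp add: gaussian_start_with_noise_def normal_vector_def)

lemma stein_system_start:
  shows "stein_system M (range (\<lambda>a \<omega>. (Z \<omega> - m) \<bullet> a))"
    and "expectation (\<lambda>\<omega>. ((Z \<omega> - m) \<bullet> a) * ((Z \<omega> - m) \<bullet> b)) = a \<bullet> (P *v b)"
proof -
  obtain B :: "real^'x^'x" where B: "P = B ** transpose B"
    and law: "distr M borel Z = distr (isotropic_normal 1) borel (\<lambda>z. m + B *v z)"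
    using start_noise by (auto simp: gaussian_start_with_noise_def normal_vector_def)
  have T: "(\<lambda>z. m + B *v z) \<in> measurable (isotropic_normal 1) borel"
    by (intro borel_measurable_add measurable_const)
      (auto intro!: borel_measurable_continuous_onI linear_continuous_on bounded_linear_intros simp: matrix_vector_mul_bounded_linear)
  let ?q = "\<lambda>a x. (x - m) \<bullet> a"
  have Q: "range ?q \<subseteq> borel_measurable borel" by auto
  have eq: "?q a (m + B *v z) = z \<bullet> (transpose B *v a)" for a z by (simp add: inner_matrix_transpose)
  have "stein_system (isotropic_normal 1) ((\<lambda>q z. q (m + B *v z)) ` range ?q)"
    by (rule stein_system_mono[OF stein_system_isotropic(1)]) (auto simp: inner_matrix_transpose)
  then have "stein_system (distr M borel Z) (range ?q)"
    unfolding law by (rule stein_system_distr[OF T Q, THEN iffD2])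
  then have "stein_system M ((\<lambda>q \<omega>. q (Z \<omega>)) ` range ?q)"
    by (rule stein_system_distr[OF start_measurable Q, THEN iffD1])
  then show "stein_system M (range (\<lambda>a \<omega>. (Z \<omega> - m) \<bullet> a))" by (simp add: image_image)
  have "expectation (\<lambda>\<omega>. ?q a (Z \<omega>) * ?q b (Z \<omega>)) = (\<integral>x. ?q a x * ?q b x \<partial>distr M borel Z)"
    by (rule integral_distr[OF start_measurable, symmetric]) simp
  also have "\<dots> = (\<integral>z. ?q a (m + B *v z) * ?q b (m + B *v z) \<partial>isotropic_normal 1)"
    unfolding law by (rule integral_distr[OF T]) simp
  also have "\<dots> = (transpose B *v a) \<bullet> (transpose B *v b)"
    unfolding eq by (simp add: stein_system_isotropic(2))
  also have "\<dots> = a \<bullet> (P *v b)"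
    unfolding B inner_matrix_transpose transpose_transpose matrix_vector_mul_assoc ..
  finally show "expectation (\<lambda>\<omega>. ((Z \<omega> - m) \<bullet> a) * ((Z \<omega> - m) \<bullet> b)) = a \<bullet> (P *v b)" .
qed

text \<open>The components of the discretized error and of the discretized observations at level \<open>l\<close> all have this
  form, so they belong to one jointly normal family.\<close>

definition scalar_functional :: "nat \<Rightarrow> nat \<Rightarrow> real^'x \<Rightarrow> (nat \<Rightarrow> (real^'y) \<times> (real^'x)) \<Rightarrow> 'w \<Rightarrow> real" where
  "scalar_functional l n a b \<omega> = (Z \<omega> - m) \<bullet> a + (\<Sum>j<n. noise_increment l j \<omega> \<bullet> b j)"

lemma indep_product_expectation:
  fixes \<xi>1 \<xi>2 \<eta>1 \<eta>2 :: "'w \<Rightarrow> real"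
  assumes ind: "indep_set (sets N1) (sets N2)" "space N1 = space M" "space N2 = space M"
    and S: "stein_system M H1" "stein_system M H2" and H: "H1 \<subseteq> borel_measurable N1" "H2 \<subseteq> borel_measurable N2"
    and el: "\<xi>1 \<in> H1" "\<eta>1 \<in> H1" "\<xi>2 \<in> H2" "\<eta>2 \<in> H2"
  shows "expectation (\<lambda>\<omega>. (\<xi>1 \<omega> + \<xi>2 \<omega>) * (\<eta>1 \<omega> + \<eta>2 \<omega>))
    = expectation (\<lambda>\<omega>. \<xi>1 \<omega> * \<eta>1 \<omega>) + expectation (\<lambda>\<omega>. \<xi>2 \<omega> * \<eta>2 \<omega>)"
proof -
  have cross: "expectation (\<lambda>\<omega>. f \<omega> * g \<omega>) = 0" if "f \<in> H1" "g \<in> H2" for f g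
    using indep_orthogonal[OF ind, of f g] that H stein_systemD1[OF S(1)] stein_systemD1[OF S(2)] stein_system_mean[OF S(2)]
    by auto
  have sq: "integrable M (\<lambda>\<omega>. f \<omega> * g \<omega>)" if "f \<in> H1 \<union> H2" "g \<in> H1 \<union> H2" for f g
    using that stein_systemD1[OF S(1)] stein_systemD1[OF S(2)] by (intro square_integrable_mult) auto
  have "expectation (\<lambda>\<omega>. (\<xi>1 \<omega> + \<xi>2 \<omega>) * (\<eta>1 \<omega> + \<eta>2 \<omega>))
     = expectation (\<lambda>\<omega>. (\<xi>1 \<omega> * \<eta>1 \<omega> + \<xi>2 \<omega> * \<eta>2 \<omega>) + (\<xi>1 \<omega> * \<eta>2 \<omega> + \<eta>1 \<omega> * \<xi>2 \<omega>))"
    by (intro Bochner_Integration.integral_cong refl) (simp add: algebra_simps)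
  also have "\<dots> = (expectation (\<lambda>\<omega>. \<xi>1 \<omega> * \<eta>1 \<omega>) + expectation (\<lambda>\<omega>. \<xi>2 \<omega> * \<eta>2 \<omega>))
     + (expectation (\<lambda>\<omega>. \<xi>1 \<omega> * \<eta>2 \<omega>) + expectation (\<lambda>\<omega>. \<eta>1 \<omega> * \<xi>2 \<omega>))"
    using el by (simp add: sq)
  finally show ?thesis using el by (simp add: cross)
qed

lemma measurable_vimage_borel: "f \<in> borel_measurable borel \<Longrightarrow> (\<lambda>\<omega>. f (X \<omega>)) \<in> borel_measurable (vimage_algebra (space M) X borel)"
  using measurable_compose[OF measurable_vimage_algebra1[of X "space M" borel]] by simp

text \<open>Induction over the steps: the next increment is independent of the past.\<close>

lemma stein_system_increments:
  shows "stein_system M (range (\<lambda>b \<omega>. \<Sum>j<n. noise_increment l j \<omega> \<bullet> b j))" (is "stein_system M (?U n)")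
    and "expectation (\<lambda>\<omega>. (\<Sum>j<n. noise_increment l j \<omega> \<bullet> b j) * (\<Sum>j<n. noise_increment l j \<omega> \<bullet> b' j))
      = step_size l * (\<Sum>j<n. b j \<bullet> b' j)"
proof -
  have "stein_system M (?U n) \<and> (\<forall>b b'. expectation (\<lambda>\<omega>. (\<Sum>j<n. noise_increment l j \<omega> \<bullet> b j) * (\<Sum>j<n. noise_increment l j \<omega> \<bullet> b' j))
      = step_size l * (\<Sum>j<n. b j \<bullet> b' j))"
  proof (induction n)
    case 0
    have "range (\<lambda>b \<omega>. \<Sum>j<0::nat. noise_increment l j \<omega> \<bullet> b j) = {\<lambda>_. 0}" by auto
    then show ?case using stein_system_zero by simp
  next
    case (Suc n)
    let ?N1 = "noise_algebra {0..real n * step_size l}" and ?N2 = "vimage_algebra (space M) (noise_increment l n) borel"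
    let ?G = "range (\<lambda>b \<omega>. noise_increment l n \<omega> \<bullet> b)"
    have m1: "?U n \<subseteq> borel_measurable ?N1"
    proof safe
      fix b :: "nat \<Rightarrow> (real^'y) \<times> (real^'x)"
      have [measurable]: "noise_increment l j \<in> borel_measurable ?N1" if "j \<in> {..<n}" for j
        using that by (intro noise_increment_adapted) simp
      show "(\<lambda>\<omega>. \<Sum>j<n. noise_increment l j \<omega> \<bullet> b j) \<in> borel_measurable ?N1"
        by (intro borel_measurable_sum borel_measurable_inner borel_measurable_const) measurable
    qed
    have m2: "?G \<subseteq> borel_measurable ?N2"
      by (auto intro!: measurable_vimage_borel[where f="\<lambda>x. x \<bullet> _"])
    note I = noise_increment_law(2)[of n l] space_process_algebra space_vimage_algebra
    note S = conjunct1[OF Suc.IH] stein_system_increment(1)[of l n]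
    have "stein_system M (?U (Suc n))"
      by (rule stein_system_mono[OF stein_system_indep_add[OF I S m1 m2]], safe, unfold sum.lessThan_Suc)
        (intro exI conjI, rule refl, (rule rangeI)+)
    moreover have "expectation (\<lambda>\<omega>. (\<Sum>j<Suc n. noise_increment l j \<omega> \<bullet> b j) * (\<Sum>j<Suc n. noise_increment l j \<omega> \<bullet> b' j))
      = step_size l * (\<Sum>j<Suc n. b j \<bullet> b' j)" for b b'
      using indep_product_expectation[OF I S m1 m2 rangeI[of _ b] rangeI[of _ b'] rangeI[of _ "b n"] rangeI[of _ "b' n"]]
        Suc.IH stein_system_increment(2)[of l n "b n" "b' n"]
      by (simp add: distrib_left)
    ultimately show ?case by blast
  qed
  then show "stein_system M (?U n)"
    "expectation (\<lambda>\<omega>. (\<Sum>j<n. noise_increment l j \<omega> \<bullet> b j) * (\<Sum>j<n. noise_increment l j \<omega> \<bullet> b' j))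
      = step_size l * (\<Sum>j<n. b j \<bullet> b' j)" by blast+
qed

lemma stein_system_functional:
  shows "stein_system M (range (case_prod (scalar_functional l n)))"
    and "expectation (\<lambda>\<omega>. scalar_functional l n a b \<omega> * scalar_functional l n a' b' \<omega>)
      = a \<bullet> (P *v a') + step_size l * (\<Sum>j<n. b j \<bullet> b' j)"
proof -
  let ?N1 = "vimage_algebra (space M) Z borel" and ?N2 = "noise_algebra {0..}"
  let ?H = "range (\<lambda>a \<omega>. (Z \<omega> - m) \<bullet> a)" and ?U = "range (\<lambda>b \<omega>. \<Sum>j<n. noise_increment l j \<omega> \<bullet> b j)"
  have I: "indep_set (sets ?N1) (sets ?N2)" "space ?N1 = space M" "space ?N2 = space M"
    using start_noise by (simp_all add: gaussian_start_with_noise_def)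
  have m1: "?H \<subseteq> borel_measurable ?N1"
    by (auto intro!: measurable_vimage_borel[where f="\<lambda>x. (x - m) \<bullet> _"])
  have m2: "?U \<subseteq> borel_measurable ?N2"
  proof safe
    fix b :: "nat \<Rightarrow> (real^'y) \<times> (real^'x)"
    have [measurable]: "noise_increment l j \<in> borel_measurable ?N2" for j
      using noise_increment_adapted[of j "Suc j" l]
      by (rule borel_measurable_subalgebra) (auto intro!: sets_process_algebra_mono)
    show "(\<lambda>\<omega>. \<Sum>j<n. noise_increment l j \<omega> \<bullet> b j) \<in> borel_measurable ?N2" by measurable
  qed
  note S = stein_system_start(1) stein_system_increments(1)[of l n]
  show "stein_system M (range (case_prod (scalar_functional l n)))"
    by (rule stein_system_mono[OF stein_system_indep_add[OF I S m1 m2]], safe, unfold scalar_functional_def[abs_def] case_prod_conv)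
      (intro exI conjI, rule refl, (rule rangeI)+)
  show "expectation (\<lambda>\<omega>. scalar_functional l n a b \<omega> * scalar_functional l n a' b' \<omega>)
      = a \<bullet> (P *v a') + step_size l * (\<Sum>j<n. b j \<bullet> b' j)"
    using indep_product_expectation[OF I S m1 m2 rangeI[of _ a] rangeI[of _ a'] rangeI[of _ b] rangeI[of _ b']]
    by (simp add: scalar_functional_def stein_system_start(2) stein_system_increments(2))
qed

lemma input_functional_scalar:
  fixes f :: "real^'x \<Rightarrow> (nat \<Rightarrow> (real^'y) \<times> (real^'x)) \<Rightarrow> 'c::euclidean_space"
  assumes "input_functional c n f" "0 \<le> c"
  shows "\<exists>a b. (\<forall>e. norm (a e) \<le> c * norm e) \<and> (\<forall>e. \<forall>j<n. norm (b e j) \<le> c * norm e) \<and>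
    (\<forall>e l. (\<lambda>\<omega>. f (Z \<omega> - m) (\<lambda>j. noise_increment l j \<omega>) \<bullet> e) = scalar_functional l n (a e) (b e))"
proof -
  obtain D C where D: "linear_bounded_by c D" "\<And>j. j < n \<Longrightarrow> linear_bounded_by c (C j)" "\<And>z u. f z u = D z + (\<Sum>j<n. C j (u j))"
    using assms(1) by (auto simp: input_functional_def)
  show ?thesis
  proof (intro exI[of _ "\<lambda>e. adjoint D e"] exI[of _ "\<lambda>e j. adjoint (C j) e"] conjI allI impI)
    show "norm (adjoint D e) \<le> c * norm e" for e using D(1) assms(2) by (rule adjoint_bound)
    show "norm (adjoint (C j) e) \<le> c * norm e" if "j < n" for e j using D(2)[OF that] assms(2) by (rule adjoint_bound)
    show "(\<lambda>\<omega>. f (Z \<omega> - m) (\<lambda>j. noise_increment l j \<omega>) \<bullet> e) = scalar_functional l n (adjoint D e) (\<lambda>j. adjoint (C j) e)" for e l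
    proof
      fix \<omega>
      have "(\<Sum>j<n. C j (noise_increment l j \<omega>) \<bullet> e) = (\<Sum>j<n. noise_increment l j \<omega> \<bullet> adjoint (C j) e)"
        by (intro sum.cong refl) (simp add: adjoint_works[OF linear_bounded_byD(1)[OF D(2)]])
      then show "f (Z \<omega> - m) (\<lambda>j. noise_increment l j \<omega>) \<bullet> e = scalar_functional l n (adjoint D e) (\<lambda>j. adjoint (C j) e) \<omega>"
        unfolding scalar_functional_def D(3)
        by (simp add: inner_add_left inner_sum_left adjoint_works[OF linear_bounded_byD(1)[OF D(1)]])
    qed
  qed
qed

text \<open>The inputs are uncorrelated, so only squares of coefficients remain. The \<open>n\<close> increments contribute the
  elapsed time \<open>n \<Delta>\<^sub>l\<close>, whatever the level.\<close>

lemma mean_square_functional: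
  fixes f :: "real^'x \<Rightarrow> (nat \<Rightarrow> (real^'y) \<times> (real^'x)) \<Rightarrow> 'c::euclidean_space"
  assumes f: "input_functional c n f" "0 \<le> c" and p: "\<And>x. x \<bullet> (P *v x) \<le> p * (norm x)\<^sup>2" "0 \<le> p"
  shows "mean_square M (\<lambda>\<omega>. f (Z \<omega> - m) (\<lambda>j. noise_increment l j \<omega>))
      \<le> ennreal (c\<^sup>2 * (real DIM('c) * (p + real n * step_size l)))"
    and "expectation (\<lambda>\<omega>. f (Z \<omega> - m) (\<lambda>j. noise_increment l j \<omega>)) = 0"
    and "square_integrable M (\<lambda>\<omega>. f (Z \<omega> - m) (\<lambda>j. noise_increment l j \<omega>))"
proof -
  let ?f = "\<lambda>\<omega>. f (Z \<omega> - m) (\<lambda>j. noise_increment l j \<omega>)"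
  obtain a b where a: "\<And>e. norm (a e) \<le> c * norm e" and b: "\<And>e j. j < n \<Longrightarrow> norm (b e j) \<le> c * norm e"
    and ab: "\<And>e l. (\<lambda>\<omega>. f (Z \<omega> - m) (\<lambda>j. noise_increment l j \<omega>) \<bullet> e) = scalar_functional l n (a e) (b e)"
    using input_functional_scalar[OF f] by blast
  have in_H: "(\<lambda>\<omega>. ?f \<omega> \<bullet> e) \<in> range (case_prod (scalar_functional l n))" for e
    unfolding ab by (rule range_eqI[of _ _ "(a e, b e)"]) simp
  have sqe: "square_integrable M (\<lambda>\<omega>. ?f \<omega> \<bullet> e)" for e
    by (rule stein_systemD1[OF stein_system_functional(1) in_H])
  have fm: "?f \<in> borel_measurable M" by (intro input_functional_measurable[OF f(1)]) measurable
  have norm: "(norm (?f \<omega>))\<^sup>2 = (\<Sum>e\<in>Basis. (?f \<omega> \<bullet> e)\<^sup>2)" for \<omega>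
    unfolding power2_norm_eq_inner by (subst euclidean_inner) (simp add: power2_eq_square)
  have ie: "integrable M (\<lambda>\<omega>. (?f \<omega> \<bullet> e)\<^sup>2)" for e
    using sqe[of e] by (simp add: square_integrable_def)
  show sq: "square_integrable M ?f"
    unfolding square_integrable_def norm using fm ie by simp
  have e: "expectation (\<lambda>\<omega>. (?f \<omega> \<bullet> e)\<^sup>2) \<le> c\<^sup>2 * (p + real n * step_size l)" if "e \<in> Basis" for e
  proof -
    have n1: "norm e = 1" using that by simp
    have "expectation (\<lambda>\<omega>. (?f \<omega> \<bullet> e)\<^sup>2) = a e \<bullet> (P *v a e) + step_size l * (\<Sum>j<n. b e j \<bullet> b e j)"
      unfolding power2_eq_square using stein_system_functional(2)[of l n "a e" "b e" "a e" "b e"]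
      by (simp add: fun_cong[OF ab])
    also have "\<dots> \<le> p * c\<^sup>2 + step_size l * (\<Sum>j<n. c\<^sup>2)"
    proof (intro add_mono mult_left_mono sum_mono)
      show "a e \<bullet> (P *v a e) \<le> p * c\<^sup>2"
        using a[of e] n1 p(2) by (intro order_trans[OF p(1)] mult_left_mono power_mono) auto
      show "b e j \<bullet> b e j \<le> c\<^sup>2" if "j \<in> {..<n}" for j
        using b[of j e] n1 that power_mono[of "norm (b e j)" c 2] by (simp add: power2_norm_eq_inner)
    qed (use step_size_pos[of l] in auto)
    also have "\<dots> = c\<^sup>2 * (p + real n * step_size l)" by (simp add: algebra_simps)
    finally show ?thesis .
  qed
  have "expectation (\<lambda>\<omega>. (norm (?f \<omega>))\<^sup>2) = (\<Sum>e\<in>(Basis :: 'c set). expectation (\<lambda>\<omega>. (?f \<omega> \<bullet> e)\<^sup>2))"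
    unfolding norm using ie by (rule Bochner_Integration.integral_sum)
  also have "\<dots> \<le> (\<Sum>e\<in>(Basis :: 'c set). c\<^sup>2 * (p + real n * step_size l))" by (rule sum_mono) (rule e)
  finally show "mean_square M ?f \<le> ennreal (c\<^sup>2 * (real DIM('c) * (p + real n * step_size l)))"
    unfolding mean_square_eq_integral[OF sq] by (intro ennreal_leI) (simp add: mult_ac)
  show "expectation ?f = 0"
  proof (rule euclidean_eqI)
    fix e :: 'c
    have "expectation ?f \<bullet> e = expectation (\<lambda>\<omega>. ?f \<omega> \<bullet> e)"
      using square_integrable_integrable[OF sq] by simp
    also have "\<dots> = 0" by (rule stein_system_mean[OF stein_system_functional(1) in_H])
    finally show "expectation ?f \<bullet> e = 0 \<bullet> e" by simp
  qed
qed

end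

section \<open>Covariances of the discretized filter error\<close>

lemma input_functional_precompose:
  assumes "input_functional a n f" "linear_bounded_by t I" "linear_bounded_by t T" "0 \<le> a" "0 \<le> t"
  shows "input_functional (a * t) n (\<lambda>z u. f (I z) (\<lambda>j. T (u j)))"
proof -
  obtain D c where 1: "linear_bounded_by a D" "\<forall>j<n. linear_bounded_by a (c j)" "\<forall>z u. f z u = D z + (\<Sum>j<n. c j (u j))"
    using assms(1) by (auto simp: input_functional_def)
  have "linear_bounded_by (a * t) (\<lambda>z. D (I z))" using linear_bounded_by_comp[OF assms(2) 1(1) assms(4)] .
  moreover have "\<forall>j<n. linear_bounded_by (a * t) (\<lambda>x. c j (T x))"
    using linear_bounded_by_comp[OF assms(3) _ assms(4)] 1(2) by blast
  ultimately show ?thesis unfolding input_functional_def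
    using 1(3) by (intro exI[of _ "\<lambda>z. D (I z)"] exI[of _ "\<lambda>j x. c j (T x)"]) simp
qed

lemma linear_bounded_by_exists:
  fixes D :: "'a::euclidean_space \<Rightarrow> 'b::euclidean_space"
  assumes "linear D" shows "\<exists>a\<ge>1. linear_bounded_by a D"
proof -
  obtain a where "a > 0" "\<And>x. norm (D x) \<le> a * norm x" using linear_bounded_pos[OF assms] by blast
  then have "linear_bounded_by a D" using assms by (simp add: linear_bounded_by_def)
  then have "linear_bounded_by (max 1 a) D" by (rule linear_bounded_by_mono) simp
  then show ?thesis by (intro exI[of _ "max 1 a"]) simp
qed

lemma discrete_gronwall:
  fixes q :: "nat \<Rightarrow> 'a::real_normed_vector"
  assumes "norm (q 0) \<le> q0" and step: "\<And>k. k < n \<Longrightarrow> norm (q (Suc k)) \<le> (1 + c * d) * norm (q k) + d * r"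
    and c: "0 \<le> c" "0 \<le> d" "0 \<le> r" "0 \<le> q0" and n: "real n * d \<le> T" and k: "k \<le> n"
  shows "norm (q k) \<le> (q0 + T * r) * exp (c * T)"
proof -
  have "norm (q k) \<le> (q0 + real k * (d * r)) * (1 + c * d) ^ k" using k
  proof (induction k)
    case 0
    then show ?case using assms by simp
  next
    case (Suc k)
    let ?p = "(1 + c * d) ^ k"
    have "norm (q (Suc k)) \<le> (1 + c * d) * norm (q k) + d * r" using step Suc.prems by simp
    also have "\<dots> \<le> (1 + c * d) * ((q0 + real k * (d * r)) * ?p) + (d * r) * ((1 + c * d) * ?p)"
    proof (intro add_mono mult_left_mono)
      have "d * r * 1 \<le> d * r * ((1 + c * d) * ?p)"
        using c by (intro mult_left_mono) (auto simp flip: power_Suc intro!: one_le_power)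
      then show "d * r \<le> (d * r) * ((1 + c * d) * ?p)" by simp
    qed (use Suc c in auto)
    also have "\<dots> = (q0 + real (Suc k) * (d * r)) * (1 + c * d) ^ Suc k" by (simp add: algebra_simps)
    finally show ?case .
  qed
  also have "\<dots> \<le> (q0 + T * r) * exp (c * T)"
  proof (rule mult_mono)
    have kd: "real k * d \<le> T" using mult_right_mono[of "real k" "real n" d] k n c by simp
    then show "q0 + real k * (d * r) \<le> q0 + T * r" using mult_right_mono[OF kd c(3)] by (simp add: mult_ac)
    show "(1 + c * d) ^ k \<le> exp (c * T)" by (rule power_one_plus_le_exp[OF c(1,2) kd])
    have "0 \<le> T" using n c(2) order_trans by (meson mult_nonneg_nonneg of_nat_0_le_iff)
    then show "0 \<le> q0 + T * r" using c by simp
  qed (use c in auto)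
  finally show ?thesis .
qed

definition cross_covariance :: "'w measure \<Rightarrow> ('w \<Rightarrow> real^'m) \<Rightarrow> ('w \<Rightarrow> real^'n) \<Rightarrow> real^'n^'m" where
  "cross_covariance M f g = (\<chi> i j. \<integral>\<omega>. f \<omega> $ i * g \<omega> $ j \<partial>M)"

lemma square_integrable_nth:
  fixes f :: "'w \<Rightarrow> real^'m"
  assumes "square_integrable M f" shows "square_integrable M (\<lambda>\<omega>. f \<omega> $ i)"
  using square_integrable_linear[OF _ assms, of "\<lambda>x. x $ i"] by (simp add: linear_iff)

lemma square_integrable_nth_mult:
  fixes f :: "'w \<Rightarrow> real^'m" and g :: "'w \<Rightarrow> real^'n"
  assumes "square_integrable M f" "square_integrable M g"
  shows "integrable M (\<lambda>\<omega>. f \<omega> $ i * g \<omega> $ j)"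
  by (rule square_integrable_mult[OF square_integrable_nth[OF assms(1)] square_integrable_nth[OF assms(2)]])

lemma cross_covariance_add:
  assumes "square_integrable M f" "square_integrable M f'" "square_integrable M g"
  shows "cross_covariance M (\<lambda>\<omega>. f \<omega> + f' \<omega>) g = cross_covariance M f g + cross_covariance M f' g"
    and "cross_covariance M g (\<lambda>\<omega>. f \<omega> + f' \<omega>) = cross_covariance M g f + cross_covariance M g f'"
  using assms by (simp_all add: cross_covariance_def vec_eq_iff distrib_left distrib_right square_integrable_nth_mult)

lemma cross_covariance_mult:
  fixes f :: "'w \<Rightarrow> real^'m" and g :: "'w \<Rightarrow> real^'n"
  assumes "square_integrable M f" "square_integrable M g"
  shows "cross_covariance M (\<lambda>\<omega>. Q *v f \<omega>) g = Q ** cross_covariance M f g"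
    and "cross_covariance M g (\<lambda>\<omega>. Q *v f \<omega>) = cross_covariance M g f ** transpose Q"
proof -
  have i: "integrable M (\<lambda>\<omega>. f \<omega> $ k * g \<omega> $ j)" "integrable M (\<lambda>\<omega>. g \<omega> $ j * f \<omega> $ k)" for j k
    using assms by (auto intro: square_integrable_nth_mult)
  show "cross_covariance M (\<lambda>\<omega>. Q *v f \<omega>) g = Q ** cross_covariance M f g"
    by (simp add: cross_covariance_def vec_eq_iff matrix_vector_mult_def matrix_matrix_mult_def sum_distrib_right mult.assoc i)
  have c: "g \<omega> $ j * (Q $ k $ k' * f \<omega> $ k') = (g \<omega> $ j * f \<omega> $ k') * Q $ k $ k'" for \<omega> j k k' by simp
  show "cross_covariance M g (\<lambda>\<omega>. Q *v f \<omega>) = cross_covariance M g f ** transpose Q"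
    by (simp add: cross_covariance_def vec_eq_iff matrix_vector_mult_def matrix_matrix_mult_def transpose_def sum_distrib_left c i)
qed

lemma cross_covariance_scaleR:
  "cross_covariance M (\<lambda>\<omega>. c *\<^sub>R f \<omega>) g = c *\<^sub>R cross_covariance M f g"
  "cross_covariance M g (\<lambda>\<omega>. c *\<^sub>R f \<omega>) = c *\<^sub>R cross_covariance M g f"
proof -
  have c: "g \<omega> $ i * (c * f \<omega> $ j) = c * (g \<omega> $ i * f \<omega> $ j)" for \<omega> i j by simp
  then show "cross_covariance M (\<lambda>\<omega>. c *\<^sub>R f \<omega>) g = c *\<^sub>R cross_covariance M f g"
    "cross_covariance M g (\<lambda>\<omega>. c *\<^sub>R f \<omega>) = c *\<^sub>R cross_covariance M g f"
    by (simp_all add: cross_covariance_def vec_eq_iff mult.assoc c)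
qed

text \<open>The noises of the step are uncorrelated with the past, so besides the propagated covariances only their
  mutual covariance remains.\<close>

lemma cross_covariance_step:
  fixes e N :: "'w \<Rightarrow> real^'p" and x :: "'w \<Rightarrow> real^'q" and y N' :: "'w \<Rightarrow> real^'r"
  assumes sq: "square_integrable M e" "square_integrable M x" "square_integrable M y" "square_integrable M N" "square_integrable M N'"
    and 0: "cross_covariance M e N' = 0" "cross_covariance M N x = 0" "cross_covariance M N y = 0"
  shows "cross_covariance M (\<lambda>\<omega>. e \<omega> + d *\<^sub>R (H *v e \<omega>) + N \<omega>) (\<lambda>\<omega>. y \<omega> + d *\<^sub>R (B *v x \<omega>) + N' \<omega>)
    = cross_covariance M e y + d *\<^sub>R (cross_covariance M e x ** transpose B) + d *\<^sub>R (H ** cross_covariance M e y)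
      + d\<^sup>2 *\<^sub>R (H ** (cross_covariance M e x ** transpose B)) + cross_covariance M N N'"
proof -
  have l: "linear (\<lambda>x. c *\<^sub>R (Q *v x))" for c and Q :: "real^'k^'l"
    by (intro linear_compose_scale_right) simp
  have He: "square_integrable M (\<lambda>\<omega>. H *v e \<omega>)" "square_integrable M (\<lambda>\<omega>. d *\<^sub>R (H *v e \<omega>))"
    using square_integrable_linear[OF _ sq(1), of "(*v) H"] square_integrable_linear[OF l sq(1), of d H] by simp_all
  have Bx: "square_integrable M (\<lambda>\<omega>. B *v x \<omega>)" "square_integrable M (\<lambda>\<omega>. d *\<^sub>R (B *v x \<omega>))"
    using square_integrable_linear[OF _ sq(2), of "(*v) B"] square_integrable_linear[OF l sq(2), of d B] by simp_all
  have z: "H ** (0 :: real^'r^'p) = 0" "(0 :: real^'q^'p) ** transpose B = 0"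
    by (simp_all add: matrix_matrix_mult_def vec_eq_iff)
  show ?thesis
    using sq He Bx 0
    by (simp add: cross_covariance_add square_integrable_add cross_covariance_scaleR cross_covariance_mult z
        power2_eq_square scaleR_add_right)
qed

context gaussian_noise
begin

lemma functional_uncorrelated:
  fixes f :: "real^'x \<Rightarrow> (nat \<Rightarrow> (real^'y) \<times> (real^'x)) \<Rightarrow> 'c::euclidean_space"
  assumes f: "input_functional c n f" "0 \<le> c" "n \<le> k"
  shows "expectation (\<lambda>\<omega>. (f (Z \<omega> - m) (\<lambda>j. noise_increment l j \<omega>) \<bullet> e) * (noise_increment l k \<omega> \<bullet> b)) = 0"
proof -
  obtain a0 b0 where ab: "\<And>e l. (\<lambda>\<omega>. f (Z \<omega> - m) (\<lambda>j. noise_increment l j \<omega>) \<bullet> e) = scalar_functional l n (a0 e) (b0 e)"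
    using input_functional_scalar[OF f(1,2)] by blast
  let ?b1 = "\<lambda>j. if j < n then b0 e j else 0" and ?b2 = "\<lambda>j. if j = k then b else 0"
  have 1: "f (Z \<omega> - m) (\<lambda>j. noise_increment l j \<omega>) \<bullet> e = scalar_functional l (Suc k) (a0 e) ?b1 \<omega>" for \<omega>
  proof -
    have "(\<Sum>j<n. noise_increment l j \<omega> \<bullet> b0 e j) = (\<Sum>j<Suc k. noise_increment l j \<omega> \<bullet> ?b1 j)"
      using f(3) by (intro sum.mono_neutral_cong_left) auto
    then show ?thesis using fun_cong[OF ab, of \<omega> l e] by (simp add: scalar_functional_def)
  qed
  have 2: "noise_increment l k \<omega> \<bullet> b = scalar_functional l (Suc k) 0 ?b2 \<omega>" for \<omega>
    by (simp add: scalar_functional_def if_distrib[of "\<lambda>x. _ \<bullet> x"] cong: if_cong)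
  have 3: "(\<Sum>j<Suc k. ?b1 j \<bullet> ?b2 j) = 0" using f(3) by (intro sum.neutral) auto
  show ?thesis unfolding 1 2 stein_system_functional(2) 3 by simp
qed

text \<open>The scheme started from the centred initial state and driven by the noise of the model, without
  observations. The signal minus the scheme driven by the true observations follows the same recursion, up to
  the discretization error of the signal.\<close>

definition filter_error :: "real^'x^'x \<Rightarrow> real^'x^'y \<Rightarrow> real^'x^'x \<Rightarrow> real^'y^'y \<Rightarrow> nat \<Rightarrow> nat \<Rightarrow> 'w \<Rightarrow> real^'x" where
  "filter_error A C R1h R2h l k \<omega> = euler A C R1h R2h P l (Z \<omega> - m) (\<lambda>r. V r \<omega>) (\<lambda>r. W r \<omega>) (\<lambda>_. 0) k"

end

text \<open>The Euler scheme of the pair of signal and observation. Its observation component approximates the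
  observation path by exact linear functionals of the inputs that also drive the filter error.\<close>

definition model_scheme ::
  "real^'x^'x \<Rightarrow> real^'x^'y \<Rightarrow> real^'x^'x \<Rightarrow> real^'y^'y \<Rightarrow> nat \<Rightarrow> real^'x \<Rightarrow> (nat \<Rightarrow> (real^'y) \<times> (real^'x)) \<Rightarrow> nat \<Rightarrow>
   (real^'x) \<times> (real^'y)" where
  "model_scheme A C R1h R2h l z u k =
     linear_recursion (\<lambda>_ s. (A *v fst s, C *v fst s)) (\<lambda>_ u. (R1h *v snd u, R2h *v fst u)) (step_size l) (z, 0) u k"

lemma model_scheme_simps:
  "model_scheme A C R1h R2h l z u 0 = (z, 0)"
  "fst (model_scheme A C R1h R2h l z u (Suc k)) = fst (model_scheme A C R1h R2h l z u k)
     + step_size l *\<^sub>R (A *v fst (model_scheme A C R1h R2h l z u k)) + R1h *v snd (u k)"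
  "snd (model_scheme A C R1h R2h l z u (Suc k)) = snd (model_scheme A C R1h R2h l z u k)
     + step_size l *\<^sub>R (C *v fst (model_scheme A C R1h R2h l z u k)) + R2h *v fst (u k)"
  by (simp_all add: model_scheme_def)

lemma model_scheme_add:
  "model_scheme A C R1h R2h l (z + z') (\<lambda>j. u j + u' j) k = model_scheme A C R1h R2h l z u k + model_scheme A C R1h R2h l z' u' k"
proof -
  have lin: "linear (\<lambda>s::(real^'a) \<times> (real^'b). (A *v fst s, C *v fst s))" "linear (\<lambda>u::(real^'b) \<times> (real^'a). (R1h *v snd u, R2h *v fst u))"
    by (auto intro!: linearI simp: algebra_simps)
  have "(z + z', 0 :: real^'b) = (z, 0) + (z', 0)" by simp
  then show ?thesis unfolding model_scheme_def
    using linear_recursion_add[OF lin] by metis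
qed

lemma model_scheme_functional:
  fixes A :: "real^'x^'x" and C :: "real^'x^'y" and R1h :: "real^'x^'x" and R2h :: "real^'y^'y"
  assumes T: "0 \<le> T"
  obtains B where "1 \<le> B" "\<And>l n. real n * step_size l \<le> T \<Longrightarrow>
       input_functional B n (\<lambda>z u. model_scheme A C R1h R2h l z u n)"
proof -
  let ?F = "\<lambda>s::(real^'x) \<times> (real^'y). (A *v fst s, C *v fst s)" and ?G = "\<lambda>u::(real^'y) \<times> (real^'x). (R1h *v snd u, R2h *v fst u)"
  have lin: "linear ?F" "linear ?G"
    by (auto intro!: linearI simp: algebra_simps)
  obtain b1 where b1: "1 \<le> b1" "linear_bounded_by b1 ?F" using linear_bounded_by_exists[OF lin(1)] by blast
  obtain b2 where b2: "1 \<le> b2" "linear_bounded_by b2 ?G" using linear_bounded_by_exists[OF lin(2)] by blast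
  define b where "b = max b1 b2"
  have b: "1 \<le> b" "linear_bounded_by b ?F" "linear_bounded_by b ?G"
    using b1 b2 by (auto simp: b_def elim: linear_bounded_by_mono)
  show ?thesis
  proof (rule that[of "b * exp (b * T)"])
    show B: "1 \<le> b * exp (b * T)" using mult_mono[of 1 b 1 "exp (b * T)"] b T by simp
    fix l n assume n: "real n * step_size l \<le> T"
    have I: "linear_bounded_by 1 (\<lambda>z::real^'x. (z, 0::real^'y))" by (auto simp: linear_bounded_by_def intro!: linearI)
    have "input_functional (b * (1 + b * step_size l) ^ n) n (\<lambda>z u. linear_recursion (\<lambda>_. ?F) (\<lambda>_. ?G) (step_size l) z u n)"
      using b step_size_pos[of l] by (intro linear_recursion_bounded) auto
    moreover have "b * (1 + b * step_size l) ^ n \<le> b * exp (b * T)"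
      using b step_size_pos[of l] n by (intro mult_left_mono power_one_plus_le_exp) auto
    ultimately have "input_functional (b * exp (b * T)) n (\<lambda>z u. linear_recursion (\<lambda>_. ?F) (\<lambda>_. ?G) (step_size l) z u n)"
      by (rule input_functional_mono)
    from input_functional_precompose[OF this I linear_bounded_by_id[OF order_refl]] B
    show "input_functional (b * exp (b * T)) n (\<lambda>z u. model_scheme A C R1h R2h l z u n)"
      unfolding model_scheme_def by simp
  qed
qed

text \<open>This is the recursion of the covariance of two Euler schemes, as in \<open>cross_covariance_step\<close>. With
  \<open>B = 0\<close> it describes the covariance with a random vector that does not change any more.\<close>

lemma matrix_recursion_bound:
  fixes q :: "nat \<Rightarrow> real^'n^'m" and H :: "nat \<Rightarrow> real^'m^'m" and B :: "real^'n^'n"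
  assumes cL: "0 \<le> cL" "\<And>(A::real^'m^'m) (B::real^'n^'m). norm (A ** B) \<le> cL * norm A * norm B"
    and cR: "0 \<le> cR" "\<And>(A::real^'n^'m) (B::real^'n^'n). norm (A ** B) \<le> cR * norm A * norm B"
    and step: "\<And>k. k < n \<Longrightarrow> q (Suc k) = q k + d *\<^sub>R (q k ** B) + d *\<^sub>R (H k ** q k) + d\<^sup>2 *\<^sub>R (H k ** (q k ** B)) + \<rho> k"
    and \<rho>: "\<And>k. k < n \<Longrightarrow> norm (\<rho> k) \<le> d * r" and H: "\<And>k. norm (H k) \<le> h"
    and d: "0 \<le> d" "d \<le> 1" "0 \<le> r" "0 \<le> q0" "norm (q 0) \<le> q0" and n: "real n * d \<le> T" "k \<le> n"
  shows "norm (q k) \<le> (q0 + T * r) * exp ((cR * norm B + cL * h + cL * h * cR * norm B) * T)"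
proof (rule discrete_gronwall[where q = q and n = n and d = d and r = r and k = k])
  have h: "0 \<le> h" using H[of 0] norm_ge_zero order_trans by blast
  then show "0 \<le> cR * norm B + cL * h + cL * h * cR * norm B" using cL cR by simp
  fix k assume k: "k < n"
  have 1: "norm (q k ** B) \<le> cR * norm B * norm (q k)" using cR(2)[of "q k" B] by (simp add: mult_ac)
  have Hq: "norm (H k ** v) \<le> cL * h * norm v" for v :: "real^'n^'m"
    using cL(2)[of "H k" v] mult_right_mono[OF mult_left_mono[OF H[of k] cL(1)], of "norm v"] by simp
  have 3: "norm (H k ** (q k ** B)) \<le> cL * h * (cR * norm B * norm (q k))"
    by (rule order_trans[OF Hq mult_left_mono[OF 1]]) (use cL(1) h in simp)
  have "norm (q (Suc k)) \<le> norm (q k) + norm (d *\<^sub>R (q k ** B)) + norm (d *\<^sub>R (H k ** q k)) + norm (d\<^sup>2 *\<^sub>R (H k ** (q k ** B))) + norm (\<rho> k)"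
    unfolding step[OF k] by (intro norm_triangle_le add_right_mono order_refl)
  also have "\<dots> \<le> norm (q k) + d * (cR * norm B * norm (q k)) + d * (cL * h * norm (q k)) + d * (cL * h * (cR * norm B * norm (q k))) + d * r"
  proof (intro add_mono order_refl \<rho>[OF k])
    show "norm (d *\<^sub>R (q k ** B)) \<le> d * (cR * norm B * norm (q k))" using mult_left_mono[OF 1 d(1)] d(1) by simp
    show "norm (d *\<^sub>R (H k ** q k)) \<le> d * (cL * h * norm (q k))" using mult_left_mono[OF Hq[of "q k"] d(1)] d(1) by simp
    have "d\<^sup>2 \<le> d" using d(1,2) mult_left_mono[of d 1 d] by (simp add: power2_eq_square)
    then have "d\<^sup>2 * norm (H k ** (q k ** B)) \<le> d * (cL * h * (cR * norm B * norm (q k)))"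
      using 3 d(1) by (intro mult_mono) auto
    then show "norm (d\<^sup>2 *\<^sub>R (H k ** (q k ** B))) \<le> d * (cL * h * (cR * norm B * norm (q k)))" by simp
  qed
  also have "\<dots> = (1 + (cR * norm B + cL * h + cL * h * cR * norm B) * d) * norm (q k) + d * r"
    by (simp add: algebra_simps)
  finally show "norm (q (Suc k)) \<le> (1 + (cR * norm B + cL * h + cL * h * cR * norm B) * d) * norm (q k) + d * r" .
qed (use d n in auto)

context gaussian_noise
begin

lemma noise_increment_square_integrable:
  "square_integrable M (\<lambda>\<omega>. fst (noise_increment l k \<omega>))" "square_integrable M (\<lambda>\<omega>. snd (noise_increment l k \<omega>))"
proof -
  have "integrable M (\<lambda>\<omega>. (noise_increment l k \<omega> \<bullet> b)\<^sup>2)" for b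
    using stein_systemD1[OF stein_system_increment(1)[of l k]] unfolding square_integrable_def by auto
  moreover have "(norm (noise_increment l k \<omega>))\<^sup>2 = (\<Sum>b\<in>Basis. (noise_increment l k \<omega> \<bullet> b)\<^sup>2)" for \<omega>
    unfolding power2_norm_eq_inner by (subst euclidean_inner) (simp add: power2_eq_square)
  ultimately have "square_integrable M (noise_increment l k)"
    by (simp add: square_integrable_def)
  then show "square_integrable M (\<lambda>\<omega>. fst (noise_increment l k \<omega>))" "square_integrable M (\<lambda>\<omega>. snd (noise_increment l k \<omega>))"
    by (rule square_integrable_linear[OF linear_fst], rule square_integrable_linear[OF linear_snd])
qed

lemma inner_fst_snd_axis:
  fixes u :: "(real^'y) \<times> (real^'x)"
  shows "fst u $ i = u \<bullet> (axis i 1, 0)" "snd u $ j = u \<bullet> (0, axis j 1)"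
  by (cases u; simp add: inner_axis)+

lemma noise_increment_covariance:
  "cross_covariance M (\<lambda>\<omega>. fst (noise_increment l k \<omega>)) (\<lambda>\<omega>. fst (noise_increment l k \<omega>)) = step_size l *\<^sub>R mat 1"
  "cross_covariance M (\<lambda>\<omega>. snd (noise_increment l k \<omega>)) (\<lambda>\<omega>. snd (noise_increment l k \<omega>)) = step_size l *\<^sub>R mat 1"
  "cross_covariance M (\<lambda>\<omega>. snd (noise_increment l k \<omega>)) (\<lambda>\<omega>. fst (noise_increment l k \<omega>)) = 0"
  "cross_covariance M (\<lambda>\<omega>. fst (noise_increment l k \<omega>)) (\<lambda>\<omega>. snd (noise_increment l k \<omega>)) = 0"
  unfolding cross_covariance_def vec_eq_iff inner_fst_snd_axis
  by (simp_all add: stein_system_increment(2) mat_def inner_axis_axis)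

lemma functional_increment_covariance:
  fixes f :: "real^'x \<Rightarrow> (nat \<Rightarrow> (real^'y) \<times> (real^'x)) \<Rightarrow> real^'k" and l :: nat
  assumes f: "input_functional c n f" "0 \<le> c" "n \<le> k"
  defines "g \<equiv> \<lambda>\<omega>. f (Z \<omega> - m) (\<lambda>j. noise_increment l j \<omega>)"
  shows "cross_covariance M g (\<lambda>\<omega>. fst (noise_increment l k \<omega>)) = 0" "cross_covariance M g (\<lambda>\<omega>. snd (noise_increment l k \<omega>)) = 0"
    "cross_covariance M (\<lambda>\<omega>. fst (noise_increment l k \<omega>)) g = 0" "cross_covariance M (\<lambda>\<omega>. snd (noise_increment l k \<omega>)) g = 0"
proof -
  have i: "g \<omega> $ i = g \<omega> \<bullet> axis i 1" for \<omega> i by (simp add: inner_axis)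
  have u: "expectation (\<lambda>\<omega>. (g \<omega> \<bullet> e) * (noise_increment l k \<omega> \<bullet> b)) = 0" for e b
    unfolding g_def by (rule functional_uncorrelated[OF f])
  have u': "expectation (\<lambda>\<omega>. (noise_increment l k \<omega> \<bullet> b) * (g \<omega> \<bullet> e)) = 0" for e b
    using u[of e b] by (simp add: mult.commute)
  show "cross_covariance M g (\<lambda>\<omega>. fst (noise_increment l k \<omega>)) = 0" "cross_covariance M g (\<lambda>\<omega>. snd (noise_increment l k \<omega>)) = 0"
    unfolding cross_covariance_def vec_eq_iff inner_fst_snd_axis by (simp_all add: i u)
  show "cross_covariance M (\<lambda>\<omega>. fst (noise_increment l k \<omega>)) g = 0" "cross_covariance M (\<lambda>\<omega>. snd (noise_increment l k \<omega>)) g = 0"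
    unfolding cross_covariance_def vec_eq_iff inner_fst_snd_axis by (simp_all add: i u')
qed

end

definition error_functional ::
  "real^'x^'x \<Rightarrow> real^'x^'y \<Rightarrow> real^'x^'x \<Rightarrow> real^'y^'y \<Rightarrow> real^'x^'x \<Rightarrow> nat \<Rightarrow> nat \<Rightarrow>
   real^'x \<Rightarrow> (nat \<Rightarrow> (real^'y) \<times> (real^'x)) \<Rightarrow> real^'x" where
  "error_functional A C R1h R2h P l n z u =
     euler_recursion A C R1h R2h P l z (\<lambda>j. (R1h *v snd (u j), - (R2h *v fst (u j)))) n"

lemma linear_noise_input:
  "linear (\<lambda>u::(real^'y) \<times> (real^'x). (R1h *v snd u, - (R2h *v fst u)))" for R1h :: "real^'x^'x" and R2h :: "real^'y^'y"
  by (auto intro!: linearI simp: algebra_simps)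

lemma error_functional_bounds:
  fixes A :: "real^'x^'x" and C :: "real^'x^'y" and R1h :: "real^'x^'x" and R2h :: "real^'y^'y"
  assumes "\<exists>K::real. \<forall>k l. \<forall>j1 j2. \<bar>riccati_rec A C R1h R2h P l k $ j1 $ j2\<bar> \<le> K" and T: "0 \<le> T"
  obtains B K where "1 \<le> B" "0 \<le> K"
    "\<And>l n. real n * step_size l \<le> T \<Longrightarrow> input_functional B n (error_functional A C R1h R2h P l n)"
    "\<And>l n. real n * step_size l \<le> T \<Longrightarrow>
       input_functional (K * step_size l) (2 * n)
         (\<lambda>z u. error_functional A C R1h R2h P (Suc l) (2 * n) z u
              - error_functional A C R1h R2h P l n z (\<lambda>j. u (2 * j) + u (2 * j + 1)))"
proof -
  let ?T = "\<lambda>u::(real^'y) \<times> (real^'x). (R1h *v snd u, - (R2h *v fst u))"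
  obtain B K where B: "1 \<le> B" and K: "0 \<le> K"
    and f: "\<And>l n. real n * step_size l \<le> T \<Longrightarrow> input_functional B n (\<lambda>z u. euler_recursion A C R1h R2h P l z u n)"
    and g: "\<And>l n. real n * step_size l \<le> T \<Longrightarrow> input_functional (K * step_size l) (2 * n)
         (\<lambda>z u. euler_recursion A C R1h R2h P (Suc l) z u (2 * n) - euler_recursion A C R1h R2h P l z (\<lambda>j. u (2 * j) + u (2 * j + 1)) n)"
    by (rule euler_functional[OF assms]) blast
  obtain t where t: "1 \<le> t" "linear_bounded_by t ?T" using linear_bounded_by_exists[OF linear_noise_input] by blast
  show ?thesis
  proof (rule that[of "B * t" "K * t"])
    show "1 \<le> B * t" using B t mult_mono[of 1 B 1 t] by simp
    show "0 \<le> K * t" using K t by simp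
    show "input_functional (B * t) n (error_functional A C R1h R2h P l n)" if "real n * step_size l \<le> T" for l n
      using input_functional_precompose[OF f[OF that] linear_bounded_by_id[OF t(1)] t(2)] B t
      unfolding error_functional_def by simp
    show "input_functional (K * t * step_size l) (2 * n)
         (\<lambda>z u. error_functional A C R1h R2h P (Suc l) (2 * n) z u
              - error_functional A C R1h R2h P l n z (\<lambda>j. u (2 * j) + u (2 * j + 1)))" if "real n * step_size l \<le> T" for l n
    proof -
      have s: "?T (u + v) = ?T u + ?T v" for u v by (simp add: algebra_simps)
      show ?thesis
        using input_functional_precompose[OF g[OF that] linear_bounded_by_id[OF t(1)] t(2)] K t step_size_pos[of l]
        unfolding error_functional_def s by (simp add: mult_ac)
    qed
  qed
qed

lemma (in gaussian_noise) filter_error_eq: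
  "filter_error A C R1h R2h l k \<omega> = error_functional A C R1h R2h P l k (Z \<omega> - m) (\<lambda>j. noise_increment l j \<omega>)"
proof -
  have "increment (\<lambda>_. 0) l j = (0::real^'y)" for j by (simp add: increment_def)
  then show ?thesis unfolding filter_error_def euler_eq_recursion error_functional_def
    by (simp add: noise_increment_def)
qed

context gaussian_noise
begin

text \<open>With the gain of the Riccati recursion, the covariance of the discretized filter error with the
  discretized signal satisfies that recursion up to \<open>O(d\<^sup>2)\<close> per step, hence stays \<open>O(d)\<close> close to its solution.
  Then the covariance of the error with the discretized observation picks up only \<open>O(d\<^sup>2)\<close> per step and is
  \<open>O(d)\<close> on bounded time intervals. This is the discrete form of the orthogonality that characterizes the
  Kalman gain.\<close>

lemma filter_error_observation_covariance:
  assumes bdd: "\<exists>K::real. \<forall>k l. \<forall>j1 j2. \<bar>riccati_rec A C R1h R2h P l k $ j1 $ j2\<bar> \<le> K" and T: "0 \<le> T"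
    and R1: "transpose R1h = R1h" and R2: "transpose R2h = R2h" "invertible R2h"
  obtains K where "0 \<le> K"
    "\<And>l n j. j \<le> n \<Longrightarrow> real n * step_size l \<le> T \<Longrightarrow>
       norm (cross_covariance M (filter_error A C R1h R2h l n)
         (\<lambda>\<omega>. snd (model_scheme A C R1h R2h l (Z \<omega> - m) (\<lambda>j. noise_increment l j \<omega>) j))) \<le> K * step_size l"
proof -
  let ?P = "riccati_rec A C R1h R2h P" and ?S = "S_matrix C R2h" and ?U = "gain A C R1h R2h P"
  let ?e = "filter_error A C R1h R2h"
  let ?s = "\<lambda>l k \<omega>. model_scheme A C R1h R2h l (Z \<omega> - m) (\<lambda>j. noise_increment l j \<omega>) k"
  let ?x = "\<lambda>l k \<omega>. fst (?s l k \<omega>)" and ?y = "\<lambda>l k \<omega>. snd (?s l k \<omega>)"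
  define H where "H l k = A - ?P l k ** ?S" for l k
  let ?dV = "\<lambda>l k \<omega>. fst (noise_increment l k \<omega>)" and ?dW = "\<lambda>l k \<omega>. snd (noise_increment l k \<omega>)"
  define N where "N l k \<omega> = R1h *v ?dW l k \<omega> + (- (?U l k ** R2h)) *v ?dV l k \<omega>" for l k \<omega>
  obtain B1 K1 where B1: "1 \<le> B1" "0 \<le> K1"
      "\<And>l n. real n * step_size l \<le> T \<Longrightarrow> input_functional B1 n (error_functional A C R1h R2h P l n)"
      "\<And>l n. real n * step_size l \<le> T \<Longrightarrow> input_functional (K1 * step_size l) (2 * n)
         (\<lambda>z u. error_functional A C R1h R2h P (Suc l) (2 * n) z u
              - error_functional A C R1h R2h P l n z (\<lambda>j. u (2 * j) + u (2 * j + 1)))"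
    by (rule error_functional_bounds[OF bdd T]) blast
  obtain B2 where B2: "1 \<le> B2" "\<And>l n. real n * step_size l \<le> T \<Longrightarrow> input_functional B2 n (\<lambda>z u. model_scheme A C R1h R2h l z u n)"
    by (rule model_scheme_functional[OF T]) blast
  have l1: "linear_bounded_by 1 (fst :: (real^'x) \<times> (real^'y) \<Rightarrow> _)" "linear_bounded_by 1 (snd :: (real^'x) \<times> (real^'y) \<Rightarrow> _)"
    by (auto simp: linear_bounded_by_def linear_fst norm_fst_le linear_snd norm_snd_le)
  have fx: "input_functional B2 k (\<lambda>z u. fst (model_scheme A C R1h R2h l z u k))"
    and fy: "input_functional B2 k (\<lambda>z u. snd (model_scheme A C R1h R2h l z u k))"
    if "real k * step_size l \<le> T" for l k
    using input_functional_comp[OF B2(2)[OF that] l1(1)] input_functional_comp[OF B2(2)[OF that] l1(2)] by simp_all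
  obtain p where p: "0 \<le> p" "\<And>x. x \<bullet> (P *v x) \<le> p * (norm x)\<^sup>2" using quadratic_form_bound by blast
  have sqe: "square_integrable M (?e l k)" if "real k * step_size l \<le> T" for l k
    using mean_square_functional(3)[OF B1(3)[OF that] _ p(2,1)] B1(1) by (simp add: filter_error_eq[abs_def])
  have sqx: "square_integrable M (?x l k)" and sqy: "square_integrable M (?y l k)" if "real k * step_size l \<le> T" for l k
    using mean_square_functional(3)[OF fx[OF that] _ p(2,1)] mean_square_functional(3)[OF fy[OF that] _ p(2,1)] B2(1) by simp_all
  have sqm: "square_integrable M (\<lambda>\<omega>. Q *v f \<omega>)" if "square_integrable M f" for Q :: "real^'k^'n" and f
    using square_integrable_linear[OF _ that, of "(*v) Q"] by simp
  note sqd = noise_increment_square_integrable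
  have sqN: "square_integrable M (N l k)" "square_integrable M (\<lambda>\<omega>. R1h *v ?dW l k \<omega>)" "square_integrable M (\<lambda>\<omega>. R2h *v ?dV l k \<omega>)"
     "square_integrable M (\<lambda>\<omega>. (- (?U l k ** R2h)) *v ?dV l k \<omega>)" for l k
    unfolding N_def by (intro square_integrable_add sqm sqd)+
  have ce: "cross_covariance M (?e l k) (?dV l k) = 0" "cross_covariance M (?e l k) (?dW l k) = 0" if "real k * step_size l \<le> T" for l k
    using functional_increment_covariance(1,2)[OF B1(3)[OF that] _ order_refl] B1(1) by (simp_all add: filter_error_eq[abs_def])
  have cN: "cross_covariance M (N l k) (\<lambda>\<omega>. f (Z \<omega> - m) (\<lambda>j. noise_increment l j \<omega>)) = 0"
    if "input_functional B2 n f" "n \<le> k" "square_integrable M (\<lambda>\<omega>. f (Z \<omega> - m) (\<lambda>j. noise_increment l j \<omega>))" for l k n f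
  proof -
    have z: "cross_covariance M (?dV l k) (\<lambda>\<omega>. f (Z \<omega> - m) (\<lambda>j. noise_increment l j \<omega>)) = 0"
      "cross_covariance M (?dW l k) (\<lambda>\<omega>. f (Z \<omega> - m) (\<lambda>j. noise_increment l j \<omega>)) = 0"
      using functional_increment_covariance(3,4)[OF that(1) _ that(2)] B2(1) by simp_all
    show ?thesis
      unfolding N_def cross_covariance_add(1)[OF sqN(2,4) that(3)] cross_covariance_mult(1)[OF sqd(2) that(3)] cross_covariance_mult(1)[OF sqd(1) that(3)] z
      by (simp add: matrix_matrix_mult_def vec_eq_iff)
  qed
  have step: "?e l (Suc k) = (\<lambda>\<omega>. ?e l k \<omega> + step_size l *\<^sub>R (H l k *v ?e l k \<omega>) + N l k \<omega>)" for l k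
  proof -
    have nm: "(- Q) *v v = - (Q *v v)" for Q :: "real^'y^'x" and v
      by (simp add: matrix_vector_mult_def vec_eq_iff sum_negf)
    show ?thesis unfolding filter_error_eq[abs_def] error_functional_def N_def H_def
      by (simp add: fun_eq_iff euler_drift_def euler_input_def nm matrix_vector_mul_assoc[symmetric] linear_neg)
  qed
  define Q where "Q l k = cross_covariance M (?e l k) (?x l k)" for l k
  define D where "D l k = cross_covariance M (?e l k) (?y l k)" for l k
  have cNN: "cross_covariance M (N l k) (\<lambda>\<omega>. R1h *v ?dW l k \<omega>) = step_size l *\<^sub>R (R1h ** R1h)"
    "cross_covariance M (N l k) (\<lambda>\<omega>. R2h *v ?dV l k \<omega>) = - (step_size l *\<^sub>R (?P l k ** transpose C))" for l k
  proof -
    note b = bounded_bilinear_matrix_mult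
    have Winv: "matrix_inv (R2h ** R2h) ** (R2h ** R2h) = mat 1"
      using someI_ex[OF invertible_mult[OF R2(2) R2(2), unfolded invertible_def]] by (simp add: matrix_inv_def)
    have s: "a ** (c *\<^sub>R B) = c *\<^sub>R (a ** B)" "(c *\<^sub>R a) ** B = c *\<^sub>R (a ** B)" "(- a) ** B = - (a ** B)" "a ** (0 :: real^'h^'g) = 0"
      "(0 :: real^'g^'k) ** B = 0"
      for a :: "real^'g^'k" and B :: "real^'h^'g" and c
      using bounded_bilinear.scaleR_right[OF b] bounded_bilinear.scaleR_left[OF b] bounded_bilinear.minus_left[OF b]
        bounded_bilinear.zero_right[OF b] bounded_bilinear.zero_left[OF b] by auto
    (* The gain inverts the covariance of the observation noise, which yields P C^T as in the drift term. *)
    have UR: "?U l k ** R2h ** R2h = ?P l k ** transpose C"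
      unfolding gain_def using Winv by (simp add: matrix_mul_assoc[symmetric])
    show "cross_covariance M (N l k) (\<lambda>\<omega>. R1h *v ?dW l k \<omega>) = step_size l *\<^sub>R (R1h ** R1h)"
      unfolding N_def
      by (simp add: cross_covariance_add cross_covariance_mult sqN sqm sqd noise_increment_covariance s R1)
    show "cross_covariance M (N l k) (\<lambda>\<omega>. R2h *v ?dV l k \<omega>) = - (step_size l *\<^sub>R (?P l k ** transpose C))"
      unfolding N_def
      by (simp add: cross_covariance_add cross_covariance_mult sqN sqm sqd noise_increment_covariance s R2 UR)
  qed
  have c0: "cross_covariance M (?e l k) (\<lambda>\<omega>. R1h *v ?dW l k \<omega>) = 0" "cross_covariance M (?e l k) (\<lambda>\<omega>. R2h *v ?dV l k \<omega>) = 0"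
    if "real k * step_size l \<le> T" for l k
    using ce[OF that] by (simp_all add: cross_covariance_mult sqe[OF that] sqd matrix_matrix_mult_def vec_eq_iff)
  have Qstep: "Q l (Suc k) = Q l k + step_size l *\<^sub>R (Q l k ** transpose A) + step_size l *\<^sub>R (H l k ** Q l k)
      + (step_size l)\<^sup>2 *\<^sub>R (H l k ** (Q l k ** transpose A)) + step_size l *\<^sub>R (R1h ** R1h)" if k: "real k * step_size l \<le> T" for l k
    unfolding Q_def step model_scheme_simps(2)
      cross_covariance_step[OF sqe[OF k] sqx[OF k] sqx[OF k] sqN(1) sqN(2) c0(1)[OF k]
        cN[OF fx[OF k] order_refl sqx[OF k]] cN[OF fx[OF k] order_refl sqx[OF k]]] cNN ..
  have Dstep: "D l (Suc k) = D l k + step_size l *\<^sub>R (Q l k ** transpose C) + step_size l *\<^sub>R (H l k ** D l k)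
      + (step_size l)\<^sup>2 *\<^sub>R (H l k ** (Q l k ** transpose C)) + - (step_size l *\<^sub>R (?P l k ** transpose C))" if k: "real k * step_size l \<le> T" for l k
    unfolding Q_def D_def step model_scheme_simps(3)
      cross_covariance_step[OF sqe[OF k] sqx[OF k] sqy[OF k] sqN(1) sqN(3) c0(2)[OF k]
        cN[OF fx[OF k] order_refl sqx[OF k]] cN[OF fy[OF k] order_refl sqy[OF k]]] cNN ..
  have Estep: "cross_covariance M (?e l (Suc k)) (?y l j) = cross_covariance M (?e l k) (?y l j)
      + step_size l *\<^sub>R (H l k ** cross_covariance M (?e l k) (?y l j))"
    if k: "real k * step_size l \<le> T" "j \<le> k" for l k j
  proof -
    have j: "real j * step_size l \<le> T"
      using k(2) less_imp_le[OF step_size_pos[of l]] by (intro order_trans[OF mult_right_mono k(1)]) auto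
    have He: "square_integrable M (\<lambda>\<omega>. step_size l *\<^sub>R (H l k *v ?e l k \<omega>))"
      using square_integrable_linear[OF _ sqm[OF sqe[OF k(1)], of "H l k"], of "\<lambda>x. step_size l *\<^sub>R x"] by (simp add: linear_iff scaleR_add_right)
    show ?thesis unfolding step
      by (simp add: cross_covariance_add square_integrable_add sqe[OF k(1)] sqm He sqN(1) sqy[OF j]
          cross_covariance_scaleR cross_covariance_mult cN[OF fy[OF j] k(2) sqy[OF j]])
  qed
  have Q0: "Q l 0 = P" for l
  proof -
    have "x $ i = x \<bullet> axis i 1" for x :: "real^'x" and i by (simp add: inner_axis)
    then show ?thesis
      unfolding Q_def cross_covariance_def filter_error_def
      by (simp add: model_scheme_simps stein_system_start(2) vec_eq_iff)
        (simp add: inner_axis matrix_vector_mul_component inner_commute[of "axis _ _"] row_def)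
  qed
  have D0: "D l 0 = 0" for l
    unfolding D_def cross_covariance_def by (simp add: model_scheme_simps vec_eq_iff)
  obtain r K0 where r: "0 \<le> r" "0 \<le> K0" "\<And>l k. norm (?P l k) \<le> r"
    and "\<And>l k n. k < 2 * n \<Longrightarrow> real n * step_size l \<le> T \<Longrightarrow> norm (?P (Suc l) k - ?P l (k div 2)) \<le> K0 * step_size l"
    by (rule riccati_rec_refine[OF bdd]) blast
  obtain c1 where c1: "0 \<le> c1" "\<And>(A::real^'x^'x) (B::real^'x^'x). norm (A ** B) \<le> c1 * norm A * norm B"
    using matrix_mult_norm_bound by blast
  obtain c2 where c2: "0 \<le> c2" "\<And>(A::real^'x^'x) (B::real^'y^'x). norm (A ** B) \<le> c2 * norm A * norm B"
    using matrix_mult_norm_bound by blast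
  obtain c3 where c3: "0 \<le> c3" "\<And>(A::real^'y^'x) (B::real^'y^'y). norm (A ** B) \<le> c3 * norm A * norm B"
    using matrix_mult_norm_bound by blast
  have m1: "norm (A ** B) \<le> c1 * a * b" if "norm A \<le> a" "norm B \<le> b" for A B :: "real^'x^'x" and a b
  proof -
    have "0 \<le> a" using that(1) norm_ge_zero order_trans by blast
    then have "c1 * norm A * norm B \<le> c1 * a * b" using that c1(1) by (intro mult_mono mult_left_mono) auto
    then show ?thesis using c1(2)[of A B] by linarith
  qed
  have m2: "norm (A ** B) \<le> c2 * a * b" if "norm A \<le> a" "norm B \<le> b" for A :: "real^'x^'x" and B :: "real^'y^'x" and a b
  proof -
    have "0 \<le> a" using that(1) norm_ge_zero order_trans by blast
    then have "c2 * norm A * norm B \<le> c2 * a * b" using that c2(1) by (intro mult_mono mult_left_mono) auto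
    then show ?thesis using c2(2)[of A B] by linarith
  qed
  define h where "h = norm A + c1 * r * norm ?S"
  have h: "norm (H l k) \<le> h" for l k
    unfolding H_def h_def using norm_triangle_ineq4[of A "?P l k ** ?S"] m1[OF r(3)[of l k], of ?S "norm ?S"] by simp
  have h0: "0 \<le> h" using c1 r by (simp add: h_def)
  define w where "w = c1 * h * (c1 * r * (c1 * norm ?S * r))"
  have w: "norm (H l k ** (?P l k ** (?S ** ?P l k))) \<le> w" for l k
    unfolding w_def by (intro m1 h r order_refl)
  have w0: "0 \<le> w" using c1 h0 r by (simp add: w_def)
  define kq where "kq = (0 + T * w) * exp ((c1 * norm (transpose A) + c1 * h + c1 * h * c1 * norm (transpose A)) * T)"
  have kq: "0 \<le> kq" using T w0 by (simp add: kq_def)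
  note bil = bounded_bilinear_matrix_mult
  note bils = bounded_bilinear.add_left[OF bil] bounded_bilinear.add_right[OF bil] bounded_bilinear.diff_left[OF bil]
    bounded_bilinear.diff_right[OF bil] bounded_bilinear.scaleR_left[OF bil] bounded_bilinear.scaleR_right[OF bil]
  have grid: "real k * step_size l \<le> T" if "k \<le> n" "real n * step_size l \<le> T" for k n l
    using that(1) less_imp_le[OF step_size_pos[of l]] by (intro order_trans[OF mult_right_mono that(2)]) auto
  (* Q and the Riccati recursion satisfy the same recursion up to the term d^2 H P S P. *)
  have Qb: "norm (Q l k - ?P l k) \<le> kq * step_size l" if n: "real k * step_size l \<le> T" for l k
  proof -
    let ?d = "step_size l"
    have d: "0 \<le> ?d" "?d \<le> 1" using step_size_pos[of l] step_size_le_1[of l] by auto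
    have "norm (Q l k - ?P l k) \<le> (0 + T * (?d * w)) * exp ((c1 * norm (transpose A) + c1 * h + c1 * h * c1 * norm (transpose A)) * T)"
    proof (rule matrix_recursion_bound[OF c1 c1, where H = "H l" and \<rho> = "\<lambda>k. ?d\<^sup>2 *\<^sub>R (H l k ** (?P l k ** (?S ** ?P l k)))" and n = k and d = ?d])
      fix i assume "i < k"
      then have i: "real i * ?d \<le> T" by (rule grid[OF less_imp_le n])
      show "Q l (Suc i) - ?P l (Suc i) = (Q l i - ?P l i) + ?d *\<^sub>R ((Q l i - ?P l i) ** transpose A)
          + ?d *\<^sub>R (H l i ** (Q l i - ?P l i)) + ?d\<^sup>2 *\<^sub>R (H l i ** ((Q l i - ?P l i) ** transpose A))
          + ?d\<^sup>2 *\<^sub>R (H l i ** (?P l i ** (?S ** ?P l i)))"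
        unfolding Qstep[OF i]
        by (simp add: Let_def Ricc_def SRicc_def H_def bils matrix_mul_assoc scaleR_add_right scaleR_diff_right algebra_simps)
      show "norm (?d\<^sup>2 *\<^sub>R (H l i ** (?P l i ** (?S ** ?P l i)))) \<le> ?d * (?d * w)"
        using mult_left_mono[OF w[of l i], of "?d\<^sup>2"] by (simp add: power2_eq_square mult_ac)
    qed (use h d w0 n Q0 in auto)
    then show ?thesis by (simp add: kq_def mult_ac)
  qed
  define v where "v = c2 * kq * norm (transpose C) + c2 * h * (c2 * (r + kq) * norm (transpose C))"
  have v0: "0 \<le> v" using c2 kq h0 r by (simp add: v_def)
  define kd where "kd = (0 + T * v) * exp ((c3 * norm (0 :: real^'y^'y) + c2 * h + c2 * h * c3 * norm (0 :: real^'y^'y)) * T)"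
  have kd: "0 \<le> kd" using T v0 by (simp add: kd_def)
  (* The drift contributes Q C^T and the noise - P C^T, so the sum is O(d) by the preceding bound. *)
  have Db: "norm (D l k) \<le> kd * step_size l" if n: "real k * step_size l \<le> T" for l k
  proof -
    let ?d = "step_size l"
    let ?\<rho> = "\<lambda>k. ?d *\<^sub>R ((Q l k - ?P l k) ** transpose C + ?d *\<^sub>R (H l k ** (Q l k ** transpose C)))"
    have d: "0 \<le> ?d" "?d \<le> 1" using step_size_pos[of l] step_size_le_1[of l] by auto
    have "norm (D l k) \<le> (0 + T * (?d * v)) * exp ((c3 * norm (0 :: real^'y^'y) + c2 * h + c2 * h * c3 * norm (0 :: real^'y^'y)) * T)"
    proof (rule matrix_recursion_bound[OF c2 c3, where H = "H l" and \<rho> = ?\<rho> and n = k and d = ?d])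
      fix i assume "i < k"
      then have i: "real i * ?d \<le> T" by (rule grid[OF less_imp_le n])
      show "D l (Suc i) = D l i + ?d *\<^sub>R (D l i ** 0) + ?d *\<^sub>R (H l i ** D l i) + ?d\<^sup>2 *\<^sub>R (H l i ** (D l i ** 0)) + ?\<rho> i"
        unfolding Dstep[OF i]
        by (simp add: bils scaleR_add_right scaleR_diff_right bounded_bilinear.zero_right[OF bil] power2_eq_square)
      have Qn: "norm (Q l i) \<le> r + kq"
      proof -
        have "kq * ?d \<le> kq" using kq d mult_left_mono[of ?d 1 kq] by simp
        then show ?thesis using Qb[OF i] r(3)[of l i] norm_triangle_sub[of "Q l i" "?P l i"] by linarith
      qed
      have "norm ((Q l i - ?P l i) ** transpose C + ?d *\<^sub>R (H l i ** (Q l i ** transpose C)))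
         \<le> c2 * (kq * ?d) * norm (transpose C) + ?d * (c2 * h * (c2 * (r + kq) * norm (transpose C)))"
      proof (rule norm_triangle_le, rule add_mono)
        show "norm ((Q l i - ?P l i) ** transpose C) \<le> c2 * (kq * ?d) * norm (transpose C)"
          by (intro m2 Qb[OF i] order_refl)
        have "norm (H l i ** (Q l i ** transpose C)) \<le> c2 * h * (c2 * (r + kq) * norm (transpose C))"
          by (intro m2 h Qn order_refl)
        then show "norm (?d *\<^sub>R (H l i ** (Q l i ** transpose C))) \<le> ?d * (c2 * h * (c2 * (r + kq) * norm (transpose C)))"
          using d(1) by (simp add: mult_left_mono)
      qed
      then have "norm ((Q l i - ?P l i) ** transpose C + ?d *\<^sub>R (H l i ** (Q l i ** transpose C))) \<le> ?d * v"
        by (simp add: v_def algebra_simps)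
      then show "norm (?\<rho> i) \<le> ?d * (?d * v)" using mult_left_mono[of _ "?d * v" ?d] d(1) by simp
    qed (use h d v0 n D0 in auto)
    then show ?thesis by (simp add: kd_def mult_ac)
  qed
  define ke where "ke = kd * exp ((c3 * norm (0 :: real^'y^'y) + c2 * h + c2 * h * c3 * norm (0 :: real^'y^'y)) * T)"
  (* After step j the observation is fixed and the covariance is only propagated by the drift of the error. *)
  have Eb: "norm (cross_covariance M (?e l n) (?y l j)) \<le> ke * step_size l" if j: "j \<le> n" and n: "real n * step_size l \<le> T" for l n j
  proof -
    let ?d = "step_size l"
    have d: "0 \<le> ?d" "?d \<le> 1" using step_size_pos[of l] step_size_le_1[of l] by auto
    have nj: "real (n - j) * ?d \<le> T" by (rule grid[OF diff_le_self n])
    have "norm (cross_covariance M (?e l (j + (n - j))) (?y l j))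
       \<le> (kd * ?d + T * 0) * exp ((c3 * norm (0 :: real^'y^'y) + c2 * h + c2 * h * c3 * norm (0 :: real^'y^'y)) * T)"
    proof (rule matrix_recursion_bound[OF c2 c3, where q = "\<lambda>i. cross_covariance M (?e l (j + i)) (?y l j)" and H = "\<lambda>i. H l (j + i)" and \<rho> = "\<lambda>_. 0" and d = ?d, OF _ _ h d _ _ _ nj order_refl])
      fix i assume "i < n - j"
      then have i: "real (j + i) * ?d \<le> T" by (intro grid[OF _ n]) simp
      show "cross_covariance M (?e l (j + Suc i)) (?y l j) = cross_covariance M (?e l (j + i)) (?y l j)
         + ?d *\<^sub>R (cross_covariance M (?e l (j + i)) (?y l j) ** 0) + ?d *\<^sub>R (H l (j + i) ** cross_covariance M (?e l (j + i)) (?y l j))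
         + ?d\<^sup>2 *\<^sub>R (H l (j + i) ** (cross_covariance M (?e l (j + i)) (?y l j) ** 0)) + 0"
        using Estep[OF i] by (simp add: bounded_bilinear.zero_right[OF bil])
    next
      show "norm (cross_covariance M (?e l (j + 0)) (?y l j)) \<le> kd * ?d"
        using Db[OF grid[OF j n]] by (simp add: D_def)
    qed (use kd d in auto)
    then show ?thesis using j by (simp add: ke_def mult_ac)
  qed
  have "0 \<le> ke" using kd by (simp add: ke_def)
  then show ?thesis using that[of ke] Eb by blast
qed

end

section \<open>Pathwise convergence of the Euler schemes\<close>

definition grid_index :: "real \<Rightarrow> nat \<Rightarrow> nat" where
  "grid_index s l = nat \<lfloor>s * 2 ^ l\<rfloor>"

lemma grid_index:
  assumes "0 \<le> s"
  shows "real (grid_index s l) * step_size l \<le> s" "s < real (grid_index s l) * step_size l + step_size l"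
proof -
  have 0: "0 \<le> s * 2 ^ l" using assms by simp
  have "real (grid_index s l) = of_int \<lfloor>s * 2 ^ l\<rfloor>" using 0 by (simp add: grid_index_def)
  then have "real (grid_index s l) \<le> s * 2 ^ l" "s * 2 ^ l < real (grid_index s l) + 1" by linarith+
  then show "real (grid_index s l) * step_size l \<le> s" "s < real (grid_index s l) * step_size l + step_size l"
    by (simp_all add: step_size_def field_simps)
qed

lemma grid_index_le: "s \<le> real t \<Longrightarrow> grid_index s l \<le> t * 2 ^ l"
proof -
  assume "s \<le> real t"
  then have "s * 2 ^ l \<le> real (t * 2 ^ l)" by simp
  then have "\<lfloor>s * 2 ^ l\<rfloor> \<le> int (t * 2 ^ l)" by linarith
  then show ?thesis unfolding grid_index_def by (simp only: nat_le_iff)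
qed

lemma grid_index_grid: "l \<le> n \<Longrightarrow> grid_index (real j * step_size l) n = j * 2 ^ (n - l)"
proof -
  assume "l \<le> n"
  then have "(2::real) ^ n = 2 ^ l * 2 ^ (n - l)" by (simp flip: power_add)
  then have "real j * step_size l * 2 ^ n = real (j * 2 ^ (n - l))" by (simp add: step_size_def)
  then show ?thesis by (simp only: grid_index_def floor_of_nat nat_int)
qed

lemma step_size_tendsto: "step_size \<longlonglongrightarrow> 0"
  using summable_LIMSEQ_zero[OF summable_step_size] .

lemma integral_matrix_vector:
  fixes Q :: "real^'n^'m"
  assumes "f integrable_on S"
  shows "integral S (\<lambda>s. Q *v f s) = Q *v integral S f"
  using integral_linear[OF assms, of "(*v) Q"] by (simp add: o_def matrix_vector_mul_bounded_linear)

text \<open>A single sample path. As the noise is additive, the equations make sense path by path.\<close>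

locale signal_path =
  fixes A :: "real^'x^'x" and C :: "real^'x^'y" and R1h :: "real^'x^'x" and R2h :: "real^'y^'y"
    and x w :: "real \<Rightarrow> real^'x" and y v :: "real \<Rightarrow> real^'y"
  assumes cont: "continuous_on {0..} x" "continuous_on {0..} v"
    and signal: "\<And>t. 0 \<le> t \<Longrightarrow> x t = x 0 + integral {0..t} (\<lambda>s. A *v x s) + R1h *v w t"
    and observation: "\<And>t. 0 \<le> t \<Longrightarrow> y t = integral {0..t} (\<lambda>s. C *v x s) + R2h *v v t"
begin

definition path_increment :: "nat \<Rightarrow> nat \<Rightarrow> (real^'y) \<times> (real^'x)" where
  "path_increment l j = (increment v l j, increment w l j)"

definition local_error :: "nat \<Rightarrow> nat \<Rightarrow> real^'x" where
  "local_error l k = integral {real k * step_size l..real (Suc k) * step_size l} (\<lambda>s. x s - x (real k * step_size l))"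

lemma integrable_x: "0 \<le> a \<Longrightarrow> x integrable_on {a..b}"
  by (intro integrable_continuous_interval continuous_on_subset[OF cont(1)]) auto

lemma integral_step:
  fixes Q :: "real^'x^'n"
  shows "integral {0..real (Suc k) * step_size l} (\<lambda>s. Q *v x s) - integral {0..real k * step_size l} (\<lambda>s. Q *v x s)
    = step_size l *\<^sub>R (Q *v x (real k * step_size l)) + Q *v local_error l k"
proof -
  let ?a = "real k * step_size l" and ?b = "real (Suc k) * step_size l"
  have ab: "0 \<le> ?a" "?a \<le> ?b" "?b - ?a = step_size l" using step_size_pos[of l] by (auto simp: algebra_simps)
  have i: "(\<lambda>s. Q *v x s) integrable_on {0..?b}"
    using integrable_linear[OF integrable_x[OF order_refl], of "(*v) Q"] by (simp add: o_def matrix_vector_mul_bounded_linear)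
  have "integral {0..?b} (\<lambda>s. Q *v x s) - integral {0..?a} (\<lambda>s. Q *v x s) = integral {?a..?b} (\<lambda>s. Q *v x s)"
    unfolding Henstock_Kurzweil_Integration.integral_combine[OF ab(1,2) i, symmetric] by simp
  also have "\<dots> = Q *v integral {?a..?b} x" by (rule integral_matrix_vector[OF integrable_x[OF ab(1)]])
  also have "integral {?a..?b} x = step_size l *\<^sub>R x ?a + local_error l k"
  proof -
    have "local_error l k = integral {?a..?b} x - integral {?a..?b} (\<lambda>_. x ?a)"
      unfolding local_error_def by (rule integral_diff[OF integrable_x[OF ab(1)] integrable_const_ivl])
    then show ?thesis using ab by simp
  qed
  finally show ?thesis by (simp add: matrix_vector_right_distrib matrix_vector_mult_scaleR)
qed

lemma signal_step:
  "x (real (Suc k) * step_size l) = x (real k * step_size l) + step_size l *\<^sub>R (A *v x (real k * step_size l))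
     + A *v local_error l k + R1h *v increment w l k"
  "y (real (Suc k) * step_size l) = y (real k * step_size l) + step_size l *\<^sub>R (C *v x (real k * step_size l))
     + C *v local_error l k + R2h *v increment v l k"
proof -
  have g: "0 \<le> real k * step_size l" "0 \<le> real (Suc k) * step_size l" using step_size_pos[of l] by auto
  show "x (real (Suc k) * step_size l) = x (real k * step_size l) + step_size l *\<^sub>R (A *v x (real k * step_size l))
     + A *v local_error l k + R1h *v increment w l k"
    using signal[OF g(1)] signal[OF g(2)] integral_step[where Q = A and k = k and l = l]
    by (simp add: increment_def matrix_vector_mult_diff_distrib algebra_simps del: of_nat_Suc)
  show "y (real (Suc k) * step_size l) = y (real k * step_size l) + step_size l *\<^sub>R (C *v x (real k * step_size l))
     + C *v local_error l k + R2h *v increment v l k"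
    using observation[OF g(1)] observation[OF g(2)] integral_step[where Q = C and k = k and l = l]
    by (simp add: increment_def matrix_vector_mult_diff_distrib algebra_simps del: of_nat_Suc)
qed

lemma local_error_small:
  assumes "0 < \<epsilon>" "0 \<le> T"
  shows "\<forall>\<^sub>F l in sequentially. \<forall>k. real (Suc k) * step_size l \<le> T \<longrightarrow> norm (local_error l k) \<le> step_size l * \<epsilon>"
proof -
  have "uniformly_continuous_on {0..T} x"
    by (intro compact_uniformly_continuous continuous_on_subset[OF cont(1)]) auto
  then obtain \<delta> where \<delta>: "0 < \<delta>" "\<And>s t. s \<in> {0..T} \<Longrightarrow> t \<in> {0..T} \<Longrightarrow> dist t s < \<delta> \<Longrightarrow> dist (x t) (x s) < \<epsilon>"
    using assms(1) unfolding uniformly_continuous_on_def by metis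
  have "\<forall>\<^sub>F l in sequentially. step_size l < \<delta>"
    using step_size_tendsto \<delta>(1) by (rule order_tendstoD)
  then show ?thesis
  proof eventually_elim
    fix l assume l: "step_size l < \<delta>"
    show "\<forall>k. real (Suc k) * step_size l \<le> T \<longrightarrow> norm (local_error l k) \<le> step_size l * \<epsilon>"
    proof (intro allI impI)
      fix k assume k: "real (Suc k) * step_size l \<le> T"
      let ?a = "real k * step_size l" and ?b = "real (Suc k) * step_size l"
      have ab: "0 \<le> ?a" "?a \<le> ?b" "?b - ?a = step_size l" using step_size_pos[of l] by (auto simp: algebra_simps)
      have "norm (local_error l k) \<le> \<epsilon> * (?b - ?a)"
        unfolding local_error_def
      proof (rule integral_bound[OF ab(2)])
        show "continuous_on {?a..?b} (\<lambda>s. x s - x ?a)"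
          by (intro continuous_intros continuous_on_subset[OF cont(1)]) (use ab in auto)
        fix s assume s: "s \<in> {?a..?b}"
        then have "dist s ?a < \<delta>" using ab(3) l by (simp add: dist_real_def)
        moreover have "0 \<le> s" using s ab(1) by (simp only: atLeastAtMost_iff) linarith
        ultimately show "norm (x s - x ?a) \<le> \<epsilon>"
          using \<delta>(2)[of ?a s] s ab k by (simp add: dist_norm less_imp_le)
      qed
      then show "norm (local_error l k) \<le> step_size l * \<epsilon>" using ab(3) by (simp add: mult.commute)
    qed
  qed
qed

text \<open>By uniform continuity of the path the local errors are \<open>o(d)\<close> uniformly on the grid, and the discrete
  Gronwall inequality sums them to \<open>o(1)\<close>.\<close>

lemma driven_recursion_small:
  fixes D :: "nat \<Rightarrow> nat \<Rightarrow> 's::real_normed_vector"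
  assumes T: "0 \<le> T" and b: "0 \<le> b" and D0: "\<And>l. D l 0 = 0"
    and step: "\<And>l k. norm (D l (Suc k)) \<le> (1 + b * step_size l) * norm (D l k) + b * norm (local_error l k)"
    and \<epsilon>: "0 < \<epsilon>"
  shows "\<forall>\<^sub>F l in sequentially. \<forall>k. real k * step_size l \<le> T \<longrightarrow> norm (D l k) \<le> \<epsilon>"
proof -
  define c where "c = T * b * exp (b * T) + 1"
  have c: "0 < c" using T b by (simp add: c_def add_nonneg_pos)
  have "0 < \<epsilon> / c" using \<epsilon> c by simp
  from local_error_small[OF this T] show ?thesis
  proof eventually_elim
    fix l assume l: "\<forall>k. real (Suc k) * step_size l \<le> T \<longrightarrow> norm (local_error l k) \<le> step_size l * (\<epsilon> / c)"
    show "\<forall>k. real k * step_size l \<le> T \<longrightarrow> norm (D l k) \<le> \<epsilon>"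
    proof (intro allI impI)
      fix k assume k: "real k * step_size l \<le> T"
      have "norm (D l k) \<le> (0 + T * (b * (\<epsilon> / c))) * exp (b * T)"
      proof (rule discrete_gronwall[where n = k and d = "step_size l"])
        fix i assume "i < k"
        then have "real (Suc i) * step_size l \<le> T"
          using less_imp_le[OF step_size_pos[of l]] by (intro order_trans[OF mult_right_mono k]) auto
        then have "norm (local_error l i) \<le> step_size l * (\<epsilon> / c)" using l by blast
        then have "b * norm (local_error l i) \<le> step_size l * (b * (\<epsilon> / c))"
          using mult_left_mono[OF _ b] by (metis mult.left_commute)
        then show "norm (D l (Suc i)) \<le> (1 + b * step_size l) * norm (D l i) + step_size l * (b * (\<epsilon> / c))"
          using step[of l i] by linarith
      qed (use D0 b \<epsilon> c k step_size_pos[of l] in auto)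
      also have "\<dots> = (T * b * exp (b * T)) / c * \<epsilon>" by simp
      also have "\<dots> \<le> 1 * \<epsilon>"
        using \<epsilon> c by (intro mult_right_mono) (auto simp: c_def divide_le_eq)
      finally show "norm (D l k) \<le> \<epsilon>" by simp
    qed
  qed
qed

lemma model_scheme_converges:
  assumes T: "0 \<le> T" and \<epsilon>: "0 < \<epsilon>" and y0: "y 0 = 0"
  shows "\<forall>\<^sub>F l in sequentially. \<forall>k. real k * step_size l \<le> T \<longrightarrow>
    norm ((x (real k * step_size l), y (real k * step_size l)) - model_scheme A C R1h R2h l (x 0) (path_increment l) k) \<le> \<epsilon>"
proof -
  let ?F = "\<lambda>s::(real^'x) \<times> (real^'y). (A *v fst s, C *v fst s)"
  have "linear ?F" by (auto intro!: linearI simp: algebra_simps)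
  then obtain b where b: "1 \<le> b" "linear_bounded_by b ?F" using linear_bounded_by_exists by blast
  show ?thesis
  proof (rule driven_recursion_small[OF T _ _ _ \<epsilon>, where b = b])
    fix l k
    let ?d = "\<lambda>k. (x (real k * step_size l), y (real k * step_size l)) - model_scheme A C R1h R2h l (x 0) (path_increment l) k"
    have eq: "?d (Suc k) = ?d k + step_size l *\<^sub>R ?F (?d k) + ?F (local_error l k, 0)"
      unfolding signal_step
      by (simp add: prod_eq_iff model_scheme_simps path_increment_def algebra_simps del: of_nat_Suc)
    have "norm (?d (Suc k)) \<le> norm (?d k) + step_size l * (b * norm (?d k)) + b * norm (local_error l k, 0 :: real^'y)"
      unfolding eq
    proof (intro norm_triangle_le add_mono order_refl)
      show "norm (step_size l *\<^sub>R ?F (?d k)) \<le> step_size l * (b * norm (?d k))"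
        using mult_left_mono[OF linear_bounded_byD(2)[OF b(2), of "?d k"] less_imp_le[OF step_size_pos[of l]]]
        by (simp only: norm_scaleR abs_of_pos[OF step_size_pos])
      show "norm (?F (local_error l k, 0)) \<le> b * norm (local_error l k, 0 :: real^'y)" by (rule linear_bounded_byD(2)[OF b(2)])
    qed
    then show "norm (?d (Suc k)) \<le> (1 + b * step_size l) * norm (?d k) + b * norm (local_error l k)"
      by (simp add: norm_Pair algebra_simps)
  qed (use b y0 in \<open>auto simp: model_scheme_simps\<close>)
qed

lemma observation_scheme_tendsto:
  assumes s: "0 \<le> s" and y0: "y 0 = 0"
  shows "(\<lambda>l. snd (model_scheme A C R1h R2h l (x 0) (path_increment l) (grid_index s l))) \<longlonglongrightarrow> y s"
proof -
  have gl: "(\<lambda>l. real (grid_index s l) * step_size l) \<longlonglongrightarrow> s"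
  proof (rule tendsto_sandwich[of "\<lambda>l. s - step_size l" _ _ "\<lambda>_. s"])
    show "(\<lambda>l. s - step_size l) \<longlonglongrightarrow> s" using tendsto_diff[OF tendsto_const step_size_tendsto, of s] by simp
    show "\<forall>\<^sub>F l in sequentially. s - step_size l \<le> real (grid_index s l) * step_size l"
      using grid_index(2)[OF s] by (intro always_eventually allI) (simp add: less_imp_le algebra_simps)
  qed (use grid_index(1)[OF s] in auto)
  have "continuous_on {0..s + 1} (\<lambda>t. integral {0..t} (\<lambda>s. C *v x s) + R2h *v v t)"
  proof (intro continuous_on_add)
    have "(\<lambda>s. C *v x s) integrable_on {0..s + 1}"
      using integrable_linear[OF integrable_x[OF order_refl], of "(*v) C"] by (simp add: o_def matrix_vector_mul_bounded_linear)
    then show "continuous_on {0..s + 1} (\<lambda>t. integral {0..t} (\<lambda>s. C *v x s))" by (rule indefinite_integral_continuous_1)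
    show "continuous_on {0..s + 1} (\<lambda>t. R2h *v v t)"
      by (intro bounded_linear.continuous_on[OF matrix_vector_mul_bounded_linear] continuous_on_subset[OF cont(2)]) auto
  qed
  then have yc: "continuous_on {0..s + 1} y"
    by (rule continuous_on_cong[THEN iffD1, rotated -1]) (auto simp: observation)
  have 1: "(\<lambda>l. y (real (grid_index s l) * step_size l)) \<longlonglongrightarrow> y s"
  proof (rule continuous_on_tendsto_compose[OF yc gl])
    have "0 \<le> real (grid_index s l) * step_size l \<and> real (grid_index s l) * step_size l \<le> s + 1" for l
      using grid_index(1)[OF s, of l] less_imp_le[OF step_size_pos[of l]] by simp
    then show "\<forall>\<^sub>F l in sequentially. real (grid_index s l) * step_size l \<in> {0..s + 1}"
      by (intro always_eventually allI) simp
  qed (use s in simp)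
  have 2: "(\<lambda>l. y (real (grid_index s l) * step_size l)
      - snd (model_scheme A C R1h R2h l (x 0) (path_increment l) (grid_index s l))) \<longlonglongrightarrow> 0"
  proof (rule tendstoI)
    fix \<epsilon> :: real assume e: "0 < \<epsilon>"
    then have "0 < \<epsilon> / 2" by simp
    from model_scheme_converges[OF s this y0] show "\<forall>\<^sub>F l in sequentially. dist (y (real (grid_index s l) * step_size l)
      - snd (model_scheme A C R1h R2h l (x 0) (path_increment l) (grid_index s l))) 0 < \<epsilon>"
    proof eventually_elim
      fix l assume *: "\<forall>k. real k * step_size l \<le> s \<longrightarrow>
        norm ((x (real k * step_size l), y (real k * step_size l)) - model_scheme A C R1h R2h l (x 0) (path_increment l) k) \<le> \<epsilon> / 2"
      let ?k = "grid_index s l"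
      have snd_le: "norm (snd p) \<le> norm p" for p :: "(real^'x) \<times> (real^'y)"
        using norm_snd_le[of "snd p" "fst p"] by simp
      have "norm (snd ((x (real ?k * step_size l), y (real ?k * step_size l)) - model_scheme A C R1h R2h l (x 0) (path_increment l) ?k)) \<le> \<epsilon> / 2"
        by (rule order_trans[OF snd_le *[rule_format, OF grid_index(1)[OF s]]])
      then show "dist (y (real ?k * step_size l) - snd (model_scheme A C R1h R2h l (x 0) (path_increment l) ?k)) 0 < \<epsilon>"
        using e by simp
    qed
  qed
  show ?thesis using tendsto_diff[OF 1 2] by simp
qed

text \<open>Inserting the observation equation into the scheme shows that the difference follows the linear
  recursion of the error, and that all noise terms cancel; only the local errors of the signal drive it.\<close>

lemma filter_scheme_tendsto:
  assumes bdd: "\<exists>K::real. \<forall>k l. \<forall>j1 j2. \<bar>riccati_rec A C R1h R2h P l k $ j1 $ j2\<bar> \<le> K"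
  shows "(\<lambda>l. x (real t) - euler A C R1h R2h P l m (\<lambda>_. 0) (\<lambda>_. 0) y (t * 2 ^ l)
      - error_functional A C R1h R2h P l (t * 2 ^ l) (x 0 - m) (path_increment l)) \<longlonglongrightarrow> 0"
proof -
  obtain b where b: "1 \<le> b" "\<And>l k. linear_bounded_by b (euler_drift A C R1h R2h P l k)"
    using euler_drift_bounded[OF bdd] by blast
  let ?H = "euler_drift A C R1h R2h P"
  define D where "D l k = x (real k * step_size l) - euler A C R1h R2h P l m (\<lambda>_. 0) (\<lambda>_. 0) y k
      - error_functional A C R1h R2h P l k (x 0 - m) (path_increment l)" for l k
  have step: "D l (Suc k) = D l k + step_size l *\<^sub>R ?H l k (D l k) + ?H l k (local_error l k)" for l k
  proof -
    have UC: "gain A C R1h R2h P l k *v (C *v z) = (riccati_rec A C R1h R2h P l k ** S_matrix C R2h) *v z" for z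
      by (simp add: gain_def S_matrix_def matrix_vector_mul_assoc matrix_mul_assoc)
    have neg: "gain A C R1h R2h P l k *v (- z) = - (gain A C R1h R2h P l k *v z)" for z
      by (simp add: linear_neg)
    have iy: "increment y l k = step_size l *\<^sub>R (C *v x (real k * step_size l)) + C *v local_error l k + R2h *v increment v l k"
      unfolding increment_def[of y] signal_step by simp
    show ?thesis
      unfolding D_def error_functional_def euler_eq_recursion linear_recursion.simps signal_step(1)
      by (simp add: euler_input_def euler_drift_def path_increment_def iy UC neg matrix_vector_right_distrib
          matrix_vector_mult_diff_distrib matrix_vector_mult_diff_rdistrib matrix_vector_mult_scaleR
          increment_def[of "\<lambda>_. 0"] scaleR_diff_right)
  qed
  have ds: "norm (D l (Suc k)) \<le> (1 + b * step_size l) * norm (D l k) + b * norm (local_error l k)" for l k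
  proof -
    have "norm (D l (Suc k)) \<le> norm (D l k) + step_size l * (b * norm (D l k)) + b * norm (local_error l k)"
      unfolding step
    proof (intro norm_triangle_le add_mono order_refl)
      show "norm (step_size l *\<^sub>R ?H l k (D l k)) \<le> step_size l * (b * norm (D l k))"
        using mult_left_mono[OF linear_bounded_byD(2)[OF b(2), of l k "D l k"] less_imp_le[OF step_size_pos[of l]]]
        by (simp only: norm_scaleR abs_of_pos[OF step_size_pos])
      show "norm (?H l k (local_error l k)) \<le> b * norm (local_error l k)" by (rule linear_bounded_byD(2)[OF b(2)])
    qed
    then show ?thesis by (simp add: algebra_simps)
  qed
  have D0: "D l 0 = 0" for l by (simp add: D_def error_functional_def)
  have "(\<lambda>l. D l (t * 2 ^ l)) \<longlonglongrightarrow> 0"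
  proof (rule tendstoI)
    fix \<epsilon> :: real assume e: "0 < \<epsilon>"
    have "\<forall>\<^sub>F l in sequentially. \<forall>k. real k * step_size l \<le> real t \<longrightarrow> norm (D l k) \<le> \<epsilon> / 2"
      by (rule driven_recursion_small[OF _ _ D0 ds]) (use b e in auto)
    then show "\<forall>\<^sub>F l in sequentially. dist (D l (t * 2 ^ l)) 0 < \<epsilon>"
    proof eventually_elim
      fix l assume "\<forall>k. real k * step_size l \<le> real t \<longrightarrow> norm (D l k) \<le> \<epsilon> / 2"
      then have "norm (D l (t * 2 ^ l)) \<le> \<epsilon> / 2" by (simp only: step_size_grid order_refl)
      then show "dist (D l (t * 2 ^ l)) 0 < \<epsilon>" using e by simp
    qed
  qed
  then show ?thesis by (simp only: D_def step_size_grid)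
qed

end

section \<open>Orthogonality to the observations\<close>

text \<open>For growing \<open>a\<close> these functions decrease to the indicator of \<open>{..c}\<close>, so products of test functions reach
  the events that generate the sigma-algebra of a process. Squaring the positive part makes the function
  differentiable at \<open>c\<close>.\<close>

lemma smooth_test_step:
  fixes c a :: real
  defines "h \<equiv> \<lambda>x. 1 / (1 + (max 0 (a * (x - c)))\<^sup>2)"
  shows "\<exists>h'. smooth_test h h'"
proof -
  define g :: "real \<Rightarrow> real" where "g x = 1 / (1 + (max 0 x)\<^sup>2)" for x
  define g' :: "real \<Rightarrow> real" where "g' x = - (2 * max 0 x) / (1 + (max 0 x)\<^sup>2)\<^sup>2" for x
  have pos: "0 < 1 + (max 0 x)\<^sup>2" for x :: real by (simp add: add_pos_nonneg)
  have sq: "((\<lambda>x. (max 0 x)\<^sup>2) has_real_derivative 2 * max 0 x) (at x)" for x :: real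
  proof (cases "x = 0")
    case False
    show ?thesis
    proof (cases "x > 0")
      case True
      have "((\<lambda>x::real. x\<^sup>2) has_real_derivative 2 * x) (at x)" by (auto intro!: derivative_eq_intros)
      then have "((\<lambda>x. (max 0 x)\<^sup>2) has_real_derivative 2 * x) (at x)"
        by (rule has_field_derivative_transform_within_open[of _ _ _ "{0<..}"]) (use True in auto)
      then show ?thesis using True by simp
    next
      case False
      have "((\<lambda>x::real. 0) has_real_derivative 0) (at x)" by simp
      then have "((\<lambda>x. (max 0 x)\<^sup>2) has_real_derivative 0) (at x)"
        by (rule has_field_derivative_transform_within_open[of _ _ _ "{..<0}"]) (use False \<open>x \<noteq> 0\<close> in \<open>auto simp: max_def\<close>)
      then show ?thesis using False by simp
    qed
  next
    case True
    have "((\<lambda>y. ((max 0 y)\<^sup>2 - (max 0 (0::real))\<^sup>2) / (y - 0)) \<longlongrightarrow> 0) (at 0)"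
    proof (rule Lim_null_comparison)
      have "\<bar>((max 0 y)\<^sup>2 - (max 0 (0::real))\<^sup>2) / (y - 0)\<bar> \<le> \<bar>y\<bar>" for y :: real
        by (cases "y = 0") (auto simp: max_def power2_eq_square)
      then show "\<forall>\<^sub>F y in at 0. norm (((max 0 y)\<^sup>2 - (max 0 (0::real))\<^sup>2) / (y - 0)) \<le> \<bar>y\<bar>"
        by (intro always_eventually allI) (simp only: real_norm_def)
      show "((\<lambda>y::real. \<bar>y\<bar>) \<longlongrightarrow> 0) (at 0)" by (rule tendsto_eq_intros refl | simp)+
    qed
    then show ?thesis using True by (simp add: has_field_derivative_iff)
  qed
  have d: "(g has_real_derivative g' x) (at x)" for x
  proof -
    have "((\<lambda>x. 1 / (1 + (max 0 x)\<^sup>2)) has_real_derivative (0 * (1 + (max 0 x)\<^sup>2) - 1 * (0 + 2 * max 0 x)) / ((1 + (max 0 x)\<^sup>2) * (1 + (max 0 x)\<^sup>2))) (at x)"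
      using pos[of x] by (intro DERIV_divide DERIV_const DERIV_add sq) simp
    then show ?thesis by (simp add: g_def[abs_def] g'_def power2_eq_square)
  qed
  have "continuous_on UNIV g'" unfolding g'_def
    using pos by (intro continuous_intros ballI) (metis less_irrefl zero_less_power)
  moreover have "\<bar>g x\<bar> \<le> 1" for x using pos[of x] by (simp add: g_def)
  moreover have "\<bar>g' x\<bar> \<le> 1" for x
  proof -
    let ?m = "max 0 x"
    have "2 * ?m \<le> 1 + ?m\<^sup>2" using sum_squares_bound[of 1 ?m] by simp
    also have "\<dots> \<le> (1 + ?m\<^sup>2)\<^sup>2" using pos[of x] by (simp add: power2_eq_square mult_le_cancel_left1)
    finally show ?thesis using pos[of x] by (simp add: g'_def abs_div divide_le_eq)
  qed
  ultimately have "smooth_test g g'" using d unfolding smooth_test_def bounded_iff by auto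
  from smooth_test_affine[OF this, of a "- a * c"] show ?thesis
    by (intro exI) (simp add: h_def g_def algebra_simps)
qed

lemma smooth_test_step_tendsto:
  fixes x c :: real
  shows "(\<lambda>n. 1 / (1 + (max 0 (real n * (x - c)))\<^sup>2)) \<longlonglongrightarrow> indicator {..c} x"
proof (cases "x \<le> c")
  case True
  then have "max 0 (real n * (x - c)) = 0" for n by (intro max_absorb1 mult_nonneg_nonpos) auto
  then show ?thesis using True by simp
next
  case False
  then have p: "0 < x - c" by simp
  have "LIM n sequentially. (x - c) * real n :> at_top"
    by (rule filterlim_tendsto_pos_mult_at_top[OF tendsto_const p filterlim_real_sequentially])
  then have "LIM n sequentially. ((x - c) * real n)\<^sup>2 :> at_top" by (intro filterlim_pow_at_top) auto
  then have "LIM n sequentially. 1 + ((x - c) * real n)\<^sup>2 :> at_top" by (rule filterlim_tendsto_add_at_top[OF tendsto_const])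
  then have "(\<lambda>n. inverse (1 + ((x - c) * real n)\<^sup>2)) \<longlonglongrightarrow> 0" by (rule tendsto_inverse_0_at_top)
  moreover have "max 0 (real n * (x - c)) = (x - c) * real n" for n using p by (simp add: mult.commute)
  ultimately show ?thesis using False by (simp add: inverse_eq_divide mult.commute)
qed

lemma borel_measurable_component:
  fixes f :: "'w \<Rightarrow> real^'n"
  shows "f \<in> borel_measurable M \<Longrightarrow> (\<lambda>\<omega>. f \<omega> $ i) \<in> borel_measurable M"
  by (rule measurable_compose[OF _ borel_measurable_nth])

text \<open>The events that finitely many coordinates lie below given levels are stable under intersection and
  generate the sigma-algebra, and the events over which \<open>\<xi>\<close> integrates to zero form a Dynkin system.\<close>

lemma (in prob_space) orthogonal_to_process_algebra:
  fixes \<xi> :: "'a \<Rightarrow> real" and Y :: "real \<Rightarrow> 'a \<Rightarrow> real^'n"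
  assumes \<xi>: "integrable M \<xi>" and Y: "\<And>s. s \<in> I \<Longrightarrow> Y s \<in> borel_measurable M"
    and test: "\<And>(J::nat set) s b h. finite J \<Longrightarrow> (\<And>i. i \<in> J \<Longrightarrow> s i \<in> I) \<Longrightarrow> (\<And>i. i \<in> J \<Longrightarrow> \<exists>h'. smooth_test (h i) h') \<Longrightarrow>
      expectation (\<lambda>\<omega>. \<xi> \<omega> * (\<Prod>i\<in>J. h i (Y (s i) \<omega> $ b i))) = 0"
    and A: "A \<in> sets (process_algebra M I Y)"
  shows "(\<integral>\<omega>\<in>A. \<xi> \<omega> \<partial>M) = 0"
proof -
  define G where "G = {{\<omega>\<in>space M. \<forall>(s, b, c)\<in>F. Y s \<omega> $ b \<le> c} | F. finite F \<and> fst ` F \<subseteq> I}"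
  have nat_version: "expectation (\<lambda>\<omega>. \<xi> \<omega> * (\<Prod>i\<in>J. indicator {..c i} (Y (s i) \<omega> $ b i))) = 0"
    if J: "finite J" "\<And>i. i \<in> J \<Longrightarrow> s i \<in> I" for J :: "nat set" and s b and c :: "nat \<Rightarrow> real"
  proof -
    let ?h = "\<lambda>n i x. 1 / (1 + (max 0 (real n * (x - c i)))\<^sup>2)"
    have Ym: "(\<lambda>\<omega>. Y (s i) \<omega> $ b i) \<in> borel_measurable M" if "i \<in> J" for i
      by (rule borel_measurable_component[OF Y[OF J(2)[OF that]]])
    have z: "expectation (\<lambda>\<omega>. \<xi> \<omega> * (\<Prod>i\<in>J. ?h n i (Y (s i) \<omega> $ b i))) = 0" for n
      by (rule test[OF J]) (auto intro!: smooth_test_step)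
    have "(\<lambda>n. expectation (\<lambda>\<omega>. \<xi> \<omega> * (\<Prod>i\<in>J. ?h n i (Y (s i) \<omega> $ b i))))
       \<longlonglongrightarrow> expectation (\<lambda>\<omega>. \<xi> \<omega> * (\<Prod>i\<in>J. indicator {..c i} (Y (s i) \<omega> $ b i)))"
    proof (rule integral_dominated_convergence[where w = "\<lambda>\<omega>. \<bar>\<xi> \<omega>\<bar>"])
      have [measurable]: "\<xi> \<in> borel_measurable M" using \<xi> by simp
      show "(\<lambda>\<omega>. \<xi> \<omega> * (\<Prod>i\<in>J. indicator {..c i} (Y (s i) \<omega> $ b i))) \<in> borel_measurable M"
        by (intro borel_measurable_times borel_measurable_prod measurable_compose[OF Ym]) auto
      show "(\<lambda>\<omega>. \<xi> \<omega> * (\<Prod>i\<in>J. ?h n i (Y (s i) \<omega> $ b i))) \<in> borel_measurable M" for n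
        by (intro borel_measurable_times borel_measurable_prod measurable_compose[OF Ym]) auto
      show "integrable M (\<lambda>\<omega>. \<bar>\<xi> \<omega>\<bar>)" using \<xi> by simp
      show "AE \<omega> in M. (\<lambda>n. \<xi> \<omega> * (\<Prod>i\<in>J. ?h n i (Y (s i) \<omega> $ b i))) \<longlonglongrightarrow> \<xi> \<omega> * (\<Prod>i\<in>J. indicator {..c i} (Y (s i) \<omega> $ b i))"
        by (intro AE_I2 tendsto_mult tendsto_const tendsto_prod smooth_test_step_tendsto)
      have "\<bar>\<Prod>i\<in>J. ?h n i (Y (s i) \<omega> $ b i)\<bar> \<le> 1" for n \<omega>
        unfolding abs_prod by (intro prod_le_1) (auto simp: add_pos_nonneg)
      then have "\<bar>\<xi> \<omega>\<bar> * \<bar>\<Prod>i\<in>J. ?h n i (Y (s i) \<omega> $ b i)\<bar> \<le> \<bar>\<xi> \<omega>\<bar> * 1" for n \<omega>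
        by (intro mult_left_mono) auto
      then show "AE \<omega> in M. norm (\<xi> \<omega> * (\<Prod>i\<in>J. ?h n i (Y (s i) \<omega> $ b i))) \<le> \<bar>\<xi> \<omega>\<bar>" for n
        by (simp add: abs_mult)
    qed
    then show ?thesis unfolding z by (simp add: LIMSEQ_const_iff)
  qed
  have G0: "g \<in> sets M \<and> (\<integral>\<omega>\<in>g. \<xi> \<omega> \<partial>M) = 0" if "g \<in> G" for g
  proof -
    obtain F where F: "finite F" "fst ` F \<subseteq> I" "g = {\<omega>\<in>space M. \<forall>(s, b, c)\<in>F. Y s \<omega> $ b \<le> c}"
      using \<open>g \<in> G\<close> by (auto simp: G_def)
    obtain f where f: "bij_betw f {..<card F} F" using ex_bij_betw_nat_finite[OF F(1)] by (auto simp: atLeast0LessThan)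
    let ?s = "\<lambda>i. fst (f i)" and ?b = "\<lambda>i. fst (snd (f i))" and ?c = "\<lambda>i. snd (snd (f i))"
    have fI: "?s i \<in> I" if "i \<in> {..<card F}" for i using f F(2) that by (auto simp: bij_betw_def)
    have ind: "indicator g \<omega> = (\<Prod>i<card F. indicator {..?c i} (Y (?s i) \<omega> $ ?b i) :: real)" if \<omega>: "\<omega> \<in> space M" for \<omega>
    proof -
      have "(\<Prod>i<card F. indicator {..?c i} (Y (?s i) \<omega> $ ?b i) :: real) = (\<Prod>p\<in>F. indicator {..snd (snd p)} (Y (fst p) \<omega> $ fst (snd p)))"
        by (rule prod.reindex_bij_betw[OF f])
      also have "\<dots> = indicator g \<omega>"
      proof (cases "\<omega> \<in> g")
        case True
        then have "Y (fst p) \<omega> $ fst (snd p) \<le> snd (snd p)" if "p \<in> F" for p using F(3) that by auto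
        then show ?thesis using True by (simp add: prod.neutral)
      next
        case False
        then obtain p where "p \<in> F" "\<not> Y (fst p) \<omega> $ fst (snd p) \<le> snd (snd p)" using F(3) \<omega> by auto
        then have "(\<Prod>p\<in>F. indicator {..snd (snd p)} (Y (fst p) \<omega> $ fst (snd p)) :: real) = 0"
          by (intro prod_zero[OF F(1)] bexI[of _ p]) auto
        then show ?thesis using False by simp
      qed
      finally show ?thesis by simp
    qed
    have "(\<integral>\<omega>\<in>g. \<xi> \<omega> \<partial>M) = expectation (\<lambda>\<omega>. \<xi> \<omega> * (\<Prod>i<card F. indicator {..?c i} (Y (?s i) \<omega> $ ?b i)))"
      unfolding set_lebesgue_integral_def by (intro Bochner_Integration.integral_cong refl) (simp add: ind)
    also have "\<dots> = 0" using fI by (intro nat_version) auto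
    finally have "(\<integral>\<omega>\<in>g. \<xi> \<omega> \<partial>M) = 0" .
    moreover have "g \<in> sets M"
    proof -
      have "{\<omega>\<in>space M. \<forall>p\<in>F. Y (fst p) \<omega> $ fst (snd p) \<le> snd (snd p)} \<in> sets M"
      proof (rule sets.sets_Collect_finite_All[OF _ F(1)])
        fix p assume "p \<in> F"
        then have "fst p \<in> I" using F(2) by auto
        note [measurable] = borel_measurable_component[OF Y[OF this]]
        show "{\<omega>\<in>space M. Y (fst p) \<omega> $ fst (snd p) \<le> snd (snd p)} \<in> sets M" by measurable
      qed
      then show ?thesis unfolding F(3) by (simp add: case_prod_unfold)
    qed
    ultimately show ?thesis by simp
  qed
  have Gsub: "G \<subseteq> Pow (space M)" by (auto simp: G_def)
  have "Int_stable G"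
  proof (rule Int_stableI)
    fix a b assume "a \<in> G" "b \<in> G"
    then obtain F1 F2 where F: "finite F1" "fst ` F1 \<subseteq> I" "a = {\<omega>\<in>space M. \<forall>(s, b, c)\<in>F1. Y s \<omega> $ b \<le> c}"
      "finite F2" "fst ` F2 \<subseteq> I" "b = {\<omega>\<in>space M. \<forall>(s, b, c)\<in>F2. Y s \<omega> $ b \<le> c}"
      by (auto simp: G_def)
    have "a \<inter> b = {\<omega>\<in>space M. \<forall>(s, b, c)\<in>F1 \<union> F2. Y s \<omega> $ b \<le> c}"
      unfolding F(3,6) ball_Un by blast
    then show "a \<inter> b \<in> G" unfolding G_def using F by (intro CollectI exI[of _ "F1 \<union> F2"]) auto
  qed
  define N where "N = sigma (space M) G"
  have N: "sets N = sigma_sets (space M) G" "space N = space M" using Gsub by (auto simp: N_def)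
  have "Y s \<in> borel_measurable N" if s: "s \<in> I" for s
  proof -
    have "(\<lambda>\<omega>. Y s \<omega> $ b) \<in> borel_measurable N" for b
      unfolding borel_measurable_iff_le
    proof
      fix c
      have "{\<omega> \<in> space M. Y s \<omega> $ b \<le> c} \<in> G"
        unfolding G_def using s by (intro CollectI exI[of _ "{(s, b, c)}"]) auto
      then show "{\<omega> \<in> space N. Y s \<omega> $ b \<le> c} \<in> sets N" unfolding N by (rule sigma_sets.Basic)
    qed
    then show ?thesis
      by (subst borel_measurable_euclidean_space) (auto simp: Basis_vec_def inner_axis)
  qed
  then have "sets (process_algebra N I Y) \<subseteq> sets N" by (intro sets_process_algebra_subset)
  then have "A \<in> sets N" using A by (auto simp: sets_process_algebra N(2))
  then have "A \<in> sigma_sets (space M) G" using N by simp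
  then have "A \<in> sets M \<and> (\<integral>\<omega>\<in>A. \<xi> \<omega> \<partial>M) = 0"
  proof (induct rule: sigma_sets_induct_disjoint[OF \<open>Int_stable G\<close> Gsub, consumes 1, case_names basic empty compl union])
    case (basic A)
    then show ?case by (rule G0)
  next
    case empty
    then show ?case by (simp add: set_lebesgue_integral_def)
  next
    case (compl A)
    have si: "integrable M (\<lambda>\<omega>. indicator A \<omega> *\<^sub>R \<xi> \<omega>)" using compl \<xi> by (intro integrable_mult_indicator) auto
    have "(\<integral>\<omega>\<in>space M - A. \<xi> \<omega> \<partial>M) = expectation (\<lambda>\<omega>. \<xi> \<omega> - indicator A \<omega> *\<^sub>R \<xi> \<omega>)"
      unfolding set_lebesgue_integral_def by (intro Bochner_Integration.integral_cong refl) (auto simp: indicator_def)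
    also have "\<dots> = expectation \<xi> - (\<integral>\<omega>\<in>A. \<xi> \<omega> \<partial>M)"
      unfolding set_lebesgue_integral_def using \<xi> si by (rule Bochner_Integration.integral_diff)
    also have "expectation \<xi> = 0" using nat_version[of "{}"] by simp
    finally show ?case using compl by auto
  next
    case (union A)
    have "(\<integral>\<omega>\<in>(\<Union>i. A i). \<xi> \<omega> \<partial>M) = (\<Sum>i. \<integral>\<omega>\<in>A i. \<xi> \<omega> \<partial>M)"
    proof (rule lebesgue_integral_countable_add)
      show "A i \<inter> A j = {}" if "i \<noteq> j" for i j using union(1) that by (auto simp: disjoint_family_on_def)
      show "set_integrable M (\<Union>i. A i) \<xi>" unfolding set_integrable_def
        using union \<xi> by (intro integrable_mult_indicator) auto
    qed (use union in auto)
    then show ?case using union by auto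
  qed
  then show ?thesis by simp
qed

section \<open>The discretized filter converges\<close>

locale filter_model =
  fixes M :: "'w measure"
    and A :: "real^'x^'x" and C :: "real^'x^'y"
    and R1h :: "real^'x^'x" and R2h :: "real^'y^'y"
    and M0 :: "real^'x" and P0 :: "real^'x^'x"
    and X :: "real \<Rightarrow> 'w \<Rightarrow> real^'x" and Y :: "real \<Rightarrow> 'w \<Rightarrow> real^'y"
    and V :: "real \<Rightarrow> 'w \<Rightarrow> real^'y" and W :: "real \<Rightarrow> 'w \<Rightarrow> real^'x"
    and t :: nat
  assumes prob: "prob_space M"
    and R1: "transpose R1h = R1h" and R2: "transpose R2h = R2h" "invertible R2h"
    and model: "signal_observation M A C R1h R2h M0 P0 X Y V W"
    and bdd: "\<exists>K::real. \<forall>k l. \<forall>j1 j2. \<bar>riccati_rec A C R1h R2h P0 l k $ j1 $ j2\<bar> \<le> K"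

sublocale filter_model \<subseteq> gaussian_noise M M0 P0 "X 0" V W
  using prob model by (simp add: gaussian_noise_def gaussian_noise_axioms_def signal_observation_def)

lemma sum_increment:
  "a \<le> b \<Longrightarrow> (\<Sum>i=a..<b. increment p l i) = p (real b * step_size l) - p (real a * step_size l)"
  unfolding increment_def by (rule sum_Suc_diff')

lemma borel_measurable_zero_Pair:
  fixes f :: "'w \<Rightarrow> 'a::euclidean_space"
  assumes "f \<in> borel_measurable M"
  shows "(\<lambda>\<omega>. (0::'b::euclidean_space, f \<omega>)) \<in> borel_measurable M"
proof -
  have "(\<lambda>y::'a. (0::'b, y)) \<in> borel_measurable borel"
    by (intro borel_measurable_continuous_onI continuous_on_Pair continuous_on_const continuous_on_id)
  from measurable_compose[OF assms this] show ?thesis .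
qed

lemma (in prob_space) mean_square_const: "mean_square M (\<lambda>_. c) = ennreal ((norm c)\<^sup>2)"
  by (simp add: mean_square_def emeasure_space_1)

context filter_model
begin

lemma observation_measurable: "0 \<le> s \<Longrightarrow> Y s \<in> borel_measurable M"
  and signal_measurable: "0 \<le> s \<Longrightarrow> X s \<in> borel_measurable M"
  using model by (auto simp: signal_observation_def)

lemma AE_signal_path:
  "AE \<omega> in M. signal_path A C R1h R2h (\<lambda>t. X t \<omega>) (\<lambda>t. W t \<omega>) (\<lambda>t. Y t \<omega>) (\<lambda>t. V t \<omega>) \<and> Y 0 \<omega> = 0"
proof -
  have 1: "AE \<omega> in M. continuous_on {0..} (\<lambda>t. X t \<omega>) \<and>
        (\<forall>t\<ge>0. X t \<omega> = X 0 \<omega> + integral {0..t} (\<lambda>s. A *v X s \<omega>) + R1h *v W t \<omega>) \<and>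
        Y 0 \<omega> = 0 \<and>
        (\<forall>t\<ge>0. Y t \<omega> = integral {0..t} (\<lambda>s. C *v X s \<omega>) + R2h *v V t \<omega>)"
    using model by (simp add: signal_observation_def)
  have 2: "AE \<omega> in M. continuous_on {0..} (\<lambda>t. (V t \<omega>, W t \<omega>))"
    using brownian by (simp add: standard_brownian_motion_def)
  show ?thesis using 1 2
  proof eventually_elim
    fix \<omega>
    assume c: "continuous_on {0..} (\<lambda>t. (V t \<omega>, W t \<omega>))"
    have v: "continuous_on {0..} (\<lambda>t. V t \<omega>)" using continuous_on_fst[OF c] by simp
    assume *: "continuous_on {0..} (\<lambda>t. X t \<omega>) \<and>
        (\<forall>t\<ge>0. X t \<omega> = X 0 \<omega> + integral {0..t} (\<lambda>s. A *v X s \<omega>) + R1h *v W t \<omega>) \<and>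
        Y 0 \<omega> = 0 \<and>
        (\<forall>t\<ge>0. Y t \<omega> = integral {0..t} (\<lambda>s. C *v X s \<omega>) + R2h *v V t \<omega>)"
    have "signal_path A C R1h R2h (\<lambda>t. X t \<omega>) (\<lambda>t. W t \<omega>) (\<lambda>t. Y t \<omega>) (\<lambda>t. V t \<omega>)"
    proof (rule signal_path.intro[OF _ v])
      show "X t \<omega> = X 0 \<omega> + integral {0..t} (\<lambda>s. A *v X s \<omega>) + R1h *v W t \<omega>" if "0 \<le> t" for t using * that by blast
      show "Y t \<omega> = integral {0..t} (\<lambda>s. C *v X s \<omega>) + R2h *v V t \<omega>" if "0 \<le> t" for t using * that by blast
    qed (use * in blast)
    then show "signal_path A C R1h R2h (\<lambda>t. X t \<omega>) (\<lambda>t. W t \<omega>) (\<lambda>t. Y t \<omega>) (\<lambda>t. V t \<omega>) \<and> Y 0 \<omega> = 0"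
      using * by blast
  qed
qed

lemma path_increment_eq:
  assumes "signal_path A C R1h R2h (\<lambda>t. X t \<omega>) (\<lambda>t. W t \<omega>) (\<lambda>t. Y t \<omega>) (\<lambda>t. V t \<omega>)"
  shows "signal_path.path_increment (\<lambda>t. W t \<omega>) (\<lambda>t. V t \<omega>) l = (\<lambda>j. noise_increment l j \<omega>)"
  by (simp add: fun_eq_iff signal_path.path_increment_def[OF assms] noise_increment_def)

definition error :: "nat \<Rightarrow> 'w \<Rightarrow> real^'x" where
  "error l = filter_error A C R1h R2h l (t * 2 ^ l)"

definition filter_scheme :: "nat \<Rightarrow> 'w \<Rightarrow> real^'x" where
  "filter_scheme l \<omega> = euler A C R1h R2h P0 l M0 (\<lambda>_. 0) (\<lambda>_. 0) (\<lambda>r. Y r \<omega>) (t * 2 ^ l)"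

definition observation_scheme :: "nat \<Rightarrow> nat \<Rightarrow> 'w \<Rightarrow> real^'y" where
  "observation_scheme l k \<omega> = snd (model_scheme A C R1h R2h l (X 0 \<omega>) (\<lambda>j. noise_increment l j \<omega>) k)"

lemma grid_t: "real (t * 2 ^ l) * step_size l \<le> real t"
  by (simp only: step_size_grid order_refl)

lemma noise_increment_refine:
  "noise_increment l j \<omega> = noise_increment (Suc l) (2 * j) \<omega> + noise_increment (Suc l) (2 * j + 1) \<omega>"
  unfolding noise_increment_def by (simp add: increment_refine[of _ l])

lemma error_cauchy:
  obtains c where "0 \<le> c" "\<And>l. error l \<in> borel_measurable M" "\<And>l. square_integrable M (error l)"
    "\<And>l. mean_square M (\<lambda>\<omega>. error (Suc l) \<omega> - error l \<omega>) \<le> ennreal (c * (step_size l)\<^sup>2)"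
proof -
  obtain B K where B: "1 \<le> B" "0 \<le> K"
    and f: "\<And>l n. real n * step_size l \<le> real t \<Longrightarrow> input_functional B n (error_functional A C R1h R2h P0 l n)"
    and g: "\<And>l n. real n * step_size l \<le> real t \<Longrightarrow> input_functional (K * step_size l) (2 * n)
         (\<lambda>z u. error_functional A C R1h R2h P0 (Suc l) (2 * n) z u
              - error_functional A C R1h R2h P0 l n z (\<lambda>j. u (2 * j) + u (2 * j + 1)))"
    by (rule error_functional_bounds[OF bdd, of "real t"]) auto
  obtain p where p: "0 \<le> p" "\<And>x. x \<bullet> (P0 *v x) \<le> p * (norm x)\<^sup>2" using quadratic_form_bound by blast
  have e: "error l = (\<lambda>\<omega>. error_functional A C R1h R2h P0 l (t * 2 ^ l) (X 0 \<omega> - M0) (\<lambda>j. noise_increment l j \<omega>))" for l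
    by (simp add: error_def fun_eq_iff filter_error_eq)
  have sq: "square_integrable M (error l)" for l
    unfolding e using B by (intro mean_square_functional(3)[OF f[OF grid_t] _ p(2,1)]) auto
  define c where "c = K\<^sup>2 * (real DIM(real^'x) * (p + real t))"
  have "mean_square M (\<lambda>\<omega>. error (Suc l) \<omega> - error l \<omega>) \<le> ennreal (c * (step_size l)\<^sup>2)" for l
  proof -
    have s: "t * 2 ^ Suc l = 2 * (t * 2 ^ l)" by simp
    have eq: "error (Suc l) \<omega> - error l \<omega> = error_functional A C R1h R2h P0 (Suc l) (2 * (t * 2 ^ l)) (X 0 \<omega> - M0) (\<lambda>j. noise_increment (Suc l) j \<omega>)
        - error_functional A C R1h R2h P0 l (t * 2 ^ l) (X 0 \<omega> - M0) (\<lambda>j. noise_increment (Suc l) (2 * j) \<omega> + noise_increment (Suc l) (2 * j + 1) \<omega>)" for \<omega>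
      unfolding e s by (simp only: noise_increment_refine[of l])
    have "mean_square M (\<lambda>\<omega>. error (Suc l) \<omega> - error l \<omega>)
       \<le> ennreal ((K * step_size l)\<^sup>2 * (real DIM(real^'x) * (p + real (2 * (t * 2 ^ l)) * step_size (Suc l))))"
      unfolding eq using B step_size_pos[of l]
      by (intro mean_square_functional(1)[OF g[OF grid_t] _ p(2,1)]) auto
    also have "real (2 * (t * 2 ^ l)) * step_size (Suc l) = real t" using step_size_grid[of t "Suc l"] by simp
    finally show ?thesis by (simp add: c_def power_mult_distrib mult_ac)
  qed
  moreover have "0 \<le> c" using p by (simp add: c_def)
  ultimately show ?thesis using that[of c] sq by (simp add: square_integrable_def)
qed

lemma observation_scheme_tendsto_AE:
  "AE \<omega> in M. \<forall>s\<ge>0. (\<lambda>l. observation_scheme l (grid_index s l) \<omega>) \<longlonglongrightarrow> Y s \<omega>"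
  using AE_signal_path
proof eventually_elim
  fix \<omega> assume *: "signal_path A C R1h R2h (\<lambda>t. X t \<omega>) (\<lambda>t. W t \<omega>) (\<lambda>t. Y t \<omega>) (\<lambda>t. V t \<omega>) \<and> Y 0 \<omega> = 0"
  then have p: "signal_path A C R1h R2h (\<lambda>t. X t \<omega>) (\<lambda>t. W t \<omega>) (\<lambda>t. Y t \<omega>) (\<lambda>t. V t \<omega>)" by simp
  show "\<forall>s\<ge>0. (\<lambda>l. observation_scheme l (grid_index s l) \<omega>) \<longlonglongrightarrow> Y s \<omega>"
    using signal_path.observation_scheme_tendsto[OF p] * by (simp add: observation_scheme_def path_increment_eq[OF p])
qed

lemma filter_scheme_tendsto_AE:
  "AE \<omega> in M. (\<lambda>l. X (real t) \<omega> - filter_scheme l \<omega> - error l \<omega>) \<longlonglongrightarrow> 0"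
  using AE_signal_path
proof eventually_elim
  fix \<omega> assume *: "signal_path A C R1h R2h (\<lambda>t. X t \<omega>) (\<lambda>t. W t \<omega>) (\<lambda>t. Y t \<omega>) (\<lambda>t. V t \<omega>) \<and> Y 0 \<omega> = 0"
  then have p: "signal_path A C R1h R2h (\<lambda>t. X t \<omega>) (\<lambda>t. W t \<omega>) (\<lambda>t. Y t \<omega>) (\<lambda>t. V t \<omega>)" by simp
  show "(\<lambda>l. X (real t) \<omega> - filter_scheme l \<omega> - error l \<omega>) \<longlonglongrightarrow> 0"
    using signal_path.filter_scheme_tendsto[OF p bdd, of t M0]
    by (simp add: filter_scheme_def error_def filter_error_eq path_increment_eq[OF p])
qed

text \<open>The coefficients of the functional multiply increments of the observations, which have a drift. The
  bound is first proved for the discretized observations at finer and finer levels, where the drift is a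
  finite sum of bounded functionals, and then passes to the limit by Fatou's lemma.\<close>

lemma observation_functional_mean_square:
  obtains c where "0 \<le> c"
    "\<And>l a (f :: real^'x \<Rightarrow> (nat \<Rightarrow> (real^'x) \<times> (real^'y)) \<Rightarrow> real^'x).
      input_functional a (t * 2 ^ l) f \<Longrightarrow> 0 \<le> a \<Longrightarrow>
      mean_square M (\<lambda>\<omega>. f M0 (\<lambda>j. (0, increment (\<lambda>r. Y r \<omega>) l j))) \<le> ennreal (c * a\<^sup>2)"
proof -
  obtain p where p: "0 \<le> p" "\<And>x. x \<bullet> (P0 *v x) \<le> p * (norm x)\<^sup>2" using quadratic_form_bound by blast
  obtain B where B: "1 \<le> B" "\<And>l n. real n * step_size l \<le> real t \<Longrightarrow> input_functional B n (\<lambda>z u. model_scheme A C R1h R2h l z u n)"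
    by (rule model_scheme_functional[of "real t"]) auto
  obtain b2 where b2: "1 \<le> b2" "linear_bounded_by b2 (\<lambda>u::(real^'y) \<times> (real^'x). (0::real^'x, R2h *v fst u))"
  proof -
    have "linear (\<lambda>u::(real^'y) \<times> (real^'x). (0::real^'x, R2h *v fst u))"
      by (auto intro!: linearI simp: algebra_simps)
    then show thesis using linear_bounded_by_exists that by blast
  qed
  obtain b3 where b3: "1 \<le> b3" "linear_bounded_by b3 (\<lambda>s::(real^'x) \<times> (real^'y). C *v fst s)"
  proof -
    have "linear (\<lambda>s::(real^'x) \<times> (real^'y). C *v fst s)"
      by (auto intro!: linearI simp: algebra_simps)
    then show thesis using linear_bounded_by_exists that by blast
  qed
  have pair: "linear_bounded_by 1 (\<lambda>y::real^'y. (0::real^'x, y))"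
    by (auto simp: linear_bounded_by_def norm_Pair intro!: linearI)
  let ?s = "\<lambda>q k \<omega>. model_scheme A C R1h R2h q (X 0 \<omega>) (\<lambda>j. noise_increment q j \<omega>) k"
  define cX where "cX = 2 * (B\<^sup>2 * (real DIM((real^'x) \<times> (real^'y)) * (p + real t))) + 2 * (B * norm M0)\<^sup>2"
  have cX: "0 \<le> cX" using p by (simp add: cX_def)
  have sm: "?s q k \<in> borel_measurable M" and sms: "mean_square M (?s q k) \<le> ennreal cX"
    if k: "real k * step_size q \<le> real t" for q k
  proof -
    have split: "?s q k = (\<lambda>\<omega>. model_scheme A C R1h R2h q (X 0 \<omega> - M0) (\<lambda>j. noise_increment q j \<omega>) k + model_scheme A C R1h R2h q M0 (\<lambda>_. 0) k)"
      using model_scheme_add[of A C R1h R2h q "X 0 _ - M0" M0 "\<lambda>j. noise_increment q j _" "\<lambda>_. 0" k] by (simp add: fun_eq_iff)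
    note fs = mean_square_functional[OF B(2)[OF k] _ p(2,1)]
    have m: "(\<lambda>\<omega>. model_scheme A C R1h R2h q (X 0 \<omega> - M0) (\<lambda>j. noise_increment q j \<omega>) k) \<in> borel_measurable M"
      by (intro input_functional_measurable[OF B(2)[OF k]]) measurable
    then show "?s q k \<in> borel_measurable M" unfolding split by measurable
    have "norm (model_scheme A C R1h R2h q M0 (\<lambda>_. 0) k) \<le> B * norm M0"
    proof -
      obtain D c where "linear_bounded_by B D" "\<forall>j<k. linear_bounded_by B (c j)" "\<forall>z u. model_scheme A C R1h R2h q z u k = D z + (\<Sum>j<k. c j (u j))"
        using B(2)[OF k] by (auto simp: input_functional_def)
      then show ?thesis by (simp add: linear_bounded_by_def linear_0)
    qed
    then have c: "mean_square M (\<lambda>_. model_scheme A C R1h R2h q M0 (\<lambda>_. 0) k) \<le> ennreal ((B * norm M0)\<^sup>2)"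
      unfolding mean_square_const by (intro ennreal_leI power_mono) auto
    have "mean_square M (\<lambda>\<omega>. model_scheme A C R1h R2h q (X 0 \<omega> - M0) (\<lambda>j. noise_increment q j \<omega>) k)
        \<le> ennreal (B\<^sup>2 * (real DIM((real^'x) \<times> (real^'y)) * (p + real k * step_size q)))"
      using fs(1) B(1) by simp
    also have "\<dots> \<le> ennreal (B\<^sup>2 * (real DIM((real^'x) \<times> (real^'y)) * (p + real t)))"
      using k by (intro ennreal_leI mult_left_mono) auto
    finally have c': "mean_square M (\<lambda>\<omega>. model_scheme A C R1h R2h q (X 0 \<omega> - M0) (\<lambda>j. noise_increment q j \<omega>) k)
        \<le> ennreal (B\<^sup>2 * (real DIM((real^'x) \<times> (real^'y)) * (p + real t)))" .
    show "mean_square M (?s q k) \<le> ennreal cX"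
      unfolding split cX_def by (rule mean_square_add_le[OF m borel_measurable_const c' c]) (use p in simp_all)
  qed
  define c where "c = 2 * (2 * ((norm M0)\<^sup>2) + 2 * (b2\<^sup>2 * (real DIM(real^'x) * (p + real t)))) + 2 * (b3\<^sup>2 * cX * (real t)\<^sup>2)"
  have "0 \<le> c" using p cX by (simp add: c_def)
  moreover have "mean_square M (\<lambda>\<omega>. f M0 (\<lambda>j. (0, increment (\<lambda>r. Y r \<omega>) l j))) \<le> ennreal (c * a\<^sup>2)"
    if f: "input_functional a (t * 2 ^ l) f" and a: "0 \<le> a" for l a and f :: "real^'x \<Rightarrow> (nat \<Rightarrow> (real^'x) \<times> (real^'y)) \<Rightarrow> real^'x"
  proof -
    let ?n = "t * 2 ^ l"
    obtain D C' where D: "linear_bounded_by a D" "\<And>j. j < ?n \<Longrightarrow> linear_bounded_by a (C' j)" "\<And>z u. f z u = D z + (\<Sum>j<?n. C' j (u j))"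
      using f by (auto simp: input_functional_def)
    let ?g = "\<lambda>j q. grid_index (real j * step_size l) q"
    let ?F = "\<lambda>q \<omega>. f M0 (\<lambda>j. (0, observation_scheme q (?g (Suc j) q) \<omega> - observation_scheme q (?g j q) \<omega>))"
    have dl: "0 \<le> real j * step_size l" for j using step_size_pos[of l] by simp
    have gt: "real (?g j q) * step_size q \<le> real t" if "j \<le> ?n" for j q
    proof -
      have "real j * step_size l \<le> real t"
        using less_imp_le[OF step_size_pos[of l]] that by (intro order_trans[OF mult_right_mono grid_t]) (simp_all only: of_nat_le_iff)
      then show ?thesis using grid_index(1)[OF dl, of j q] by linarith
    qed
    have Cm: "(\<lambda>\<omega>. C' j (h \<omega>)) \<in> borel_measurable M" if "j < ?n" "h \<in> borel_measurable M" for j and h :: "'w \<Rightarrow> (real^'x) \<times> (real^'y)"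
      using that(2) D(2)[OF that(1)]
      by (intro measurable_compose[OF that(2)] borel_measurable_continuous_onI linear_continuous_on)
        (auto simp: linear_conv_bounded_linear[symmetric] dest: linear_bounded_byD)
    have om: "observation_scheme q (?g j q) \<in> borel_measurable M" if "j \<le> ?n" for j q
    proof -
      have "(snd :: (real^'x) \<times> (real^'y) \<Rightarrow> real^'y) \<in> borel_measurable borel"
        by (intro borel_measurable_continuous_onI continuous_on_snd continuous_on_id)
      from measurable_compose[OF sm[OF gt[OF that]] this] show ?thesis
        unfolding observation_scheme_def[abs_def] .
    qed
    have Fm: "?F q \<in> borel_measurable M" for q
      unfolding D(3)
    proof (intro borel_measurable_add borel_measurable_const borel_measurable_sum Cm)
      fix j assume "j \<in> {..<?n}"
      then have o: "observation_scheme q (?g j q) \<in> borel_measurable M" "observation_scheme q (?g (Suc j) q) \<in> borel_measurable M"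
        by (intro om; simp)+
      show "(\<lambda>\<omega>. (0::real^'x, observation_scheme q (?g (Suc j) q) \<omega> - observation_scheme q (?g j q) \<omega>)) \<in> borel_measurable M"
        by (intro borel_measurable_zero_Pair borel_measurable_diff o)
    qed auto
    have lim: "AE \<omega> in M. (\<lambda>q. ?F q \<omega>) \<longlonglongrightarrow> f M0 (\<lambda>j. (0, increment (\<lambda>r. Y r \<omega>) l j))"
      using observation_scheme_tendsto_AE
    proof eventually_elim
      fix \<omega> assume *: "\<forall>s\<ge>0. (\<lambda>l. observation_scheme l (grid_index s l) \<omega>) \<longlonglongrightarrow> Y s \<omega>"
      have "bounded_linear (C' j)" if "j < ?n" for j
        using D(2)[OF that] by (simp add: linear_conv_bounded_linear[symmetric] linear_bounded_by_def)
      then show "(\<lambda>q. ?F q \<omega>) \<longlonglongrightarrow> f M0 (\<lambda>j. (0, increment (\<lambda>r. Y r \<omega>) l j))"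
        unfolding D(3) increment_def
      proof (intro tendsto_add tendsto_const tendsto_sum)
        fix j assume j: "j \<in> {..<?n}"
        have T: "(\<lambda>q. observation_scheme q (?g i q) \<omega>) \<longlonglongrightarrow> Y (real i * step_size l) \<omega>" for i using * dl by blast
        show "(\<lambda>q. C' j (0, observation_scheme q (?g (Suc j) q) \<omega> - observation_scheme q (?g j q) \<omega>))
           \<longlonglongrightarrow> C' j (0, Y (real (Suc j) * step_size l) \<omega> - Y (real j * step_size l) \<omega>)"
          using \<open>\<And>j. j < ?n \<Longrightarrow> bounded_linear (C' j)\<close> j
          by (intro bounded_linear.tendsto[of "C' j"] tendsto_Pair tendsto_const tendsto_diff T) simp
      qed
    qed
    show ?thesis
    proof (rule mean_square_lim[OF Fm lim])
      fix q assume lq: "l \<le> q"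
      let ?r = "2 ^ (q - l) :: nat"
      have gg: "?g j q = j * ?r" for j by (rule grid_index_grid[OF lq])
      have rq: "real ?r * step_size q = step_size l"
      proof -
        have "(2::real) ^ q = 2 ^ l * 2 ^ (q - l)" using lq by (simp flip: power_add)
        then show ?thesis by (simp add: step_size_def)
      qed
      (* An increment of level l of the observations discretized at level q is the noise increment of level l
         plus the drift, summed over the fine steps. *)
      have block: "observation_scheme q (?g (Suc j) q) \<omega> - observation_scheme q (?g j q) \<omega>
         = R2h *v fst (noise_increment l j \<omega>) + (\<Sum>i=j * ?r..<Suc j * ?r. step_size q *\<^sub>R (C *v fst (?s q i \<omega>)))" for j \<omega>
      proof -
        have le: "j * ?r \<le> Suc j * ?r" by simp
        have "observation_scheme q (Suc j * ?r) \<omega> - observation_scheme q (j * ?r) \<omega>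
          = (\<Sum>i=j * ?r..<Suc j * ?r. observation_scheme q (Suc i) \<omega> - observation_scheme q i \<omega>)"
          by (rule sum_Suc_diff'[OF le, symmetric])
        also have "\<dots> = (\<Sum>i=j * ?r..<Suc j * ?r. step_size q *\<^sub>R (C *v fst (?s q i \<omega>)) + R2h *v increment (\<lambda>r. V r \<omega>) q i)"
          by (simp add: observation_scheme_def model_scheme_simps noise_increment_def)
        also have "\<dots> = (\<Sum>i=j * ?r..<Suc j * ?r. step_size q *\<^sub>R (C *v fst (?s q i \<omega>))) + R2h *v (\<Sum>i=j * ?r..<Suc j * ?r. increment (\<lambda>r. V r \<omega>) q i)"
          by (simp only: sum.distrib linear_sum[OF matrix_vector_mul_linear])
        also have "(\<Sum>i=j * ?r..<Suc j * ?r. increment (\<lambda>r. V r \<omega>) q i) = fst (noise_increment l j \<omega>)"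
        proof -
          have g: "real (k * ?r) * step_size q = real k * step_size l" for k
            using rq by (simp only: of_nat_mult mult.assoc)
          show ?thesis unfolding sum_increment[OF le] g by (simp add: noise_increment_def increment_def)
        qed
        finally show ?thesis unfolding gg by (simp add: add.commute)
      qed
      let ?T1 = "\<lambda>\<omega>. \<Sum>j<?n. C' j (0, R2h *v fst (noise_increment l j \<omega>))"
      let ?I = "\<lambda>j \<omega>. \<Sum>i=j * ?r..<Suc j * ?r. step_size q *\<^sub>R (C *v fst (?s q i \<omega>))"
      let ?T2 = "\<lambda>\<omega>. \<Sum>j<?n. C' j (0, ?I j \<omega>)"
      have Feq: "?F q = (\<lambda>\<omega>. (D M0 + ?T1 \<omega>) + ?T2 \<omega>)"
      proof
        fix \<omega>
        have "C' j (0, observation_scheme q (?g (Suc j) q) \<omega> - observation_scheme q (?g j q) \<omega>)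
            = C' j (0, R2h *v fst (noise_increment l j \<omega>)) + C' j (0, ?I j \<omega>)" if "j < ?n" for j
          unfolding block using linear_add[OF linear_bounded_byD(1)[OF D(2)[OF that]], of "(0, _)" "(0, _)"] by simp
        then show "?F q \<omega> = (D M0 + ?T1 \<omega>) + ?T2 \<omega>"
          unfolding D(3) by (simp add: sum.distrib)
      qed
      have f1: "input_functional (a * b2) ?n (\<lambda>(z::real^'x) (u::nat \<Rightarrow> (real^'y) \<times> (real^'x)). \<Sum>j<?n. C' j (0, R2h *v fst (u j)))"
        unfolding input_functional_def
        using a b2 linear_bounded_by_comp[OF b2(2) D(2) a]
        by (intro exI[of _ "\<lambda>_. 0"] exI[of _ "\<lambda>j u. C' j (0, R2h *v fst u)"]) (auto intro!: linear_bounded_by_zero)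
      have T1m: "?T1 \<in> borel_measurable M"
        using input_functional_measurable[OF f1, of "\<lambda>\<omega>. X 0 \<omega> - M0" M "noise_increment l"] by simp
      have T1: "mean_square M ?T1 \<le> ennreal (a\<^sup>2 * (b2\<^sup>2 * (real DIM(real^'x) * (p + real t))))"
        using mean_square_functional(1)[OF f1 _ p(2,1), of l, unfolded step_size_grid] a b2
        by (simp add: power_mult_distrib mult_ac)
      have it: "real i * step_size q \<le> real t" if "j < ?n" "i < Suc j * ?r" for i j
      proof -
        have "i \<le> ?n * ?r" using that by (meson Suc_leI less_imp_le mult_le_mono1 order_trans)
        then have "real i * step_size q \<le> real (?n * ?r) * step_size q"
          using step_size_pos[of q] by (intro mult_right_mono) (simp_all only: of_nat_le_iff less_imp_le)
        also have "\<dots> = real ?n * step_size l" using rq by (simp only: of_nat_mult mult.assoc)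
        finally show ?thesis using grid_t[of l] by linarith
      qed
      have Ims: "mean_square M (?I j) \<le> ennreal (b3\<^sup>2 * cX * (step_size l)\<^sup>2)" and Im: "?I j \<in> borel_measurable M" if j: "j < ?n" for j
      proof -
        have m: "?s q i \<in> borel_measurable M" "mean_square M (?s q i) \<le> ennreal cX" if "i \<in> {j * ?r..<Suc j * ?r}" for i
          using sm sms it[OF j] that by auto
        have b: "linear_bounded_by (step_size q * b3) (\<lambda>s::(real^'x) \<times> (real^'y). step_size q *\<^sub>R (C *v fst s))"
          using b3(2) step_size_pos[of q] by (intro linear_bounded_by_scale) auto
        have mi: "(\<lambda>\<omega>. step_size q *\<^sub>R (C *v fst (?s q i \<omega>))) \<in> borel_measurable M" if "i \<in> {j * ?r..<Suc j * ?r}" for i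
          using m(1)[OF that] linear_bounded_byD(1)[OF b]
          by (intro measurable_compose[OF m(1)[OF that], of "\<lambda>s. step_size q *\<^sub>R (C *v fst s)"] borel_measurable_continuous_onI linear_continuous_on)
            (auto simp: linear_conv_bounded_linear)
        then show "?I j \<in> borel_measurable M" by (rule borel_measurable_sum)
        have "mean_square M (?I j) \<le> ennreal (b3\<^sup>2 * cX * (\<Sum>i=j * ?r..<Suc j * ?r. step_size q)\<^sup>2)"
        proof (rule mean_square_sum[OF _ step_size_pos _ mi])
          fix i assume i: "i \<in> {j * ?r..<Suc j * ?r}"
          have "mean_square M (\<lambda>\<omega>. step_size q *\<^sub>R (C *v fst (?s q i \<omega>))) \<le> ennreal ((step_size q * b3)\<^sup>2) * mean_square M (?s q i)"
            by (rule mean_square_linear[OF b m(1)[OF i]])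
          also have "\<dots> \<le> ennreal ((step_size q * b3)\<^sup>2) * ennreal cX" by (intro mult_left_mono m(2)[OF i]) simp
          also have "\<dots> = ennreal (b3\<^sup>2 * cX * (step_size q)\<^sup>2)"
            using cX by (simp add: ennreal_mult[symmetric] power_mult_distrib mult_ac)
          finally show "mean_square M (\<lambda>\<omega>. step_size q *\<^sub>R (C *v fst (?s q i \<omega>))) \<le> ennreal (b3\<^sup>2 * cX * (step_size q)\<^sup>2)" .
        qed (use cX in auto)
        also have "(\<Sum>i=j * ?r..<Suc j * ?r. step_size q) = step_size l" using rq by simp
        finally show "mean_square M (?I j) \<le> ennreal (b3\<^sup>2 * cX * (step_size l)\<^sup>2)" .
      qed
      have T2m: "(\<lambda>\<omega>. C' j (0, ?I j \<omega>)) \<in> borel_measurable M" if "j < ?n" for j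
        by (intro Cm[OF that] borel_measurable_zero_Pair Im[OF that])
      have T2: "mean_square M ?T2 \<le> ennreal (a\<^sup>2 * (b3\<^sup>2 * cX) * (\<Sum>j<?n. step_size l)\<^sup>2)"
      proof (rule mean_square_sum[OF _ step_size_pos])
        fix j assume "j \<in> {..<?n}"
        then have j: "j < ?n" by simp
        show "(\<lambda>\<omega>. C' j (0, ?I j \<omega>)) \<in> borel_measurable M" by (rule T2m[OF j])
        have "mean_square M (\<lambda>\<omega>. C' j (0, ?I j \<omega>)) \<le> ennreal ((a * 1)\<^sup>2) * mean_square M (?I j)"
          by (rule mean_square_linear[OF linear_bounded_by_comp[OF pair D(2)[OF j] a] Im[OF j]])
        also have "\<dots> \<le> ennreal ((a * 1)\<^sup>2) * ennreal (b3\<^sup>2 * cX * (step_size l)\<^sup>2)" by (intro mult_left_mono Ims[OF j]) simp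
        also have "\<dots> = ennreal (a\<^sup>2 * (b3\<^sup>2 * cX) * (step_size l)\<^sup>2)"
          using cX by (simp add: ennreal_mult[symmetric] mult_ac)
        finally show "mean_square M (\<lambda>\<omega>. C' j (0, ?I j \<omega>)) \<le> ennreal (a\<^sup>2 * (b3\<^sup>2 * cX) * (step_size l)\<^sup>2)" .
      qed (use cX in auto)
      have ts: "(\<Sum>j<?n. step_size l) = real t" using step_size_grid[of t l] by simp
      have "mean_square M (\<lambda>_. D M0) \<le> ennreal (a\<^sup>2 * (norm M0)\<^sup>2)"
        unfolding mean_square_const using power_mono[OF linear_bounded_byD(2)[OF D(1), of M0], of 2]
        by (intro ennreal_leI) (simp add: power_mult_distrib)
      then have "mean_square M (\<lambda>\<omega>. D M0 + ?T1 \<omega>) \<le> ennreal (2 * (a\<^sup>2 * (norm M0)\<^sup>2) + 2 * (a\<^sup>2 * (b2\<^sup>2 * (real DIM(real^'x) * (p + real t)))))"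
        using p by (intro mean_square_add_le[OF borel_measurable_const T1m _ T1]) auto
      then have "mean_square M (?F q) \<le> ennreal (2 * (2 * (a\<^sup>2 * (norm M0)\<^sup>2) + 2 * (a\<^sup>2 * (b2\<^sup>2 * (real DIM(real^'x) * (p + real t))))) + 2 * (a\<^sup>2 * (b3\<^sup>2 * cX) * (real t)\<^sup>2))"
        unfolding Feq using p cX T2m
        by (intro mean_square_add_le[OF borel_measurable_add[OF borel_measurable_const T1m] _ _ T2[unfolded ts]]) auto
      then show "mean_square M (?F q) \<le> ennreal (c * a\<^sup>2)"
        by (simp add: c_def algebra_simps)
    qed
  qed
  ultimately show ?thesis using that by blast
qed

end

section \<open>The limit filter is the conditional expectation\<close>

lemma (in prob_space) abs_expectation_le:
  fixes f :: "'a \<Rightarrow> real"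
  assumes [measurable]: "f \<in> borel_measurable M" and B: "\<And>x. \<bar>f x\<bar> \<le> B"
  shows "\<bar>expectation f\<bar> \<le> B"
proof -
  have "integrable M f" using B by (intro integrable_const_bound[of _ B]) auto
  then have "\<bar>expectation f\<bar> \<le> expectation (\<lambda>x. \<bar>f x\<bar>)" using integral_norm_bound[of M f] by simp
  also have "\<dots> \<le> B" using B \<open>integrable M f\<close> by (intro integral_le_const) auto
  finally show ?thesis .
qed

lemma (in gaussian_noise) functional_in_system:
  fixes f :: "real^'x \<Rightarrow> (nat \<Rightarrow> (real^'y) \<times> (real^'x)) \<Rightarrow> 'c::euclidean_space"
  assumes f: "input_functional c k f" "0 \<le> c" "k \<le> n"
  shows "(\<lambda>\<omega>. f (Z \<omega> - m) (\<lambda>j. noise_increment l j \<omega>) \<bullet> e) \<in> range (case_prod (scalar_functional l n))"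
proof -
  obtain a b where ab: "\<And>e l. (\<lambda>\<omega>. f (Z \<omega> - m) (\<lambda>j. noise_increment l j \<omega>) \<bullet> e) = scalar_functional l k (a e) (b e)"
    using input_functional_scalar[OF f(1,2)] by blast
  let ?b = "\<lambda>j. if j < k then b e j else 0"
  have "(\<Sum>j<k. noise_increment l j \<omega> \<bullet> b e j) = (\<Sum>j<n. noise_increment l j \<omega> \<bullet> ?b j)" for \<omega>
    using f(3) by (intro sum.mono_neutral_cong_left) auto
  then have "scalar_functional l k (a e) (b e) = scalar_functional l n (a e) ?b"
    by (simp add: scalar_functional_def fun_eq_iff)
  then show ?thesis unfolding ab by (intro range_eqI[of _ _ "(a e, ?b)"]) simp
qed

context filter_model
begin

text \<open>At level \<open>l\<close> integration by parts bounds the expectation by the covariances of the discretized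
  error with the discretized observations, which are \<open>O(\<Delta>\<^sub>l)\<close>. The errors converge in mean square and the
  discretized observations almost surely, so the bound passes to the limit.\<close>

lemma limit_error_orthogonal:
  assumes lim: "AE \<omega> in M. (\<lambda>l. error l \<omega>) \<longlonglongrightarrow> \<Xi> \<omega>" and \<Xi>m: "\<Xi> \<in> borel_measurable M"
    and c: "0 \<le> c" and ms: "\<And>l. mean_square M (\<lambda>\<omega>. error l \<omega> - \<Xi> \<omega>) \<le> ennreal (c * (step_size l)\<^sup>2)"
    and em: "\<And>l. square_integrable M (error l)"
    and J: "finite (J :: nat set)" "\<And>i. i \<in> J \<Longrightarrow> s i \<in> {0..real t}" "\<And>i. i \<in> J \<Longrightarrow> \<exists>h'. smooth_test (h i) h'"
  shows "expectation (\<lambda>\<omega>. \<Xi> \<omega> $ a * (\<Prod>i\<in>J. h i (Y (s i) \<omega> $ b i))) = 0"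
proof -
  have "\<forall>i\<in>J. \<exists>h'. smooth_test (h i) h'" using J(3) by blast
  from bchoice[OF this] obtain h' where h: "\<And>i. i \<in> J \<Longrightarrow> smooth_test (h i) (h' i)" by blast
  obtain K where K: "0 \<le> K"
    "\<And>l n j. j \<le> n \<Longrightarrow> real n * step_size l \<le> real t \<Longrightarrow>
       norm (cross_covariance M (filter_error A C R1h R2h l n)
         (\<lambda>\<omega>. snd (model_scheme A C R1h R2h l (X 0 \<omega> - M0) (\<lambda>j. noise_increment l j \<omega>) j))) \<le> K * step_size l"
    by (rule filter_error_observation_covariance[OF bdd _ R1 R2, of "real t"]) auto
  obtain B1 K1 where B1: "1 \<le> B1" "0 \<le> K1"
      "\<And>l n. real n * step_size l \<le> real t \<Longrightarrow> input_functional B1 n (error_functional A C R1h R2h P0 l n)"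
      "\<And>l n. real n * step_size l \<le> real t \<Longrightarrow> input_functional (K1 * step_size l) (2 * n)
         (\<lambda>z u. error_functional A C R1h R2h P0 (Suc l) (2 * n) z u
              - error_functional A C R1h R2h P0 l n z (\<lambda>j. u (2 * j) + u (2 * j + 1)))"
    by (rule error_functional_bounds[OF bdd, of "real t"]) auto
  obtain B2 where B2: "1 \<le> B2" "\<And>l n. real n * step_size l \<le> real t \<Longrightarrow> input_functional B2 n (\<lambda>z u. model_scheme A C R1h R2h l z u n)"
    by (rule model_scheme_functional[of "real t"]) auto
  let ?k = "\<lambda>l i. grid_index (s i) l"
  (* The discretized observations are not centred: eta is their centred part and q their mean. *)
  define \<eta> where "\<eta> l i \<omega> = snd (model_scheme A C R1h R2h l (X 0 \<omega> - M0) (\<lambda>j. noise_increment l j \<omega>) (?k l i)) $ b i" for l i \<omega>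
  define q where "q l i = snd (model_scheme A C R1h R2h l M0 (\<lambda>_. 0) (?k l i)) $ b i" for l i
  define \<xi> where "\<xi> l \<omega> = error l \<omega> $ a" for l \<omega>
  have obs: "observation_scheme l (?k l i) \<omega> $ b i = \<eta> l i \<omega> + q l i" for l i \<omega>
    unfolding observation_scheme_def \<eta>_def q_def
    using model_scheme_add[of A C R1h R2h l "X 0 \<omega> - M0" M0 "\<lambda>j. noise_increment l j \<omega>" "\<lambda>_. 0" "?k l i"] by simp
  have kt: "real (?k l i) * step_size l \<le> real t" "?k l i \<le> t * 2 ^ l" if "i \<in> J" for i l
    using grid_index(1)[of "s i" l] J(2)[OF that] by (auto intro: grid_index_le)
  let ?H = "\<lambda>l. range (case_prod (scalar_functional l (t * 2 ^ l)))"
  have \<xi>H: "\<xi> l \<in> ?H l" for l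
  proof -
    have "\<xi> l = (\<lambda>\<omega>. error_functional A C R1h R2h P0 l (t * 2 ^ l) (X 0 \<omega> - M0) (\<lambda>j. noise_increment l j \<omega>) \<bullet> axis a 1)"
      by (simp add: \<xi>_def[abs_def] error_def filter_error_eq inner_axis)
    then show ?thesis using functional_in_system[OF B1(3)[OF grid_t] _ order_refl] B1(1) by simp
  qed
  have \<eta>H: "\<eta> l i \<in> ?H l" if i: "i \<in> J" for l i
  proof -
    have "\<eta> l i = (\<lambda>\<omega>. model_scheme A C R1h R2h l (X 0 \<omega> - M0) (\<lambda>j. noise_increment l j \<omega>) (?k l i) \<bullet> (0, axis (b i) 1))"
      by (simp add: \<eta>_def[abs_def] inner_prod_def inner_axis)
    then show ?thesis using functional_in_system[OF B2(2)[OF kt(1)[OF i]] _ kt(2)[OF i]] B2(1) by simp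
  qed
  have "\<forall>i\<in>J. \<exists>B. \<forall>x. \<bar>h i x\<bar> \<le> B" "\<forall>i\<in>J. \<exists>B. \<forall>x. \<bar>h' i x\<bar> \<le> B" using smooth_test_bounds[OF h] by blast+
  then obtain Bh Bh' where Bh: "\<And>i x. i \<in> J \<Longrightarrow> \<bar>h i x\<bar> \<le> Bh i" "\<And>i x. i \<in> J \<Longrightarrow> \<bar>h' i x\<bar> \<le> Bh' i" by metis
  have Bh0: "0 \<le> Bh i" "0 \<le> Bh' i" if "i \<in> J" for i
    using Bh[OF that] abs_ge_zero order_trans by blast+
  define G where "G = (\<Prod>i\<in>J. Bh i)"
  have G0: "0 \<le> G" unfolding G_def using Bh0 by (intro prod_nonneg) auto
  have G: "\<bar>\<Prod>i\<in>J. h i (g i)\<bar> \<le> G" for g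
    unfolding G_def abs_prod using Bh by (intro prod_mono) auto
  define D where "D = (\<Sum>i\<in>J. Bh' i * (\<Prod>j\<in>J - {i}. Bh j))"
  have Hm: "f \<in> borel_measurable M" if "f \<in> ?H l" for f l
    using stein_systemD1[OF stein_system_functional(1) that] by (simp add: square_integrable_def)
  let ?\<Pi> = "\<lambda>l \<omega>. \<Prod>i\<in>J. h i (\<eta> l i \<omega> + q l i)"
  have \<Pi>m: "?\<Pi> l \<in> borel_measurable M" for l
  proof (rule borel_measurable_prod)
    fix i assume i: "i \<in> J"
    have [measurable]: "\<eta> l i \<in> borel_measurable M" "h i \<in> borel_measurable borel"
      using Hm[OF \<eta>H[OF i]] smooth_testD(2)[OF h[OF i]] by auto
    show "(\<lambda>\<omega>. h i (\<eta> l i \<omega> + q l i)) \<in> borel_measurable M" by measurable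
  qed
  have small: "\<bar>expectation (\<lambda>\<omega>. \<xi> l \<omega> * ?\<Pi> l \<omega>)\<bar> \<le> K * D * step_size l" for l
  proof -
    let ?E = "\<lambda>i. expectation (\<lambda>\<omega>. h' i (\<eta> l i \<omega> + q l i) * (\<Prod>j\<in>J - {i}. h j (\<eta> l j \<omega> + q l j)))"
    have "expectation (\<lambda>\<omega>. \<xi> l \<omega> * ?\<Pi> l \<omega>) = (\<Sum>i\<in>J. expectation (\<lambda>\<omega>. \<xi> l \<omega> * \<eta> l i \<omega>) * ?E i)"
      by (rule stein_systemD2[where h = "\<lambda>i x. h i (x + q l i)" and h' = "\<lambda>i x. h' i (x + q l i)", OF stein_system_functional(1) \<xi>H J(1) \<eta>H])
        (auto intro!: smooth_test_shift h)
    also have "\<bar>\<dots>\<bar> \<le> (\<Sum>i\<in>J. (K * step_size l) * (Bh' i * (\<Prod>j\<in>J - {i}. Bh j)))"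
    proof (rule order_trans[OF sum_abs], rule sum_mono)
      fix i assume i: "i \<in> J"
      let ?y = "\<lambda>\<omega>. snd (model_scheme A C R1h R2h l (X 0 \<omega> - M0) (\<lambda>j. noise_increment l j \<omega>) (?k l i))"
      have "expectation (\<lambda>\<omega>. \<xi> l \<omega> * \<eta> l i \<omega>) = cross_covariance M (filter_error A C R1h R2h l (t * 2 ^ l)) ?y $ a $ b i"
        by (simp add: cross_covariance_def \<xi>_def error_def \<eta>_def)
      then have "\<bar>expectation (\<lambda>\<omega>. \<xi> l \<omega> * \<eta> l i \<omega>)\<bar> \<le> norm (cross_covariance M (filter_error A C R1h R2h l (t * 2 ^ l)) ?y)"
        using component_le_norm_cart[of "cross_covariance M (filter_error A C R1h R2h l (t * 2 ^ l)) ?y $ a" "b i"]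
          Finite_Cartesian_Product.norm_nth_le[of "cross_covariance M (filter_error A C R1h R2h l (t * 2 ^ l)) ?y" a] by linarith
      then have 1: "\<bar>expectation (\<lambda>\<omega>. \<xi> l \<omega> * \<eta> l i \<omega>)\<bar> \<le> K * step_size l"
        using K(2)[OF kt(2)[OF i] grid_t[of l]] by linarith
      have 2: "\<bar>?E i\<bar> \<le> Bh' i * (\<Prod>j\<in>J - {i}. Bh j)"
      proof (rule abs_expectation_le)
        have "(\<lambda>\<omega>. \<Prod>j\<in>J - {i}. h j (\<eta> l j \<omega> + q l j)) \<in> borel_measurable M"
        proof (rule borel_measurable_prod)
          fix j assume "j \<in> J - {i}"
          then have j: "j \<in> J" by simp
          have [measurable]: "\<eta> l j \<in> borel_measurable M" "h j \<in> borel_measurable borel"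
            using Hm[OF \<eta>H[OF j]] smooth_testD(2)[OF h[OF j]] by auto
          show "(\<lambda>\<omega>. h j (\<eta> l j \<omega> + q l j)) \<in> borel_measurable M" by measurable
        qed
        moreover have [measurable]: "\<eta> l i \<in> borel_measurable M" "h' i \<in> borel_measurable borel"
          using Hm[OF \<eta>H[OF i]] smooth_testD(3)[OF h[OF i]] by auto
        ultimately show "(\<lambda>\<omega>. h' i (\<eta> l i \<omega> + q l i) * (\<Prod>j\<in>J - {i}. h j (\<eta> l j \<omega> + q l j))) \<in> borel_measurable M"
          by (intro borel_measurable_times) auto
        show "\<bar>h' i (\<eta> l i x + q l i) * (\<Prod>j\<in>J - {i}. h j (\<eta> l j x + q l j))\<bar> \<le> Bh' i * (\<Prod>j\<in>J - {i}. Bh j)" for x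
          unfolding abs_mult abs_prod using Bh Bh0 i by (intro mult_mono prod_mono prod_nonneg) auto
      qed
      show "\<bar>expectation (\<lambda>\<omega>. \<xi> l \<omega> * \<eta> l i \<omega>) * ?E i\<bar> \<le> (K * step_size l) * (Bh' i * (\<Prod>j\<in>J - {i}. Bh j))"
        unfolding abs_mult using 1 2 by (intro mult_mono) auto
    qed
    also have "\<dots> = K * D * step_size l" by (simp add: D_def sum_distrib_left mult_ac)
    finally show ?thesis .
  qed
  have lim0: "(\<lambda>l. K * D * step_size l) \<longlonglongrightarrow> K * D * 0" by (intro tendsto_intros step_size_tendsto)
  have to0: "(\<lambda>l. expectation (\<lambda>\<omega>. \<xi> l \<omega> * ?\<Pi> l \<omega>)) \<longlonglongrightarrow> 0"
  proof (rule Lim_null_comparison)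
    show "\<forall>\<^sub>F l in sequentially. norm (expectation (\<lambda>\<omega>. \<xi> l \<omega> * ?\<Pi> l \<omega>)) \<le> K * D * step_size l"
      using small by (intro always_eventually allI) (simp only: real_norm_def)
  qed (use lim0 in simp)
  have sq\<Xi>: "square_integrable M (\<lambda>\<omega>. error l \<omega> - \<Xi> \<omega>)" for l
  proof (rule square_integrableI)
    show "(\<lambda>\<omega>. error l \<omega> - \<Xi> \<omega>) \<in> borel_measurable M"
      using em[of l] \<Xi>m by (intro borel_measurable_diff) (simp_all add: square_integrable_def)
    show "mean_square M (\<lambda>\<omega>. error l \<omega> - \<Xi> \<omega>) < \<infinity>" using le_less_trans[OF ms[of l]] by simp
  qed
  have sqd: "square_integrable M (\<lambda>\<omega>. \<xi> l \<omega> - \<Xi> \<omega> $ a)" for l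
    using square_integrable_nth[OF sq\<Xi>[of l], of a] by (simp add: \<xi>_def)
  have i\<xi>: "integrable M (\<xi> l)" for l
    using square_integrable_integrable[OF square_integrable_nth[OF em[of l], of a]] by (simp add: \<xi>_def[abs_def])
  have i\<Xi>: "integrable M (\<lambda>\<omega>. \<Xi> \<omega> $ a)"
    using Bochner_Integration.integrable_diff[OF i\<xi>[of 0] square_integrable_integrable[OF sqd[of 0]]] by simp
  (* With s the step size, |d| <= s + d^2 / s turns the rate in mean square into a rate in the mean. *)
  have d0: "(\<lambda>l. expectation (\<lambda>\<omega>. (\<xi> l \<omega> - \<Xi> \<omega> $ a) * ?\<Pi> l \<omega>)) \<longlonglongrightarrow> 0"
  proof (rule Lim_null_comparison[where g = "\<lambda>l. (G + G * c) * step_size l"])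
    have "(\<lambda>l. (G + G * c) * step_size l) \<longlonglongrightarrow> (G + G * c) * 0" by (intro tendsto_intros step_size_tendsto)
    then show "(\<lambda>l. (G + G * c) * step_size l) \<longlonglongrightarrow> 0" by simp
    have "\<bar>expectation (\<lambda>\<omega>. (\<xi> l \<omega> - \<Xi> \<omega> $ a) * ?\<Pi> l \<omega>)\<bar> \<le> (G + G * c) * step_size l" for l
    proof -
      let ?d = "\<lambda>\<omega>. \<xi> l \<omega> - \<Xi> \<omega> $ a"
      have s: "0 < step_size l" by (rule step_size_pos)
      have id2: "integrable M (\<lambda>\<omega>. (?d \<omega>)\<^sup>2)" using sqd[of l] by (simp add: square_integrable_def)
      have "expectation (\<lambda>\<omega>. (?d \<omega>)\<^sup>2) \<le> expectation (\<lambda>\<omega>. (norm (error l \<omega> - \<Xi> \<omega>))\<^sup>2)"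
      proof (rule integral_mono[OF id2])
        show "integrable M (\<lambda>\<omega>. (norm (error l \<omega> - \<Xi> \<omega>))\<^sup>2)" using sq\<Xi>[of l] by (simp add: square_integrable_def)
        show "(?d \<omega>)\<^sup>2 \<le> (norm (error l \<omega> - \<Xi> \<omega>))\<^sup>2" for \<omega>
          using power_mono[OF component_le_norm_cart[of "error l \<omega> - \<Xi> \<omega>" a], of 2] by (simp add: \<xi>_def)
      qed
      also have "\<dots> \<le> c * (step_size l)\<^sup>2"
        using ms[of l] c unfolding mean_square_eq_integral[OF sq\<Xi>] by (subst (asm) ennreal_le_iff) auto
      finally have Ed: "expectation (\<lambda>\<omega>. (?d \<omega>)\<^sup>2) \<le> c * (step_size l)\<^sup>2" .
      have i1: "integrable M (\<lambda>\<omega>. ?d \<omega> * ?\<Pi> l \<omega>)"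
        using square_integrable_integrable[OF sqd[of l]] \<Pi>m G by (intro integrable_mult_bounded) auto
      have "\<bar>expectation (\<lambda>\<omega>. ?d \<omega> * ?\<Pi> l \<omega>)\<bar> \<le> expectation (\<lambda>\<omega>. \<bar>?d \<omega> * ?\<Pi> l \<omega>\<bar>)"
        using integral_norm_bound[of M "\<lambda>\<omega>. ?d \<omega> * ?\<Pi> l \<omega>"] by simp
      also have "\<dots> \<le> expectation (\<lambda>\<omega>. G * (step_size l + (?d \<omega>)\<^sup>2 / step_size l))"
      proof (rule integral_mono)
        show "integrable M (\<lambda>\<omega>. \<bar>?d \<omega> * ?\<Pi> l \<omega>\<bar>)" using i1 by simp
        show "integrable M (\<lambda>\<omega>. G * (step_size l + (?d \<omega>)\<^sup>2 / step_size l))" using id2 by simp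
        fix \<omega>
        have "2 * step_size l * \<bar>?d \<omega>\<bar> \<le> (step_size l)\<^sup>2 + \<bar>?d \<omega>\<bar>\<^sup>2" by (rule sum_squares_bound)
        moreover have "0 \<le> step_size l * \<bar>?d \<omega>\<bar>" using s by simp
        ultimately have "step_size l * \<bar>?d \<omega>\<bar> \<le> (step_size l)\<^sup>2 + (?d \<omega>)\<^sup>2" by simp
        then have "\<bar>?d \<omega>\<bar> \<le> step_size l + (?d \<omega>)\<^sup>2 / step_size l" using s by (simp add: field_simps power2_eq_square)
        then show "\<bar>?d \<omega> * ?\<Pi> l \<omega>\<bar> \<le> G * (step_size l + (?d \<omega>)\<^sup>2 / step_size l)"
          unfolding abs_mult mult.commute[of G] using G[of "\<lambda>i. \<eta> l i \<omega> + q l i"] G0 s by (intro mult_mono) auto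
      qed
      also have "\<dots> = G * (step_size l + expectation (\<lambda>\<omega>. (?d \<omega>)\<^sup>2) / step_size l)"
        using id2 by (simp add: prob_space)
      also have "\<dots> \<le> G * (step_size l + c * (step_size l)\<^sup>2 / step_size l)"
        using Ed G0 s by (intro mult_left_mono add_left_mono divide_right_mono) auto
      also have "\<dots> = (G + G * c) * step_size l" using s by (simp add: power2_eq_square algebra_simps)
      finally show ?thesis .
    qed
    then show "\<forall>\<^sub>F l in sequentially. norm (expectation (\<lambda>\<omega>. (\<xi> l \<omega> - \<Xi> \<omega> $ a) * ?\<Pi> l \<omega>)) \<le> (G + G * c) * step_size l"
      by (intro always_eventually allI) simp
  qed
  have main: "(\<lambda>l. expectation (\<lambda>\<omega>. \<Xi> \<omega> $ a * ?\<Pi> l \<omega>)) \<longlonglongrightarrow> expectation (\<lambda>\<omega>. \<Xi> \<omega> $ a * (\<Prod>i\<in>J. h i (Y (s i) \<omega> $ b i)))"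
  proof (rule integral_dominated_convergence[where w = "\<lambda>\<omega>. \<bar>\<Xi> \<omega> $ a\<bar> * G"])
    note [measurable] = borel_measurable_component[OF \<Xi>m, of a] \<Pi>m
    have "(\<lambda>\<omega>. \<Prod>i\<in>J. h i (Y (s i) \<omega> $ b i)) \<in> borel_measurable M"
    proof (rule borel_measurable_prod)
      fix i assume i: "i \<in> J"
      have "Y (s i) \<in> borel_measurable M" using J(2)[OF i] by (intro observation_measurable) simp
      from measurable_compose[OF borel_measurable_component[OF this] smooth_testD(2)[OF h[OF i]]]
      show "(\<lambda>\<omega>. h i (Y (s i) \<omega> $ b i)) \<in> borel_measurable M" .
    qed
    then show "(\<lambda>\<omega>. \<Xi> \<omega> $ a * (\<Prod>i\<in>J. h i (Y (s i) \<omega> $ b i))) \<in> borel_measurable M" by measurable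
    show "(\<lambda>\<omega>. \<Xi> \<omega> $ a * ?\<Pi> l \<omega>) \<in> borel_measurable M" for l by measurable
    show "integrable M (\<lambda>\<omega>. \<bar>\<Xi> \<omega> $ a\<bar> * G)" using i\<Xi> by simp
    show "AE \<omega> in M. (\<lambda>l. \<Xi> \<omega> $ a * ?\<Pi> l \<omega>) \<longlonglongrightarrow> \<Xi> \<omega> $ a * (\<Prod>i\<in>J. h i (Y (s i) \<omega> $ b i))"
      using observation_scheme_tendsto_AE
    proof eventually_elim
      fix \<omega> assume *: "\<forall>s\<ge>0. (\<lambda>l. observation_scheme l (grid_index s l) \<omega>) \<longlonglongrightarrow> Y s \<omega>"
      show "(\<lambda>l. \<Xi> \<omega> $ a * ?\<Pi> l \<omega>) \<longlonglongrightarrow> \<Xi> \<omega> $ a * (\<Prod>i\<in>J. h i (Y (s i) \<omega> $ b i))"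
      proof (intro tendsto_mult tendsto_const tendsto_prod)
        fix i assume i: "i \<in> J"
        have "(\<lambda>l. \<eta> l i \<omega> + q l i) \<longlonglongrightarrow> Y (s i) \<omega> $ b i"
          unfolding obs[symmetric] using * J(2)[OF i] by (intro tendsto_vec_nth) auto
        then show "(\<lambda>l. h i (\<eta> l i \<omega> + q l i)) \<longlonglongrightarrow> h i (Y (s i) \<omega> $ b i)"
          using continuous_on_tendsto_compose[OF smooth_testD(4)[OF h[OF i]]] by simp
      qed
    qed
    show "AE \<omega> in M. norm (\<Xi> \<omega> $ a * ?\<Pi> l \<omega>) \<le> \<bar>\<Xi> \<omega> $ a\<bar> * G" for l
      using G by (auto simp: abs_mult intro!: mult_left_mono)
  qed
  have "(\<lambda>l. expectation (\<lambda>\<omega>. (\<xi> l \<omega> - \<Xi> \<omega> $ a) * ?\<Pi> l \<omega>) + expectation (\<lambda>\<omega>. \<Xi> \<omega> $ a * ?\<Pi> l \<omega>))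
      \<longlonglongrightarrow> 0 + expectation (\<lambda>\<omega>. \<Xi> \<omega> $ a * (\<Prod>i\<in>J. h i (Y (s i) \<omega> $ b i)))"
    by (rule tendsto_add[OF d0 main])
  moreover have "expectation (\<lambda>\<omega>. (\<xi> l \<omega> - \<Xi> \<omega> $ a) * ?\<Pi> l \<omega>) + expectation (\<lambda>\<omega>. \<Xi> \<omega> $ a * ?\<Pi> l \<omega>) = expectation (\<lambda>\<omega>. \<xi> l \<omega> * ?\<Pi> l \<omega>)" for l
  proof -
    have "integrable M (\<lambda>\<omega>. (\<xi> l \<omega> - \<Xi> \<omega> $ a) * ?\<Pi> l \<omega>)" "integrable M (\<lambda>\<omega>. \<Xi> \<omega> $ a * ?\<Pi> l \<omega>)"
      using square_integrable_integrable[OF sqd[of l]] i\<Xi> \<Pi>m G by (auto intro!: integrable_mult_bounded)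
    then show ?thesis by (simp flip: Bochner_Integration.integral_add add: algebra_simps)
  qed
  ultimately have "(\<lambda>l. expectation (\<lambda>\<omega>. \<xi> l \<omega> * ?\<Pi> l \<omega>)) \<longlonglongrightarrow> expectation (\<lambda>\<omega>. \<Xi> \<omega> $ a * (\<Prod>i\<in>J. h i (Y (s i) \<omega> $ b i)))"
    by simp
  then show ?thesis using LIMSEQ_unique[OF to0] by simp
qed

end

context filter_model
begin

abbreviation observed :: "'w measure" where
  "observed \<equiv> process_algebra M {0..real t} Y"

lemma subalgebra_observed: "subalgebra M observed"
  unfolding subalgebra_def using sets_process_algebra_subset[of "{0..real t}" Y M] observation_measurable by auto

lemma filter_scheme_functional:
  "filter_scheme l \<omega> = euler_recursion A C R1h R2h P0 l M0 (\<lambda>j. (0, increment (\<lambda>r. Y r \<omega>) l j)) (t * 2 ^ l)"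
  unfolding filter_scheme_def euler_eq_recursion by (simp add: increment_def[of "\<lambda>_. 0"])

lemma filter_scheme_adapted: "filter_scheme l \<in> borel_measurable observed"
proof -
  obtain B K where B: "1 \<le> B" "0 \<le> K"
    and f: "\<And>l n. real n * step_size l \<le> real t \<Longrightarrow> input_functional B n (\<lambda>z u. euler_recursion A C R1h R2h P0 l z u n)"
    and "\<And>l n. real n * step_size l \<le> real t \<Longrightarrow> input_functional (K * step_size l) (2 * n)
         (\<lambda>z u. euler_recursion A C R1h R2h P0 (Suc l) z u (2 * n) - euler_recursion A C R1h R2h P0 l z (\<lambda>j. u (2 * j) + u (2 * j + 1)) n)"
    by (rule euler_functional[OF bdd, of "real t"]) auto
  have Ym: "Y (real k * step_size l) \<in> borel_measurable observed" if "k \<le> t * 2 ^ l" for k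
  proof (rule measurable_process_algebra)
    have "real k * step_size l \<le> real t"
      using less_imp_le[OF step_size_pos[of l]] that by (intro order_trans[OF mult_right_mono grid_t]) (simp_all only: of_nat_le_iff)
    then show "real k * step_size l \<in> {0..real t}" using less_imp_le[OF step_size_pos[of l]] by simp
  qed
  show ?thesis
    unfolding filter_scheme_functional[abs_def]
  proof (rule input_functional_measurable[OF f[OF grid_t]])
    show "(\<lambda>\<omega>. (0::real^'x, increment (\<lambda>r. Y r \<omega>) l j)) \<in> borel_measurable observed" if "j < t * 2 ^ l" for j
      unfolding increment_def using that by (intro borel_measurable_zero_Pair borel_measurable_diff Ym) auto
  qed simp
qed

lemma filter_scheme_measurable: "filter_scheme l \<in> borel_measurable M"
  by (rule measurable_from_subalg[OF subalgebra_observed filter_scheme_adapted])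

lemma filter_scheme_cauchy:
  obtains c where "0 \<le> c" "\<And>l. mean_square M (\<lambda>\<omega>. filter_scheme (Suc l) \<omega> - filter_scheme l \<omega>) \<le> ennreal (c * (step_size l)\<^sup>2)"
    "\<And>l. mean_square M (filter_scheme l) \<le> ennreal c"
proof -
  obtain B K where B: "1 \<le> B" "0 \<le> K"
    and f: "\<And>l n. real n * step_size l \<le> real t \<Longrightarrow> input_functional B n (\<lambda>z u. euler_recursion A C R1h R2h P0 l z u n)"
    and g: "\<And>l n. real n * step_size l \<le> real t \<Longrightarrow> input_functional (K * step_size l) (2 * n)
         (\<lambda>z u. euler_recursion A C R1h R2h P0 (Suc l) z u (2 * n) - euler_recursion A C R1h R2h P0 l z (\<lambda>j. u (2 * j) + u (2 * j + 1)) n)"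
    by (rule euler_functional[OF bdd, of "real t"]) auto
  obtain c where c: "0 \<le> c"
    "\<And>l a (f :: real^'x \<Rightarrow> (nat \<Rightarrow> (real^'x) \<times> (real^'y)) \<Rightarrow> real^'x).
      input_functional a (t * 2 ^ l) f \<Longrightarrow> 0 \<le> a \<Longrightarrow>
      mean_square M (\<lambda>\<omega>. f M0 (\<lambda>j. (0, increment (\<lambda>r. Y r \<omega>) l j))) \<le> ennreal (c * a\<^sup>2)"
    by (rule observation_functional_mean_square) blast
  show ?thesis
  proof (rule that[of "c * K\<^sup>2 + c * B\<^sup>2"])
    show "0 \<le> c * K\<^sup>2 + c * B\<^sup>2" using c(1) by simp
    fix l
    have s: "t * 2 ^ Suc l = 2 * (t * 2 ^ l)" by simp
    have i: "(0, increment (\<lambda>r. Y r \<omega>) l j) = (0::real^'x, increment (\<lambda>r. Y r \<omega>) (Suc l) (2 * j)) + (0, increment (\<lambda>r. Y r \<omega>) (Suc l) (2 * j + 1))" for j \<omega>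
      by (simp add: increment_refine[of _ l])
    have "mean_square M (\<lambda>\<omega>. filter_scheme (Suc l) \<omega> - filter_scheme l \<omega>) \<le> ennreal (c * (K * step_size l)\<^sup>2)"
      unfolding filter_scheme_functional i
      by (rule c(2)[OF g[OF grid_t[of l], folded s]]) (use B less_imp_le[OF step_size_pos[of l]] in simp)
    also have "\<dots> \<le> ennreal ((c * K\<^sup>2 + c * B\<^sup>2) * (step_size l)\<^sup>2)"
      using c(1) by (intro ennreal_leI) (simp add: power_mult_distrib algebra_simps)
    finally show "mean_square M (\<lambda>\<omega>. filter_scheme (Suc l) \<omega> - filter_scheme l \<omega>) \<le> ennreal ((c * K\<^sup>2 + c * B\<^sup>2) * (step_size l)\<^sup>2)" .
    have "mean_square M (filter_scheme l) \<le> ennreal (c * B\<^sup>2)"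
      unfolding filter_scheme_functional[abs_def] using B by (intro c(2)[OF f[OF grid_t]]) simp
    also have "\<dots> \<le> ennreal (c * K\<^sup>2 + c * B\<^sup>2)" using c(1) by (intro ennreal_leI) simp
    finally show "mean_square M (filter_scheme l) \<le> ennreal (c * K\<^sup>2 + c * B\<^sup>2)" .
  qed
qed

text \<open>The error of the limit filter is orthogonal to everything that is measurable with respect to the
  observations, and the limit filter is measurable with respect to them. So it is the conditional
  expectation.\<close>

lemma filter_scheme_rate:
  shows "filter_mean M X Y (real t) \<in> borel_measurable M"
    and "\<exists>c\<ge>0. \<forall>l. mean_square M (\<lambda>\<omega>. filter_scheme l \<omega> - filter_mean M X Y (real t) \<omega>) \<le> ennreal (c * (step_size l)\<^sup>2)"
proof -
  obtain ce where ce: "0 \<le> ce" "\<And>l. error l \<in> borel_measurable M" "\<And>l. square_integrable M (error l)"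
    "\<And>l. mean_square M (\<lambda>\<omega>. error (Suc l) \<omega> - error l \<omega>) \<le> ennreal (ce * (step_size l)\<^sup>2)"
    by (rule error_cauchy) blast
  obtain cf where cf: "0 \<le> cf" "\<And>l. mean_square M (\<lambda>\<omega>. filter_scheme (Suc l) \<omega> - filter_scheme l \<omega>) \<le> ennreal (cf * (step_size l)\<^sup>2)"
    "\<And>l. mean_square M (filter_scheme l) \<le> ennreal cf"
    by (rule filter_scheme_cauchy) blast
  define \<Xi> where "\<Xi> \<omega> = lim (\<lambda>l. error l \<omega>)" for \<omega>
  define m where "m \<omega> = lim (\<lambda>l. filter_scheme l \<omega>)" for \<omega>
  have \<Xi>m: "\<Xi> \<in> borel_measurable M" unfolding \<Xi>_def[abs_def] by (rule borel_measurable_lim_metric) (rule ce)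
  have mF: "m \<in> borel_measurable observed" unfolding m_def[abs_def] by (rule borel_measurable_lim_metric) (rule filter_scheme_adapted)
  have mM: "m \<in> borel_measurable M" by (rule measurable_from_subalg[OF subalgebra_observed mF])
  have lim\<Xi>: "AE \<omega> in M. (\<lambda>l. error l \<omega>) \<longlonglongrightarrow> \<Xi> \<omega>"
    using mean_square_cauchy_convergent[OF prob ce(2) ce(1) ce(4)]
    by eventually_elim (simp add: \<Xi>_def convergent_LIMSEQ_iff)
  have limm: "AE \<omega> in M. (\<lambda>l. filter_scheme l \<omega>) \<longlonglongrightarrow> m \<omega>"
    using mean_square_cauchy_convergent[OF prob filter_scheme_measurable cf(1) cf(2)]
    by eventually_elim (simp add: m_def convergent_LIMSEQ_iff)
  have X: "AE \<omega> in M. X (real t) \<omega> = m \<omega> + \<Xi> \<omega>"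
    using filter_scheme_tendsto_AE lim\<Xi> limm
  proof eventually_elim
    fix \<omega> assume a: "(\<lambda>l. X (real t) \<omega> - filter_scheme l \<omega> - error l \<omega>) \<longlonglongrightarrow> 0"
      and b: "(\<lambda>l. error l \<omega>) \<longlonglongrightarrow> \<Xi> \<omega>" and c: "(\<lambda>l. filter_scheme l \<omega>) \<longlonglongrightarrow> m \<omega>"
    have "(\<lambda>l. X (real t) \<omega> - filter_scheme l \<omega> - error l \<omega>) \<longlonglongrightarrow> X (real t) \<omega> - m \<omega> - \<Xi> \<omega>"
      by (intro tendsto_intros b c)
    from LIMSEQ_unique[OF this a] show "X (real t) \<omega> = m \<omega> + \<Xi> \<omega>" by (simp add: algebra_simps)
  qed
  have ms\<Xi>: "mean_square M (\<lambda>\<omega>. error l \<omega> - \<Xi> \<omega>) \<le> ennreal ((ce * 4) * (step_size l)\<^sup>2)" for l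
    using mean_square_cauchy_limit[OF ce(2) lim\<Xi> ce(1) ce(4), of l] by (simp add: power_mult_distrib mult_ac)
  have msm: "mean_square M (\<lambda>\<omega>. filter_scheme l \<omega> - m \<omega>) \<le> ennreal ((cf * 4) * (step_size l)\<^sup>2)" for l
    using mean_square_cauchy_limit[OF filter_scheme_measurable limm cf(1) cf(2), of l] by (simp add: power_mult_distrib mult_ac)
  have sqm: "square_integrable M m"
  proof (rule square_integrableI[OF mM])
    have "mean_square M m \<le> ennreal cf" by (rule mean_square_lim[OF filter_scheme_measurable limm]) (rule cf(3))
    also have "\<dots> < \<infinity>" by simp
    finally show "mean_square M m < \<infinity>" .
  qed
  have im: "integrable M (\<lambda>\<omega>. m \<omega> $ a)" for a
    by (rule square_integrable_integrable[OF square_integrable_nth[OF sqm]])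
  have sq\<Xi>: "square_integrable M \<Xi>"
  proof -
    have "square_integrable M (\<lambda>\<omega>. error 0 \<omega> - \<Xi> \<omega>)"
      using ce(2)[of 0] \<Xi>m ms\<Xi>[of 0] by (intro square_integrableI) (auto intro: le_less_trans)
    from square_integrable_linear[OF linear_uminus this]
    have "square_integrable M (\<lambda>\<omega>. error 0 \<omega> + - (error 0 \<omega> - \<Xi> \<omega>))"
      by (rule square_integrable_add[OF ce(3)])
    then show ?thesis by simp
  qed
  have i\<Xi>: "integrable M (\<lambda>\<omega>. \<Xi> \<omega> $ a)" for a
    by (rule square_integrable_integrable[OF square_integrable_nth[OF sq\<Xi>]])
  have orth: "(\<integral>\<omega>\<in>S. \<Xi> \<omega> $ a \<partial>M) = 0" if "S \<in> sets observed" for S a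
  proof (rule orthogonal_to_process_algebra[OF i\<Xi> _ _ that])
    show "Y s \<in> borel_measurable M" if "s \<in> {0..real t}" for s using observation_measurable that by simp
    fix J :: "nat set" and s b h
    assume "finite J" "\<And>i. i \<in> J \<Longrightarrow> s i \<in> {0..real t}" "\<And>i. i \<in> J \<Longrightarrow> \<exists>h'. smooth_test (h i) h'"
    then show "expectation (\<lambda>\<omega>. \<Xi> \<omega> $ a * (\<Prod>i\<in>J. h i (Y (s i) \<omega> $ b i))) = 0"
      using ce(1) by (intro limit_error_orthogonal[OF lim\<Xi> \<Xi>m _ ms\<Xi> ce(3)]) auto
  qed
  interpret F: finite_measure_subalgebra M observed
    by (unfold_locales) (rule subalgebra_observed)
  have Xm: "(\<lambda>\<omega>. X (real t) \<omega> $ a) \<in> borel_measurable M" for a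
    by (rule borel_measurable_component[OF signal_measurable]) simp
  have XAE: "AE \<omega> in M. X (real t) \<omega> $ a = m \<omega> $ a + \<Xi> \<omega> $ a" for a using X by eventually_elim simp
  have iX: "integrable M (\<lambda>\<omega>. X (real t) \<omega> $ a)" for a
  proof -
    have "integrable M (\<lambda>\<omega>. m \<omega> $ a + \<Xi> \<omega> $ a)" using im i\<Xi> by simp
    then show ?thesis using integrable_cong_AE[OF Xm _ XAE] borel_measurable_component[OF mM] borel_measurable_component[OF \<Xi>m] by simp
  qed
  have ce_eq: "AE \<omega> in M. real_cond_exp M observed (\<lambda>\<omega>. X (real t) \<omega> $ a) \<omega> = m \<omega> $ a" for a
  proof (rule F.real_cond_exp_charact[OF _ iX im borel_measurable_component[OF mF]])
    fix S assume S: "S \<in> sets observed"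
    then have SM: "S \<in> sets M" using subalgebra_observed by (auto simp: subalgebra_def)
    note [measurable] = SM Xm borel_measurable_component[OF mM] borel_measurable_component[OF \<Xi>m]
    have "(\<integral>\<omega>\<in>S. X (real t) \<omega> $ a \<partial>M) = (\<integral>\<omega>\<in>S. (m \<omega> $ a + \<Xi> \<omega> $ a) \<partial>M)"
      unfolding set_lebesgue_integral_def using XAE[of a] by (intro integral_cong_AE) auto
    also have "\<dots> = (\<integral>\<omega>\<in>S. m \<omega> $ a \<partial>M) + (\<integral>\<omega>\<in>S. \<Xi> \<omega> $ a \<partial>M)"
      unfolding set_lebesgue_integral_def scaleR_add_right
      using integrable_mult_indicator[OF SM im] integrable_mult_indicator[OF SM i\<Xi>] by (rule Bochner_Integration.integral_add)
    finally show "(\<integral>\<omega>\<in>S. X (real t) \<omega> $ a \<partial>M) = (\<integral>\<omega>\<in>S. m \<omega> $ a \<partial>M)" using orth[OF S] by simp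
  qed
  have "AE \<omega> in M. \<forall>a. real_cond_exp M observed (\<lambda>\<omega>. X (real t) \<omega> $ a) \<omega> = m \<omega> $ a"
    using ce_eq by (simp add: AE_all_countable)
  then have fm: "AE \<omega> in M. filter_mean M X Y (real t) \<omega> = m \<omega>"
    by eventually_elim (simp add: filter_mean_def vec_eq_iff)
  show "filter_mean M X Y (real t) \<in> borel_measurable M"
  proof (subst borel_measurable_euclidean_space, rule ballI)
    fix e :: "real^'x" assume "e \<in> Basis"
    then obtain a where e: "e = axis a 1" by (auto simp: Basis_vec_def)
    have "(\<lambda>\<omega>. real_cond_exp M observed (\<lambda>\<omega>'. X (real t) \<omega>' $ a) \<omega>) \<in> borel_measurable M"
      by (rule borel_measurable_cond_exp2)
    then show "(\<lambda>\<omega>. filter_mean M X Y (real t) \<omega> \<bullet> e) \<in> borel_measurable M"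
      by (simp add: e inner_axis filter_mean_def)
  qed
  have "mean_square M (\<lambda>\<omega>. filter_scheme l \<omega> - filter_mean M X Y (real t) \<omega>) \<le> ennreal ((cf * 4) * (step_size l)\<^sup>2)" for l
  proof -
    have "mean_square M (\<lambda>\<omega>. filter_scheme l \<omega> - filter_mean M X Y (real t) \<omega>) \<le> mean_square M (\<lambda>\<omega>. filter_scheme l \<omega> - m \<omega>)"
      using fm by (intro mean_square_mono_AE) (auto elim!: eventually_mono)
    then show ?thesis using msm[of l] by (rule order_trans)
  qed
  then show "\<exists>c\<ge>0. \<forall>l. mean_square M (\<lambda>\<omega>. filter_scheme l \<omega> - filter_mean M X Y (real t) \<omega>) \<le> ennreal (c * (step_size l)\<^sup>2)"
    using cf(1) by (intro exI[of _ "cf * 4"]) auto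
qed

end

section \<open>Fluctuations of the multilevel estimator\<close>

text \<open>The part of a coupled pair that does not depend on the observations. At level zero there is no coarse
  partner.\<close>

definition coupled_error ::
  "real^'x^'x \<Rightarrow> real^'x^'y \<Rightarrow> real^'x^'x \<Rightarrow> real^'y^'y \<Rightarrow> real^'x^'x \<Rightarrow> nat \<Rightarrow> nat \<Rightarrow>
   real^'x \<Rightarrow> (real \<Rightarrow> real^'y) \<Rightarrow> (real \<Rightarrow> real^'x) \<Rightarrow> real^'x" where
  "coupled_error A C R1h R2h P t l z v w =
     euler A C R1h R2h P l z v w (\<lambda>_. 0) (t * 2 ^ l) -
     (if l = 0 then 0 else euler A C R1h R2h P (l - 1) z v w (\<lambda>_. 0) (t * 2 ^ (l - 1)))"

text \<open>At level zero the coefficients are bounded, and at higher levels they are \<open>O(\<Delta>\<^sub>l)\<close>. The constant is chosen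
  before the inputs, because it has to serve all samples of all levels.\<close>

lemma coupled_error_properties:
  fixes A :: "real^'x^'x" and C :: "real^'x^'y" and R1h :: "real^'x^'x" and R2h :: "real^'y^'y" and P :: "real^'x^'x"
  assumes bdd: "\<exists>K::real. \<forall>k l. \<forall>j1 j2. \<bar>riccati_rec A C R1h R2h P l k $ j1 $ j2\<bar> \<le> K"
  shows "\<exists>c\<ge>0. \<forall>(M::'w measure) m Z (V :: real \<Rightarrow> 'w \<Rightarrow> real^'y) W l. gaussian_noise M m P Z V W \<longrightarrow>
    (let U = (\<lambda>\<omega>. coupled_error A C R1h R2h P t l (Z \<omega> - m) (\<lambda>r. V r \<omega>) (\<lambda>r. W r \<omega>)) in
      mean_square M U \<le> ennreal (c * step_size l) \<and> integral\<^sup>L M U = 0 \<and> square_integrable M U \<and>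
      U \<in> borel_measurable (process_algebra M {0..} (\<lambda>t \<omega>. (Z \<omega>, V t \<omega>, W t \<omega>))))"
proof -
  obtain B K where B: "1 \<le> B" "0 \<le> K"
    and f: "\<And>l n. real n * step_size l \<le> real t \<Longrightarrow> input_functional B n (error_functional A C R1h R2h P l n)"
    and g: "\<And>l n. real n * step_size l \<le> real t \<Longrightarrow> input_functional (K * step_size l) (2 * n)
         (\<lambda>z u. error_functional A C R1h R2h P (Suc l) (2 * n) z u
              - error_functional A C R1h R2h P l n z (\<lambda>j. u (2 * j) + u (2 * j + 1)))"
    by (rule error_functional_bounds[OF bdd, of "real t"]) auto
  obtain p where p: "0 \<le> p" "\<And>x. x \<bullet> (P *v x) \<le> p * (norm x)\<^sup>2" using quadratic_form_bound by blast
  define \<kappa> where "\<kappa> = real DIM(real^'x) * (p + real t)"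
  have \<kappa>: "0 \<le> \<kappa>" using p by (simp add: \<kappa>_def)
  (* The factor 4 comes from the coarse partner: its step is twice the step of level l. *)
  define c where "c = (B\<^sup>2 + 4 * K\<^sup>2) * \<kappa>"
  have grid: "real (t * 2 ^ l) * step_size l \<le> real t" for l by (simp only: step_size_grid order_refl)
  show ?thesis
  proof (intro exI[of _ c] conjI allI impI)
    show "0 \<le> c" using \<kappa> by (simp add: c_def)
    fix M :: "'w measure" and m Z W l and V :: "real \<Rightarrow> 'w \<Rightarrow> real^'y"
    assume gn: "gaussian_noise M m P Z V W"
    interpret gaussian_noise M m P Z V W by (rule gn)
    let ?U = "\<lambda>\<omega>. coupled_error A C R1h R2h P t l (Z \<omega> - m) (\<lambda>r. V r \<omega>) (\<lambda>r. W r \<omega>)"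
    let ?N = "process_algebra M {0..} (\<lambda>t \<omega>. (Z \<omega>, V t \<omega>, W t \<omega>))"
    have e: "euler A C R1h R2h P l (Z \<omega> - m) (\<lambda>r. V r \<omega>) (\<lambda>r. W r \<omega>) (\<lambda>_. 0) k
       = error_functional A C R1h R2h P l k (Z \<omega> - m) (\<lambda>j. noise_increment l j \<omega>)" for l k \<omega>
      unfolding filter_error_eq[symmetric] filter_error_def ..
    have "\<exists>F b. ?U = (\<lambda>\<omega>. F (Z \<omega> - m) (\<lambda>j. noise_increment l j \<omega>)) \<and> input_functional b (t * 2 ^ l) F \<and> 0 \<le> b \<and> b\<^sup>2 * \<kappa> \<le> c * step_size l"
    proof (cases l)
      case 0
      have "B\<^sup>2 * \<kappa> \<le> c * step_size 0" using \<kappa> by (simp add: c_def step_size_def mult_right_mono)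
      then show ?thesis using f[OF grid[of 0]] B unfolding 0 coupled_error_def e
        by (intro exI[of _ "error_functional A C R1h R2h P 0 (t * 2 ^ 0)"] exI[of _ B]) simp
    next
      case (Suc k)
      have s: "t * 2 ^ Suc k = 2 * (t * 2 ^ k)" by simp
      have inc: "noise_increment k j \<omega> = noise_increment (Suc k) (2 * j) \<omega> + noise_increment (Suc k) (2 * j + 1) \<omega>" for j \<omega>
        unfolding noise_increment_def by (simp add: increment_refine[of _ k])
      let ?F = "\<lambda>z u. error_functional A C R1h R2h P (Suc k) (2 * (t * 2 ^ k)) z u
              - error_functional A C R1h R2h P k (t * 2 ^ k) z (\<lambda>j. u (2 * j) + u (2 * j + 1))"
      have "?U = (\<lambda>\<omega>. ?F (Z \<omega> - m) (\<lambda>j. noise_increment l j \<omega>))"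
        unfolding Suc coupled_error_def e s by (simp add: inc)
      moreover have "(K * step_size k)\<^sup>2 * \<kappa> \<le> c * step_size l"
      proof -
        have "(K * step_size k)\<^sup>2 = (K\<^sup>2 * 4 * step_size l) * step_size l"
          unfolding Suc step_size_Suc by (simp add: power_mult_distrib power2_eq_square)
        also have "\<dots> \<le> (K\<^sup>2 * 4 * 1) * step_size l"
          using step_size_le_1[of l] step_size_pos[of l] by (intro mult_right_mono mult_left_mono) auto
        also have "\<dots> \<le> (B\<^sup>2 + 4 * K\<^sup>2) * step_size l"
          using step_size_pos[of l] by (intro mult_right_mono) auto
        finally have "(K * step_size k)\<^sup>2 \<le> (B\<^sup>2 + 4 * K\<^sup>2) * step_size l" .
        from mult_right_mono[OF this \<kappa>] show ?thesis unfolding c_def by (simp add: mult_ac)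
      qed
      moreover have "input_functional (K * step_size k) (t * 2 ^ l) ?F" using g[OF grid[of k]] unfolding Suc s .
      ultimately show ?thesis using B(2) less_imp_le[OF step_size_pos[of k]]
        by (intro exI[of _ ?F] exI[of _ "K * step_size k"]) simp
    qed
    then obtain F b where F: "?U = (\<lambda>\<omega>. F (Z \<omega> - m) (\<lambda>j. noise_increment l j \<omega>))" "input_functional b (t * 2 ^ l) F" "0 \<le> b" "b\<^sup>2 * \<kappa> \<le> c * step_size l"
      by blast
    note ms = mean_square_functional[OF F(2,3) p(2,1), of l, unfolded step_size_grid]
    have 1: "mean_square M ?U \<le> ennreal (c * step_size l)"
      unfolding F(1) by (rule order_trans[OF ms(1) ennreal_leI]) (use F(4) in \<open>simp add: \<kappa>_def\<close>)
    have VW: "(\<lambda>\<omega>. (Z \<omega>, V r \<omega>, W r \<omega>)) \<in> borel_measurable ?N" if "0 \<le> r" for r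
      by (rule measurable_process_algebra) (use that in simp)
    have Zm: "Z \<in> borel_measurable ?N"
    proof -
      have "(fst :: (real^'x) \<times> ((real^'y) \<times> (real^'x)) \<Rightarrow> _) \<in> borel_measurable borel"
        by (intro borel_measurable_continuous_onI continuous_on_fst continuous_on_id)
      from measurable_compose[OF VW[OF order_refl] this] show ?thesis by simp
    qed
    have Bm: "(\<lambda>\<omega>. (V r \<omega>, W r \<omega>)) \<in> borel_measurable ?N" if "0 \<le> r" for r
    proof -
      have "(snd :: (real^'x) \<times> ((real^'y) \<times> (real^'x)) \<Rightarrow> _) \<in> borel_measurable borel"
        by (intro borel_measurable_continuous_onI continuous_on_snd continuous_on_id)
      from measurable_compose[OF VW[OF that] this] show ?thesis by simp
    qed
    have "noise_increment l j \<in> borel_measurable ?N" for j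
      unfolding noise_increment_eq using less_imp_le[OF step_size_pos[of l]]
      by (intro borel_measurable_diff Bm) auto
    then have 2: "?U \<in> borel_measurable ?N"
      unfolding F(1) using Zm by (intro input_functional_measurable[OF F(2)] borel_measurable_diff borel_measurable_const)
    show "let U = ?U in mean_square M U \<le> ennreal (c * step_size l) \<and> integral\<^sup>L M U = 0 \<and> square_integrable M U \<and> U \<in> borel_measurable ?N"
      unfolding Let_def using 1 2 ms(2,3) unfolding F(1) by simp
  qed
qed

context filter_model
begin

text \<open>The parts of the samples that are driven by the observations telescope to the scheme at the
  finest level; what remains is linear in the independent centred inputs.\<close>

lemma multilevel_estimator_split:
  assumes N: "\<And>l. l \<le> L \<Longrightarrow> 0 < N l"
  shows "multilevel_estimator A C R1h R2h P0 Y L N Z Vb Wb t \<omega> = filter_scheme L \<omega> +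
    (\<Sum>(l, i)\<in>(SIGMA l:{0..L}. {1..N l}).
       (1 / real (N l)) *\<^sub>R coupled_error A C R1h R2h P0 t l (Z l i \<omega> - M0) (\<lambda>r. Vb l i r \<omega>) (\<lambda>r. Wb l i r \<omega>))"
proof -
  let ?\<zeta> = "\<lambda>l i s. euler A C R1h R2h P0 s (Z l i \<omega>) (\<lambda>r. Vb l i r \<omega>) (\<lambda>r. Wb l i r \<omega>) (\<lambda>r. Y r \<omega>) (t * 2 ^ s)"
  let ?e = "\<lambda>l i s. euler A C R1h R2h P0 s (Z l i \<omega> - M0) (\<lambda>r. Vb l i r \<omega>) (\<lambda>r. Wb l i r \<omega>) (\<lambda>_. 0) (t * 2 ^ s)"
  let ?U = "\<lambda>l i. coupled_error A C R1h R2h P0 t l (Z l i \<omega> - M0) (\<lambda>r. Vb l i r \<omega>) (\<lambda>r. Wb l i r \<omega>)"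
  have z: "?\<zeta> l i s = filter_scheme s \<omega> + ?e l i s" for l i s
    unfolding filter_scheme_def by (rule euler_split)
  have avg: "(1 / real (N l)) *\<^sub>R (\<Sum>i=1..N l. a + b i) = a + (\<Sum>i=1..N l. (1 / real (N l)) *\<^sub>R b i)"
    if "l \<le> L" for l and a :: "real^'x" and b
  proof -
    have "(\<Sum>i=1..N l. a) = real (N l) *\<^sub>R a" by (simp only: sum_constant_scaleR card_atLeastAtMost) simp
    then show ?thesis using N[OF that] by (simp only: sum.distrib scaleR_add_right scaleR_sum_right) simp
  qed
  have l0: "(1 / real (N 0)) *\<^sub>R (\<Sum>i=1..N 0. ?\<zeta> 0 i 0) = filter_scheme 0 \<omega> + (\<Sum>i=1..N 0. (1 / real (N 0)) *\<^sub>R ?U 0 i)"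
    unfolding z avg[OF le0] by (simp add: coupled_error_def)
  have ll: "(1 / real (N l)) *\<^sub>R (\<Sum>i=1..N l. ?\<zeta> l i l - ?\<zeta> l i (l - 1))
      = (filter_scheme l \<omega> - filter_scheme (l - 1) \<omega>) + (\<Sum>i=1..N l. (1 / real (N l)) *\<^sub>R ?U l i)" if "l \<in> {1..L}" for l
  proof -
    have d: "?\<zeta> l i l - ?\<zeta> l i (l - 1) = (filter_scheme l \<omega> - filter_scheme (l - 1) \<omega>) + ?U l i" for i
      unfolding z using that by (simp add: coupled_error_def)
    show ?thesis unfolding d using that by (intro avg) simp
  qed
  have "multilevel_estimator A C R1h R2h P0 Y L N Z Vb Wb t \<omega>
     = (filter_scheme 0 \<omega> + (\<Sum>l=1..L. filter_scheme l \<omega> - filter_scheme (l - 1) \<omega>))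
       + ((\<Sum>i=1..N 0. (1 / real (N 0)) *\<^sub>R ?U 0 i) + (\<Sum>l=1..L. \<Sum>i=1..N l. (1 / real (N l)) *\<^sub>R ?U l i))"
    unfolding multilevel_estimator_def Let_def l0 using ll by (simp add: sum.distrib)
  also have "\<dots> = filter_scheme L \<omega> + (\<Sum>l=0..L. \<Sum>i=1..N l. (1 / real (N l)) *\<^sub>R ?U l i)"
    using sum_telescope''[of 0 L "\<lambda>l. filter_scheme l \<omega>"] by (simp add: sum.atLeast_Suc_atMost[of 0 L])
  finally show ?thesis by (simp add: sum.Sigma)
qed

text \<open>Different samples are independent and centred, hence orthogonal, so their mean squares add up. Level \<open>l\<close> has
  \<open>N\<^sub>l\<close> terms, each with the squared weight \<open>1 / N\<^sub>l\<^sup>2\<close>.\<close>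

lemma fluctuation_mean_square:
  obtains c where "0 \<le> c"
    "\<And>L N Z Vb Wb. (\<And>l. l \<le> L \<Longrightarrow> 0 < N l) \<Longrightarrow> multilevel_inputs M M0 P0 (X 0) V W L N Z Vb Wb \<Longrightarrow>
      let F = (\<lambda>\<omega>. \<Sum>(l, i)\<in>(SIGMA l:{0..L}. {1..N l}).
         (1 / real (N l)) *\<^sub>R coupled_error A C R1h R2h P0 t l (Z l i \<omega> - M0) (\<lambda>r. Vb l i r \<omega>) (\<lambda>r. Wb l i r \<omega>)) in
      F \<in> borel_measurable M \<and> mean_square M F \<le> ennreal (c * (\<Sum>l=0..L. step_size l / real (N l)))"
proof -
  obtain c where c: "0 \<le> c" and cp: "\<forall>(M::'w measure) m Z V W l. gaussian_noise M m P0 Z V W \<longrightarrow>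
    (let U = (\<lambda>\<omega>. coupled_error A C R1h R2h P0 t l (Z \<omega> - m) (\<lambda>r. V r \<omega>) (\<lambda>r. W r \<omega>)) in
      mean_square M U \<le> ennreal (c * step_size l) \<and> integral\<^sup>L M U = 0 \<and> square_integrable M U \<and>
      U \<in> borel_measurable (process_algebra M {0..} (\<lambda>t \<omega>. (Z \<omega>, V t \<omega>, W t \<omega>))))"
    using coupled_error_properties[OF bdd, of t] by blast
  show ?thesis
  proof (rule that[OF c])
    fix L N Z Vb Wb
    assume N: "\<And>l. l \<le> L \<Longrightarrow> 0 < N l" and inp: "multilevel_inputs M M0 P0 (X 0) V W L N Z Vb Wb"
    let ?S = "SIGMA l:{0..L}. {1..N l}"
    let ?ev = "\<lambda>j. case j of None \<Rightarrow> start_noise_events M (X 0) V W | Some (l, i) \<Rightarrow> start_noise_events M (Z l i) (Vb l i) (Wb l i)"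
    let ?U = "\<lambda>l i \<omega>. coupled_error A C R1h R2h P0 t l (Z l i \<omega> - M0) (\<lambda>r. Vb l i r \<omega>) (\<lambda>r. Wb l i r \<omega>)"
    let ?f = "\<lambda>(l, i) \<omega>. (1 / real (N l)) *\<^sub>R ?U l i \<omega>"
    let ?A = "\<lambda>l i. process_algebra M {0..} (\<lambda>t \<omega>. (Z l i \<omega>, Vb l i t \<omega>, Wb l i t \<omega>))"
    have gn: "gaussian_noise M M0 P0 (Z l i) (Vb l i) (Wb l i)" if "(l, i) \<in> ?S" for l i
      using inp that prob by (simp add: multilevel_inputs_def gaussian_noise_def gaussian_noise_axioms_def)
    have U: "mean_square M (?U l i) \<le> ennreal (c * step_size l)" "expectation (?U l i) = 0" "square_integrable M (?U l i)" "?U l i \<in> borel_measurable (?A l i)"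
      if "(l, i) \<in> ?S" for l i
      using cp[rule_format, OF gn[OF that], of l] by (simp_all add: Let_def)
    have ind: "indep_sets ?ev (insert None (Some ` ?S))" using inp by (simp add: multilevel_inputs_def)
    have orthU: "expectation (\<lambda>\<omega>. ?U l i \<omega> \<bullet> ?U l' i' \<omega>) = 0" if a: "(l, i) \<in> ?S" and b: "(l', i') \<in> ?S" and ne: "(l, i) \<noteq> (l', i')" for l i l' i'
    proof (rule indep_orthogonal[OF _ _ _ U(4)[OF a] U(4)[OF b] U(3)[OF a] U(3)[OF b] U(2)[OF b]])
      show "indep_set (sets (?A l i)) (sets (?A l' i'))"
      proof (rule indep_setI)
        have ev: "?ev j \<subseteq> events" if "j \<in> insert None (Some ` ?S)" for j using ind that unfolding indep_sets_def by blast
        show "sets (?A l i) \<subseteq> events" using ev[of "Some (l, i)"] a by (simp add: start_noise_events_def)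
        show "sets (?A l' i') \<subseteq> events" using ev[of "Some (l', i')"] b by (simp add: start_noise_events_def)
        fix x y assume xy: "x \<in> sets (?A l i)" "y \<in> sets (?A l' i')"
        let ?x = "\<lambda>j. if j = Some (l, i) then x else y"
        have "prob (\<Inter>j\<in>{Some (l, i), Some (l', i')}. ?x j) = (\<Prod>j\<in>{Some (l, i), Some (l', i')}. prob (?x j))"
          by (rule indep_setsD[OF ind]) (use a b ne xy in \<open>auto simp: start_noise_events_def\<close>)
        then show "prob (x \<inter> y) = prob x * prob y" using ne by auto
      qed
    qed simp_all
    have sq: "square_integrable M (?f s)" if "s \<in> ?S" for s
    proof -
      obtain l i where s: "s = (l, i)" by (cases s)
      have "linear (\<lambda>x::real^'x. (1 / real (N l)) *\<^sub>R x)" by (simp add: linear_iff scaleR_add_right)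
      from square_integrable_linear[OF this U(3)[of l i]] show ?thesis using that by (simp add: s)
    qed
    have "mean_square M (\<lambda>\<omega>. \<Sum>s\<in>?S. ?f s \<omega>) = (\<Sum>s\<in>?S. mean_square M (?f s))"
    proof (rule mean_square_orthogonal_sum[OF _ sq])
      fix s s' assume s: "s \<in> ?S" "s' \<in> ?S" "s \<noteq> s'"
      obtain l i l' i' where eq: "s = (l, i)" "s' = (l', i')" by (cases s, cases s')
      show "expectation (\<lambda>\<omega>. ?f s \<omega> \<bullet> ?f s' \<omega>) = 0"
        using orthU[of l i l' i'] s unfolding eq by simp
    qed auto
    also have "\<dots> \<le> (\<Sum>(l, i)\<in>?S. ennreal (c * step_size l / (real (N l))\<^sup>2))"
    proof (rule sum_mono)
      fix s assume s: "s \<in> ?S"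
      obtain l i where eq: "s = (l, i)" by (cases s)
      have lb: "linear_bounded_by (1 / real (N l)) (\<lambda>x::real^'x. (1 / real (N l)) *\<^sub>R x)"
        using linear_bounded_by_scale[OF linear_bounded_by_id[OF order_refl], of "1 / real (N l)"] by simp
      have "mean_square M (?f s) \<le> ennreal ((1 / real (N l))\<^sup>2) * mean_square M (?U l i)"
        unfolding eq prod.case by (rule mean_square_linear[OF lb]) (use U(3)[of l i] s eq in \<open>simp add: square_integrable_def\<close>)
      also have "\<dots> \<le> ennreal ((1 / real (N l))\<^sup>2) * ennreal (c * step_size l)"
        using U(1)[of l i] s eq by (intro mult_left_mono) auto
      also have "\<dots> = ennreal (c * step_size l / (real (N l))\<^sup>2)"
        using c less_imp_le[OF step_size_pos[of l]] by (simp add: ennreal_mult[symmetric] power_divide)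
      finally show "mean_square M (?f s) \<le> (case s of (l, i) \<Rightarrow> ennreal (c * step_size l / (real (N l))\<^sup>2))" by (simp add: eq)
    qed
    also have "\<dots> = (\<Sum>l=0..L. \<Sum>i=1..N l. ennreal (c * step_size l / (real (N l))\<^sup>2))"
      by (rule sum.Sigma[symmetric]) auto
    also have "\<dots> = (\<Sum>l=0..L. ennreal (c * (step_size l / real (N l))))"
    proof (rule sum.cong[OF refl])
      fix l assume "l \<in> {0..L}"
      then have "0 < N l" using N by simp
      then show "(\<Sum>i=1..N l. ennreal (c * step_size l / (real (N l))\<^sup>2)) = ennreal (c * (step_size l / real (N l)))"
        using c less_imp_le[OF step_size_pos[of l]]
        by (simp add: ennreal_of_nat_eq_real_of_nat ennreal_mult[symmetric] power2_eq_square)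
    qed
    also have "\<dots> = ennreal (\<Sum>l=0..L. c * (step_size l / real (N l)))"
      using c less_imp_le[OF step_size_pos] by (intro sum_ennreal) auto
    also have "(\<Sum>l=0..L. c * (step_size l / real (N l))) = c * (\<Sum>l=0..L. step_size l / real (N l))" by (simp add: sum_distrib_left)
    finally have "mean_square M (\<lambda>\<omega>. \<Sum>s\<in>?S. ?f s \<omega>) \<le> ennreal (c * (\<Sum>l=0..L. step_size l / real (N l)))" .
    moreover have "(\<lambda>\<omega>. \<Sum>s\<in>?S. ?f s \<omega>) \<in> borel_measurable M"
      using sq by (intro borel_measurable_sum) (simp add: square_integrable_def)
    moreover have "(\<Sum>(l, i)\<in>?S. (1 / real (N l)) *\<^sub>R ?U l i \<omega>) = (\<Sum>s\<in>?S. ?f s \<omega>)" for \<omega>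
      by (intro sum.cong) auto
    ultimately show "let F = (\<lambda>\<omega>. \<Sum>(l, i)\<in>?S. (1 / real (N l)) *\<^sub>R ?U l i \<omega>) in
      F \<in> borel_measurable M \<and> mean_square M F \<le> ennreal (c * (\<Sum>l=0..L. step_size l / real (N l)))"
      unfolding Let_def by simp
  qed
qed

end

section \<open>The error of the multilevel estimator\<close>

theorem theorem3p1:
  fixes M :: "'w measure"
    and A :: "real^'x^'x" and C :: "real^'x^'y"
    and R1h :: "real^'x^'x" and R2h :: "real^'y^'y"
    and M0 :: "real^'x" and P0 :: "real^'x^'x"
    and X :: "real \<Rightarrow> 'w \<Rightarrow> real^'x" and Y :: "real \<Rightarrow> 'w \<Rightarrow> real^'y"
    and V :: "real \<Rightarrow> 'w \<Rightarrow> real^'y" and W :: "real \<Rightarrow> 'w \<Rightarrow> real^'x"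
    and T t :: nat
  assumes "prob_space M"
    and "transpose R1h = R1h" and "invertible R1h"
    and "transpose R2h = R2h" and "invertible R2h"
    and "signal_observation M A C R1h R2h M0 P0 X Y V W"
    and "log_norm A < 0"
    and "\<exists>K::real. \<forall>k l. \<forall>j1 j2. \<bar>riccati_rec A C R1h R2h P0 l k $ j1 $ j2\<bar> \<le> K"
    and "controllability_rank A R1h = CARD('x)"
    and "observability_rank A C = CARD('x)"
    and "T \<ge> 1" and "t \<le> T - 1"
  shows "\<exists>K::real. \<forall>L\<ge>1. \<forall>N. (\<forall>l\<le>L. N l \<ge> 2) \<longrightarrow>
    (\<forall>Z Vb Wb. multilevel_inputs M M0 P0 (X 0) V W L N Z Vb Wb \<longrightarrow>
      (\<integral>\<^sup>+\<omega>. ennreal ((norm (multilevel_estimator A C R1h R2h P0 Y L N Z Vb Wb t \<omega>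
                          - filter_mean M X Y (real t) \<omega>))\<^sup>2) \<partial>M)
      \<le> ennreal (K *
          ((\<Sum>l=0..L. step_size l / real (N l))
           + (\<Sum>l=1..L. \<Sum>q\<in>{1..L} - {l}.
                step_size l * step_size q / (real (N l) * real (N q)))
           + (step_size L)\<^sup>2)))"
proof -
  interpret filter_model M A C R1h R2h M0 P0 X Y V W t
    by (rule filter_model.intro) (use assms in blast)+
  obtain c1 where c1: "0 \<le> c1" "\<And>l. mean_square M (\<lambda>\<omega>. filter_scheme l \<omega> - filter_mean M X Y (real t) \<omega>) \<le> ennreal (c1 * (step_size l)\<^sup>2)"
    using filter_scheme_rate(2) by blast
  obtain c2 where c2: "0 \<le> c2"
    "\<And>L N Z Vb Wb. (\<And>l. l \<le> L \<Longrightarrow> 0 < N l) \<Longrightarrow> multilevel_inputs M M0 P0 (X 0) V W L N Z Vb Wb \<Longrightarrow>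
      let F = (\<lambda>\<omega>. \<Sum>(l, i)\<in>(SIGMA l:{0..L}. {1..N l}).
         (1 / real (N l)) *\<^sub>R coupled_error A C R1h R2h P0 t l (Z l i \<omega> - M0) (\<lambda>r. Vb l i r \<omega>) (\<lambda>r. Wb l i r \<omega>)) in
      F \<in> borel_measurable M \<and> mean_square M F \<le> ennreal (c2 * (\<Sum>l=0..L. step_size l / real (N l)))"
    by (rule fluctuation_mean_square) blast
  show ?thesis
  proof (intro exI[of _ "2 * c1 + 2 * c2"] allI impI)
    fix L :: nat and N :: "nat \<Rightarrow> nat" and Z Vb Wb
    assume N: "\<forall>l\<le>L. 2 \<le> N l" and inp: "multilevel_inputs M M0 P0 (X 0) V W L N Z Vb Wb"
    have N0: "0 < N l" if "l \<le> L" for l using N that by fastforce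
    let ?F = "\<lambda>\<omega>. \<Sum>(l, i)\<in>(SIGMA l:{0..L}. {1..N l}).
         (1 / real (N l)) *\<^sub>R coupled_error A C R1h R2h P0 t l (Z l i \<omega> - M0) (\<lambda>r. Vb l i r \<omega>) (\<lambda>r. Wb l i r \<omega>)"
    let ?G = "\<lambda>\<omega>. filter_scheme L \<omega> - filter_mean M X Y (real t) \<omega>"
    let ?s1 = "\<Sum>l=0..L. step_size l / real (N l)"
    let ?s2 = "\<Sum>l=1..L. \<Sum>q\<in>{1..L} - {l}. step_size l * step_size q / (real (N l) * real (N q))"
    have F: "?F \<in> borel_measurable M" "mean_square M ?F \<le> ennreal (c2 * ?s1)"
      using c2(2)[OF N0 inp] by (simp_all add: Let_def)
    have s: "0 \<le> ?s1" "0 \<le> ?s2"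
      using less_imp_le[OF step_size_pos] by (intro sum_nonneg divide_nonneg_nonneg mult_nonneg_nonneg; simp)+
    have eq: "multilevel_estimator A C R1h R2h P0 Y L N Z Vb Wb t \<omega> - filter_mean M X Y (real t) \<omega> = ?G \<omega> + ?F \<omega>" for \<omega>
      using multilevel_estimator_split[where L = L and N = N and Z = Z and Vb = Vb and Wb = Wb and \<omega> = \<omega>, OF N0] by simp
    have "(\<integral>\<^sup>+\<omega>. ennreal ((norm (multilevel_estimator A C R1h R2h P0 Y L N Z Vb Wb t \<omega> - filter_mean M X Y (real t) \<omega>))\<^sup>2) \<partial>M)
       = mean_square M (\<lambda>\<omega>. ?G \<omega> + ?F \<omega>)"
      unfolding eq mean_square_def ..
    also have "\<dots> \<le> ennreal (2 * (c1 * (step_size L)\<^sup>2) + 2 * (c2 * ?s1))"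
      using c1 c2(1) s F
      by (intro mean_square_add_le borel_measurable_diff filter_scheme_measurable filter_scheme_rate(1)) auto
    also have "\<dots> \<le> ennreal ((2 * c1 + 2 * c2) * (?s1 + ?s2 + (step_size L)\<^sup>2))"
    proof (rule ennreal_leI)
      have "(2 * c1) * (step_size L)\<^sup>2 \<le> (2 * c1 + 2 * c2) * (step_size L)\<^sup>2" "(2 * c2) * ?s1 \<le> (2 * c1 + 2 * c2) * ?s1"
        using c1(1) c2(1) s by (intro mult_right_mono; simp)+
      moreover have "0 \<le> (2 * c1 + 2 * c2) * ?s2" using c1(1) c2(1) s by simp
      ultimately show "2 * (c1 * (step_size L)\<^sup>2) + 2 * (c2 * ?s1) \<le> (2 * c1 + 2 * c2) * (?s1 + ?s2 + (step_size L)\<^sup>2)"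
        unfolding distrib_left by linarith
    qed
    finally show "(\<integral>\<^sup>+\<omega>. ennreal ((norm (multilevel_estimator A C R1h R2h P0 Y L N Z Vb Wb t \<omega> - filter_mean M X Y (real t) \<omega>))\<^sup>2) \<partial>M)
       \<le> ennreal ((2 * c1 + 2 * c2) * (?s1 + ?s2 + (step_size L)\<^sup>2))" .
  qed
qed

end
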